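(* Let $\Omega\subset\mathbb{R}^3$ be a domain and $S\subset\Omega$ a bounded connected domain, both uniformly $C^3$. There exist positive constants $H_*$, $C_s$, $c_0$ depending only on $S$ (through its shape, not its position in $\Omega$) and $\Omega$ such that the following holds. Let $\mathbf{u}\in W^{1,2}_0(S,\Omega)$ with $\operatorname{div}\mathbf{u}=0$ and in addition $|\nabla^2\mathbf{u}|\in L^2(F)$. Whenever $h<H_*$, where $h=\operatorname{dist}(S,\partial\Omega)$, and $\sigma_h:=c_0h^{\frac12}$, one has $$|u_{P3}|\le C_s\left(h^{\frac32}\|\nabla^2\mathbf{u}\|_{L^2(\mathcal{C}_{\sigma_h}\cap F)}+h\,\|\nabla\mathbf{u}\|_{L^2(\mathcal{C}_{\sigma_h}\cap F)}\right).$$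
   Context: A domain $D\subset\mathbb{R}^3$ is uniformly $C^3$ if there are constants $\sigma_0,K>0$ such that, near each boundary point $x_0$, in suitable orthonormal coordinates centred at $x_0$ with $x_3$-axis normal to $\partial D$, $\partial D$ is the graph $x_3=g(\mathbf{x}')$, $\mathbf{x}'=(x_1,x_2)$, $|\mathbf{x}'|<\sigma_0$, with $|\nabla^ig(\mathbf{x}')|\le K|\mathbf{x}'|^{2-i}$ for $i=0,1,2$ and $|\nabla^3g(\mathbf{x}')|\le K$. $F=\Omega\setminus\overline{S}$. $W^{1,2}_0(S,\Omega)$ is the set of vector fields $\mathbf{u}:\Omega\to\mathbb{R}^3$, $\mathbf{u}\in W^{1,2}_0(\Omega)$, for which there are vectors $\mathbf{u}_*,\boldsymbol{\omega}\in\mathbb{R}^3$ with $\mathbf{u}(\mathbf{x})=\mathbf{u}_*+\boldsymbol{\omega}\times(\mathbf{x}-\mathbf{x}_* )$ for $\mathbf{x}\in S$, where $\mathbf{x}_*\in\overline{S}$ is a fixed point. $h=\operatorname{dist}(S,\partial\Omega)=|PQ|$, where $P\in\partial S$ and $Q\in\partial\Omega$ realize the distance; it is assumed throughout that $h<H:=\operatorname{diam}S$. Orthogonal coordinates $(x_1,x_2,x_3)$ are chosen with origin $Q$ and $P=(0,0,h)$; the plane of $\mathbf{x}'=(x_1,x_2)$ is tangent to $\partial\Omega$ at $Q$ and parallel to the tangent plane of $\partial S$ at $P$. $\mathbf{u}_P=\mathbf{u}_*+\boldsymbol{\omega}\times(P-\mathbf{x}_* )=(u_{P1},u_{P2},u_{P3})$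 is the rigid velocity at $P$ in these coordinates. For $\sigma>0$, $\mathcal{C}_\sigma\cap F=\{|\mathbf{x}'|<\sigma\}\cap F$. Constants depending only on the shape of $S$ are the same for all rigid copies of $S$ contained in $\Omega$. *)

theory Defs
  imports "HOL-Analysis.Analysis"
begin

section \<open>Classical derivatives\<close>

definition partial_deriv :: "'n::finite \<Rightarrow> (real^'n \<Rightarrow> real) \<Rightarrow> real^'n \<Rightarrow> real" where
  "partial_deriv i f x = frechet_derivative f (at x) (axis i 1)"

text \<open>Only meant for open \<open>U\<close>, since differentiability is taken in a full neighbourhood.\<close>

primrec Ck_on :: "nat \<Rightarrow> (real^'n) set \<Rightarrow> (real^'n::finite \<Rightarrow> real) \<Rightarrow> bool" where
  "Ck_on 0 U f \<longleftrightarrow> continuous_on U f"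
| "Ck_on (Suc k) U f \<longleftrightarrow>
     (\<forall>x\<in>U. f differentiable (at x)) \<and> (\<forall>i. Ck_on k U (partial_deriv i f))"

text \<open>
  \<open>deriv_norm k f x\<close> is \<open>\<bar>\<nabla>\<^sup>k f(x)\<bar>\<close>, the Euclidean norm of the array of all
  iterated partial derivatives of order \<open>k\<close>.
\<close>

primrec deriv_normsq :: "nat \<Rightarrow> (real^'n::finite \<Rightarrow> real) \<Rightarrow> real^'n \<Rightarrow> real" where
  "deriv_normsq 0 f x = (f x)\<^sup>2"
| "deriv_normsq (Suc k) f x = (\<Sum>i\<in>UNIV. deriv_normsq k (partial_deriv i f) x)"

definition deriv_norm :: "nat \<Rightarrow> (real^'n::finite \<Rightarrow> real) \<Rightarrow> real^'n \<Rightarrow> real" where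
  "deriv_norm k f x = sqrt (deriv_normsq k f x)"

section \<open>Domains and local coordinates\<close>

definition is_domain :: "(real^3) set \<Rightarrow> bool" where
  "is_domain D \<longleftrightarrow> open D \<and> connected D \<and> D \<noteq> {}"

text \<open>
  An orthonormal coordinate system with origin \<open>p\<close> is given by an orthogonal transformation \<open>T\<close>:
  the point with coordinates \<open>y\<close> is \<open>p + T y\<close>, and the \<open>k\<close>-th basis vector is \<open>T (axis k 1)\<close>.
\<close>

definition horiz :: "real^3 \<Rightarrow> real^2" where
  "horiz y = vector [y$1, y$2]"

definition uniformly_C3 :: "(real^3) set \<Rightarrow> bool" where
  "uniformly_C3 D \<longleftrightarrow>
    (\<exists>\<sigma>\<^sub>0>0. \<exists>K>0. \<forall>p\<in>frontier D. \<exists>T g.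
       orthogonal_transformation T \<and>
       frontier D \<inter> (\<lambda>y. p + T y) ` {y. norm (horiz y) < \<sigma>\<^sub>0 \<and> \<bar>y$3\<bar> < \<sigma>\<^sub>0}
         = (\<lambda>y. p + T y) ` {y. norm (horiz y) < \<sigma>\<^sub>0 \<and> \<bar>y$3\<bar> < \<sigma>\<^sub>0 \<and> y$3 = g (horiz y)} \<and>
       Ck_on 3 (ball 0 \<sigma>\<^sub>0) g \<and>
       (\<forall>z. norm z < \<sigma>\<^sub>0 \<longrightarrow>
          (\<forall>i\<le>2. deriv_norm i g z \<le> K * norm z ^ (2 - i)) \<and> deriv_norm 3 g z \<le> K))"
  \<comment> \<open>The bounds for \<open>i = 0, 1\<close> force \<open>g 0 = 0\<close> and \<open>\<nabla>g 0 = 0\<close>, so the graph passes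
      through \<open>p\<close> and the third axis is normal to the boundary there.\<close>

text \<open>The plane through \<open>p\<close> orthogonal to \<open>n\<close> is tangent to the surface \<open>A\<close> at \<open>p\<close>.\<close>

definition normal_at :: "(real^3) set \<Rightarrow> real^3 \<Rightarrow> real^3 \<Rightarrow> bool" where
  "normal_at A p n \<longleftrightarrow> ((\<lambda>y. ((y - p) \<bullet> n) / norm (y - p)) \<longlongrightarrow> 0) (at p within A)"

definition adapted_frame ::
  "(real^3) set \<Rightarrow> (real^3) set \<Rightarrow> real^3 \<Rightarrow> real^3 \<Rightarrow> (real^3 \<Rightarrow> real^3) \<Rightarrow> bool" where
  "adapted_frame S \<Omega> P Q T \<longleftrightarrow>
     P \<in> frontier S \<and> Q \<in> frontier \<Omega> \<and> dist P Q = setdist S (frontier \<Omega>) \<and>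
     orthogonal_transformation T \<and>
     P = Q + T (axis 3 (setdist S (frontier \<Omega>))) \<and>
     normal_at (frontier \<Omega>) Q (T (axis 3 1)) \<and> normal_at (frontier S) P (T (axis 3 1))"

definition cyl :: "real^3 \<Rightarrow> (real^3 \<Rightarrow> real^3) \<Rightarrow> real \<Rightarrow> (real^3) set" where
  "cyl Q T \<sigma> = (\<lambda>y. Q + T y) ` {y. norm (horiz y) < \<sigma>}"

definition rigid_copy :: "(real^3) set \<Rightarrow> (real^3) set \<Rightarrow> bool" where
  "rigid_copy S\<^sub>0 S \<longleftrightarrow> (\<exists>A b. rotation_matrix A \<and> S = (\<lambda>x. b + A *v x) ` S\<^sub>0)"

section \<open>Sobolev spaces\<close>

definition test_fun :: "(real^'n::finite) set \<Rightarrow> (real^'n \<Rightarrow> real) \<Rightarrow> bool" where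
  "test_fun U \<phi> \<longleftrightarrow>
     (\<forall>k. Ck_on k UNIV \<phi>) \<and> compact (closure {x. \<phi> x \<noteq> 0}) \<and> closure {x. \<phi> x \<noteq> 0} \<subseteq> U"

definition loc_integrable :: "(real^'n::finite) set \<Rightarrow> (real^'n \<Rightarrow> real) \<Rightarrow> bool" where
  "loc_integrable U f \<longleftrightarrow> (\<forall>K. compact K \<and> K \<subseteq> U \<longrightarrow> f absolutely_integrable_on K)"

definition weak_partial ::
  "(real^'n::finite) set \<Rightarrow> 'n \<Rightarrow> (real^'n \<Rightarrow> real) \<Rightarrow> (real^'n \<Rightarrow> real) \<Rightarrow> bool" where
  "weak_partial U i f g \<longleftrightarrow>
     loc_integrable U f \<and> loc_integrable U g \<and>
     (\<forall>\<phi>. test_fun U \<phi> \<longrightarrow>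
        (LINT x:U|lebesgue. f x * partial_deriv i \<phi> x) = - (LINT x:U|lebesgue. g x * \<phi> x))"

text \<open>
  Derivatives of vector fields carry the differentiation indices last:
  \<open>Du x $ i $ j\<close> is \<open>\<partial>\<^sub>j u\<^sub>i\<close> and \<open>D2u x $ i $ j $ k\<close> is \<open>\<partial>\<^sub>k \<partial>\<^sub>j u\<^sub>i\<close>.
  The norms on these types are the Euclidean (Frobenius) norms.
\<close>

definition weak_grad :: "(real^3) set \<Rightarrow> (real^3 \<Rightarrow> real^3) \<Rightarrow> (real^3 \<Rightarrow> real^3^3) \<Rightarrow> bool" where
  "weak_grad U u Du \<longleftrightarrow> (\<forall>i j. weak_partial U j (\<lambda>x. u x $ i) (\<lambda>x. Du x $ i $ j))"

definition weak_hess ::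
  "(real^3) set \<Rightarrow> (real^3 \<Rightarrow> real^3) \<Rightarrow> (real^3 \<Rightarrow> real^3^3^3) \<Rightarrow> bool" where
  "weak_hess U u D2u \<longleftrightarrow> (\<exists>Du. weak_grad U u Du \<and>
     (\<forall>i j k. weak_partial U k (\<lambda>x. Du x $ i $ j) (\<lambda>x. D2u x $ i $ j $ k)))"

definition L2_on :: "'a::euclidean_space set \<Rightarrow> ('a \<Rightarrow> 'b::euclidean_space) \<Rightarrow> bool" where
  "L2_on A f \<longleftrightarrow> f \<in> borel_measurable (lebesgue_on A) \<and>
     (\<lambda>x. (norm (f x))\<^sup>2) absolutely_integrable_on A"

definition L2_norm :: "'a::euclidean_space set \<Rightarrow> ('a \<Rightarrow> 'b::euclidean_space) \<Rightarrow> real" where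
  "L2_norm A f = sqrt (LINT x:A|lebesgue. (norm (f x))\<^sup>2)"

text \<open>The closure of \<open>C\<^sub>c\<^sup>\<infinity>(\<Omega>)\<close> in the \<open>W\<^sup>1\<^sup>,\<^sup>2(\<Omega>)\<close> norm.\<close>

definition W12_0 :: "(real^3) set \<Rightarrow> (real^3 \<Rightarrow> real^3) set" where
  "W12_0 \<Omega> = {u. \<exists>Du. weak_grad \<Omega> u Du \<and> L2_on \<Omega> u \<and> L2_on \<Omega> Du \<and>
     (\<exists>\<phi>::nat \<Rightarrow> real^3 \<Rightarrow> real^3.
        (\<forall>n i. test_fun \<Omega> (\<lambda>x. \<phi> n x $ i)) \<and>
        (\<lambda>n. L2_norm \<Omega> (\<lambda>x. \<phi> n x - u x)) \<longlonglongrightarrow> 0 \<and>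
        (\<lambda>n. L2_norm \<Omega> (\<lambda>x. jacobian (\<phi> n) (at x) - Du x)) \<longlonglongrightarrow> 0)}"

text \<open>As usual, elements of Sobolev spaces are only determined almost everywhere.\<close>

definition rigid_on ::
  "(real^3) set \<Rightarrow> (real^3 \<Rightarrow> real^3) \<Rightarrow> real^3 \<Rightarrow> real^3 \<Rightarrow> real^3 \<Rightarrow> bool" where
  "rigid_on S u x\<^sub>s u\<^sub>s \<omega> \<longleftrightarrow> (AE x in lebesgue. x \<in> S \<longrightarrow> u x = u\<^sub>s + cross3 \<omega> (x - x\<^sub>s))"

definition W12_0_rigid ::
  "(real^3) set \<Rightarrow> (real^3) set \<Rightarrow> real^3 \<Rightarrow> (real^3 \<Rightarrow> real^3) set" where
  "W12_0_rigid S \<Omega> x\<^sub>s = {u \<in> W12_0 \<Omega>. \<exists>u\<^sub>s \<omega>. rigid_on S u x\<^sub>s u\<^sub>s \<omega>}"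

end

theory Submission
  imports Defs
begin

text \<open>
  In coordinates centred at \<open>Q\<close> the gap is \<open>\<beta>(v) < z < \<tau>(v)\<close> over a disc of radius \<open>R\<close> comparable to \<open>h\<^sup>1\<^sup>/\<^sup>2\<close>,
  and \<open>u\<close> vanishes below it and is rigid above it. Testing \<open>div u = 0\<close> with a radial cut-off of the
  disc expresses \<open>u\<^sub>P\<^sub>3\<close>, up to a factor \<open>R\<^sup>2\<close>, by the horizontal flux through the gap. The vertical integral of a
  horizontal component differs from the trapezoidal value, which only involves the rigid velocity at
  the top, by the square of the height times an integral of \<open>\<bar>\<nabla>\<^sup>2u\<bar>\<close>. To leading order the trapezoidal
  values are an odd function of \<open>v\<close> times \<open>\<tau> - \<beta>\<close>; against the radial weight only the odd part of \<open>\<tau> - \<beta>\<close> survives,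
  which is of order \<open>R\<^sup>3\<close> by the \<open>C\<^sup>3\<close> bound. The rigid velocities themselves are bounded by the vertical integrals of \<open>\<bar>\<nabla>u\<bar>\<close>,
  since \<open>u\<close> vanishes at the bottom of the gap. Cauchy-Schwarz on the gap then gives the estimate. For \<open>h = 0\<close>
  a cruder version of the argument gives \<open>\<bar>u\<^sub>P\<^sub>3\<bar> \<le> M r\<close> for all small \<open>r\<close>, whence \<open>u\<^sub>P\<^sub>3 = 0\<close>.
\<close>

subsection \<open>Smooth functions\<close>

text \<open>The powers of \<open>h\<close> dictate the method. Over a disc of radius of order
  \<open>h^(1/2)\<close> the gap has volume of order \<open>h^2\<close>, so Cauchy-Schwarz turns an
  integral over it into \<open>h\<close> times an L2 norm. Bounding the horizontal flux by height
  times gradient would give only \<open>h^(1/2)\<close> in front of the gradient norm. Subtracting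
  the trapezoidal value moves this loss to the second derivatives and gains a factor
  \<open>h\<close> there; parity recovers the missing half power for the rest.

  The tangential and angular velocities of \<open>S\<close> may be large. The rotation about the
  vertical axis has to cancel exactly; the other parts are absorbed into vertical integrals of the
  gradient.

  The gap is open at its top, so a compactly supported test function must run on into
  \<open>S\<close>. There a vertical cut-off \<open>\<kappa>\<close>, equal to one around the gap,
  ends it, and since \<open>u\<close> is rigid in \<open>S\<close> its contribution is explicit.

  Regularity is the other obstacle: \<open>u\<close> has a weak gradient across the boundary of
  \<open>S\<close> but a Hessian only outside, and its boundary values are encoded by approximation.
  Every pointwise statement therefore lives on almost every vertical line.\<close>

primrec ck1 :: "nat \<Rightarrow> (real \<Rightarrow> real) \<Rightarrow> bool" where
  "ck1 0 f \<longleftrightarrow> True"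
| "ck1 (Suc k) f \<longleftrightarrow> (\<exists>f'. (\<forall>t. (f has_real_derivative f' t) (at t)) \<and> ck1 k f')"

text \<open>The chain of derivatives in \<open>ck1\<close> is existential, which spares computing
  iterated derivatives in the closure lemmas. Order zero demands nothing, not even continuity; the
  quantifier over all orders makes up for that.\<close>

definition smooth1 :: "(real \<Rightarrow> real) \<Rightarrow> bool" where
  "smooth1 f \<longleftrightarrow> (\<forall>k. ck1 k f)"

lemma ck1_Suc_imp: "ck1 (Suc k) f \<Longrightarrow> ck1 k f"
proof (induction k arbitrary: f)
  case (Suc k)
  then obtain f' where "\<forall>t. (f has_real_derivative f' t) (at t)" "ck1 (Suc k) f'" by auto
  then show ?case using Suc.IH by auto
qed simp

text \<open>Derivatives are unique, so the witnesses hidden in the different orders all coincide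
  with \<open>deriv f\<close>.\<close>

lemma smooth1_deriv:
  assumes "smooth1 f" shows "(f has_real_derivative deriv f t) (at t)" "smooth1 (deriv f)"
proof -
  obtain f' where f': "\<And>t. (f has_real_derivative f' t) (at t)"
    using assms unfolding smooth1_def by (metis ck1.simps(2))
  then have eq: "deriv f = f'" by (auto simp: fun_eq_iff intro: DERIV_imp_deriv)
  show "(f has_real_derivative deriv f t) (at t)" using f' eq by simp
  show "smooth1 (deriv f)" unfolding smooth1_def
  proof
    fix k
    obtain f'' where "\<And>t. (f has_real_derivative f'' t) (at t)" "ck1 k f''"
      using assms unfolding smooth1_def by (metis ck1.simps(2))
    moreover from this have "f'' = deriv f" by (auto simp: fun_eq_iff intro: DERIV_imp_deriv[symmetric])
    ultimately show "ck1 k (deriv f)" by simp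
  qed
qed

lemma smooth1_has_derivI:
  assumes "\<And>t. (f has_real_derivative f' t) (at t)" "smooth1 f'"
  shows "smooth1 f"
  unfolding smooth1_def
proof
  fix k show "ck1 k f" using assms by (cases k) (auto simp: smooth1_def)
qed

lemma ck1_const: "ck1 k (\<lambda>_. c)"
proof (induction k arbitrary: c)
  case (Suc k)
  show ?case by (auto intro!: exI[of _ "\<lambda>_. 0"] Suc)
qed simp

lemma ck1_add: "ck1 k f \<Longrightarrow> ck1 k g \<Longrightarrow> ck1 k (\<lambda>t. f t + g t)"
proof (induction k arbitrary: f g)
  case (Suc k)
  obtain f' g' where "\<forall>t. (f has_real_derivative f' t) (at t)" "ck1 k f'"
     "\<forall>t. (g has_real_derivative g' t) (at t)" "ck1 k g'"
    using Suc.prems by auto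
  then show ?case using Suc.IH[of f' g']
    by (auto intro!: exI[of _ "\<lambda>t. f' t + g' t"] derivative_intros)
qed simp

lemma ck1_mult: "ck1 k f \<Longrightarrow> ck1 k g \<Longrightarrow> ck1 k (\<lambda>t. f t * g t)"
proof (induction k arbitrary: f g)
  case (Suc k)
  obtain f' g' where fg: "\<forall>t. (f has_real_derivative f' t) (at t)" "ck1 k f'"
     "\<forall>t. (g has_real_derivative g' t) (at t)" "ck1 k g'"
    using Suc.prems by auto
  have "ck1 k (\<lambda>t. f' t * g t + f t * g' t)"
    by (intro ck1_add Suc.IH fg Suc.prems[THEN ck1_Suc_imp])
  moreover have "\<forall>t. ((\<lambda>t. f t * g t) has_real_derivative f' t * g t + f t * g' t) (at t)"
    using fg by (auto intro!: derivative_eq_intros)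
  ultimately show ?case unfolding ck1.simps by (intro exI[of _ "\<lambda>t. f' t * g t + f t * g' t"] conjI)
qed simp

lemma smooth1_const: "smooth1 (\<lambda>_. c)"
  and smooth1_add: "smooth1 f \<Longrightarrow> smooth1 g \<Longrightarrow> smooth1 (\<lambda>t. f t + g t)"
  and smooth1_mult: "smooth1 f \<Longrightarrow> smooth1 g \<Longrightarrow> smooth1 (\<lambda>t. f t * g t)"
  by (auto simp: smooth1_def ck1_const ck1_add ck1_mult)

lemma smooth1_affine:
  assumes "smooth1 f" shows "smooth1 (\<lambda>t. f (c * t + d))"
proof -
  have "ck1 k f \<Longrightarrow> ck1 k (\<lambda>t. f (c * t + d))" for k f
  proof (induction k arbitrary: f)
    case (Suc k)
    then obtain f' where f': "\<forall>t. (f has_real_derivative f' t) (at t)" "ck1 k f'" by auto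
    have "\<forall>t. ((\<lambda>t. f (c * t + d)) has_real_derivative c * f' (c * t + d)) (at t)"
    proof
      fix t
      have "((\<lambda>t. c * t + d) has_real_derivative c) (at t)" by (auto intro!: derivative_eq_intros)
      then show "((\<lambda>t. f (c * t + d)) has_real_derivative c * f' (c * t + d)) (at t)"
        using DERIV_chain2[of f "f' (c * t + d)" "\<lambda>t. c * t + d"] f'(1) by (simp add: mult.commute)
    qed
    moreover have "ck1 k (\<lambda>t. c * f' (c * t + d))"
      using Suc.IH[OF f'(2)] ck1_const ck1_mult by blast
    ultimately show ?case by auto
  qed simp
  then show ?thesis using assms by (auto simp: smooth1_def)
qed

lemma smooth1_isCont: "smooth1 f \<Longrightarrow> isCont f t"
  using smooth1_deriv(1) DERIV_isCont by blast

lemma smooth1_continuous_on: "smooth1 f \<Longrightarrow> continuous_on X f"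
  by (simp add: continuous_at_imp_continuous_on smooth1_isCont)

text \<open>The polynomial parameter makes the family closed under differentiation, so one induction
  over all polynomials proves that exp(-1/t), extended by zero, is smooth at the origin.\<close>

definition flat :: "real poly \<Rightarrow> real \<Rightarrow> real" where
  "flat p t = (if t > 0 then poly p (1 / t) * exp (- (1 / t)) else 0)"

lemma poly_times_exp_neg_tendsto: "((\<lambda>s::real. poly p s * exp (- s)) \<longlongrightarrow> 0) at_top"
proof -
  have "((\<lambda>s::real. \<Sum>i\<le>degree p. coeff p i * (s ^ i / exp s)) \<longlongrightarrow> (\<Sum>i\<le>degree p. coeff p i * 0)) at_top"
    by (intro tendsto_intros tendsto_power_div_exp_0)
  then show ?thesis by (simp add: poly_altdef sum_distrib_right exp_minus divide_inverse mult.assoc)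
qed

text \<open>This is the difference quotient at the origin. With s = 1/t the factor 1/t becomes a
  further factor s, hence \<open>pCons 0 p\<close>, and the exponential beats every
  polynomial.\<close>

lemma flat_over_tendsto: "((\<lambda>t. flat p t / t) \<longlongrightarrow> 0) (at 0)"
proof -
  have "((\<lambda>t. poly (pCons 0 p) (inverse t) * exp (- inverse t)) \<longlongrightarrow> 0) (at_right (0::real))"
    by (rule filterlim_compose[OF poly_times_exp_neg_tendsto filterlim_inverse_at_top_right])
  moreover have "\<forall>\<^sub>F t in at_right 0. poly (pCons 0 p) (inverse t) * exp (- inverse t) = flat p t / t"
    using eventually_at_right_less[of 0] by (auto elim!: eventually_mono simp: flat_def field_simps)
  ultimately have R: "((\<lambda>t. flat p t / t) \<longlongrightarrow> 0) (at_right 0)"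
    by (rule Lim_transform_eventually)
  have "\<forall>\<^sub>F t in at_left (0::real). flat p t / t = 0"
    using eventually_at_left_real[of "-1" 0] by (auto elim!: eventually_mono simp: flat_def)
  then have "((\<lambda>t. flat p t / t) \<longlongrightarrow> 0) (at_left 0)" by (rule tendsto_eventually)
  then show ?thesis using R by (simp add: filterlim_split_at)
qed

text \<open>With s = 1/t the product rule yields s^2 (p(s) - p'(s)) exp(-s), which is where the
  polynomial on the right comes from. At the origin the claim is
  \<open>flat_over_tendsto\<close>.\<close>

lemma flat_has_derivative:
  "(flat p has_real_derivative flat (monom 1 2 * (p - pderiv p)) t) (at t)"
  (is "(_ has_real_derivative flat ?q t) _")
proof -
  consider "t > 0" | "t < 0" | "t = 0" by linarith
  then show ?thesis
  proof cases
    case 1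
    have d: "((\<lambda>t. 1 / t) has_real_derivative - (1 / t\<^sup>2)) (at t)"
      using 1 by (auto intro!: derivative_eq_intros simp: power2_eq_square)
    have "((\<lambda>t. poly p (1 / t)) has_real_derivative poly (pderiv p) (1 / t) * - (1 / t\<^sup>2)) (at t)"
      by (rule DERIV_chain2[OF poly_DERIV d])
    moreover have "((\<lambda>t. exp (- (1 / t))) has_real_derivative exp (- (1 / t)) * - (- (1 / t\<^sup>2))) (at t)"
      by (intro DERIV_chain2[OF DERIV_exp] DERIV_minus d)
    ultimately have "((\<lambda>t. poly p (1 / t) * exp (- (1 / t))) has_real_derivative
       poly (pderiv p) (1 / t) * - (1 / t\<^sup>2) * exp (- (1 / t)) +
       exp (- (1 / t)) * - (- (1 / t\<^sup>2)) * poly p (1 / t)) (at t)"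
      by (rule DERIV_mult)
    moreover have "poly (pderiv p) (1 / t) * - (1 / t\<^sup>2) * exp (- (1 / t)) +
       exp (- (1 / t)) * - (- (1 / t\<^sup>2)) * poly p (1 / t) = flat ?q t"
      using 1 by (simp add: flat_def poly_monom field_simps)
    ultimately have "((\<lambda>t. poly p (1 / t) * exp (- (1 / t))) has_real_derivative flat ?q t) (at t)"
      by simp
    moreover have "\<forall>\<^sub>F s in nhds t. poly p (1 / s) * exp (- (1 / s)) = flat p s"
      using eventually_nhds_in_open[of "{0<..}" t] 1 by (auto elim!: eventually_mono simp: flat_def)
    ultimately show ?thesis by (rule DERIV_cong_ev[OF refl _ refl, THEN iffD1, rotated])
  next
    case 2
    have "((\<lambda>t. 0) has_real_derivative flat (monom 1 2 * (p - pderiv p)) t) (at t)"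
      using 2 by (auto simp: flat_def)
    moreover have "\<forall>\<^sub>F s in nhds t. 0 = flat p s"
      using eventually_nhds_in_open[of "{..<0}" t] 2 by (auto elim!: eventually_mono simp: flat_def)
    ultimately show ?thesis by (rule DERIV_cong_ev[OF refl _ refl, THEN iffD1, rotated])
  next
    case 3
    show ?thesis using flat_over_tendsto[of p] unfolding 3
      by (simp add: has_field_derivative_iff flat_def)
  qed
qed

lemma smooth1_flat: "smooth1 (flat p)"
proof -
  have "ck1 k (flat p)" for k
    by (induction k arbitrary: p) (auto intro!: flat_has_derivative exI)
  then show ?thesis by (simp add: smooth1_def)
qed

definition fl :: "real \<Rightarrow> real" where "fl t = (if t > 0 then exp (- (1 / t)) else 0)"

lemma fl_eq_flat: "fl = flat 1"
  by (auto simp: fl_def flat_def)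

lemma smooth1_fl: "smooth1 fl"
  by (simp add: fl_eq_flat smooth1_flat)

lemma fl_bounds: "0 \<le> fl t" "fl t \<le> 1" "fl t > 0 \<longleftrightarrow> t > 0" "fl t = 0 \<longleftrightarrow> t \<le> 0"
  by (auto simp: fl_def)

definition fl' :: "real \<Rightarrow> real" where "fl' t = (if t > 0 then exp (- (1 / t)) / t\<^sup>2 else 0)"

lemma fl_has_derivative: "(fl has_real_derivative fl' t) (at t)"
proof -
  have "fl' t = flat (monom 1 2 * (1 - pderiv 1)) t"
    by (auto simp: fl'_def flat_def poly_monom field_simps)
  then show ?thesis using flat_has_derivative[of 1 t] by (simp add: fl_eq_flat)
qed

lemma fl'_bounds: "0 \<le> fl' t" "fl' t \<le> 2"
proof -
  show "0 \<le> fl' t" by (auto simp: fl'_def)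
  show "fl' t \<le> 2"
  proof (cases "t > 0")
    case True
    \<comment> \<open>The quadratic Taylor bound of the exponential at 1/t is the source of the
      constant 2.\<close>
    have "(1/t)\<^sup>2 / 2 \<le> exp (1/t)"
      using exp_lower_Taylor_quadratic[of "1/t"] True by (smt (verit) divide_pos_pos)
    then have "(1/t)\<^sup>2 * exp (- (1/t)) \<le> (2 * exp (1/t)) * exp (- (1/t))"
      by (intro mult_right_mono) auto
    then have "exp (- (1/t)) * (1/t)\<^sup>2 \<le> 2"
      by (simp add: mult.assoc flip: exp_add) (simp add: mult.commute)
    then show ?thesis using True by (simp add: fl'_def power_divide)
  qed (simp add: fl'_def)
qed

lemma continuous_fl': "continuous_on X fl'"
proof -
  have "fl' = deriv fl" using fl_has_derivative by (auto simp: fun_eq_iff intro: DERIV_imp_deriv[symmetric])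
  then show ?thesis using smooth1_deriv(2)[OF smooth1_fl] smooth1_continuous_on by simp
qed

section \<open>Smooth functions of several variables\<close>

lemma partial_deriv_eq: "(f has_derivative f') (at x) \<Longrightarrow> partial_deriv i f x = f' (axis i 1)"
  unfolding partial_deriv_def by (metis frechet_derivative_at)

definition smoothn :: "(real^'n::finite \<Rightarrow> real) \<Rightarrow> bool" where
  "smoothn f \<longleftrightarrow> (\<forall>k. Ck_on k UNIV f)"

lemma Ck_on_Suc_imp: "Ck_on (Suc k) U f \<Longrightarrow> Ck_on k U f"
proof (induction k arbitrary: f)
  case 0
  then show ?case
    by (auto intro!: continuous_at_imp_continuous_on differentiable_imp_continuous_within)
qed auto

lemma Ck_on_const: "Ck_on k UNIV (\<lambda>_::real^'a::finite. c)"
proof (induction k arbitrary: c)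
  case (Suc k)
  have "partial_deriv i (\<lambda>_. c) = (\<lambda>_::real^'a. 0)" for i
    by (auto simp: fun_eq_iff intro!: partial_deriv_eq[where f'="\<lambda>_. 0"])
  then show ?case using Suc by simp
qed (simp add: continuous_on_const)

lemma Ck_on_add: "Ck_on k UNIV f \<Longrightarrow> Ck_on k UNIV g \<Longrightarrow> Ck_on k UNIV (\<lambda>x. f x + g x)"
proof (induction k arbitrary: f g)
  case (Suc k)
  have "partial_deriv i (\<lambda>x. f x + g x) = (\<lambda>x. partial_deriv i f x + partial_deriv i g x)" for i
  proof
    fix x
    have "(f has_derivative frechet_derivative f (at x)) (at x)"
         "(g has_derivative frechet_derivative g (at x)) (at x)"
      using Suc.prems by (simp_all flip: frechet_derivative_works)
    from has_derivative_add[OF this]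
    show "partial_deriv i (\<lambda>x. f x + g x) x = partial_deriv i f x + partial_deriv i g x"
      by (subst partial_deriv_eq) (auto simp: partial_deriv_def)
  qed
  then show ?case using Suc by (auto intro: differentiable_add)
qed (auto intro: continuous_intros)

lemma Ck_on_mult: "Ck_on k UNIV f \<Longrightarrow> Ck_on k UNIV g \<Longrightarrow> Ck_on k UNIV (\<lambda>x. f x * g x)"
proof (induction k arbitrary: f g)
  case (Suc k)
  have eq: "partial_deriv i (\<lambda>x. f x * g x) = (\<lambda>x. f x * partial_deriv i g x + partial_deriv i f x * g x)" for i
  proof
    fix x
    have "(f has_derivative frechet_derivative f (at x)) (at x)"
         "(g has_derivative frechet_derivative g (at x)) (at x)"
      using Suc.prems by (simp_all flip: frechet_derivative_works)
    from has_derivative_mult[OF this]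
    show "partial_deriv i (\<lambda>x. f x * g x) x = f x * partial_deriv i g x + partial_deriv i f x * g x"
      by (subst partial_deriv_eq) (auto simp: partial_deriv_def)
  qed
  have "Ck_on k UNIV f" "Ck_on k UNIV g" using Suc.prems Ck_on_Suc_imp by blast+
  then have "Ck_on k UNIV (\<lambda>x. f x * partial_deriv i g x + partial_deriv i f x * g x)" for i
    using Suc by (intro Ck_on_add Suc.IH) auto
  then show ?case using Suc.prems eq by (auto intro: differentiable_mult)
qed (auto intro: continuous_intros)

lemma smoothn_const: "smoothn (\<lambda>_. c)"
  and smoothn_add: "smoothn f \<Longrightarrow> smoothn g \<Longrightarrow> smoothn (\<lambda>x. f x + g x)"
  and smoothn_mult: "smoothn f \<Longrightarrow> smoothn g \<Longrightarrow> smoothn (\<lambda>x. f x * g x)"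
  by (auto simp: smoothn_def Ck_on_const Ck_on_add Ck_on_mult)

lemma smoothn_prod: "(\<And>i. i \<in> I \<Longrightarrow> smoothn (f i)) \<Longrightarrow> smoothn (\<lambda>x. \<Prod>i\<in>I. f i x)"
  by (induction I rule: infinite_finite_induct) (auto intro: smoothn_const smoothn_mult)

lemma smoothn_inner: "smoothn (\<lambda>x. (x - p) \<bullet> w)"
proof -
  have "Ck_on k UNIV (\<lambda>x. (x - p) \<bullet> w)" for k
  proof (cases k)
    case (Suc m)
    have d: "((\<lambda>x. (x - p) \<bullet> w) has_derivative (\<lambda>x. x \<bullet> w)) (at x)" for x
      by (auto intro!: derivative_eq_intros)
    then have "partial_deriv i (\<lambda>x. (x - p) \<bullet> w) = (\<lambda>_. axis i 1 \<bullet> w)" for i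
      by (auto simp: fun_eq_iff intro!: partial_deriv_eq[where f'="\<lambda>x. x \<bullet> w"])
    then show ?thesis using Suc d Ck_on_const by (auto simp: differentiable_def)
  qed (auto intro!: continuous_intros)
  then show ?thesis by (simp add: smoothn_def)
qed

text \<open>A partial derivative of the composition is again a composition, with
  \<open>deriv \<phi>\<close> outside, times a partial derivative of \<open>q\<close>. The induction
  must therefore be general in \<open>\<phi>\<close>.\<close>

lemma smoothn_compose:
  assumes \<phi>: "smooth1 \<phi>" and q: "smoothn q"
  shows "smoothn (\<lambda>x. \<phi> (q x))"
proof -
  have "Ck_on k UNIV (\<lambda>x. \<phi> (q x))" for k using \<phi>
  proof (induction k arbitrary: \<phi>)
    case 0
    have "continuous_on UNIV q" using q unfolding smoothn_def by (metis Ck_on.simps(1))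
    then show ?case using smooth1_continuous_on[OF 0, of UNIV]
      by (auto intro!: continuous_on_compose2[of UNIV \<phi>])
  next
    case (Suc k)
    have qd: "Ck_on (Suc k) UNIV q" using q unfolding smoothn_def by blast
    have d: "((\<lambda>x. \<phi> (q x)) has_derivative (\<lambda>y. deriv \<phi> (q x) * frechet_derivative q (at x) y)) (at x)" for x
    proof -
      have "(q has_derivative frechet_derivative q (at x)) (at x)"
        using qd frechet_derivative_works by auto
      moreover have "(\<phi> has_derivative (\<lambda>y. deriv \<phi> (q x) * y)) (at (q x))"
        using smooth1_deriv(1)[OF Suc.prems] by (simp add: has_field_derivative_def)
      ultimately show ?thesis by (rule has_derivative_compose)
    qed
    have "partial_deriv i (\<lambda>x. \<phi> (q x)) = (\<lambda>x. deriv \<phi> (q x) * partial_deriv i q x)" for i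
      using partial_deriv_eq[OF d] by (auto simp: fun_eq_iff partial_deriv_def)
    moreover have "Ck_on k UNIV (\<lambda>x. deriv \<phi> (q x) * partial_deriv i q x)" for i
      using Suc smooth1_deriv(2) qd by (intro Ck_on_mult) auto
    ultimately show ?case using d by (auto simp: differentiable_def)
  qed
  then show ?thesis by (simp add: smoothn_def)
qed

lemma smoothnD:
  assumes "smoothn f"
  shows "(f has_derivative frechet_derivative f (at x)) (at x)" "continuous_on X f"
    "continuous_on X (partial_deriv i f)"
proof -
  have *: "Ck_on (Suc 0) UNIV f" "Ck_on 0 UNIV f" using assms unfolding smoothn_def by blast+
  then show "(f has_derivative frechet_derivative f (at x)) (at x)"
    by (simp flip: frechet_derivative_works)
  show "continuous_on X f" "continuous_on X (partial_deriv i f)"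
    using * by (auto intro: continuous_on_subset[OF _ subset_UNIV])
qed

lemma frechet_eq_sum_partial:
  assumes "f differentiable (at x)"
  shows "frechet_derivative f (at x) w = (\<Sum>i\<in>UNIV. w $ i * partial_deriv i f x)"
proof -
  have lin: "linear (frechet_derivative f (at x))" using assms linear_frechet_derivative by blast
  have "w = (\<Sum>i\<in>UNIV. w $ i *\<^sub>R axis i 1)"
    by (metis basis_expansion scalar_mult_eq_scaleR)
  then have "frechet_derivative f (at x) w = frechet_derivative f (at x) (\<Sum>i\<in>UNIV. w $ i *\<^sub>R axis i 1)" by simp
  then show ?thesis by (simp add: linear_sum[OF lin] linear_scale[OF lin] partial_deriv_def)
qed

subsection \<open>Bump functions and the fundamental lemma of the calculus of variations\<close>

text \<open>For growing \<open>n\<close> these smooth functions tend pointwise to the indicator of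
  the open box, as exp(-1/(n t)) tends to one for t > 0. The product form makes them split into a
  horizontal and a vertical factor later.\<close>

definition bump :: "nat \<Rightarrow> 'a::euclidean_space \<Rightarrow> 'a \<Rightarrow> 'a \<Rightarrow> real" where
  "bump n a b x = (\<Prod>i\<in>Basis. fl (real n * (x \<bullet> i - a \<bullet> i)) * fl (real n * (b \<bullet> i - x \<bullet> i)))"

lemma bump_bounds: "0 \<le> bump n a b x" "bump n a b x \<le> 1"
  unfolding bump_def by (auto intro!: prod_nonneg prod_le_1 mult_le_one simp: fl_bounds)

lemma bump_eq_0: "x \<notin> box a b \<Longrightarrow> bump n a b x = 0"
  unfolding bump_def by (force simp: box_def not_less fl_bounds intro!: mult_nonneg_nonpos)

lemma continuous_on_bump: "continuous_on X (bump n a b)"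
proof -
  have "continuous_on X (\<lambda>x. fl (g x))" if "continuous_on X g" for g :: "'a \<Rightarrow> real"
    by (rule continuous_on_compose2[OF smooth1_continuous_on[OF smooth1_fl, of UNIV] that]) auto
  note this[continuous_intros]
  show ?thesis unfolding bump_def by (intro continuous_intros)
qed

lemma borel_measurable_bump[measurable]: "bump n a b \<in> borel_measurable borel"
  using continuous_on_bump by (rule borel_measurable_continuous_onI)

lemma fl_scaled_tendsto: "(\<lambda>n. fl (real n * t)) \<longlonglongrightarrow> (if t > 0 then 1 else 0)"
proof (cases "t > 0")
  case True
  have "(\<lambda>n. exp (- (1 / t) * inverse (real n))) \<longlonglongrightarrow> exp (- (1 / t) * 0)"
    by (intro tendsto_intros lim_inverse_n)
  then have "(\<lambda>n. exp (- (1 / t) * inverse (real n))) \<longlonglongrightarrow> 1" by simp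
  moreover have "\<forall>\<^sub>F n in sequentially. exp (- (1 / t) * inverse (real n)) = fl (real n * t)"
    using eventually_gt_at_top[of 0]
    by eventually_elim (use True in \<open>auto simp: fl_def field_simps\<close>)
  ultimately show ?thesis using True Lim_transform_eventually by fastforce
next
  case False
  then have "fl (real n * t) = 0" for n by (simp add: fl_bounds mult_nonneg_nonpos)
  then show ?thesis using False by simp
qed

lemma bump_tendsto: "(\<lambda>n. bump n a b x) \<longlonglongrightarrow> indicator (box a b) x"
proof -
  have "(\<lambda>n. bump n a b x) \<longlonglongrightarrow> (\<Prod>i\<in>Basis. (if x \<bullet> i - a \<bullet> i > 0 then 1 else 0) * (if b \<bullet> i - x \<bullet> i > 0 then 1 else 0))"
    unfolding bump_def by (intro tendsto_intros fl_scaled_tendsto)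
  moreover have "(\<Prod>i\<in>Basis. (if x \<bullet> i - a \<bullet> i > 0 then 1 else 0) * (if b \<bullet> i - x \<bullet> i > 0 then 1 else 0)) = (indicator (box a b) x :: real)"
  proof (cases "x \<in> box a b")
    case False
    then obtain i where "i \<in> Basis" "\<not> (a \<bullet> i < x \<bullet> i \<and> x \<bullet> i < b \<bullet> i)" by (auto simp: box_def)
    then show ?thesis using False by (auto intro!: prod_zero bexI[of _ i])
  qed (auto simp: box_def)
  ultimately show ?thesis by simp
qed

lemma smoothn_bump: "smoothn (bump n a (b::real^'n::finite))"
proof -
  have "smoothn (\<lambda>x::real^'n. fl (real n * (x \<bullet> i - a \<bullet> i)) * fl (real n * (b \<bullet> i - x \<bullet> i)))" for i
  proof -
    have 1: "smooth1 (\<lambda>t. fl (real n * t + (- real n * (a \<bullet> i))))" "smooth1 (\<lambda>t. fl ((- real n) * t + real n * (b \<bullet> i)))"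
      by (intro smooth1_affine smooth1_fl)+
    have "smoothn (\<lambda>x::real^'n. (x - 0) \<bullet> i)" by (rule smoothn_inner)
    from smoothn_mult[OF smoothn_compose[OF 1(1) this] smoothn_compose[OF 1(2) this]]
    show ?thesis by (simp add: algebra_simps)
  qed
  then have "smoothn (\<lambda>x. bump n a b x)"
    unfolding bump_def by (intro smoothn_prod)
  then show ?thesis by simp
qed

lemma test_funI:
  assumes "smoothn \<phi>" "compact K" "K \<subseteq> U" "\<And>x. x \<notin> K \<Longrightarrow> \<phi> x = 0"
  shows "test_fun U \<phi>"
proof -
  have "closure {x. \<phi> x \<noteq> 0} \<subseteq> K"
    using assms by (intro closure_minimal compact_imp_closed) auto
  then show ?thesis using assms unfolding test_fun_def smoothn_def
    by (meson closed_closure compact_closure bounded_subset closure_closure compact_imp_bounded subset_trans compact_eq_bounded_closed)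
qed

lemma test_fun_bump: "cbox a b \<subseteq> U \<Longrightarrow> test_fun U (bump n a b)"
  using box_subset_cbox[of a b] by (intro test_funI[of _ "cbox a b"] smoothn_bump bump_eq_0) auto

text \<open>Open boxes are stable under intersection and generate the Borel sets, so by Dynkin's
  argument the integral of \<open>F\<close> vanishes over every Borel set.\<close>

lemma AE_zero_of_box_integrals:
  fixes F :: "'a::euclidean_space \<Rightarrow> real"
  assumes F: "integrable lborel F"
    and z: "\<And>c d. (\<integral>x. F x * indicator (box c d) x \<partial>lborel) = 0"
  shows "AE x in lborel. F x = 0"
proof -
  have Int_stable: "Int_stable (range (\<lambda>(a::'a, b). box a b))"
    by (auto simp: Int_stable_def box_Int_box)
  \<comment> \<open>The complement case of the Dynkin induction needs the whole space, which is
    exhausted by cubes.\<close>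
  have UNI: "(\<integral>x. F x * indicator UNIV x \<partial>lborel) = 0"
  proof -
    have "(\<lambda>n. \<integral>x. F x * indicator (box (- (real n *\<^sub>R One)) (real n *\<^sub>R One)) x \<partial>lborel)
        \<longlonglongrightarrow> (\<integral>x. F x * indicator UNIV x \<partial>lborel)"
    proof (rule integral_dominated_convergence[where w="\<lambda>x. norm (F x)"])
      show "AE x in lborel. (\<lambda>n. F x * indicator (box (- (real n *\<^sub>R One)) (real n *\<^sub>R One)) x) \<longlonglongrightarrow> F x * indicator UNIV x"
      proof (rule AE_I2, rule tendsto_eventually)
        fix x :: 'a
        obtain N where "x \<in> box (- (real N *\<^sub>R One)) (real N *\<^sub>R One)"
          using UN_box_eq_UNIV[where 'a='a] by blast
        then have "x \<in> box (- (real n *\<^sub>R One)) (real n *\<^sub>R One)" if "n \<ge> N" for n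
          using of_nat_mono[OF that, where 'a=real] by (fastforce simp: box_def)
        then show "\<forall>\<^sub>F n in sequentially. F x * indicator (box (- (real n *\<^sub>R One)) (real n *\<^sub>R One)) x = F x * indicator UNIV x"
          unfolding eventually_sequentially by (intro exI[of _ N]) simp
      qed
    qed (use F in \<open>auto simp: indicator_def\<close>)
    then show ?thesis by (simp add: z LIMSEQ_const_iff)
  qed
  have int: "integrable lborel (\<lambda>x. F x * indicator A x)" if "A \<in> sets lborel" for A
    using integrable_mult_indicator[OF that F] by (simp add: mult.commute)
  have "(\<integral>x. F x * indicator A x \<partial>lborel) = 0" if "A \<in> sets lborel" for A
  proof -
    have "A \<in> sigma_sets UNIV (range (\<lambda>(a::'a, b). box a b))" using that by (simp add: borel_eq_box)
    then show ?thesis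
    proof (induction rule: sigma_sets_induct_disjoint[OF Int_stable subset_Pow_Union[THEN subset_trans, OF Pow_mono[OF subset_UNIV]], consumes 1, case_names basic empty compl union])
      case (union A)
      have meas: "A i \<in> sets lborel" for i using union(2) by (auto simp: borel_eq_box)
      have "(\<integral>x\<in>(\<Union>i. A i). F x \<partial>lborel) = (\<Sum>i. \<integral>x\<in>A i. F x \<partial>lborel)"
        using union(1) meas int[of "\<Union>i. A i"]
        by (intro lebesgue_integral_countable_add) (auto simp: disjoint_family_on_def set_integrable_def mult.commute)
      then show ?case using union(3) by (simp add: set_lebesgue_integral_def mult.commute)
    next
      case (compl A)
      have A: "A \<in> sets lborel" using compl(1) by (simp add: borel_eq_box)
      have "(\<integral>x. F x * indicator (UNIV - A) x \<partial>lborel) = (\<integral>x. F x * indicator UNIV x - F x * indicator A x \<partial>lborel)"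
        by (intro Bochner_Integration.integral_cong) (auto simp: indicator_def)
      also have "\<dots> = 0" using compl UNI int[OF A] int[of UNIV] by (subst Bochner_Integration.integral_diff) auto
      finally show ?case .
    qed (use z in auto)
  qed
  then show ?thesis
    by (intro density_unique_real[OF F]) (auto simp: set_lebesgue_integral_def mult.commute)
qed

text \<open>Dominated convergence replaces the bumps by indicators of boxes, which reduces the claim
  to \<open>AE_zero_of_box_integrals\<close>.\<close>

lemma fundamental_lemma_box:
  fixes F :: "'a::euclidean_space \<Rightarrow> real"
  assumes F: "integrable lborel F"
    and z: "\<And>c d n. cbox c d \<subseteq> cbox a b \<Longrightarrow> (\<integral>x. F x * bump n c d x \<partial>lborel) = 0"
  shows "AE x in lborel. x \<in> box a b \<longrightarrow> F x = 0"
proof -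
  have zbox: "(\<integral>x. F x * indicator (box c d) x \<partial>lborel) = 0" if ab: "cbox c d \<subseteq> cbox a b" for c d
  proof -
    have "(\<lambda>n. \<integral>x. F x * bump n c d x \<partial>lborel) \<longlonglongrightarrow> (\<integral>x. F x * indicator (box c d) x \<partial>lborel)"
    proof (rule integral_dominated_convergence[where w="\<lambda>x. norm (F x)"])
      show "AE x in lborel. norm (F x * bump n c d x) \<le> norm (F x)" for n
        by (intro AE_I2) (simp add: abs_mult abs_of_nonneg[OF bump_bounds(1)] mult_right_le_one_le bump_bounds)
      show "AE x in lborel. (\<lambda>n. F x * bump n c d x) \<longlonglongrightarrow> F x * indicator (box c d) x"
        by (intro AE_I2 tendsto_intros bump_tendsto)
    qed (use F in auto)
    then show ?thesis by (simp add: z[OF ab] LIMSEQ_const_iff)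
  qed
  have "AE x in lborel. F x * indicator (box a b) x = 0"
  proof (rule AE_zero_of_box_integrals)
    show "integrable lborel (\<lambda>x. F x * indicator (box a b) x)"
      using integrable_mult_indicator[OF _ F, of "box a b"] by (simp add: mult.commute)
    fix c d :: 'a
    \<comment> \<open>\<open>F\<close> is cut to \<open>box a b\<close>, and the test boxes are
      arbitrary. Since the intersection of two boxes is a box, only boxes inside
      \<open>cbox a b\<close> matter.\<close>
    obtain e f where ef: "box a b \<inter> box c d = box e f" using box_Int_box[of a b c d] by blast
    show "(\<integral>x. F x * indicator (box a b) x * indicator (box c d) x \<partial>lborel) = 0"
    proof (cases "box e f = {}")
      case True
      then have "F x * indicator (box a b) x * indicator (box c d) x = 0" for x
        using ef by (auto simp: indicator_def)
      then show ?thesis by (simp only: integral_zero)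
    next
      case False
      then have "cbox e f \<subseteq> cbox a b"
        using ef by (metis closure_box closure_mono Int_lower1 inf.absorb_iff2 box_eq_empty(1) subset_empty)
      then have "(\<integral>x. F x * indicator (box e f) x \<partial>lborel) = 0" using zbox by blast
      then show ?thesis unfolding ef[symmetric] by (simp add: indicator_inter_arith mult.assoc)
    qed
  qed
  then show ?thesis by eventually_elim (auto simp: indicator_def)
qed

text \<open>Boxes with rational corners whose closure lies in \<open>W\<close> cover
  \<open>W\<close> and are countable, so the exceptional null sets can be united.\<close>

lemma AE_open_of_boxes:
  fixes W :: "'a::euclidean_space set"
  assumes W: "open W"
    and box: "\<And>a b. cbox a b \<subseteq> W \<Longrightarrow> AE x in lborel. x \<in> box a b \<longrightarrow> P x"
  shows "AE x in lborel. x \<in> W \<longrightarrow> P x"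
proof -
  obtain D :: "('a \<times> 'a) set" where D: "countable D" "\<And>p. p \<in> D \<Longrightarrow> cbox (fst p) (snd p) \<subseteq> W"
    "W = (\<Union>p\<in>D. box (fst p) (snd p))"
  proof -
    define R where "R = {(a,b). box a b \<noteq> {} \<and> cbox a b \<subseteq> W \<and> (\<forall>i\<in>Basis. a \<bullet> i \<in> \<rat> \<and> b \<bullet> i \<in> \<rat>)}"
    have cr: "countable {x::'a. \<forall>i\<in>Basis. x \<bullet> i \<in> \<rat>}"
    proof -
      have "{x::'a. \<forall>i\<in>Basis. x \<bullet> i \<in> \<rat>} \<subseteq> (\<lambda>f. \<Sum>i\<in>Basis. f i *\<^sub>R i) ` (Basis \<rightarrow>\<^sub>E \<rat>)"
      proof
        fix x :: 'a assume "x \<in> {x. \<forall>i\<in>Basis. x \<bullet> i \<in> \<rat>}"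
        then show "x \<in> (\<lambda>f. \<Sum>i\<in>Basis. f i *\<^sub>R i) ` (Basis \<rightarrow>\<^sub>E \<rat>)"
          by (intro image_eqI[of _ _ "restrict (\<lambda>i. x \<bullet> i) Basis"]) (auto simp: euclidean_representation)
      qed
      moreover have "countable (Basis \<rightarrow>\<^sub>E \<rat> :: ('a \<Rightarrow> real) set)"
        by (intro countable_PiE) (auto simp: countable_rat)
      ultimately show ?thesis by (rule countable_subset[OF _ countable_image])
    qed
    have "R \<subseteq> {x::'a. \<forall>i\<in>Basis. x \<bullet> i \<in> \<rat>} \<times> {x::'a. \<forall>i\<in>Basis. x \<bullet> i \<in> \<rat>}"
      by (auto simp: R_def)
    then have "countable R" by (rule countable_subset) (intro countable_SIGMA cr)
    moreover have "W = (\<Union>p\<in>R. box (fst p) (snd p))"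
    proof
      show "W \<subseteq> (\<Union>p\<in>R. box (fst p) (snd p))"
      proof
        fix x assume "x \<in> W"
        then obtain e where e: "e > 0" "cball x e \<subseteq> W" using W open_contains_cball by metis
        obtain a b where ab: "\<forall>i\<in>Basis. a \<bullet> i \<in> \<rat> \<and> b \<bullet> i \<in> \<rat>" "x \<in> box a b" "box a b \<subseteq> ball x e"
          using rational_boxes[OF e(1)] by metis
        have "cbox a b \<subseteq> cball x e"
          using ab(2,3) e(1) by (metis closure_box closure_mono closure_ball empty_iff less_irrefl)
        then show "x \<in> (\<Union>p\<in>R. box (fst p) (snd p))"
          using ab e(2) by (intro UN_I[of "(a,b)"]) (auto simp: R_def)
      qed
      show "(\<Union>p\<in>R. box (fst p) (snd p)) \<subseteq> W"
        by (auto simp: R_def dest!: subsetD[OF box_subset_cbox])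
    qed
    moreover have "cbox (fst p) (snd p) \<subseteq> W" if "p \<in> R" for p
      using that by (auto simp: R_def)
    ultimately show ?thesis by (intro that[of R])
  qed
  have "AE x in lborel. \<forall>p\<in>D. x \<in> box (fst p) (snd p) \<longrightarrow> P x"
    using D box by (intro AE_ball_countable') auto
  then show ?thesis unfolding D(3) by eventually_elim auto
qed

subsection \<open>Weak derivatives\<close>

lemma Cauchy_Schwarz_integral:
  fixes f g :: "'a \<Rightarrow> real"
  assumes [measurable]: "f \<in> borel_measurable M" "g \<in> borel_measurable M"
    and f2: "integrable M (\<lambda>x. (f x)\<^sup>2)" and g2: "integrable M (\<lambda>x. (g x)\<^sup>2)"
  shows "integrable M (\<lambda>x. f x * g x)"
    and "(\<integral>x. \<bar>f x * g x\<bar> \<partial>M) \<le> sqrt (\<integral>x. (f x)\<^sup>2 \<partial>M) * sqrt (\<integral>x. (g x)\<^sup>2 \<partial>M)"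
    and "\<bar>\<integral>x. f x * g x \<partial>M\<bar> \<le> sqrt (\<integral>x. (f x)\<^sup>2 \<partial>M) * sqrt (\<integral>x. (g x)\<^sup>2 \<partial>M)"
proof -
  have "norm (f x * g x) \<le> norm ((f x)\<^sup>2 + (g x)\<^sup>2)" for x
    using sum_squares_bound[of "\<bar>f x\<bar>" "\<bar>g x\<bar>"] mult_nonneg_nonneg[OF abs_ge_zero[of "f x"] abs_ge_zero[of "g x"]]
    by (simp only: power2_abs abs_mult real_norm_def abs_of_nonneg[OF add_nonneg_nonneg[OF zero_le_power2 zero_le_power2]])
  then show i: "integrable M (\<lambda>x. f x * g x)"
    by (intro Bochner_Integration.integrable_bound[OF Bochner_Integration.integrable_add[OF f2 g2]]) auto
  have ia: "integrable M (\<lambda>x. \<bar>f x * g x\<bar>)" using i by simp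
  have "(\<integral>\<^sup>+x. ennreal \<bar>f x\<bar> * ennreal \<bar>g x\<bar> \<partial>M)\<^sup>2 \<le> (\<integral>\<^sup>+x. ennreal \<bar>f x\<bar> ^ 2 \<partial>M) * (\<integral>\<^sup>+x. ennreal \<bar>g x\<bar> ^ 2 \<partial>M)"
    by (intro Cauchy_Schwarz_nn_integral) auto
  then have "(\<integral>\<^sup>+x. ennreal \<bar>f x * g x\<bar> \<partial>M)\<^sup>2 \<le> (\<integral>\<^sup>+x. ennreal ((f x)\<^sup>2) \<partial>M) * (\<integral>\<^sup>+x. ennreal ((g x)\<^sup>2) \<partial>M)"
    by (simp add: ennreal_mult[symmetric] abs_mult ennreal_power)
  also have "(\<integral>\<^sup>+x. ennreal ((f x)\<^sup>2) \<partial>M) = ennreal (\<integral>x. (f x)\<^sup>2 \<partial>M)" by (intro nn_integral_eq_integral f2) auto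
  also have "(\<integral>\<^sup>+x. ennreal ((g x)\<^sup>2) \<partial>M) = ennreal (\<integral>x. (g x)\<^sup>2 \<partial>M)" by (intro nn_integral_eq_integral g2) auto
  also have "(\<integral>\<^sup>+x. ennreal \<bar>f x * g x\<bar> \<partial>M) = ennreal (\<integral>x. \<bar>f x * g x\<bar> \<partial>M)" by (intro nn_integral_eq_integral ia) auto
  finally have "(\<integral>x. \<bar>f x * g x\<bar> \<partial>M)\<^sup>2 \<le> (\<integral>x. (f x)\<^sup>2 \<partial>M) * (\<integral>x. (g x)\<^sup>2 \<partial>M)"
    by (simp add: ennreal_mult[symmetric] ennreal_power)
  then have "sqrt ((\<integral>x. \<bar>f x * g x\<bar> \<partial>M)\<^sup>2) \<le> sqrt ((\<integral>x. (f x)\<^sup>2 \<partial>M) * (\<integral>x. (g x)\<^sup>2 \<partial>M))"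
    by (rule real_sqrt_le_mono)
  then show le: "(\<integral>x. \<bar>f x * g x\<bar> \<partial>M) \<le> sqrt (\<integral>x. (f x)\<^sup>2 \<partial>M) * sqrt (\<integral>x. (g x)\<^sup>2 \<partial>M)"
    by (simp add: real_sqrt_mult)
  show "\<bar>\<integral>x. f x * g x \<partial>M\<bar> \<le> sqrt (\<integral>x. (f x)\<^sup>2 \<partial>M) * sqrt (\<integral>x. (g x)\<^sup>2 \<partial>M)"
    using integral_abs_bound[of M "\<lambda>x. f x * g x"] le by linarith
qed

text \<open>Difference quotients in direction \<open>e\<close> have integral zero by translation
  invariance. They converge pointwise to the derivative and are bounded by the mean value theorem,
  so dominated convergence suffices; the derivative need not be continuous.\<close>

lemma integral_derivative_compact_support:
  fixes f :: "'a::euclidean_space \<Rightarrow> real"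
  assumes der: "\<And>x. (f has_derivative f' x) (at x)"
    and bnd: "\<And>x. \<bar>f' x e\<bar> \<le> M"
    and supp: "\<And>x. R < norm x \<Longrightarrow> f x = 0"
  shows "(\<integral>x. f' x e \<partial>lborel) = 0"
proof -
  have cont: "continuous_on UNIV f"
    using der by (auto intro!: continuous_at_imp_continuous_on has_derivative_continuous)
  then have [measurable]: "f \<in> borel_measurable borel" by (rule borel_measurable_continuous_onI)
  have line: "((\<lambda>t. f (x + t *\<^sub>R e)) has_real_derivative f' (x + t *\<^sub>R e) e) (at t)" for x t
  proof -
    have "((\<lambda>t. x + t *\<^sub>R e) has_derivative (\<lambda>t. t *\<^sub>R e)) (at t)"
      by (auto intro!: derivative_eq_intros)
    from has_derivative_compose[OF this der]
    have "((\<lambda>t. f (x + t *\<^sub>R e)) has_derivative (\<lambda>s. f' (x + t *\<^sub>R e) (s *\<^sub>R e))) (at t)" .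
    moreover have "linear (f' (x + t *\<^sub>R e))" using der has_derivative_linear by blast
    then have "f' (x + t *\<^sub>R e) (s *\<^sub>R e) = f' (x + t *\<^sub>R e) e * s" for s
      using linear_scale by fastforce
    ultimately show ?thesis by (simp add: has_field_derivative_def)
  qed
  define g where "g n x = real (Suc n) * (f (x + (1 / real (Suc n)) *\<^sub>R e) - f x)" for n x
  have [measurable]: "g n \<in> borel_measurable borel" for n unfolding g_def by measurable
  have glim: "(\<lambda>n. g n x) \<longlonglongrightarrow> f' x e" for x
  proof -
    have "((\<lambda>h. (f (x + (0 + h) *\<^sub>R e) - f (x + 0 *\<^sub>R e)) / h) \<longlongrightarrow> f' (x + 0 *\<^sub>R e) e) (at 0)"
      using line[of x 0] by (simp add: DERIV_def)
    then have "((\<lambda>h. (f (x + h *\<^sub>R e) - f x) / h) \<longlongrightarrow> f' x e) (at 0)" by simp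
    moreover have "filterlim (\<lambda>n. 1 / real (Suc n)) (at 0) sequentially"
      using LIMSEQ_inverse_real_of_nat by (auto simp: filterlim_at inverse_eq_divide)
    ultimately have "(\<lambda>n. (f (x + (1 / real (Suc n)) *\<^sub>R e) - f x) / (1 / real (Suc n))) \<longlonglongrightarrow> f' x e"
      by (rule filterlim_compose)
    then show ?thesis by (simp add: g_def mult.commute)
  qed
  \<comment> \<open>All steps have length at most \<open>norm e\<close>, hence the difference
    quotients vanish outside the enlarged ball of radius \<open>R + norm e\<close>.\<close>
  have gb: "\<bar>g n x\<bar> \<le> M * indicator (cball 0 (R + norm e)) x" for n x
  proof (cases "x \<in> cball 0 (R + norm e)")
    case True
    obtain z where "f (x + (1 / real (Suc n)) *\<^sub>R e) - f (x + 0 *\<^sub>R e) = (1 / real (Suc n) - 0) * f' (x + z *\<^sub>R e) e"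
      using MVT2[of 0 "1 / real (Suc n)" "\<lambda>t. f (x + t *\<^sub>R e)" "\<lambda>t. f' (x + t *\<^sub>R e) e"] line by auto
    then have "g n x = f' (x + z *\<^sub>R e) e" unfolding g_def by simp
    then show ?thesis using bnd True by simp
  next
    case False
    then have n: "norm x > R + norm e" by simp
    have "norm ((1 / real (Suc n)) *\<^sub>R e) \<le> norm e" by (simp add: divide_le_eq mult_le_cancel_left1)
    then have "norm (x + (1 / real (Suc n)) *\<^sub>R e) > R"
      using n norm_triangle_ineq2[of x "- ((1 / real (Suc n)) *\<^sub>R e)"] by simp
    moreover have "norm x > R" using n norm_ge_zero[of e] by linarith
    ultimately show ?thesis using supp False by (simp add: g_def)
  qed
  have fi: "integrable lborel f"
  proof -
    have "integrable lborel (\<lambda>x. indicator (cball 0 R) x *\<^sub>R f x)"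
      by (rule borel_integrable_compact) (auto intro: continuous_on_subset[OF cont])
    moreover have "(\<lambda>x. indicator (cball 0 R) x *\<^sub>R f x) = f" using supp by (force simp: indicator_def)
    ultimately show ?thesis by simp
  qed
  have trans: "integrable lborel (\<lambda>x. f (x + c))" "(\<integral>x. f (x + c) \<partial>lborel) = (\<integral>x. f x \<partial>lborel)" for c
  proof -
    have "(\<lambda>x. x + c) = (+) c" by (auto simp: fun_eq_iff)
    then have "lborel = distr lborel borel (\<lambda>x. x + c)"
      using lborel_distr_plus[of c] by simp
    then show "integrable lborel (\<lambda>x. f (x + c))" "(\<integral>x. f (x + c) \<partial>lborel) = (\<integral>x. f x \<partial>lborel)"
      using fi integrable_distr_eq[of "\<lambda>x. x + c" lborel borel f] integral_distr[of "\<lambda>x. x + c" lborel borel f] by auto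
  qed
  have gz: "(\<integral>x. g n x \<partial>lborel) = 0" for n
    unfolding g_def using trans fi by simp
  have "(\<lambda>n. \<integral>x. g n x \<partial>lborel) \<longlonglongrightarrow> (\<integral>x. f' x e \<partial>lborel)"
  proof (rule integral_dominated_convergence[where w="\<lambda>x. M * indicator (cball 0 (R + norm e)) x"])
    show "(\<lambda>x. f' x e) \<in> borel_measurable lborel"
      by (rule borel_measurable_LIMSEQ_real[OF glim]) simp
    show "integrable lborel (\<lambda>x. M * indicator (cball 0 (R + norm e)) x)"
      by (intro integrable_mult_right integrable_real_indicator emeasure_bounded_finite bounded_cball) simp
  qed (use glim gb in auto)
  then show ?thesis by (simp add: gz LIMSEQ_const_iff)
qed

lemma borel_imp_lebesgue:
  "f \<in> borel_measurable borel \<Longrightarrow> f \<in> borel_measurable lebesgue"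
  by (simp add: measurable_completion)

lemma loc_integrable_times_bump:
  assumes "loc_integrable U f" "cbox a b \<subseteq> U"
  shows "integrable lebesgue (\<lambda>x. indicator U x *\<^sub>R (f x * bump n a b x))"
proof -
  have "integrable lebesgue (\<lambda>x. indicator (cbox a b) x *\<^sub>R f x)"
    using assms by (auto simp: loc_integrable_def set_integrable_def)
  then have i: "integrable lebesgue (\<lambda>x. indicator (cbox a b) x *\<^sub>R f x)" .
  have "integrable lebesgue (\<lambda>x. bump n a b x * (indicator (cbox a b) x *\<^sub>R f x))"
  proof (rule Bochner_Integration.integrable_bound[OF i])
    show "(\<lambda>x. bump n a b x * (indicator (cbox a b) x *\<^sub>R f x)) \<in> borel_measurable lebesgue"
      by (intro borel_measurable_times borel_measurable_integrable[OF i] borel_imp_lebesgue) simp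
    show "AE x in lebesgue. norm (bump n a b x * (indicator (cbox a b) x *\<^sub>R f x)) \<le> norm (indicator (cbox a b) x *\<^sub>R f x)"
      by (intro AE_I2) (simp add: abs_mult abs_of_nonneg[OF bump_bounds(1)] mult_left_le_one_le bump_bounds)
  qed
  moreover have "(\<lambda>x. bump n a b x * (indicator (cbox a b) x *\<^sub>R f x)) = (\<lambda>x. indicator U x *\<^sub>R (f x * bump n a b x))"
  proof
    fix x show "bump n a b x * (indicator (cbox a b) x *\<^sub>R f x) = indicator U x *\<^sub>R (f x * bump n a b x)"
      using bump_eq_0[of x a b n] subsetD[OF box_subset_cbox[of a b], of x] assms(2) by (auto simp: indicator_def)
  qed
  ultimately show ?thesis by simp
qed

text \<open>Tested with bumps, the difference of the two candidates integrates to zero in every box,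
  so the fundamental lemma applies box by box.\<close>

lemma weak_partial_unique:
  fixes f :: "real^'n::finite \<Rightarrow> real"
  assumes U: "open U" and g: "weak_partial U j f g" and g': "weak_partial U j f g'"
  shows "AE x in lebesgue. x \<in> U \<longrightarrow> g x = g' x"
proof -
  have "AE x in lborel. x \<in> U \<longrightarrow> g x = g' x"
  proof (rule AE_open_of_boxes[OF U])
    fix a b :: "real^'n" assume ab: "cbox a b \<subseteq> U"
    have lg: "loc_integrable U g" "loc_integrable U g'" using g g' by (auto simp: weak_partial_def)
    define F where "F x = indicator (cbox a b) x * (g x - g' x)" for x
    have "integrable lebesgue (\<lambda>x. indicator (cbox a b) x *\<^sub>R g x)" "integrable lebesgue (\<lambda>x. indicator (cbox a b) x *\<^sub>R g' x)"
      using lg ab by (auto simp: loc_integrable_def set_integrable_def)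
    from Bochner_Integration.integrable_diff[OF this] have Fi: "integrable lebesgue F"
      by (simp add: F_def[abs_def] algebra_simps)
    \<comment> \<open>The fundamental lemma is stated for \<open>lborel\<close>, whereas weak
      derivatives are only Lebesgue measurable; a Borel version bridges the two.\<close>
    then obtain F' where F': "F' \<in> borel_measurable lborel" "AE x in lborel. F x = F' x"
      using completion_ex_borel_measurable_real[OF borel_measurable_integrable[OF Fi]] by auto
    have F'i: "integrable lborel F'"
    proof -
      have "integrable lebesgue F'"
      proof (rule integrable_cong_AE_imp[OF Fi])
        show "F' \<in> borel_measurable lebesgue" using F'(1) by (intro borel_imp_lebesgue) simp
        show "AE x in lebesgue. F x = F' x" by (rule AE_completion[OF F'(2)])
      qed
      then show ?thesis using F'(1) by (simp add: integrable_completion)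
    qed
    have "AE x in lborel. x \<in> box a b \<longrightarrow> F' x = 0"
    proof (rule fundamental_lemma_box[OF F'i])
      fix c d :: "real^'n" and n assume cd: "cbox c d \<subseteq> cbox a b"
      have cdU: "cbox c d \<subseteq> U" using ab cd by auto
      have "(LINT x:U|lebesgue. g x * bump n c d x) = (LINT x:U|lebesgue. g' x * bump n c d x)"
        using g g' test_fun_bump[OF cdU, of n] unfolding weak_partial_def by (metis minus_equation_iff)
      then have "(\<integral>x. indicator U x *\<^sub>R (g x * bump n c d x) - indicator U x *\<^sub>R (g' x * bump n c d x) \<partial>lebesgue) = 0"
        using loc_integrable_times_bump[OF lg(1) cdU, of n] loc_integrable_times_bump[OF lg(2) cdU, of n]
        by (simp add: set_lebesgue_integral_def)
      moreover have "(\<lambda>x. indicator U x *\<^sub>R (g x * bump n c d x) - indicator U x *\<^sub>R (g' x * bump n c d x)) = (\<lambda>x. F x * bump n c d x)"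
      proof
        fix x show "indicator U x *\<^sub>R (g x * bump n c d x) - indicator U x *\<^sub>R (g' x * bump n c d x) = F x * bump n c d x"
          using bump_eq_0[of x c d n] subsetD[OF box_subset_cbox[of c d], of x] cd cdU
          by (auto simp: F_def indicator_def algebra_simps)
      qed
      ultimately have "(\<integral>x. F x * bump n c d x \<partial>lebesgue) = 0" by simp
      also have "(\<integral>x. F x * bump n c d x \<partial>lebesgue) = (\<integral>x. F' x * bump n c d x \<partial>lebesgue)"
      proof (intro integral_cong_AE borel_measurable_times borel_measurable_integrable[OF Fi] borel_imp_lebesgue[OF borel_measurable_bump])
        show "F' \<in> borel_measurable lebesgue" using F'(1) by (intro borel_imp_lebesgue) simp
        show "AE x in lebesgue. F x * bump n c d x = F' x * bump n c d x"
          using AE_completion[OF F'(2)] by eventually_elim simp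
      qed
      also have "\<dots> = (\<integral>x. F' x * bump n c d x \<partial>lborel)" using F'(1) by (intro integral_completion) auto
      finally show "(\<integral>x. F' x * bump n c d x \<partial>lborel) = 0" .
    qed
    with F'(2) show "AE x in lborel. x \<in> box a b \<longrightarrow> g x = g' x"
    proof eventually_elim
      case (elim x)
      then show ?case using box_subset_cbox[of a b] by (auto simp: F_def)
    qed
  qed
  then show ?thesis by (rule AE_completion)
qed

section \<open>Integration by parts up to the boundary\<close>

lemma test_fun_zero_outside:
  fixes \<psi> :: "real^'n::finite \<Rightarrow> real"
  assumes "test_fun U \<psi>" "x \<notin> closure {x. \<psi> x \<noteq> 0}"
  shows "\<psi> x = 0" "partial_deriv j \<psi> x = 0"
proof -
  have op: "open (- closure {x. \<psi> x \<noteq> 0})" by auto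
  show "\<psi> x = 0" using assms(2) closure_subset[of "{x. \<psi> x \<noteq> 0}"] by auto
  have "(\<psi> has_derivative (\<lambda>_. 0)) (at x)"
  proof (rule has_derivative_transform_within_open[OF has_derivative_const[of 0] op])
    show "x \<in> - closure {x. \<psi> x \<noteq> 0}" using assms(2) by simp
    show "0 = \<psi> y" if "y \<in> - closure {x. \<psi> x \<noteq> 0}" for y
      using that closure_subset[of "{x. \<psi> x \<noteq> 0}"] by auto
  qed
  then show "partial_deriv j \<psi> x = 0" by (rule partial_deriv_eq)
qed

lemma test_fun_smoothn: "test_fun U \<psi> \<Longrightarrow> smoothn \<psi>"
  by (simp add: test_fun_def smoothn_def)

lemma continuous_compact_support_bounded:
  fixes g :: "'a::euclidean_space \<Rightarrow> real"
  assumes "continuous_on UNIV g" "compact K" "\<And>x. x \<notin> K \<Longrightarrow> g x = 0"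
  obtains M where "\<And>x. \<bar>g x\<bar> \<le> M"
proof -
  have "compact (g ` K)" using assms continuous_on_subset compact_continuous_image by blast
  then obtain M where "\<forall>y\<in>g ` K. norm y \<le> M" using compact_imp_bounded bounded_iff by metis
  then have "\<bar>g x\<bar> \<le> max M 0" for x using assms(3)[of x] by (cases "x \<in> K") auto
  then show ?thesis using that by blast
qed

text \<open>By \<open>sep\<close> the boundary of \<open>B\<close> misses \<open>N \<inter> \<Omega>\<close>, so cutting \<open>\<phi> \<psi>\<close> off to \<open>B\<close> does not destroy its smoothness.\<close>

lemma test_fun_cut_integral:
  fixes \<phi> \<psi> :: "real^'n::finite \<Rightarrow> real"
  assumes \<phi>: "test_fun \<Omega> \<phi>" and \<psi>: "test_fun N \<psi>" and B: "open B"
    and sep: "\<And>x. x \<in> N \<Longrightarrow> x \<in> B \<or> x \<notin> \<Omega> \<or> x \<notin> closure B"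
  shows "(\<integral>x. indicator B x * (\<phi> x * partial_deriv j \<psi> x + partial_deriv j \<phi> x * \<psi> x) \<partial>lborel) = 0"
proof -
  let ?K = "closure {x. \<psi> x \<noteq> 0}" and ?L = "closure {x. \<phi> x \<noteq> 0}"
  have K: "compact ?K" "?K \<subseteq> N" and L: "compact ?L" "?L \<subseteq> \<Omega>" using \<phi> \<psi> by (auto simp: test_fun_def)
  note s = test_fun_smoothn[OF \<phi>] test_fun_smoothn[OF \<psi>]
  define f where "f x = indicator B x * (\<phi> x * \<psi> x)" for x
  define f' where "f' x w = indicator B x * (\<phi> x * frechet_derivative \<psi> (at x) w + frechet_derivative \<phi> (at x) w * \<psi> x)" for x w
  have der: "(f has_derivative f' x) (at x)" for x
  proof (cases "x \<in> B")
    case True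
    have "((\<lambda>x. \<phi> x * \<psi> x) has_derivative (\<lambda>w. \<phi> x * frechet_derivative \<psi> (at x) w + frechet_derivative \<phi> (at x) w * \<psi> x)) (at x)"
      by (intro has_derivative_mult smoothnD(1) s)
    then have "(f has_derivative (\<lambda>w. \<phi> x * frechet_derivative \<psi> (at x) w + frechet_derivative \<phi> (at x) w * \<psi> x)) (at x)"
      by (rule has_derivative_transform_within_open[OF _ B True]) (simp add: f_def)
    then show ?thesis using True by (simp add: f'_def[abs_def])
  next
    case False
    have "\<exists>V. open V \<and> x \<in> V \<and> (\<forall>y\<in>V. f y = 0)"
    proof -
      \<comment> \<open>Outside \<open>B\<close> one of three open complements is available: of
        \<open>closure B\<close>, of the support of \<psi> when the point leaves \<open>N\<close>,
        or of the support of \<phi> when it leaves \<Omega>.\<close>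
      consider "x \<notin> closure B" | "x \<notin> ?K" | "x \<notin> ?L" using sep False K L by blast
      then show ?thesis
      proof cases
        case 1
        then show ?thesis using subsetD[OF closure_subset[of B]]
          by (intro exI[of _ "- closure B"]) (auto simp: f_def indicator_def)
      next
        case 2
        then show ?thesis using closure_subset[of "{x. \<psi> x \<noteq> 0}"]
          by (intro exI[of _ "- ?K"]) (auto simp: f_def)
      next
        case 3
        then show ?thesis using closure_subset[of "{x. \<phi> x \<noteq> 0}"]
          by (intro exI[of _ "- ?L"]) (auto simp: f_def)
      qed
    qed
    then obtain V where V: "open V" "x \<in> V" "\<And>y. y \<in> V \<Longrightarrow> f y = 0" by blast
    have "(f has_derivative (\<lambda>_. 0)) (at x)"
      by (rule has_derivative_transform_within_open[OF has_derivative_const[of 0] V(1,2)]) (simp add: V(3))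
    then show ?thesis using False by (simp add: f'_def[abs_def])
  qed
  obtain M where M: "\<And>x. \<bar>\<phi> x * partial_deriv j \<psi> x + partial_deriv j \<phi> x * \<psi> x\<bar> \<le> M"
  proof (rule continuous_compact_support_bounded[OF _ K(1)])
    show "continuous_on UNIV (\<lambda>x. \<phi> x * partial_deriv j \<psi> x + partial_deriv j \<phi> x * \<psi> x)"
      by (intro continuous_intros smoothnD s)
    show "\<phi> x * partial_deriv j \<psi> x + partial_deriv j \<phi> x * \<psi> x = 0" if "x \<notin> ?K" for x
      using test_fun_zero_outside[OF \<psi> that] by simp
  qed auto
  obtain R where R: "\<forall>x\<in>?K. norm x \<le> R" using K(1) compact_imp_bounded bounded_iff by metis
  have "(\<integral>x. f' x (axis j 1) \<partial>lborel) = 0"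
  proof (rule integral_derivative_compact_support[OF der])
    have "0 \<le> M" using M[of 0] by linarith
    then show "\<bar>f' x (axis j 1)\<bar> \<le> M" for x
      using M[of x] by (auto simp: f'_def partial_deriv_def indicator_def)
    show "f x = 0" if "R < norm x" for x
    proof -
      have "x \<notin> ?K" using R that by force
      then show ?thesis using test_fun_zero_outside(1)[OF \<psi>, of x] by (simp add: f_def)
    qed
  qed
  then show ?thesis by (simp add: f'_def partial_deriv_def)
qed

text \<open>Every component used later, of the field, its gradient or its Hessian, is an inner
  product with a tensor of norm at most one. Stating the bound in this form covers all three orders
  and all frames.\<close>

lemma L2_on_inner:
  fixes v :: "'a::euclidean_space \<Rightarrow> 'b::euclidean_space"
  assumes v: "L2_on A v" and A: "A \<in> sets lebesgue" and B: "B \<in> sets lebesgue" "B \<subseteq> A"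
    and b: "norm b \<le> 1"
  shows "(\<lambda>x. indicator B x * (v x \<bullet> b)) \<in> borel_measurable lebesgue"
    "integrable lebesgue (\<lambda>x. (indicator B x * (v x \<bullet> b))\<^sup>2)"
    "sqrt (\<integral>x. (indicator B x * (v x \<bullet> b))\<^sup>2 \<partial>lebesgue) \<le> L2_norm A v"
proof -
  have m: "(\<lambda>x. indicator A x *\<^sub>R v x) \<in> borel_measurable lebesgue"
    using v A by (simp add: L2_on_def borel_measurable_restrict_space_iff)
  have "(\<lambda>x. indicator B x * ((indicator A x *\<^sub>R v x) \<bullet> b)) \<in> borel_measurable lebesgue"
    using B(1) by (intro borel_measurable_times borel_measurable_inner m borel_measurable_indicator borel_measurable_const)
  moreover have "(\<lambda>x. indicator B x * ((indicator A x *\<^sub>R v x) \<bullet> b)) = (\<lambda>x. indicator B x * (v x \<bullet> b))"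
    using B(2) by (auto simp: indicator_def fun_eq_iff)
  ultimately show m2: "(\<lambda>x. indicator B x * (v x \<bullet> b)) \<in> borel_measurable lebesgue" by simp
  have i: "integrable lebesgue (\<lambda>x. indicator A x *\<^sub>R (norm (v x))\<^sup>2)"
    using v by (simp add: L2_on_def set_integrable_def)
  have le: "(indicator B x * (v x \<bullet> b))\<^sup>2 \<le> indicator A x *\<^sub>R (norm (v x))\<^sup>2" for x
  proof -
    have "\<bar>v x \<bullet> b\<bar> \<le> norm (v x)"
      using Cauchy_Schwarz_ineq2[of "v x" b] mult_left_mono[OF b norm_ge_zero[of "v x"]] by linarith
    then have "(v x \<bullet> b)\<^sup>2 \<le> (norm (v x))\<^sup>2" by (simp add: abs_le_square_iff[symmetric])
    then show ?thesis using B(2) by (auto simp: indicator_def)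
  qed
  show i2: "integrable lebesgue (\<lambda>x. (indicator B x * (v x \<bullet> b))\<^sup>2)"
    by (rule Bochner_Integration.integrable_bound[OF i]) (use m2 le in \<open>auto intro!: AE_I2\<close>)
  show "sqrt (\<integral>x. (indicator B x * (v x \<bullet> b))\<^sup>2 \<partial>lebesgue) \<le> L2_norm A v"
    unfolding L2_norm_def set_lebesgue_integral_def
    by (intro real_sqrt_le_mono integral_mono i i2 le)
qed

text \<open>This is the form in which zero boundary values are used: \<psi> need not vanish on the
  boundary of \<Omega>, and yet no boundary term appears. The identity is exact for the
  approximating test functions by \<open>test_fun_cut_integral\<close>, and both sides are
  continuous in L2.\<close>

lemma W12_0_cut:
  assumes u: "u \<in> W12_0 \<Omega>" and \<Omega>: "open \<Omega>"
  obtains Du where "weak_grad \<Omega> u Du" "L2_on \<Omega> u" "L2_on \<Omega> Du"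
    "\<And>B N \<psi> i j. \<lbrakk>open B; B \<subseteq> \<Omega>; \<And>x. x \<in> N \<Longrightarrow> x \<in> B \<or> x \<notin> \<Omega> \<or> x \<notin> closure B; test_fun N \<psi>\<rbrakk> \<Longrightarrow>
       (\<integral>x. (indicator B x * (u x $ i)) * partial_deriv j \<psi> x \<partial>lebesgue)
         = - (\<integral>x. (indicator B x * (Du x $ i $ j)) * \<psi> x \<partial>lebesgue)"
proof -
  obtain Du and \<phi> :: "nat \<Rightarrow> real^3 \<Rightarrow> real^3" where Du: "weak_grad \<Omega> u Du" "L2_on \<Omega> u" "L2_on \<Omega> Du"
    and \<phi>: "\<And>n i. test_fun \<Omega> (\<lambda>x. \<phi> n x $ i)"
    and lim: "(\<lambda>n. L2_norm \<Omega> (\<lambda>x. \<phi> n x - u x)) \<longlonglongrightarrow> 0"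
      "(\<lambda>n. L2_norm \<Omega> (\<lambda>x. jacobian (\<phi> n) (at x) - Du x)) \<longlonglongrightarrow> 0"
    using u unfolding W12_0_def by blast
  have \<Omega>m: "\<Omega> \<in> sets lebesgue" using \<Omega> by simp
  have \<phi>d: "(\<phi> n has_derivative (\<lambda>w. \<chi> i. frechet_derivative (\<lambda>x. \<phi> n x $ i) (at x) w)) (at x)" for n x
    by (subst has_derivative_componentwise_within)
      (auto simp: Basis_vec_def inner_axis intro!: smoothnD(1)[OF test_fun_smoothn[OF \<phi>]])
  have jac: "jacobian (\<phi> n) (at x) $ i $ j = partial_deriv j (\<lambda>x. \<phi> n x $ i) x" for n x i j
    unfolding jacobian_def matrix_def frechet_derivative_at[OF \<phi>d, symmetric] partial_deriv_def by simp
  have cont: "continuous_on UNIV (\<phi> n)" for n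
    using \<phi>d by (auto intro!: continuous_at_imp_continuous_on has_derivative_continuous)
  have contj: "continuous_on UNIV (\<lambda>x. jacobian (\<phi> n) (at x))" for n
  proof -
    have eq: "(\<lambda>x. jacobian (\<phi> n) (at x)) = (\<lambda>x. \<chi> i j. partial_deriv j (\<lambda>x. \<phi> n x $ i) x)"
      by (auto simp: fun_eq_iff vec_eq_iff jac)
    show ?thesis unfolding eq
      by (intro continuous_on_vec_lambda smoothnD(3)[OF test_fun_smoothn[OF \<phi>]])
  qed
  have L2: "L2_on \<Omega> (\<lambda>x. g x - v x)"
    if v: "L2_on \<Omega> v" and g: "continuous_on UNIV g" "compact K" "\<And>x. x \<notin> K \<Longrightarrow> g x = 0"
    for g v :: "real^3 \<Rightarrow> 'b::euclidean_space" and K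
  proof -
    have gm: "g \<in> borel_measurable borel" using g(1) by (rule borel_measurable_continuous_onI)
    have g2: "integrable lborel (\<lambda>x. (norm (g x))\<^sup>2)"
    proof -
      have "integrable lborel (\<lambda>x. indicator K x *\<^sub>R (norm (g x))\<^sup>2)"
        by (intro borel_integrable_compact g(2) continuous_intros continuous_on_subset[OF g(1)]) auto
      moreover have "(\<lambda>x. indicator K x *\<^sub>R (norm (g x))\<^sup>2) = (\<lambda>x. (norm (g x))\<^sup>2)"
        using g(3) by (force simp: indicator_def)
      ultimately show ?thesis by simp
    qed
    then have g2: "integrable lebesgue (\<lambda>x. (norm (g x))\<^sup>2)"
      using gm by (subst integrable_completion) auto
    have m: "(\<lambda>x. g x - v x) \<in> borel_measurable (lebesgue_on \<Omega>)"
      using v by (intro borel_measurable_diff measurable_restrict_space1[OF borel_imp_lebesgue[OF gm]]) (simp add: L2_on_def)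
    moreover have "integrable lebesgue (\<lambda>x. indicator \<Omega> x *\<^sub>R (norm (g x - v x))\<^sup>2)"
    proof (rule Bochner_Integration.integrable_bound)
      show "integrable lebesgue (\<lambda>x. 2 * (norm (g x))\<^sup>2 + 2 * (indicator \<Omega> x *\<^sub>R (norm (v x))\<^sup>2))"
        using g2 v by (auto simp: L2_on_def set_integrable_def)
      have "(\<lambda>x. (norm (g x - v x))\<^sup>2) \<in> borel_measurable (lebesgue_on \<Omega>)" using m by measurable
      then show "(\<lambda>x. indicator \<Omega> x *\<^sub>R (norm (g x - v x))\<^sup>2) \<in> borel_measurable lebesgue"
        using \<Omega>m by (simp add: borel_measurable_restrict_space_iff)
      have "(norm (g x - v x))\<^sup>2 \<le> 2 * (norm (g x))\<^sup>2 + 2 * (norm (v x))\<^sup>2" for x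
      proof -
        have "(norm (g x - v x))\<^sup>2 \<le> (norm (g x) + norm (v x))\<^sup>2"
          by (intro power_mono norm_triangle_ineq4) auto
        also have "\<dots> \<le> 2 * (norm (g x))\<^sup>2 + 2 * (norm (v x))\<^sup>2"
          using sum_squares_bound[of "norm (g x)" "norm (v x)"] by (simp add: power2_sum)
        finally show ?thesis .
      qed
      then show "AE x in lebesgue. norm (indicator \<Omega> x *\<^sub>R (norm (g x - v x))\<^sup>2)
          \<le> norm (2 * (norm (g x))\<^sup>2 + 2 * (indicator \<Omega> x *\<^sub>R (norm (v x))\<^sup>2))"
        by (intro AE_I2) (auto simp: indicator_def)
    qed
    ultimately show ?thesis by (simp add: L2_on_def set_integrable_def)
  qed
  define K where "K n = (\<Union>i\<in>UNIV. closure {x. \<phi> n x $ i \<noteq> 0})" for n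
  have K: "compact (K n)" for n unfolding K_def using \<phi> by (intro compact_UN) (auto simp: test_fun_def)
  have K0: "\<phi> n x = 0" "jacobian (\<phi> n) (at x) = 0" if "x \<notin> K n" for n x
  proof -
    have x: "x \<notin> closure {x. \<phi> n x $ i \<noteq> 0}" for i using that by (auto simp: K_def)
    show "\<phi> n x = 0" "jacobian (\<phi> n) (at x) = 0"
      using test_fun_zero_outside[OF \<phi> x] by (simp_all add: vec_eq_iff jac)
  qed
  have L2n: "L2_on \<Omega> (\<lambda>x. \<phi> n x - u x)" "L2_on \<Omega> (\<lambda>x. jacobian (\<phi> n) (at x) - Du x)" for n
    by (rule L2[OF Du(2) cont K K0(1)], assumption, rule L2[OF Du(3) contj K K0(2)], assumption)
  show ?thesis
  proof (rule that[OF Du])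
    fix B N and \<psi> :: "real^3 \<Rightarrow> real" and i j :: 3
    assume B: "open B" "B \<subseteq> \<Omega>" and sep: "\<And>x. x \<in> N \<Longrightarrow> x \<in> B \<or> x \<notin> \<Omega> \<or> x \<notin> closure B" and \<psi>: "test_fun N \<psi>"
    have Bm: "B \<in> sets lebesgue" using B by simp
    have ptest: "p \<in> borel_measurable lebesgue \<and> integrable lebesgue (\<lambda>x. (p x)\<^sup>2)"
      if p: "continuous_on UNIV p" "\<And>x. x \<notin> closure {x. \<psi> x \<noteq> 0} \<Longrightarrow> p x = 0" for p :: "real^3 \<Rightarrow> real"
    proof -
      have pm: "p \<in> borel_measurable borel" using p(1) by (rule borel_measurable_continuous_onI)
      have "integrable lborel (\<lambda>x. indicator (closure {x. \<psi> x \<noteq> 0}) x *\<^sub>R (p x)\<^sup>2)"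
        using \<psi> by (intro borel_integrable_compact continuous_intros continuous_on_subset[OF p(1)]) (auto simp: test_fun_def)
      moreover have "(\<lambda>x. indicator (closure {x. \<psi> x \<noteq> 0}) x *\<^sub>R (p x)\<^sup>2) = (\<lambda>x. (p x)\<^sup>2)"
        using p(2) by (force simp: indicator_def)
      ultimately have "integrable lborel (\<lambda>x. (p x)\<^sup>2)" by simp
      then have "integrable lebesgue (\<lambda>x. (p x)\<^sup>2)" using pm by (subst integrable_completion) auto
      then show ?thesis using pm borel_imp_lebesgue by blast
    qed
    have p1: "\<psi> \<in> borel_measurable lebesgue" "integrable lebesgue (\<lambda>x. (\<psi> x)\<^sup>2)"
      using ptest[OF smoothnD(2)[OF test_fun_smoothn[OF \<psi>]] test_fun_zero_outside(1)[OF \<psi>]] by blast+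
    have p2: "partial_deriv j \<psi> \<in> borel_measurable lebesgue" "integrable lebesgue (\<lambda>x. (partial_deriv j \<psi> x)\<^sup>2)"
      using ptest[OF smoothnD(3)[OF test_fun_smoothn[OF \<psi>]] test_fun_zero_outside(2)[OF \<psi>]] by blast+
    have na: "norm (axis i (1::real)) \<le> 1" "norm (axis i (axis j (1::real))) \<le> 1" by (simp_all add: norm_eq_sqrt_inner inner_axis_axis)
    have comp: "v \<bullet> axis i 1 = v $ i" "w \<bullet> axis i (axis j 1) = w $ i $ j" for v :: "real^3" and w :: "real^3^3"
      by (simp_all add: inner_axis)
    note A1 = L2_on_inner[OF L2n(1) \<Omega>m Bm B(2) na(1), unfolded comp]
    note A2 = L2_on_inner[OF L2n(2) \<Omega>m Bm B(2) na(2), unfolded comp]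
    note A3 = L2_on_inner[OF Du(2) \<Omega>m Bm B(2) na(1), unfolded comp]
    note A4 = L2_on_inner[OF Du(3) \<Omega>m Bm B(2) na(2), unfolded comp]
    let ?X = "(\<integral>x. (indicator B x * (u x $ i)) * partial_deriv j \<psi> x \<partial>lebesgue)
         + (\<integral>x. (indicator B x * (Du x $ i $ j)) * \<psi> x \<partial>lebesgue)"
    let ?e1 = "\<lambda>n. (\<integral>x. (indicator B x * ((\<phi> n x - u x) $ i)) * partial_deriv j \<psi> x \<partial>lebesgue)"
    let ?e2 = "\<lambda>n. (\<integral>x. (indicator B x * ((jacobian (\<phi> n) (at x) - Du x) $ i $ j)) * \<psi> x \<partial>lebesgue)"
    \<comment> \<open>\<open>?X\<close> does not depend on \<open>n\<close>. Adding the two errors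
      replaces \<open>u\<close> by the approximant, for which the sum is zero; letting the errors
      tend to zero gives \<open>?X = 0\<close>.\<close>
    have eq: "?X = - (?e1 n + ?e2 n)" for n
    proof -
      note ii = Cauchy_Schwarz_integral(1)[OF A1(1)[of n] p2(1) A1(2) p2(2)] Cauchy_Schwarz_integral(1)[OF A2(1)[of n] p1(1) A2(2) p1(2)]
         Cauchy_Schwarz_integral(1)[OF A3(1) p2(1) A3(2) p2(2)] Cauchy_Schwarz_integral(1)[OF A4(1) p1(1) A4(2) p1(2)]
      have "?X + (?e1 n + ?e2 n) = (\<integral>x. ((indicator B x * (u x $ i)) * partial_deriv j \<psi> x + (indicator B x * (Du x $ i $ j)) * \<psi> x)
         + ((indicator B x * ((\<phi> n x - u x) $ i)) * partial_deriv j \<psi> x + (indicator B x * ((jacobian (\<phi> n) (at x) - Du x) $ i $ j)) * \<psi> x) \<partial>lebesgue)"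
        using ii by simp
      also have "\<dots> = (\<integral>x. indicator B x * (\<phi> n x $ i * partial_deriv j \<psi> x + partial_deriv j (\<lambda>x. \<phi> n x $ i) x * \<psi> x) \<partial>lebesgue)"
        by (intro Bochner_Integration.integral_cong) (auto simp: jac algebra_simps)
      also have "\<dots> = (\<integral>x. indicator B x * (\<phi> n x $ i * partial_deriv j \<psi> x + partial_deriv j (\<lambda>x. \<phi> n x $ i) x * \<psi> x) \<partial>lborel)"
      proof (rule integral_completion)
        have "(\<lambda>x. \<phi> n x $ i * partial_deriv j \<psi> x + partial_deriv j (\<lambda>x. \<phi> n x $ i) x * \<psi> x) \<in> borel_measurable borel"
          by (intro borel_measurable_continuous_onI continuous_intros smoothnD(2,3) test_fun_smoothn[OF \<phi>] test_fun_smoothn[OF \<psi>])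
        then show "(\<lambda>x. indicator B x * (\<phi> n x $ i * partial_deriv j \<psi> x + partial_deriv j (\<lambda>x. \<phi> n x $ i) x * \<psi> x)) \<in> borel_measurable lborel"
          using B(1) by simp
      qed
      also have "\<dots> = 0" by (rule test_fun_cut_integral[OF \<phi> \<psi> B(1) sep])
      finally show ?thesis by linarith
    qed
    have "\<bar>?X\<bar> \<le> L2_norm \<Omega> (\<lambda>x. \<phi> n x - u x) * sqrt (\<integral>x. (partial_deriv j \<psi> x)\<^sup>2 \<partial>lebesgue)
        + L2_norm \<Omega> (\<lambda>x. jacobian (\<phi> n) (at x) - Du x) * sqrt (\<integral>x. (\<psi> x)\<^sup>2 \<partial>lebesgue)" for n
    proof -
      have "\<bar>?e1 n\<bar> \<le> L2_norm \<Omega> (\<lambda>x. \<phi> n x - u x) * sqrt (\<integral>x. (partial_deriv j \<psi> x)\<^sup>2 \<partial>lebesgue)"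
        using Cauchy_Schwarz_integral(3)[OF A1(1)[of n] p2(1) A1(2) p2(2)]
        by (rule order_trans) (intro mult_right_mono A1(3), simp)
      moreover have "\<bar>?e2 n\<bar> \<le> L2_norm \<Omega> (\<lambda>x. jacobian (\<phi> n) (at x) - Du x) * sqrt (\<integral>x. (\<psi> x)\<^sup>2 \<partial>lebesgue)"
        using Cauchy_Schwarz_integral(3)[OF A2(1)[of n] p1(1) A2(2) p1(2)]
        by (rule order_trans) (intro mult_right_mono A2(3), simp)
      ultimately show ?thesis unfolding eq[of n] by linarith
    qed
    moreover have "(\<lambda>n. L2_norm \<Omega> (\<lambda>x. \<phi> n x - u x) * sqrt (\<integral>x. (partial_deriv j \<psi> x)\<^sup>2 \<partial>lebesgue)
        + L2_norm \<Omega> (\<lambda>x. jacobian (\<phi> n) (at x) - Du x) * sqrt (\<integral>x. (\<psi> x)\<^sup>2 \<partial>lebesgue)) \<longlonglongrightarrow> 0 * sqrt (\<integral>x. (partial_deriv j \<psi> x)\<^sup>2 \<partial>lebesgue) + 0 * sqrt (\<integral>x. (\<psi> x)\<^sup>2 \<partial>lebesgue)"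
      by (intro tendsto_intros lim)
    ultimately have "\<bar>?X\<bar> \<le> 0"
      by (intro LIMSEQ_le_const[where X="\<lambda>n. L2_norm \<Omega> (\<lambda>x. \<phi> n x - u x) * sqrt (\<integral>x. (partial_deriv j \<psi> x)\<^sup>2 \<partial>lebesgue)
        + L2_norm \<Omega> (\<lambda>x. jacobian (\<phi> n) (at x) - Du x) * sqrt (\<integral>x. (\<psi> x)\<^sup>2 \<partial>lebesgue)"]) auto
    then show "(\<integral>x. (indicator B x * (u x $ i)) * partial_deriv j \<psi> x \<partial>lebesgue)
         = - (\<integral>x. (indicator B x * (Du x $ i $ j)) * \<psi> x \<partial>lebesgue)"
      by linarith
  qed
qed

subsection \<open>Absolute continuity on lines\<close>

lemma AE_lborel_prodD:
  fixes P :: "'a::euclidean_space \<times> 'b::euclidean_space \<Rightarrow> bool"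
  assumes "AE p in lborel. P p"
  shows "AE v in lborel. AE z in lborel. P (v, z)"
proof (rule lborel_pair.AE_pair)
  show "AE p in lborel \<Otimes>\<^sub>M lborel. P p" unfolding lborel_prod by (rule assms)
qed

lemma AE_lborel_fst:
  assumes "AE v in lborel. P v"
  shows "AE p in (lborel :: ('a::euclidean_space \<times> 'b::euclidean_space) measure). P (fst p)"
proof -
  obtain N where N: "N \<in> null_sets (lborel :: 'a measure)" "{v. \<not> P v} \<subseteq> N"
    using assms by (auto simp: eventually_ae_filter)
  have "AE p in lborel \<Otimes>\<^sub>M (lborel :: 'b measure). fst p \<notin> N"
  proof (rule lborel_pair.AE_pair_measure)
    have "N \<in> sets borel" using N by auto
    then show "{x \<in> space (lborel \<Otimes>\<^sub>M lborel). fst x \<notin> N} \<in> sets (lborel \<Otimes>\<^sub>M (lborel :: 'b measure))" by measurable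
    show "AE x in lborel. AE y in (lborel :: 'b measure). fst (x, y) \<notin> N"
      using AE_not_in[OF N(1)] by eventually_elim simp
  qed
  then have "AE p in (lborel :: ('a \<times> 'b) measure). fst p \<notin> N" unfolding lborel_prod .
  then show ?thesis by eventually_elim (use N in auto)
qed

lemma
  fixes f :: "'a::euclidean_space \<times> 'b::euclidean_space \<Rightarrow> real"
  assumes f: "integrable lborel f"
  shows AE_lborel_slice_integrable: "AE v in lborel. integrable lborel (\<lambda>z. f (v, z))"
    and lborel_slice_integrable: "integrable lborel (\<lambda>v. \<integral>z. f (v, z) \<partial>lborel)"
    and lborel_slice_integral: "(\<integral>p. f p \<partial>lborel) = (\<integral>v. \<integral>z. f (v, z) \<partial>lborel \<partial>lborel)"
proof -
  have f': "integrable (lborel \<Otimes>\<^sub>M lborel) f" using f by (simp add: lborel_prod)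
  show "AE v in lborel. integrable lborel (\<lambda>z. f (v, z))" by (rule lborel_pair.AE_integrable_fst'[OF f'])
  show "integrable lborel (\<lambda>v. \<integral>z. f (v, z) \<partial>lborel)" by (rule lborel_pair.integrable_fst'[OF f'])
  show "(\<integral>p. f p \<partial>lborel) = (\<integral>v. \<integral>z. f (v, z) \<partial>lborel \<partial>lborel)"
    using lborel_pair.integral_fst'[OF f'] by (simp add: lborel_prod)
qed

lemma slice_integral_measurable:
  fixes f :: "'a::euclidean_space \<times> 'b::euclidean_space \<Rightarrow> real"
  assumes "f \<in> borel_measurable borel"
  shows "(\<lambda>v. \<integral>z. f (v, z) \<partial>lborel) \<in> borel_measurable borel"
proof -
  have "f \<in> borel_measurable (borel \<Otimes>\<^sub>M lborel)"
    using assms by (simp add: borel_prod[symmetric] cong: measurable_cong_sets)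
  then show ?thesis by measurable
qed

lemma integrable_lborel_times:
  fixes m :: "'a::euclidean_space \<Rightarrow> real" and k :: "'b::euclidean_space \<Rightarrow> real"
  assumes m: "integrable lborel m" and k: "integrable lborel k"
  shows "integrable lborel (\<lambda>p. m (fst p) * k (snd p))"
proof -
  have mm: "m \<in> borel_measurable borel" "k \<in> borel_measurable borel" using m k by auto
  have "integrable (lborel \<Otimes>\<^sub>M lborel) (\<lambda>p. m (fst p) * k (snd p))"
  proof (rule lborel_pair.Fubini_integrable)
    show "(\<lambda>p. m (fst p) * k (snd p)) \<in> borel_measurable (lborel \<Otimes>\<^sub>M lborel)" using mm by measurable
    show "integrable lborel (\<lambda>x. \<integral>y. norm (m (fst (x, y)) * k (snd (x, y))) \<partial>lborel)"
      using m by (simp add: abs_mult)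
  qed (use k in auto)
  then show ?thesis by (simp add: lborel_prod)
qed

lemma primitive_compact_support:
  fixes \<phi> :: "real \<Rightarrow> real"
  assumes cont: "continuous_on UNIV \<phi>" and supp: "\<And>t. t \<notin> {a..b} \<Longrightarrow> \<phi> t = 0"
  defines "\<theta> \<equiv> \<lambda>t. \<integral>s. indicator {..t} s * \<phi> s \<partial>lborel"
  shows "(\<theta> has_real_derivative \<phi> t) (at t)"
proof -
  define c d where "c = min a t - 1" and "d = t + 1"
  have supp': "\<phi> t = 0" if "t < a" for t using supp that by auto
  have eq: "\<theta> x = integral {c..x} \<phi>" if "x \<in> {c<..<d}" for x
  proof -
    have "\<theta> x = (\<integral>s. indicator {c..x} s *\<^sub>R \<phi> s \<partial>lborel)"
      unfolding \<theta>_def using supp' by (intro Bochner_Integration.integral_cong) (auto simp: indicator_def c_def not_le)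
    also have "\<dots> = integral {c..x} \<phi>"
    proof -
      have "set_integrable lborel {c..x} \<phi>"
        unfolding set_integrable_def by (intro borel_integrable_compact continuous_on_subset[OF cont]) auto
      from set_borel_integral_eq_integral(2)[OF this] show ?thesis by (simp add: set_lebesgue_integral_def)
    qed
    finally show ?thesis .
  qed
  have t: "t \<in> {c<..<d}" by (auto simp: c_def d_def)
  have "((\<lambda>x. integral {c..x} \<phi>) has_real_derivative \<phi> t) (at t within {c..d})"
    using t by (intro integral_has_real_derivative continuous_on_subset[OF cont]) auto
  then have "((\<lambda>x. integral {c..x} \<phi>) has_real_derivative \<phi> t) (at t)"
    using t by (simp add: at_within_Icc_at)
  then show ?thesis
    by (rule has_field_derivative_transform_within_open[where S="{c<..<d}"]) (use t eq in auto)
qed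

lemma bump_Pair: "bump n (a, a') (b, b') (v, z) = bump n a b v * bump n a' b' z"
proof -
  have "(\<Prod>i\<in>Basis. h i) = (\<Prod>i\<in>Basis. h (i, 0)) * (\<Prod>i\<in>Basis. h (0, i))" for h :: "'a \<times> 'b \<Rightarrow> real"
    unfolding Basis_prod_def
    by (subst prod.union_disjoint) (auto simp: Basis_prod_def prod.reindex inj_on_def)
  then show ?thesis by (simp add: bump_def)
qed

lemma bump_real: "bump n a b t = fl (real n * (t - a)) * fl (real n * (b - (t::real)))"
  by (simp add: bump_def)

lemma smooth1_bump: "smooth1 (bump n a (b::real))"
proof -
  have "smooth1 (\<lambda>t. fl (real n * t + (- real n * a)) * fl ((- real n) * t + real n * b))"
    by (intro smooth1_mult smooth1_affine[OF smooth1_fl])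
  moreover have "(\<lambda>t. fl (real n * t + (- real n * a)) * fl ((- real n) * t + real n * b)) = bump n a b"
    by (auto simp: fun_eq_iff bump_real algebra_simps)
  ultimately show ?thesis by simp
qed

lemma integrable_bump: "integrable lborel (bump n a b)"
proof -
  have "integrable lborel (\<lambda>x. indicator (cbox a b) x *\<^sub>R bump n a b x)"
    by (intro borel_integrable_compact continuous_on_bump) auto
  moreover have "(\<lambda>x. indicator (cbox a b) x *\<^sub>R bump n a b x) = bump n a b"
  proof
    fix x show "indicator (cbox a b) x *\<^sub>R bump n a b x = bump n a b x"
      using bump_eq_0[of x a b n] subsetD[OF box_subset_cbox[of a b], of x] by (auto simp: indicator_def)
  qed
  ultimately show ?thesis by simp
qed

lemma integral_bump_pos:
  assumes "a < (b::real)" shows "(\<integral>x. bump 1 a b x \<partial>lborel) > 0"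
proof -
  have "\<not> (AE x in lborel. bump 1 a b x = 0)"
  proof
    assume "AE x in lborel. bump 1 a b x = 0"
    then have "AE x in lborel. x \<notin> {a<..<b}"
      by eventually_elim (auto simp: bump_real fl_bounds)
    then have "emeasure lborel {a<..<b} = 0" by (subst (asm) AE_iff_measurable[of "{a<..<b}"]) auto
    then show False using assms by simp
  qed
  then show ?thesis
    using integral_nonneg_eq_0_iff_AE[OF integrable_bump[of 1 a b] AE_I2[OF bump_bounds(1)]]
      Bochner_Integration.integral_nonneg[of lborel "bump 1 a b", OF bump_bounds(1)] by linarith
qed

text \<open>Both sides are the integral of \<open>k z * l s\<close> over the half plane where
  \<open>s\<close> is at most \<open>z\<close>. It serves as integration by parts for a tail
  integral against a density.\<close>

lemma triangle_Fubini:
  fixes k l :: "real \<Rightarrow> real"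
  assumes k: "integrable lborel k" and l: "integrable lborel l"
  shows "(\<integral>s. (\<integral>z. indicator {s..} z * k z \<partial>lborel) * l s \<partial>lborel) = (\<integral>z. k z * (\<integral>s. indicator {..z} s * l s \<partial>lborel) \<partial>lborel)"
proof -
  have kl: "integrable (lborel \<Otimes>\<^sub>M lborel) (\<lambda>p::real\<times>real. l (fst p) * k (snd p))"
    using integrable_lborel_times[OF l k] by (simp add: lborel_prod)
  have "closed {p::real \<times> real. fst p \<le> snd p}" by (intro closed_Collect_le continuous_intros)
  then have "{p::real \<times> real. fst p \<le> snd p} \<in> sets (lborel \<Otimes>\<^sub>M lborel)" unfolding lborel_prod by simp
  from integrable_mult_indicator[OF this kl]
  have i: "integrable (lborel \<Otimes>\<^sub>M lborel) (\<lambda>(s, z). indicator {s..} z * k z * l s)"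
    by (rule Bochner_Integration.integrable_cong[THEN iffD1, OF refl, rotated]) (auto simp: indicator_def)
  have "(\<integral>s. (\<integral>z. indicator {s..} z * k z \<partial>lborel) * l s \<partial>lborel) = (\<integral>s. (\<integral>z. indicator {s..} z * k z * l s \<partial>lborel) \<partial>lborel)"
    by simp
  also have "\<dots> = (\<integral>z. (\<integral>s. indicator {s..} z * k z * l s \<partial>lborel) \<partial>lborel)"
    using lborel_pair.Fubini_integral[of "\<lambda>s z. indicator {s..} z * k z * l s"] i by simp
  also have "\<dots> = (\<integral>z. k z * (\<integral>s. indicator {..z} s * l s \<partial>lborel) \<partial>lborel)"
  proof (intro Bochner_Integration.integral_cong refl)
    fix z
    have "(\<integral>s. indicator {s..} z * k z * l s \<partial>lborel) = (\<integral>s. k z * (indicator {..z} s * l s) \<partial>lborel)"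
      by (intro Bochner_Integration.integral_cong) (auto simp: indicator_def)
    then show "(\<integral>s. indicator {s..} z * k z * l s \<partial>lborel) = k z * (\<integral>s. indicator {..z} s * l s \<partial>lborel)" by simp
  qed
  finally show ?thesis .
qed

lemma lborel_integral_times:
  fixes m :: "'a::euclidean_space \<Rightarrow> real" and k :: "'b::euclidean_space \<Rightarrow> real"
  assumes "integrable lborel m" "integrable lborel k"
  shows "(\<integral>p. m (fst p) * k (snd p) \<partial>lborel) = (\<integral>v. m v \<partial>lborel) * (\<integral>z. k z \<partial>lborel)"
  using lborel_slice_integral[OF integrable_lborel_times[OF assms]] by simp

lemma integrable_times_bounded:
  fixes f h :: "'a \<Rightarrow> real"
  assumes "integrable M f" "h \<in> borel_measurable M" "\<And>x. \<bar>h x\<bar> \<le> K"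
  shows "integrable M (\<lambda>x. f x * h x)"
proof (rule Bochner_Integration.integrable_bound[OF integrable_mult_right[OF assms(1), of K]])
  show "AE x in M. norm (f x * h x) \<le> norm (K * f x)"
  proof (rule AE_I2)
    fix x
    have "\<bar>h x\<bar> \<le> \<bar>K\<bar>" using assms(3)[of x] by linarith
    then show "norm (f x * h x) \<le> norm (K * f x)"
      by (simp add: abs_mult mult.commute[of "\<bar>K\<bar>"] mult_left_mono)
  qed
qed (use assms in measurable)

definition vert_test :: "real \<Rightarrow> real \<Rightarrow> (real \<Rightarrow> real) \<Rightarrow> bool" where
  "vert_test \<alpha> \<beta> \<theta> \<longleftrightarrow> smooth1 \<theta> \<and> (\<exists>a b. \<alpha> < a \<and> b < \<beta> \<and> (\<forall>t. t \<notin> {a..b} \<longrightarrow> \<theta> t = 0))"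

text \<open>If \<open>\<partial>\<^sub>z f = g\<close> weakly then \<open>f\<close> is a.e. absolutely continuous on vertical lines. The test
  functions used are \<open>\<theta>' = \<xi> - (\<integral>\<xi>) \<rho>\<close> with a fixed \<open>\<rho>\<close> of integral one.\<close>

lemma weak_derivative_slice:
  fixes f g :: "'a::euclidean_space \<times> real \<Rightarrow> real"
  assumes f: "integrable lborel f" and g: "integrable lborel g" and C: "open C" and \<alpha>\<beta>: "\<alpha> < \<beta>"
    and weak: "\<And>a b n \<theta>. cbox a b \<subseteq> C \<Longrightarrow> vert_test \<alpha> \<beta> \<theta> \<Longrightarrow>
      (\<integral>p. f p * (bump n a b (fst p) * deriv \<theta> (snd p)) \<partial>lborel) = - (\<integral>p. g p * (bump n a b (fst p) * \<theta> (snd p)) \<partial>lborel)"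
  obtains M where "AE p in lborel. fst p \<in> C \<and> \<alpha> < snd p \<and> snd p < \<beta> \<longrightarrow>
      f p = M (fst p) - (\<integral>z. indicator {snd p..} z * g (fst p, z) \<partial>lborel)"
proof -
  have [measurable]: "f \<in> borel_measurable borel" "g \<in> borel_measurable borel" using f g by auto
  \<comment> \<open>The normalised density \<open>\<rho>\<close> is placed in the middle third, so
    that its support stays away from both ends.\<close>
  define \<alpha>' \<beta>' where "\<alpha>' = (2 * \<alpha> + \<beta>) / 3" and "\<beta>' = (\<alpha> + 2 * \<beta>) / 3"
  have ab': "\<alpha> < \<alpha>'" "\<alpha>' < \<beta>'" "\<beta>' < \<beta>" using \<alpha>\<beta> by (auto simp: \<alpha>'_def \<beta>'_def)
  define \<rho> where "\<rho> t = bump 1 \<alpha>' \<beta>' t / (\<integral>x. bump 1 \<alpha>' \<beta>' x \<partial>lborel)" for t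
  have \<rho>i: "integrable lborel \<rho>" unfolding \<rho>_def using integrable_bump by auto
  have \<rho>1: "(\<integral>x. \<rho> x \<partial>lborel) = 1" unfolding \<rho>_def using integral_bump_pos[OF ab'(2)] by simp
  have \<rho>s: "smooth1 \<rho>" unfolding \<rho>_def[abs_def] divide_inverse by (intro smooth1_mult smooth1_bump smooth1_const)
  have \<rho>0: "\<rho> t = 0" if "t \<notin> {\<alpha>'..\<beta>'}" for t using that bump_eq_0[of t \<alpha>' \<beta>' 1] by (auto simp: \<rho>_def)
  have \<rho>m[measurable]: "\<rho> \<in> borel_measurable borel" using \<rho>i by auto
  define B\<rho> where "B\<rho> = 1 / (\<integral>x. bump 1 \<alpha>' \<beta>' x \<partial>lborel)"
  have \<rho>b: "\<bar>\<rho> t\<bar> \<le> B\<rho>" for t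
    using bump_bounds[of 1 \<alpha>' \<beta>' t] integral_bump_pos[OF ab'(2)] by (simp add: \<rho>_def B\<rho>_def divide_right_mono)
  have B\<rho>0: "0 \<le> B\<rho>" using \<rho>b[of 0] by linarith
  define R where "R z = (\<integral>s. indicator {..z} s * \<rho> s \<partial>lborel)" for z
  have ind_int: "integrable lborel (\<lambda>s. indicator {..z} s * k s)" if "integrable lborel k" for z :: real and k :: "real \<Rightarrow> real"
    using integrable_mult_indicator[OF _ that, of "{..z}"] by simp
  have Rm[measurable]: "R \<in> borel_measurable borel"
  proof -
    have "(\<lambda>p::real \<times> real. indicator {..fst p} (snd p) * \<rho> (snd p)) \<in> borel_measurable borel"
    proof -
      have "(\<lambda>p::real \<times> real. indicator {..fst p} (snd p) * \<rho> (snd p)) = (\<lambda>p. indicator {p. snd p \<le> fst p} p * \<rho> (snd p))"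
        by (auto simp: indicator_def fun_eq_iff)
      moreover have "closed {p::real \<times> real. snd p \<le> fst p}"
        by (intro closed_Collect_le continuous_intros)
      then have "{p::real \<times> real. snd p \<le> fst p} \<in> sets borel" by simp
      moreover have "(\<lambda>p::real\<times>real. \<rho> (snd p)) \<in> borel_measurable borel"
        by (rule measurable_compose[OF _ \<rho>m]) (simp add: borel_prod[symmetric])
      ultimately show ?thesis by simp
    qed
    from slice_integral_measurable[OF this] show ?thesis by (simp add: R_def[abs_def])
  qed
  have Rb: "\<bar>R z\<bar> \<le> 1" for z
  proof -
    have r0: "0 \<le> \<rho> t" for t using bump_bounds(1)[of 1 \<alpha>' \<beta>' t] integral_bump_pos[OF ab'(2)] by (simp add: \<rho>_def)
    have "R z \<le> (\<integral>x. \<rho> x \<partial>lborel)" unfolding R_def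
      by (intro integral_mono ind_int \<rho>i) (auto simp: indicator_def r0)
    moreover have "0 \<le> R z" unfolding R_def by (intro Bochner_Integration.integral_nonneg) (auto simp: r0)
    ultimately show ?thesis using \<rho>1 by simp
  qed
  have \<rho>sm: "(\<lambda>p. \<rho> (snd p)) \<in> borel_measurable (borel :: ('a\<times>real) measure)"
    by (rule measurable_compose[OF _ \<rho>m]) (simp add: borel_prod[symmetric])
  have Rsm: "(\<lambda>p. R (snd p)) \<in> borel_measurable (borel :: ('a\<times>real) measure)"
    by (rule measurable_compose[OF _ Rm]) (simp add: borel_prod[symmetric])
  have frho: "integrable lborel (\<lambda>p. f p * \<rho> (snd p))"
    by (rule integrable_times_bounded[OF f _ \<rho>b]) (use \<rho>sm in simp)
  have gR: "integrable lborel (\<lambda>p. g p * R (snd p))"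
    by (rule integrable_times_bounded[OF g _ Rb]) (use Rsm in simp)
  \<comment> \<open>Inserting the test function gives, for every \<open>\<xi>\<close>, that
    \<open>f + G - Mf - N\<close> is orthogonal to \<open>\<xi>\<close>: the terms with
    \<open>\<rho>\<close> and its primitive \<open>R\<close> produce \<open>Mf\<close> and
    \<open>N\<close>, and the primitive of \<open>\<xi>\<close> moves onto \<open>g\<close> as the
    tail integral \<open>G\<close>. Hence the constant of integration is
    \<open>Mf + N\<close>.\<close>
  define Mf where "Mf v = (\<integral>z. f (v, z) * \<rho> z \<partial>lborel)" for v
  define N where "N v = (\<integral>z. g (v, z) * R z \<partial>lborel)" for v
  define G where "G p = (\<integral>z. indicator {snd p..} z * g (fst p, z) \<partial>lborel)" for p
  have Mfi: "integrable lborel Mf" and Ni: "integrable lborel N"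
    using lborel_slice_integrable[OF frho] lborel_slice_integrable[OF gR] by (auto simp: Mf_def[abs_def] N_def[abs_def])
  have Gm[measurable]: "G \<in> borel_measurable borel"
  proof -
    have "(\<lambda>q::('a\<times>real)\<times>real. indicator {snd (fst q)..} (snd q) * g (fst (fst q), snd q)) \<in> borel_measurable borel"
    proof -
      have "(\<lambda>q::('a\<times>real)\<times>real. indicator {snd (fst q)..} (snd q) * g (fst (fst q), snd q))
        = (\<lambda>q. indicator {q. snd (fst q) \<le> snd q} q * g (fst (fst q), snd q))"
        by (auto simp: indicator_def fun_eq_iff)
      moreover have "closed {q::('a\<times>real)\<times>real. snd (fst q) \<le> snd q}"
        by (intro closed_Collect_le continuous_intros)
      then have "{q::('a\<times>real)\<times>real. snd (fst q) \<le> snd q} \<in> sets borel" by simp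
      moreover have "(\<lambda>q::('a\<times>real)\<times>real. g (fst (fst q), snd q)) \<in> borel_measurable borel"
        by (rule measurable_compose[of "\<lambda>q. (fst (fst q), snd q)" _ "borel :: ('a\<times>real) measure"])
          (simp_all add: borel_measurable_continuous_onI continuous_intros)
      ultimately show ?thesis by simp
    qed
    from slice_integral_measurable[OF this] show ?thesis by (simp add: G_def[abs_def])
  qed
  have gn: "integrable lborel (\<lambda>p. norm (g p))" using g by simp
  define gv where "gv v = (\<integral>z. norm (g (v, z)) \<partial>lborel)" for v
  have gvi: "integrable lborel gv" using lborel_slice_integrable[OF gn] by (simp add: gv_def[abs_def])
  have indge_int: "integrable lborel (\<lambda>s. indicator {z..} s * k s)" if "integrable lborel k" for z :: real and k :: "real \<Rightarrow> real"
    using integrable_mult_indicator[OF _ that, of "{z..}"] by simp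
  have gae: "AE v in lborel. integrable lborel (\<lambda>z. g (v, z))" by (rule AE_lborel_slice_integrable[OF g])
  have Gb: "\<bar>G (v, s)\<bar> \<le> gv v" if "integrable lborel (\<lambda>z. g (v, z))" for v s
  proof -
    have "\<bar>G (v, s)\<bar> \<le> (\<integral>z. \<bar>indicator {s..} z * g (v, z)\<bar> \<partial>lborel)"
      unfolding G_def using integral_abs_bound by auto
    also have "\<dots> \<le> gv v" unfolding gv_def
      using indge_int[OF that] that by (intro integral_mono) (auto simp: indicator_def)
    finally show ?thesis .
  qed
  have Gxi: "integrable lborel (\<lambda>p. G p * k (snd p))" if k: "integrable lborel k" for k
  proof (rule Bochner_Integration.integrable_bound[OF integrable_lborel_times[OF gvi k]])
    have km: "k \<in> borel_measurable borel" using k by auto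
    have "(\<lambda>p. k (snd p)) \<in> borel_measurable (borel :: ('a\<times>real) measure)"
      by (rule measurable_compose[OF _ km]) (simp add: borel_prod[symmetric])
    then show "(\<lambda>p. G p * k (snd p)) \<in> borel_measurable lborel" using Gm by simp
    show "AE p in lborel. norm (G p * k (snd p)) \<le> norm (gv (fst p) * k (snd p))"
      using AE_lborel_fst[OF gae]
    proof eventually_elim
      case (elim p)
      have "\<bar>G p\<bar> \<le> \<bar>gv (fst p)\<bar>" using Gb[OF elim, of "snd p"] by auto
      then show ?case by (simp add: abs_mult mult_right_mono)
    qed
  qed
  \<comment> \<open>This is the defect that has to vanish. The cut to the strip is needed for
    integrability, since \<open>Mf\<close> and \<open>N\<close> do not depend on the height.\<close>
  define F where "F p = indicator {\<alpha>..\<beta>} (snd p) * (f p - Mf (fst p) + G p - N (fst p))" for p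
  have Fi: "integrable lborel F"
  proof -
    have ii: "integrable lborel (\<lambda>s. indicator {\<alpha>..\<beta>} s :: real)" by (intro integrable_real_indicator) (auto simp: emeasure_lborel_Icc_eq)
    have sm: "(\<lambda>p::'a\<times>real. indicator {\<alpha>..\<beta>} (snd p) :: real) \<in> borel_measurable (borel :: ('a\<times>real) measure)"
      by (rule measurable_compose[where N=borel]) (simp_all add: borel_prod[symmetric])
    have "integrable lborel (\<lambda>p. f p * indicator {\<alpha>..\<beta>} (snd p))"
    proof (rule integrable_times_bounded[OF f, where K=1])
      show "(\<lambda>p::'a\<times>real. indicator {\<alpha>..\<beta>} (snd p) :: real) \<in> borel_measurable lborel" using sm by simp
      show "\<bar>indicator {\<alpha>..\<beta>} (snd p) :: real\<bar> \<le> 1" for p :: "'a \<times> real" by (simp add: indicator_def)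
    qed
    then have "integrable lborel (\<lambda>p. f p * indicator {\<alpha>..\<beta>} (snd p) - Mf (fst p) * indicator {\<alpha>..\<beta>} (snd p)
       + G p * indicator {\<alpha>..\<beta>} (snd p) - N (fst p) * indicator {\<alpha>..\<beta>} (snd p))"
      by (intro Bochner_Integration.integrable_diff Bochner_Integration.integrable_add Gxi ii integrable_lborel_times Mfi Ni)
    then show ?thesis by (simp add: F_def[abs_def] algebra_simps)
  qed
  have "AE p in lborel. p \<in> C \<times> {\<alpha><..<\<beta>} \<longrightarrow> F p = 0"
  proof (rule AE_open_of_boxes)
    show "open (C \<times> {\<alpha><..<\<beta>})" using C by (intro open_Times) auto
    fix a0 b0 :: "'a \<times> real" assume ab0: "cbox a0 b0 \<subseteq> C \<times> {\<alpha><..<\<beta>}"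
    show "AE p in lborel. p \<in> box a0 b0 \<longrightarrow> F p = 0"
    proof (rule fundamental_lemma_box[OF Fi])
      fix c d :: "'a \<times> real" and n assume cd: "cbox c d \<subseteq> cbox a0 b0"
      obtain a a' b b' where [simp]: "c = (a, a')" "d = (b, b')" by (metis surj_pair)
      show "(\<integral>p. F p * bump n c d p \<partial>lborel) = 0"
      proof (cases "cbox c d = {}")
        case True
        then have "bump n c d p = 0" for p using box_subset_cbox[of c d] by (intro bump_eq_0) auto
        then show ?thesis by simp
      next
        case False
        have sub: "cbox a b \<times> cbox a' b' \<subseteq> C \<times> {\<alpha><..<\<beta>}" using cd ab0 by (simp add: cbox_Pair_eq)
        have "cbox a b \<noteq> {}" "cbox a' b' \<noteq> {}" using False by (auto simp: cbox_Pair_eq)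
        with sub have abC: "cbox a b \<subseteq> C" and ab2: "{a'..b'} \<subseteq> {\<alpha><..<\<beta>}" "a' \<le> b'"
          by (auto simp: times_subset_iff)
        then have ab3: "\<alpha> < a'" "b' < \<beta>" by auto
        define A where "A = bump n a b"
        define \<xi> where "\<xi> = bump n a' b'"
        define \<Xi> where "\<Xi> = (\<integral>s. \<xi> s \<partial>lborel)"
        have Ai: "integrable lborel A" and \<xi>i: "integrable lborel \<xi>" using integrable_bump by (auto simp: A_def \<xi>_def)
        have Am: "A \<in> borel_measurable borel" and \<xi>m: "\<xi> \<in> borel_measurable borel" by (auto simp: A_def \<xi>_def)
        have Ab: "\<bar>A v\<bar> \<le> 1" for v using bump_bounds[of n a b v] by (simp add: A_def)
        have \<xi>b: "\<bar>\<xi> v\<bar> \<le> 1" for v using bump_bounds[of n a' b' v] by (simp add: \<xi>_def)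
        have \<xi>0: "\<xi> t = 0" if "t \<notin> {a'..b'}" for t using that bump_eq_0[of t a' b' n] by (auto simp: \<xi>_def)
        have Asm: "(\<lambda>p. A (fst p)) \<in> borel_measurable (borel :: ('a\<times>real) measure)"
          by (rule measurable_compose[OF _ Am]) (simp add: borel_prod[symmetric])
        have \<xi>sm: "(\<lambda>p. \<xi> (snd p)) \<in> borel_measurable (borel :: ('a\<times>real) measure)"
          by (rule measurable_compose[OF _ \<xi>m]) (simp add: borel_prod[symmetric])
        define \<phi> where "\<phi> s = \<xi> s - \<Xi> * \<rho> s" for s
        define \<theta> where "\<theta> t = (\<integral>s. indicator {..t} s * \<phi> s \<partial>lborel)" for t
        have \<phi>s: "smooth1 \<phi>"
        proof -
          have "smooth1 (\<lambda>s. \<xi> s + (- \<Xi>) * \<rho> s)" unfolding \<xi>_def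
            by (intro smooth1_add smooth1_bump smooth1_mult \<rho>s smooth1_const)
          then show ?thesis by (simp add: \<phi>_def[abs_def])
        qed
        have \<phi>0: "\<phi> t = 0" if "t \<notin> {min a' \<alpha>'..max b' \<beta>'}" for t
        proof -
          have "t \<notin> {a'..b'}" "t \<notin> {\<alpha>'..\<beta>'}" using that by (auto simp: min_def max_def split: if_splits)
          then show ?thesis by (simp add: \<phi>_def \<xi>0 \<rho>0)
        qed
        have \<theta>d: "(\<theta> has_real_derivative \<phi> t) (at t)" for t
          unfolding \<theta>_def[abs_def] by (rule primitive_compact_support[OF smooth1_continuous_on[OF \<phi>s] \<phi>0])
        have \<phi>i: "integrable lborel \<phi>" unfolding \<phi>_def[abs_def] using \<xi>i \<rho>i by auto
        have \<phi>1: "(\<integral>s. \<phi> s \<partial>lborel) = 0" unfolding \<phi>_def using \<xi>i \<rho>i \<rho>1 by (simp add: \<Xi>_def)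
        have \<theta>0: "\<theta> t = 0" if t: "t \<notin> {min a' \<alpha>'..max b' \<beta>'}" for t
        proof -
          from t consider "t < min a' \<alpha>'" | "t > max b' \<beta>'" by fastforce
          then show ?thesis
          proof cases
            case 1
            have "\<phi> s = 0" if "s \<le> t" for s using 1 that by (intro \<phi>0) auto
            then have "(\<lambda>s. indicator {..t} s * \<phi> s) = (\<lambda>_. 0)" by (auto simp: indicator_def fun_eq_iff)
            then show ?thesis by (simp only: \<theta>_def integral_zero)
          next
            case 2
            have "\<phi> s = 0" if "t < s" for s using 2 that by (intro \<phi>0) auto
            then have "(\<lambda>s. indicator {..t} s * \<phi> s) = \<phi>" by (auto simp: indicator_def fun_eq_iff)
            then show ?thesis by (simp only: \<theta>_def \<phi>1)
          qed
        qed
        have "\<alpha> < min a' \<alpha>'" "max b' \<beta>' < \<beta>" using ab3 ab' by auto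
        then have "vert_test \<alpha> \<beta> \<theta>" unfolding vert_test_def
          using smooth1_has_derivI[OF \<theta>d \<phi>s] \<theta>0 by blast
        from weak[OF abC this]
        have w: "(\<integral>p. f p * (A (fst p) * \<phi> (snd p)) \<partial>lborel) = - (\<integral>p. g p * (A (fst p) * \<theta> (snd p)) \<partial>lborel)"
          unfolding A_def DERIV_imp_deriv[OF \<theta>d] by simp
        define X where "X z = (\<integral>s. indicator {..z} s * \<xi> s \<partial>lborel)" for z
        have \<theta>X: "\<theta> z = X z - \<Xi> * R z" for z
          unfolding \<theta>_def \<phi>_def X_def R_def using ind_int[OF \<xi>i] ind_int[OF \<rho>i]
          by (simp add: right_diff_distrib mult.left_commute[of _ \<Xi>])
        have Xc: "continuous_on UNIV X"
        proof -
          have "(X has_real_derivative \<xi> t) (at t)" for t unfolding X_def[abs_def]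
            by (rule primitive_compact_support[OF _ \<xi>0]) (simp add: \<xi>_def continuous_on_bump)
          then show ?thesis by (auto intro!: continuous_at_imp_continuous_on DERIV_isCont)
        qed
        have Xb: "\<bar>X z\<bar> \<le> \<Xi>" for z
        proof -
          have x0: "0 \<le> \<xi> s" for s by (simp add: \<xi>_def bump_bounds)
          have "X z \<le> \<Xi>" unfolding X_def \<Xi>_def by (intro integral_mono ind_int \<xi>i) (auto simp: indicator_def x0)
          moreover have "0 \<le> X z" unfolding X_def by (intro Bochner_Integration.integral_nonneg) (auto simp: x0)
          ultimately show ?thesis by simp
        qed
        have Xsm: "(\<lambda>p. X (snd p)) \<in> borel_measurable (borel :: ('a\<times>real) measure)"
          by (rule measurable_compose[OF _ borel_measurable_continuous_onI[OF Xc]]) (simp add: borel_prod[symmetric])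
        have fA: "integrable lborel (\<lambda>p. f p * A (fst p))" and gA: "integrable lborel (\<lambda>p. g p * A (fst p))"
          using integrable_times_bounded[OF f _ Ab] integrable_times_bounded[OF g _ Ab] Asm by auto
        have I1: "integrable lborel (\<lambda>p. f p * A (fst p) * \<xi> (snd p))" by (rule integrable_times_bounded[OF fA _ \<xi>b]) (use \<xi>sm in simp)
        have I2: "integrable lborel (\<lambda>p. f p * A (fst p) * \<rho> (snd p))" by (rule integrable_times_bounded[OF fA _ \<rho>b]) (use \<rho>sm in simp)
        have J1: "integrable lborel (\<lambda>p. g p * A (fst p) * X (snd p))" by (rule integrable_times_bounded[OF gA _ Xb]) (use Xsm in simp)
        have J2: "integrable lborel (\<lambda>p. g p * A (fst p) * R (snd p))" by (rule integrable_times_bounded[OF gA _ Rb]) (use Rsm in simp)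
        have "(\<integral>p. f p * A (fst p) * \<xi> (snd p) - \<Xi> * (f p * A (fst p) * \<rho> (snd p)) \<partial>lborel)
           = - (\<integral>p. g p * A (fst p) * X (snd p) - \<Xi> * (g p * A (fst p) * R (snd p)) \<partial>lborel)"
          using w by (simp add: \<phi>_def \<theta>X algebra_simps)
        then have w2: "(\<integral>p. f p * A (fst p) * \<xi> (snd p) \<partial>lborel) - \<Xi> * (\<integral>p. f p * A (fst p) * \<rho> (snd p) \<partial>lborel)
          = - (\<integral>p. g p * A (fst p) * X (snd p) \<partial>lborel) + \<Xi> * (\<integral>p. g p * A (fst p) * R (snd p) \<partial>lborel)"
          using I1 I2 J1 J2 by simp
        have MA: "integrable lborel (\<lambda>v. Mf v * A v)" and NA: "integrable lborel (\<lambda>v. N v * A v)"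
          using integrable_times_bounded[OF Mfi _ Ab] integrable_times_bounded[OF Ni _ Ab] Am by auto
        have e1: "(\<integral>p. f p * A (fst p) * \<rho> (snd p) \<partial>lborel) = (\<integral>v. Mf v * A v \<partial>lborel)"
          unfolding lborel_slice_integral[OF I2] Mf_def
          by (intro Bochner_Integration.integral_cong refl) (simp add: mult.assoc mult.left_commute[of _ "A _"] mult.commute[of _ "A _"])
        have e2: "(\<integral>p. g p * A (fst p) * R (snd p) \<partial>lborel) = (\<integral>v. N v * A v \<partial>lborel)"
          unfolding lborel_slice_integral[OF J2] N_def
          by (intro Bochner_Integration.integral_cong refl) (simp add: mult.assoc mult.left_commute[of _ "A _"] mult.commute[of _ "A _"])
        have GA: "integrable lborel (\<lambda>p. G p * \<xi> (snd p) * A (fst p))"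
          by (rule integrable_times_bounded[OF Gxi[OF \<xi>i] _ Ab]) (use Asm in simp)
        \<comment> \<open>On almost every line \<open>triangle_Fubini\<close> turns the tail of
          \<open>g\<close> tested with \<open>\<xi>\<close> into \<open>g\<close> tested with the
          primitive \<open>X\<close>.\<close>
        have e3: "(\<integral>p. G p * \<xi> (snd p) * A (fst p) \<partial>lborel) = (\<integral>p. g p * A (fst p) * X (snd p) \<partial>lborel)"
          unfolding lborel_slice_integral[OF GA] lborel_slice_integral[OF J1]
        proof (rule integral_cong_AE)
          show "(\<lambda>v. \<integral>z. G (v, z) * \<xi> (snd (v, z)) * A (fst (v, z)) \<partial>lborel) \<in> borel_measurable lborel"
            using lborel_slice_integrable[OF GA] by auto
          show "(\<lambda>v. \<integral>z. g (v, z) * A (fst (v, z)) * X (snd (v, z)) \<partial>lborel) \<in> borel_measurable lborel"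
            using lborel_slice_integrable[OF J1] by auto
          show "AE v in lborel. (\<integral>z. G (v, z) * \<xi> (snd (v, z)) * A (fst (v, z)) \<partial>lborel) = (\<integral>z. g (v, z) * A (fst (v, z)) * X (snd (v, z)) \<partial>lborel)"
            using gae
          proof eventually_elim
            case (elim v)
            have "(\<integral>z. G (v, z) * \<xi> (snd (v, z)) * A (fst (v, z)) \<partial>lborel) = (\<integral>z. G (v, z) * \<xi> z \<partial>lborel) * A v" by simp
            also have "(\<integral>z. G (v, z) * \<xi> z \<partial>lborel) = (\<integral>z. g (v, z) * X z \<partial>lborel)"
              unfolding G_def X_def using triangle_Fubini[OF elim \<xi>i] by simp
            also have "\<dots> * A v = (\<integral>z. g (v, z) * A (fst (v, z)) * X (snd (v, z)) \<partial>lborel)"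
              by (subst integral_mult_left_zero[symmetric]) (simp add: mult_ac)
            finally show ?case .
          qed
        qed
        have "F p * bump n c d p = f p * A (fst p) * \<xi> (snd p) - (Mf (fst p) * A (fst p)) * \<xi> (snd p)
           + G p * \<xi> (snd p) * A (fst p) - (N (fst p) * A (fst p)) * \<xi> (snd p)" for p
        proof -
          have b: "bump n c d p = A (fst p) * \<xi> (snd p)" by (cases p) (simp add: bump_Pair A_def \<xi>_def)
          show ?thesis
          proof (cases "snd p \<in> {a'..b'}")
            case True
            then have "snd p \<in> {\<alpha>..\<beta>}" using ab3 by auto
            then show ?thesis unfolding b F_def by (simp add: algebra_simps)
          next
            case False
            then show ?thesis unfolding b by (simp add: \<xi>0)
          qed
        qed
        then have "(\<integral>p. F p * bump n c d p \<partial>lborel) = (\<integral>p. f p * A (fst p) * \<xi> (snd p) - (Mf (fst p) * A (fst p)) * \<xi> (snd p)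
           + G p * \<xi> (snd p) * A (fst p) - (N (fst p) * A (fst p)) * \<xi> (snd p) \<partial>lborel)" by simp
        also have "\<dots> = (\<integral>p. f p * A (fst p) * \<xi> (snd p) \<partial>lborel) - (\<integral>p. (Mf (fst p) * A (fst p)) * \<xi> (snd p) \<partial>lborel)
           + (\<integral>p. G p * \<xi> (snd p) * A (fst p) \<partial>lborel) - (\<integral>p. (N (fst p) * A (fst p)) * \<xi> (snd p) \<partial>lborel)"
          using I1 integrable_lborel_times[OF MA \<xi>i] integrable_lborel_times[OF NA \<xi>i] GA by simp
        also have "\<dots> = 0"
          using w2 unfolding e1 e2 e3 lborel_integral_times[OF MA \<xi>i] lborel_integral_times[OF NA \<xi>i] \<Xi>_def[symmetric]
          by (simp add: algebra_simps)
        finally show ?thesis .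
      qed
    qed
  qed
  then have "AE p in lborel. fst p \<in> C \<and> \<alpha> < snd p \<and> snd p < \<beta> \<longrightarrow>
      f p = (Mf (fst p) + N (fst p)) - (\<integral>z. indicator {snd p..} z * g (fst p, z) \<partial>lborel)"
  proof eventually_elim
    case (elim p)
    then show ?case by (cases p) (auto simp: F_def G_def)
  qed
  then show ?thesis by (rule that[of "\<lambda>v. Mf v + N v"])
qed

subsection \<open>Coordinates adapted to an orthonormal frame\<close>

definition vec3 :: "real^2 \<Rightarrow> real \<Rightarrow> real^3" where
  "vec3 v z = vector [v $ 1, v $ 2, z]"

text \<open>Frame coordinates are a pair of a plane vector and a height, not a vector of three
  numbers, so that Fubini and the slice results for products apply directly.\<close>

definition emb :: "real^3 \<Rightarrow> (real^3 \<Rightarrow> real^3) \<Rightarrow> (real^2) \<times> real \<Rightarrow> real^3" where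
  "emb Q T p = Q + T (vec3 (fst p) (snd p))"

lemma vec3_nth[simp]: "vec3 v z $ 1 = v $ 1" "vec3 v z $ 2 = v $ 2" "vec3 v z $ 3 = z"
  by (simp_all add: vec3_def)

lemma horiz_nth[simp]: "horiz y $ 1 = y $ 1" "horiz y $ 2 = y $ 2"
  by (simp_all add: horiz_def)

lemma horiz_vec3[simp]: "horiz (vec3 v z) = v"
  by (simp add: vec_eq_iff forall_2)

lemma vec3_horiz[simp]: "vec3 (horiz y) (y $ 3) = y"
  by (simp add: vec_eq_iff forall_3)

lemma vec3_eq_iff[simp]: "vec3 v z = vec3 v' z' \<longleftrightarrow> v = v' \<and> z = z'"
  by (auto simp: vec_eq_iff forall_3 forall_2)

lemma linear_vec3: "linear (\<lambda>p. vec3 (fst p) (snd p))"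
  by (rule linearI) (auto simp: vec_eq_iff forall_3)

lemma continuous_emb:
  assumes "orthogonal_transformation T" shows "continuous_on X (emb Q T)"
proof -
  have "linear T" using assms by (rule orthogonal_transformation_linear)
  then have "linear (\<lambda>p. T (vec3 (fst p) (snd p)))"
    using linear_compose[OF linear_vec3] by (simp add: o_def)
  then show ?thesis unfolding emb_def[abs_def] by (intro continuous_intros linear_continuous_on linear_conv_bounded_linear[THEN iffD1])
qed

lemma inner_vec3: "vec3 v z \<bullet> vec3 v' z' = v \<bullet> v' + z * z'"
  by (simp add: inner_vec_def sum_3 sum_2)

definition unemb :: "real^3 \<Rightarrow> (real^3 \<Rightarrow> real^3) \<Rightarrow> real^3 \<Rightarrow> (real^2) \<times> real" where
  "unemb Q T x = (vector [(x - Q) \<bullet> T (axis 1 1), (x - Q) \<bullet> T (axis 2 1)], (x - Q) \<bullet> T (axis 3 1))"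

context
  fixes Q :: "real^3" and T :: "real^3 \<Rightarrow> real^3"
  assumes T: "orthogonal_transformation T"
begin

lemma emb_inner: "(emb Q T p - Q) \<bullet> T y = vec3 (fst p) (snd p) \<bullet> y"
  using T by (simp add: emb_def orthogonal_transformation_def)

lemma unemb_emb: "unemb Q T (emb Q T p) = p"
  by (auto simp: unemb_def emb_inner inner_axis prod_eq_iff vec_eq_iff forall_2)

lemma emb_unemb: "emb Q T (unemb Q T x) = x"
proof -
  obtain y where y: "x - Q = T y" using orthogonal_transformation_surj[OF T] by (metis surjD)
  have "(x - Q) \<bullet> T z = y \<bullet> z" for z using T y by (simp add: orthogonal_transformation_def)
  then have "unemb Q T x = (horiz y, y $ 3)"
    by (simp add: unemb_def horiz_def inner_axis)
  then show ?thesis using y by (simp add: emb_def algebra_simps)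
qed

lemma continuous_unemb: "continuous_on X (unemb Q T)"
  unfolding unemb_def[abs_def]
proof (intro continuous_on_Pair continuous_intros)
  have eq: "(\<lambda>x. vector [(x - Q) \<bullet> T (axis 1 1), (x - Q) \<bullet> T (axis 2 1)] :: real^2) = (\<lambda>x. \<chi> i. (x - Q) \<bullet> T (axis (if i = 1 then 1 else 2) 1))"
    by (auto simp: fun_eq_iff vec_eq_iff forall_2)
  show "continuous_on X (\<lambda>x. vector [(x - Q) \<bullet> T (axis 1 1), (x - Q) \<bullet> T (axis 2 1)] :: real^2)"
    unfolding eq by (intro continuous_on_vec_lambda continuous_intros)
qed

lemma emb_image_vimage: "emb Q T ` X = unemb Q T -` X"
proof
  show "emb Q T ` X \<subseteq> unemb Q T -` X" using unemb_emb by auto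
  show "unemb Q T -` X \<subseteq> emb Q T ` X"
  proof
    fix x assume "x \<in> unemb Q T -` X"
    then show "x \<in> emb Q T ` X" using emb_unemb[of x] by (intro image_eqI[of x _ "unemb Q T x"]) auto
  qed
qed

lemma open_emb: "open X \<Longrightarrow> open (emb Q T ` X)"
  unfolding emb_image_vimage by (rule open_vimage[OF _ continuous_unemb])

lemma prod_Basis_cart: "(\<Prod>b\<in>(Basis :: (real^'n::finite) set). h b) = (\<Prod>i\<in>UNIV. h (axis i 1) :: real)"
  by (subst Basis_vec_def) (auto simp: UNION_singleton_eq_range prod.reindex inj_on_def axis_eq_axis)

text \<open>The map is a relabelling of coordinates followed by an orthogonal map and a translation,
  each of which preserves volume. For the first two, comparing the measure of boxes is
  enough.\<close>

lemma distr_emb: "distr lborel borel (emb Q T) = lborel"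
proof -
  have T': "linear T" by (rule orthogonal_transformation_linear[OF T])
  have v: "distr (lborel :: ((real^2) \<times> real) measure) borel (\<lambda>p. vec3 (fst p) (snd p)) = lborel"
  proof (rule lborel_eqI[symmetric])
    fix l u :: "real^3" assume lu: "\<And>b. b \<in> Basis \<Longrightarrow> l \<bullet> b \<le> u \<bullet> b"
    have m: "(\<lambda>p. vec3 (fst p) (snd p)) \<in> borel_measurable borel"
      by (intro borel_measurable_continuous_onI linear_continuous_on linear_conv_bounded_linear[THEN iffD1] linear_vec3)
    have lu': "l $ i \<le> u $ i" for i using lu[of "axis i 1"] by (simp add: inner_axis axis_in_Basis_iff)
    have "(\<lambda>p. vec3 (fst p) (snd p)) -` box l u = box (horiz l, l $ 3) (horiz u, u $ 3)"
      by (auto simp: mem_box_cart forall_3 forall_2 box_prod box_real)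
    then have "emeasure (distr lborel borel (\<lambda>p. vec3 (fst p) (snd p))) (box l u) = emeasure lborel (box (horiz l, l $ 3) (horiz u, u $ 3))"
      using m by (subst emeasure_distr) auto
    also have "\<dots> = (\<Prod>b\<in>Basis. ((horiz u, u $ 3) - (horiz l, l $ 3)) \<bullet> b)"
    proof (rule emeasure_lborel_box)
      have "horiz l $ i \<le> horiz u $ i" for i using exhaust_2[of i] lu' by auto
      then show "(horiz l, l $ 3) \<bullet> b \<le> (horiz u, u $ 3) \<bullet> b" if "b \<in> Basis" for b
        using that by (auto simp: Basis_prod_def Basis_vec_def inner_axis lu')
    qed
    also have "(\<Prod>b\<in>Basis. ((horiz u, u $ 3) - (horiz l, l $ 3)) \<bullet> b) = (\<Prod>b\<in>Basis. (u - l) \<bullet> b)"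
    proof -
      have *: "(\<Prod>b\<in>Basis. h b) = (\<Prod>b\<in>Basis. h (b, 0)) * (\<Prod>b\<in>Basis. h (0, b))" for h :: "(real^2) \<times> real \<Rightarrow> real"
        unfolding Basis_prod_def
        by (subst prod.union_disjoint) (auto simp: Basis_prod_def prod.reindex inj_on_def)
      have p2: "(\<Prod>i\<in>UNIV. k i) = k 1 * k 2" for k :: "2 \<Rightarrow> real" unfolding UNIV_2 by simp
      have p3: "(\<Prod>i\<in>UNIV. k i) = k 1 * k 2 * k 3" for k :: "3 \<Rightarrow> real" unfolding UNIV_3 by simp
      show ?thesis unfolding *[of "(\<bullet>) ((horiz u, u $ 3) - (horiz l, l $ 3))"] prod_Basis_cart p2 p3
        by (simp add: inner_axis)
    qed
    finally show "emeasure (distr lborel borel (\<lambda>p. vec3 (fst p) (snd p))) (box l u) = (\<Prod>b\<in>Basis. (u - l) \<bullet> b)" .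
  qed simp
  have t: "distr lborel borel T = (lborel :: (real^3) measure)"
  proof (rule lborel_eqI[symmetric])
    fix l u :: "real^3" assume lu: "\<And>b. b \<in> Basis \<Longrightarrow> l \<bullet> b \<le> u \<bullet> b"
    have m: "T \<in> borel_measurable borel"
      by (intro borel_measurable_continuous_onI linear_continuous_on linear_conv_bounded_linear[THEN iffD1] T')
    have ob: "orthogonal_transformation (inv T)" using T by (rule orthogonal_transformation_inv)
    have "T -` box l u = inv T ` box l u"
      using bij_vimage_eq_inv_image[OF orthogonal_transformation_bij[OF T]] .
    then have *: "measure lebesgue (T -` box l u) = measure lebesgue (box l u)" "T -` box l u \<in> lmeasurable"
      using measure_orthogonal_image[OF ob, of "box l u"] measurable_orthogonal_image[OF ob, of "box l u"] by auto
    have bm: "T -` box l u \<in> sets borel" using measurable_sets[OF m, of "box l u"] by simp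
    have "emeasure (distr lborel borel T) (box l u) = emeasure lborel (T -` box l u)"
      using m by (subst emeasure_distr) auto
    also have "\<dots> = emeasure lebesgue (T -` box l u)" using bm by simp
    also have "\<dots> = emeasure lebesgue (box l u)"
      using * by (simp add: emeasure_eq_measure2 del: emeasure_completion)
    also have "\<dots> = (\<Prod>b\<in>Basis. (u - l) \<bullet> b)" using lu by simp
    finally show "emeasure (distr lborel borel T) (box l u) = (\<Prod>b\<in>Basis. (u - l) \<bullet> b)" .
  qed simp
  have "distr lborel borel (emb Q T) = distr (distr (distr lborel borel (\<lambda>p. vec3 (fst p) (snd p))) borel T) borel ((+) Q)"
  proof -
    have m1: "(\<lambda>p. vec3 (fst p) (snd p)) \<in> borel_measurable borel"
      by (intro borel_measurable_continuous_onI linear_continuous_on linear_conv_bounded_linear[THEN iffD1] linear_vec3)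
    have m2: "T \<in> borel_measurable borel"
      by (intro borel_measurable_continuous_onI linear_continuous_on linear_conv_bounded_linear[THEN iffD1] T')
    have m3: "(\<lambda>p. T (vec3 (fst p) (snd p))) \<in> borel_measurable borel"
      by (rule measurable_compose[OF m1 m2])
    have "distr (distr lborel borel (\<lambda>p. vec3 (fst p) (snd p))) borel T = distr lborel borel (\<lambda>p. T (vec3 (fst p) (snd p)))"
      using m1 m2 by (subst distr_distr) (auto simp: o_def)
    moreover have "distr (distr lborel borel (\<lambda>p. T (vec3 (fst p) (snd p)))) borel ((+) Q) = distr lborel borel (emb Q T)"
      using m3 by (subst distr_distr) (auto simp: o_def emb_def[abs_def])
    ultimately show ?thesis by simp
  qed
  also have "\<dots> = lborel" unfolding v t by (rule lborel_distr_plus)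
  finally show ?thesis .
qed

lemma borel_measurable_emb[measurable]: "emb Q T \<in> borel_measurable borel"
  by (rule borel_measurable_continuous_onI[OF continuous_emb[OF T]])

lemma borel_measurable_unemb[measurable]: "unemb Q T \<in> borel_measurable borel"
  by (rule borel_measurable_continuous_onI[OF continuous_unemb])

lemma emb_image_borel: "X \<in> sets borel \<Longrightarrow> emb Q T ` X \<in> sets borel"
  unfolding emb_image_vimage using measurable_sets[OF borel_measurable_unemb, of X] by simp

lemma AE_emb:
  assumes "AE x in lebesgue. P x" shows "AE p in lborel. P (emb Q T p)"
proof -
  have "AE x in distr lborel borel (emb Q T). P x"
    unfolding distr_emb using assms by (simp add: AE_completion_iff)
  then show ?thesis by (rule AE_distrD[rotated]) simp
qed

text \<open>A Borel version is chosen before composing, because measurability in frame coordinates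
  is needed for Fubini. The outer function \<open>h\<close> allows the same representative to serve
  for the function itself and for its square.\<close>

lemma emb_transport:
  assumes f: "f \<in> borel_measurable lebesgue"
  obtains f' :: "(real^2) \<times> real \<Rightarrow> real" where "f' \<in> borel_measurable borel"
    "AE p in lborel. f' p = f (emb Q T p)"
    "\<And>(h :: real \<Rightarrow> real) k. h \<in> borel_measurable borel \<Longrightarrow> k \<in> borel_measurable borel \<Longrightarrow>
       (\<integral>x. h (f x) * k x \<partial>lebesgue) = (\<integral>p. h (f' p) * k (emb Q T p) \<partial>lborel)"
    "\<And>(h :: real \<Rightarrow> real) k. h \<in> borel_measurable borel \<Longrightarrow> k \<in> borel_measurable borel \<Longrightarrow>
       integrable lebesgue (\<lambda>x. h (f x) * k x) \<longleftrightarrow> integrable lborel (\<lambda>p. h (f' p) * k (emb Q T p))"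
proof -
  obtain f0 where f0: "f0 \<in> borel_measurable borel" "AE x in lborel. f x = f0 x"
    using completion_ex_borel_measurable_real[OF f] by auto
  have ae: "AE x in lebesgue. f x = f0 x" by (rule AE_completion[OF f0(2)])
  show ?thesis
  proof (rule that[of "\<lambda>p. f0 (emb Q T p)"])
    show "(\<lambda>p. f0 (emb Q T p)) \<in> borel_measurable borel" using f0(1) by measurable
    show "AE p in lborel. f0 (emb Q T p) = f (emb Q T p)" using AE_emb[OF ae] by eventually_elim simp
    fix h :: "real \<Rightarrow> real" and k :: "real^3 \<Rightarrow> real" assume hk: "h \<in> borel_measurable borel" "k \<in> borel_measurable borel"
    have m0: "(\<lambda>x. h (f0 x) * k x) \<in> borel_measurable borel" using hk f0(1) by measurable
    have m1: "(\<lambda>x. h (f x) * k x) \<in> borel_measurable lebesgue"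
      by (intro borel_measurable_times measurable_compose[OF f hk(1)] borel_imp_lebesgue[OF hk(2)])
    have ae2: "AE x in lebesgue. h (f x) * k x = h (f0 x) * k x" using ae by eventually_elim simp
    have "(\<integral>x. h (f x) * k x \<partial>lebesgue) = (\<integral>x. h (f0 x) * k x \<partial>lebesgue)"
      by (rule integral_cong_AE[OF m1 borel_imp_lebesgue[OF m0] ae2])
    also have "\<dots> = (\<integral>x. h (f0 x) * k x \<partial>lborel)" using m0 by (intro integral_completion) simp
    also have "\<dots> = (\<integral>x. h (f0 x) * k x \<partial>distr lborel borel (emb Q T))" by (simp only: distr_emb)
    also have "\<dots> = (\<integral>p. h (f0 (emb Q T p)) * k (emb Q T p) \<partial>lborel)" using m0 by (subst integral_distr) auto
    finally show "(\<integral>x. h (f x) * k x \<partial>lebesgue) = (\<integral>p. h (f0 (emb Q T p)) * k (emb Q T p) \<partial>lborel)" .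
    have "integrable lebesgue (\<lambda>x. h (f x) * k x) \<longleftrightarrow> integrable lebesgue (\<lambda>x. h (f0 x) * k x)"
      by (rule Bochner_Integration.integrable_cong_AE[OF m1 borel_imp_lebesgue[OF m0] ae2])
    also have "\<dots> \<longleftrightarrow> integrable lborel (\<lambda>x. h (f0 x) * k x)" using m0 by (intro integrable_completion) simp
    also have "\<dots> \<longleftrightarrow> integrable (distr lborel borel (emb Q T)) (\<lambda>x. h (f0 x) * k x)" by (simp only: distr_emb)
    also have "\<dots> \<longleftrightarrow> integrable lborel (\<lambda>p. h (f0 (emb Q T p)) * k (emb Q T p))" using m0 by (subst integrable_distr_eq) auto
    finally show "integrable lebesgue (\<lambda>x. h (f x) * k x) \<longleftrightarrow> integrable lborel (\<lambda>p. h (f0 (emb Q T p)) * k (emb Q T p))" .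
  qed
qed

lemma unemb_add_vertical: "unemb Q T (x + t *\<^sub>R T (axis 3 1)) = (fst (unemb Q T x), snd (unemb Q T x) + t)"
proof -
  have "T (axis 3 1) \<bullet> T (axis k 1) = (if k = 3 then 1 else 0)" for k
    using T by (simp add: orthogonal_transformation_def inner_axis_axis)
  then show ?thesis by (auto simp: unemb_def algebra_simps inner_add_left vec_eq_iff forall_2)
qed

lemma vertical_derivative:
  assumes \<psi>: "smoothn \<psi>" and eq: "\<And>x. \<psi> x = A (fst (unemb Q T x)) * \<theta> (snd (unemb Q T x))" and \<theta>: "smooth1 \<theta>"
  shows "frechet_derivative \<psi> (at x) (T (axis 3 1)) = A (fst (unemb Q T x)) * deriv \<theta> (snd (unemb Q T x))"
proof -
  let ?e = "T (axis 3 1)"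
  have "((\<lambda>t. x + t *\<^sub>R ?e) has_derivative (\<lambda>t. t *\<^sub>R ?e)) (at 0)" by (auto intro!: derivative_eq_intros)
  moreover have "(\<psi> has_derivative frechet_derivative \<psi> (at x)) (at (x + 0 *\<^sub>R ?e))" using smoothnD(1)[OF \<psi>] by simp
  ultimately have 1: "((\<lambda>t. \<psi> (x + t *\<^sub>R ?e)) has_derivative (\<lambda>t. frechet_derivative \<psi> (at x) (t *\<^sub>R ?e))) (at 0)"
    by (rule has_derivative_compose)
  have "((\<lambda>t. \<theta> (snd (unemb Q T x) + t)) has_real_derivative deriv \<theta> (snd (unemb Q T x) + 0) * 1) (at 0)"
    by (rule DERIV_chain2[OF smooth1_deriv(1)[OF \<theta>]]) (auto intro!: derivative_eq_intros)
  from DERIV_cmult[OF this, of "A (fst (unemb Q T x))"]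
  have "((\<lambda>t. \<psi> (x + t *\<^sub>R ?e)) has_derivative (\<lambda>c. (A (fst (unemb Q T x)) * deriv \<theta> (snd (unemb Q T x))) * c)) (at 0)"
    by (simp add: eq unemb_add_vertical has_field_derivative_def)
  from has_derivative_unique[OF 1 this, THEN fun_cong, of 1] show ?thesis by simp
qed

lemma smoothn_coord: "smoothn (\<lambda>x. fst (unemb Q T x) \<bullet> i)" "smoothn (\<lambda>x. snd (unemb Q T x))"
proof -
  have "fst (unemb Q T x) \<bullet> i = (x - Q) \<bullet> T (vec3 i 0)" for x
  proof -
    have "x - Q = T (vec3 (fst (unemb Q T x)) (snd (unemb Q T x)))" using emb_unemb[of x] by (simp add: emb_def algebra_simps)
    then have "(x - Q) \<bullet> T (vec3 i 0) = vec3 (fst (unemb Q T x)) (snd (unemb Q T x)) \<bullet> vec3 i 0"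
      using T by (simp add: orthogonal_transformation_def)
    then show ?thesis by (simp add: inner_vec3)
  qed
  then show "smoothn (\<lambda>x. fst (unemb Q T x) \<bullet> i)" using smoothn_inner by simp
  show "smoothn (\<lambda>x. snd (unemb Q T x))" by (simp add: unemb_def smoothn_inner)
qed

lemma smoothn_bump_unemb: "smoothn (\<lambda>x. bump n a b (fst (unemb Q T x)))"
  unfolding bump_def
proof (rule smoothn_prod)
  fix i :: "real^2"
  have 1: "smooth1 (\<lambda>t. fl (real n * t + (- real n * (a \<bullet> i))))" "smooth1 (\<lambda>t. fl ((- real n) * t + real n * (b \<bullet> i)))"
    by (intro smooth1_affine smooth1_fl)+
  from smoothn_mult[OF smoothn_compose[OF 1(1) smoothn_coord(1)] smoothn_compose[OF 1(2) smoothn_coord(1)], of i i]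
  show "smoothn (\<lambda>x. fl (real n * (fst (unemb Q T x) \<bullet> i - a \<bullet> i)) * fl (real n * (b \<bullet> i - fst (unemb Q T x) \<bullet> i)))"
    by (simp add: algebra_simps)
qed

lemma test_fun_product:
  assumes A: "smoothn (\<lambda>x. A (fst (unemb Q T x)))" and K: "compact K" "K \<subseteq> C" "\<And>v. v \<notin> K \<Longrightarrow> A v = 0"
    and \<theta>: "vert_test \<alpha> \<beta> \<theta>" and N: "emb Q T ` (C \<times> {\<alpha><..<\<beta>}) \<subseteq> N"
  shows "test_fun N (\<lambda>x. A (fst (unemb Q T x)) * \<theta> (snd (unemb Q T x)))"
proof -
  obtain a b where ab: "\<alpha> < a" "b < \<beta>" "\<And>t. t \<notin> {a..b} \<Longrightarrow> \<theta> t = 0" and s: "smooth1 \<theta>"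
    using \<theta> by (auto simp: vert_test_def)
  show ?thesis
  proof (rule test_funI[where K="emb Q T ` (K \<times> {a..b})"])
    show "smoothn (\<lambda>x. A (fst (unemb Q T x)) * \<theta> (snd (unemb Q T x)))"
      by (intro smoothn_mult A smoothn_compose[OF s] smoothn_coord)
    show "compact (emb Q T ` (K \<times> {a..b}))"
      by (intro compact_continuous_image continuous_emb T compact_Times K(1)) auto
    show "emb Q T ` (K \<times> {a..b}) \<subseteq> N" using K(2) ab N by fastforce
    show "A (fst (unemb Q T x)) * \<theta> (snd (unemb Q T x)) = 0" if "x \<notin> emb Q T ` (K \<times> {a..b})" for x
      using that K(3)[of "fst (unemb Q T x)"] ab(3)[of "snd (unemb Q T x)"] unfolding emb_image_vimage
      by (cases "unemb Q T x") auto
  qed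
qed

text \<open>Products of a horizontal bump and a vertical test function are admissible in
  \<open>N\<close>, and only the vertical factor is differentiated in the third frame direction.
  This is what \<open>weak_derivative_slice\<close> asks for.\<close>

lemma weak_vertical_slice:
  fixes f g :: "real^3 \<Rightarrow> real" and f' g' :: "(real^2) \<times> real \<Rightarrow> real"
  assumes N: "emb Q T ` (C \<times> {\<alpha><..<\<beta>}) \<subseteq> N" and C: "open C" "\<alpha> < \<beta>"
    and weak: "\<And>\<psi>. test_fun N \<psi> \<Longrightarrow> (\<integral>x. f x * frechet_derivative \<psi> (at x) (T (axis 3 1)) \<partial>lebesgue) = - (\<integral>x. g x * \<psi> x \<partial>lebesgue)"
    and f': "integrable lborel f'" "\<And>k. k \<in> borel_measurable borel \<Longrightarrow> (\<integral>x. f x * k x \<partial>lebesgue) = (\<integral>p. f' p * k (emb Q T p) \<partial>lborel)"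
    and g': "integrable lborel g'" "\<And>k. k \<in> borel_measurable borel \<Longrightarrow> (\<integral>x. g x * k x \<partial>lebesgue) = (\<integral>p. g' p * k (emb Q T p) \<partial>lborel)"
  obtains M where "AE p in lborel. fst p \<in> C \<and> \<alpha> < snd p \<and> snd p < \<beta> \<longrightarrow>
      f' p = M (fst p) - (\<integral>z. indicator {snd p..} z * g' (fst p, z) \<partial>lborel)"
proof (rule weak_derivative_slice[OF f'(1) g'(1) C])
  fix a b :: "real^2" and n \<theta> assume ab: "cbox a b \<subseteq> C" and \<theta>: "vert_test \<alpha> \<beta> \<theta>"
  have s: "smooth1 \<theta>" using \<theta> by (simp add: vert_test_def)
  define \<psi> where "\<psi> x = bump n a b (fst (unemb Q T x)) * \<theta> (snd (unemb Q T x))" for x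
  have t: "test_fun N \<psi>" unfolding \<psi>_def[abs_def]
    by (rule test_fun_product[OF smoothn_bump_unemb compact_cbox ab _ \<theta> N])
      (use box_subset_cbox[of a b] in \<open>auto intro!: bump_eq_0\<close>)
  have sm: "smoothn \<psi>" using t by (rule test_fun_smoothn)
  have e: "frechet_derivative \<psi> (at x) (T (axis 3 1)) = bump n a b (fst (unemb Q T x)) * deriv \<theta> (snd (unemb Q T x))" for x
    by (rule vertical_derivative[OF sm _ s]) (simp add: \<psi>_def)
  have fm: "(\<lambda>x. fst (unemb Q T x)) \<in> borel_measurable borel" "(\<lambda>x. snd (unemb Q T x)) \<in> borel_measurable borel"
    using continuous_unemb[of UNIV] by (auto intro!: borel_measurable_continuous_onI continuous_intros)
  have \<theta>m: "\<theta> \<in> borel_measurable borel" "deriv \<theta> \<in> borel_measurable borel"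
    using smooth1_continuous_on[OF s] smooth1_continuous_on[OF smooth1_deriv(2)[OF s]] by (auto intro!: borel_measurable_continuous_onI)
  have m: "(\<lambda>x. bump n a b (fst (unemb Q T x)) * deriv \<theta> (snd (unemb Q T x))) \<in> borel_measurable borel"
    "\<psi> \<in> borel_measurable borel"
    unfolding \<psi>_def[abs_def] by (intro borel_measurable_times measurable_compose[OF fm(1)] measurable_compose[OF fm(2)] \<theta>m borel_measurable_bump)+
  show "(\<integral>p. f' p * (bump n a b (fst p) * deriv \<theta> (snd p)) \<partial>lborel) = - (\<integral>p. g' p * (bump n a b (fst p) * \<theta> (snd p)) \<partial>lborel)"
    using weak[OF t] unfolding e f'(2)[OF m(1)] g'(2)[OF m(2)] by (simp add: \<psi>_def unemb_emb)
qed (use that in blast)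

end

text \<open>Weak derivatives are given in the standard basis but needed in the frame; linearity of
  the weak identity does the conversion. The index type is left open because it is a single index
  for \<open>u\<close> and a pair of indices for its gradient.\<close>

lemma weak_contract:
  fixes f :: "'i::finite \<Rightarrow> real^3 \<Rightarrow> real" and g :: "'i \<Rightarrow> 3 \<Rightarrow> real^3 \<Rightarrow> real" and a :: "'i \<Rightarrow> real"
  assumes f: "\<And>i. integrable lebesgue (f i)" and g: "\<And>i j. integrable lebesgue (g i j)" and \<psi>: "test_fun N \<psi>"
    and weak: "\<And>i j. (\<integral>x. f i x * partial_deriv j \<psi> x \<partial>lebesgue) = - (\<integral>x. g i j x * \<psi> x \<partial>lebesgue)"
  shows "(\<integral>x. (\<Sum>i\<in>UNIV. a i * f i x) * frechet_derivative \<psi> (at x) e \<partial>lebesgue)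
    = - (\<integral>x. (\<Sum>i\<in>UNIV. \<Sum>j\<in>UNIV. a i * e $ j * g i j x) * \<psi> x \<partial>lebesgue)"
proof -
  note s = test_fun_smoothn[OF \<psi>]
  have K: "compact (closure {x. \<psi> x \<noteq> 0})" using \<psi> by (simp add: test_fun_def)
  have i1: "integrable lebesgue (\<lambda>x. f i x * partial_deriv j \<psi> x)" for i j
  proof -
    obtain M where "\<And>x. \<bar>partial_deriv j \<psi> x\<bar> \<le> M"
      using continuous_compact_support_bounded[OF smoothnD(3)[OF s] K test_fun_zero_outside(2)[OF \<psi>]] by metis
    then show ?thesis
      by (intro integrable_times_bounded[OF f] borel_imp_lebesgue borel_measurable_continuous_onI smoothnD(3) s)
  qed
  have i2: "integrable lebesgue (\<lambda>x. g i j x * \<psi> x)" for i j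
  proof -
    obtain M where "\<And>x. \<bar>\<psi> x\<bar> \<le> M"
      using continuous_compact_support_bounded[OF smoothnD(2)[OF s] K test_fun_zero_outside(1)[OF \<psi>]] by metis
    then show ?thesis
      by (intro integrable_times_bounded[OF g] borel_imp_lebesgue borel_measurable_continuous_onI smoothnD(2) s)
  qed
  have d: "\<psi> differentiable (at x)" for x using smoothnD(1)[OF s] by (auto simp: differentiable_def)
  have "(\<integral>x. (\<Sum>i\<in>UNIV. a i * f i x) * frechet_derivative \<psi> (at x) e \<partial>lebesgue)
    = (\<integral>x. (\<Sum>i\<in>UNIV. \<Sum>j\<in>UNIV. (a i * e $ j) * (f i x * partial_deriv j \<psi> x)) \<partial>lebesgue)"
    by (simp add: frechet_eq_sum_partial[OF d] sum_product mult_ac)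
  also have "\<dots> = (\<Sum>i\<in>UNIV. \<Sum>j\<in>UNIV. (a i * e $ j) * (\<integral>x. f i x * partial_deriv j \<psi> x \<partial>lebesgue))"
    using i1 by (subst Bochner_Integration.integral_sum) (auto intro!: Bochner_Integration.integrable_sum)
  also have "\<dots> = - (\<Sum>i\<in>UNIV. \<Sum>j\<in>UNIV. (a i * e $ j) * (\<integral>x. g i j x * \<psi> x \<partial>lebesgue))"
    by (simp add: weak sum_negf)
  also have "(\<Sum>i\<in>UNIV. \<Sum>j\<in>UNIV. (a i * e $ j) * (\<integral>x. g i j x * \<psi> x \<partial>lebesgue))
     = (\<integral>x. (\<Sum>i\<in>UNIV. \<Sum>j\<in>UNIV. (a i * e $ j) * (g i j x * \<psi> x)) \<partial>lebesgue)"
    using i2 by (subst Bochner_Integration.integral_sum) (auto intro!: Bochner_Integration.integrable_sum)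
  also have "\<dots> = (\<integral>x. (\<Sum>i\<in>UNIV. \<Sum>j\<in>UNIV. a i * e $ j * g i j x) * \<psi> x \<partial>lebesgue)"
    by (simp add: sum_distrib_right mult.assoc)
  finally show ?thesis .
qed

subsection \<open>The velocity field in frame coordinates\<close>

text \<open>The rank-one tensor of \<open>a\<close> and \<open>X\<close>. The inner product with it
  contracts a gradient to a frame component, and nesting it treats the Hessian in the same
  way.\<close>

definition outer :: "real^'n \<Rightarrow> 'b::real_inner \<Rightarrow> 'b^'n::finite" where
  "outer a X = (\<chi> i. a $ i *\<^sub>R X)"

lemma inner_outer: "D \<bullet> outer a X = (\<Sum>i\<in>UNIV. a $ i * (D $ i \<bullet> X))"
  by (simp add: outer_def inner_vec_def)

lemma norm_outer: "norm (outer a X) = norm a * norm X"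
proof -
  have "outer a X \<bullet> outer a X = (a \<bullet> a) * (X \<bullet> X)"
    by (simp add: inner_outer inner_vec_def[of a] sum_distrib_right) (simp add: outer_def mult.assoc)
  then show ?thesis by (simp add: norm_eq_sqrt_inner real_sqrt_mult)
qed

lemma L2_on_integrable:
  fixes v :: "'a::euclidean_space \<Rightarrow> 'b::euclidean_space"
  assumes v: "L2_on A v" "A \<in> sets lebesgue" "B \<in> sets lebesgue" "B \<subseteq> A" "bounded B" and b: "norm b \<le> 1"
  shows "integrable lebesgue (\<lambda>x. indicator B x * (v x \<bullet> b))"
proof -
  have fin: "emeasure lebesgue B < \<infinity>"
    using bounded_set_imp_lmeasurable[OF v(5,3)] by (simp add: fmeasurable_def del: emeasure_completion)
  have "integrable lebesgue (\<lambda>x. (indicator B x * (v x \<bullet> b)) * indicator B x)"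
  proof (rule Cauchy_Schwarz_integral(1)[OF L2_on_inner(1)[OF v(1-4) b] _ L2_on_inner(2)[OF v(1-4) b]])
    show "(indicator B :: 'a \<Rightarrow> real) \<in> borel_measurable lebesgue" using v(3) by simp
    have "integrable lebesgue (indicator B :: 'a \<Rightarrow> real)" using v(3) fin by (intro integrable_real_indicator)
    moreover have "(\<lambda>x. (indicator B x)\<^sup>2) = (indicator B :: 'a \<Rightarrow> real)" by (auto simp: indicator_def fun_eq_iff)
    ultimately show "integrable lebesgue (\<lambda>x. (indicator B x :: real)\<^sup>2)" by simp
  qed
  moreover have "(\<lambda>x. (indicator B x * (v x \<bullet> b)) * indicator B x) = (\<lambda>x. indicator B x * (v x \<bullet> b))"
    by (auto simp: indicator_def fun_eq_iff)
  ultimately show ?thesis by simp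
qed

lemma L2_on_cong_AE:
  fixes v w :: "'a::euclidean_space \<Rightarrow> 'b::euclidean_space"
  assumes v: "L2_on A v" and A: "A \<in> sets lebesgue" and eq: "AE x in lebesgue. x \<in> A \<longrightarrow> v x = w x"
  shows "L2_on A w"
proof -
  have m: "(\<lambda>x. indicator A x *\<^sub>R v x) \<in> borel_measurable lebesgue" "integrable lebesgue (\<lambda>x. indicator A x *\<^sub>R (norm (v x))\<^sup>2)"
    using v A by (simp_all add: L2_on_def borel_measurable_restrict_space_iff set_integrable_def)
  have "AE x in lebesgue. indicator A x *\<^sub>R v x = indicator A x *\<^sub>R w x"
    using eq by eventually_elim (auto simp: indicator_def)
  then have mw: "(\<lambda>x. indicator A x *\<^sub>R w x) \<in> borel_measurable lebesgue"
    by (rule borel_measurable_AE[OF m(1)])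
  then have "w \<in> borel_measurable (lebesgue_on A)"
    using A by (simp add: borel_measurable_restrict_space_iff)
  moreover have "integrable lebesgue (\<lambda>x. indicator A x *\<^sub>R (norm (w x))\<^sup>2)"
  proof (rule integrable_cong_AE_imp[OF m(2)])
    have "(\<lambda>x. (norm (indicator A x *\<^sub>R w x))\<^sup>2) \<in> borel_measurable lebesgue" using mw by measurable
    moreover have "(\<lambda>x. (norm (indicator A x *\<^sub>R w x))\<^sup>2) = (\<lambda>x. indicator A x *\<^sub>R (norm (w x))\<^sup>2)"
      by (auto simp: indicator_def fun_eq_iff)
    ultimately show "(\<lambda>x. indicator A x *\<^sub>R (norm (w x))\<^sup>2) \<in> borel_measurable lebesgue" by simp
    show "AE x in lebesgue. indicator A x *\<^sub>R (norm (v x))\<^sup>2 = indicator A x *\<^sub>R (norm (w x))\<^sup>2"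
      using eq by eventually_elim (auto simp: indicator_def)
  qed
  ultimately show ?thesis by (simp add: L2_on_def set_integrable_def)
qed

lemma weak_grad_unique:
  assumes "open U" "weak_grad U u Du" "weak_grad U u Dv"
  shows "AE x in lebesgue. x \<in> U \<longrightarrow> Du x = Dv x"
proof -
  have "AE x in lebesgue. \<forall>i\<in>UNIV. \<forall>j\<in>UNIV. x \<in> U \<longrightarrow> Du x $ i $ j = Dv x $ i $ j"
    by (intro AE_finite_allI finite weak_partial_unique[OF assms(1) assms(2,3)[unfolded weak_grad_def, rule_format]])
  then show ?thesis by eventually_elim (auto simp: vec_eq_iff)
qed

lemma AE_interval_ex:
  assumes "AE z in lborel. Q z" "a < (b::real)"
  obtains z where "a < z" "z < b" "Q z"
proof -
  have "\<not> (\<forall>z\<in>{a<..<b}. \<not> Q z)"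
  proof
    assume *: "\<forall>z\<in>{a<..<b}. \<not> Q z"
    from assms(1) have "AE z in lborel. z \<notin> {a<..<b}" by eventually_elim (use * in auto)
    then have "emeasure lborel {a<..<b} = 0" by (subst (asm) AE_iff_measurable[of "{a<..<b}"]) auto
    then show False using assms(2) by simp
  qed
  then show ?thesis using that by auto
qed

lemma open_above_graph:
  fixes \<beta> :: "'a::euclidean_space \<Rightarrow> real"
  assumes "open U" "continuous_on U \<beta>"
  shows "open {p. fst p \<in> U \<and> \<beta> (fst p) < snd p}" "open {p. fst p \<in> U \<and> snd p < \<beta> (fst p)}"
proof -
  have o: "open (U \<times> (UNIV :: real set))" using assms by (intro open_Times) auto
  have c: "continuous_on (U \<times> (UNIV :: real set)) (\<lambda>p. snd p - \<beta> (fst p))"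
    by (intro continuous_intros continuous_on_compose2[OF assms(2)]) auto
  have "{p. fst p \<in> U \<and> \<beta> (fst p) < snd p} = (\<lambda>p. snd p - \<beta> (fst p)) -` {0<..} \<inter> (U \<times> (UNIV :: real set))"
    "{p. fst p \<in> U \<and> snd p < \<beta> (fst p)} = (\<lambda>p. snd p - \<beta> (fst p)) -` {..<0} \<inter> (U \<times> (UNIV :: real set))"
    by auto
  then show "open {p. fst p \<in> U \<and> \<beta> (fst p) < snd p}" "open {p. fst p \<in> U \<and> snd p < \<beta> (fst p)}"
    using c[unfolded continuous_on_open_vimage[OF o], rule_format, OF open_greaterThan]
      c[unfolded continuous_on_open_vimage[OF o], rule_format, OF open_lessThan] by simp_all
qed

section \<open>The radial cut-off of the disc\<close>

definition eta :: "real \<Rightarrow> real^2 \<Rightarrow> real" where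
  "eta r v = fl (1 - (norm v)\<^sup>2 / r\<^sup>2)"

text \<open>The gradient of \<open>eta r\<close> at \<open>v\<close> is \<open>- rho r v\<close>
  times \<open>v\<close>, so testing the divergence produces this weight. It is even in
  \<open>v\<close>, on which all parity arguments rest, and of size \<open>1 / r^2\<close>.\<close>

definition rho :: "real \<Rightarrow> real^2 \<Rightarrow> real" where
  "rho r v = 2 / r\<^sup>2 * fl' (1 - (norm v)\<^sup>2 / r\<^sup>2)"

lemma rho_bounds: "0 < r \<Longrightarrow> 0 \<le> rho r v" "0 < r \<Longrightarrow> rho r v \<le> 4 / r\<^sup>2"
  using fl'_bounds[of "1 - (norm v)\<^sup>2 / r\<^sup>2"] mult_left_mono[of "fl' (1 - (norm v)\<^sup>2 / r\<^sup>2)" 2 "2 / r\<^sup>2"]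
  by (auto simp: rho_def)

lemma eta_rho_0:
  assumes "0 < r" "r \<le> norm v" shows "eta r v = 0" "rho r v = 0"
proof -
  have "r\<^sup>2 \<le> (norm v)\<^sup>2" using assms by (intro power_mono) auto
  then have "1 - (norm v)\<^sup>2 / r\<^sup>2 \<le> 0" using assms(1) by simp
  then show "eta r v = 0" "rho r v = 0" by (auto simp: eta_def rho_def fl_bounds fl'_def)
qed

lemma eta_bounds: "0 \<le> eta r v" "eta r v \<le> 1"
  by (auto simp: eta_def fl_bounds)

lemma continuous_eta: "continuous_on X (eta r)" and continuous_rho: "continuous_on X (rho r)"
proof -
  have c: "continuous_on X (\<lambda>v::real^2. 1 - (norm v)\<^sup>2 * (1 / r\<^sup>2))" by (intro continuous_intros)
  show "continuous_on X (eta r)" unfolding eta_def[abs_def] divide_inverse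
    using c by (intro continuous_on_compose2[OF smooth1_continuous_on[OF smooth1_fl, of UNIV]]) (auto simp: divide_inverse)
  show "continuous_on X (rho r)" unfolding rho_def[abs_def] divide_inverse
    using c by (intro continuous_intros continuous_on_compose2[OF continuous_fl'[of UNIV]]) (auto simp: divide_inverse)
qed

lemma eta_line_derivative:
  "((\<lambda>t. eta r (v + t *\<^sub>R axis k 1)) has_real_derivative - (rho r v * v $ k)) (at 0)"
proof -
  have q: "(norm (v + t *\<^sub>R axis k 1))\<^sup>2 = (norm v)\<^sup>2 + 2 * t * v $ k + t\<^sup>2" for t :: real
    unfolding power2_norm_eq_inner
    by (simp add: inner_add_left inner_add_right inner_axis inner_commute[of "axis k 1"] inner_axis_axis power2_eq_square algebra_simps)
  have "((\<lambda>t. 1 - ((norm v)\<^sup>2 + 2 * t * v $ k + t\<^sup>2) * inverse (r\<^sup>2)) has_real_derivative - (2 * v $ k) * inverse (r\<^sup>2)) (at 0)"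
    by (auto intro!: derivative_eq_intros)
  then have "((\<lambda>t. 1 - ((norm v)\<^sup>2 + 2 * t * v $ k + t\<^sup>2) / r\<^sup>2) has_real_derivative - (2 * v $ k) / r\<^sup>2) (at 0)"
    by (simp only: divide_inverse)
  then have "((\<lambda>t. fl (1 - ((norm v)\<^sup>2 + 2 * t * v $ k + t\<^sup>2) / r\<^sup>2)) has_real_derivative
     fl' (1 - ((norm v)\<^sup>2 + 2 * 0 * v $ k + 0\<^sup>2) / r\<^sup>2) * (- (2 * v $ k) / r\<^sup>2)) (at 0)"
    by (rule DERIV_chain2[OF fl_has_derivative])
  then show ?thesis unfolding eta_def q by (simp add: rho_def algebra_simps)
qed

context
  fixes Q :: "real^3" and T :: "real^3 \<Rightarrow> real^3"
  assumes T: "orthogonal_transformation T"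
begin

lemma smoothn_eta: "smoothn (\<lambda>x. eta r (fst (unemb Q T x)))"
proof -
  have "smoothn (\<lambda>x. fst (unemb Q T x) \<bullet> axis 1 1 * (fst (unemb Q T x) \<bullet> axis 1 1) + fst (unemb Q T x) \<bullet> axis 2 1 * (fst (unemb Q T x) \<bullet> axis 2 1))"
    by (intro smoothn_add smoothn_mult smoothn_coord T)
  then have "smoothn (\<lambda>x. (norm (fst (unemb Q T x)))\<^sup>2)"
    by (simp add: inner_axis power2_norm_eq_inner inner_vec_def[of "fst _"] sum_2)
  from smoothn_compose[OF smooth1_affine[OF smooth1_fl] this, of "- 1 / r\<^sup>2" 1]
  show ?thesis by (simp add: eta_def)
qed

lemma frame_inner: "T (axis j 1) \<bullet> T (axis k 1) = (if j = k then 1 else 0)"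
  using T by (simp add: orthogonal_transformation_def inner_axis_axis)

lemma frame_expand: "w = (\<Sum>k\<in>UNIV. (w \<bullet> T (axis k 1)) *\<^sub>R T (axis k 1))"
proof -
  obtain y where y: "w = T y" using orthogonal_transformation_surj[OF T] by (metis surjD)
  have lin: "linear T" using T by (rule orthogonal_transformation_linear)
  have "T y = T (\<Sum>k\<in>UNIV. y $ k *\<^sub>R axis k 1)" by (metis basis_expansion scalar_mult_eq_scaleR)
  also have "\<dots> = (\<Sum>k\<in>UNIV. y $ k *\<^sub>R T (axis k 1))" by (simp add: linear_sum[OF lin] linear_scale[OF lin])
  finally have 1: "T y = (\<Sum>k\<in>UNIV. y $ k *\<^sub>R T (axis k 1))" .
  have 2: "T y \<bullet> T (axis k 1) = y $ k" for k using T by (simp add: orthogonal_transformation_def inner_axis)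
  show ?thesis unfolding y 2 by (rule 1)
qed

lemma frame_norm: "norm (T (axis k 1)) = 1"
  by (simp add: norm_eq_sqrt_inner frame_inner)

lemma eta_product_derivative:
  fixes \<kappa> :: "real \<Rightarrow> real" and r :: real
  assumes \<kappa>: "smooth1 \<kappa>"
  defines "\<psi> \<equiv> \<lambda>x. eta r (fst (unemb Q T x)) * \<kappa> (snd (unemb Q T x))"
  shows "smoothn \<psi>"
    "frechet_derivative \<psi> (at (emb Q T p)) (T (axis 1 1)) = - (rho r (fst p) * fst p $ 1) * \<kappa> (snd p)"
    "frechet_derivative \<psi> (at (emb Q T p)) (T (axis 2 1)) = - (rho r (fst p) * fst p $ 2) * \<kappa> (snd p)"
    "frechet_derivative \<psi> (at (emb Q T p)) (T (axis 3 1)) = eta r (fst p) * deriv \<kappa> (snd p)"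
proof -
  show sm: "smoothn \<psi>" unfolding \<psi>_def
    by (intro smoothn_mult smoothn_eta smoothn_compose[OF \<kappa>] smoothn_coord T)
  show "frechet_derivative \<psi> (at (emb Q T p)) (T (axis 3 1)) = eta r (fst p) * deriv \<kappa> (snd p)"
    using vertical_derivative[OF T sm _ \<kappa>, of "eta r" Q "emb Q T p"] by (simp add: \<psi>_def unemb_emb[OF T])
  have un: "unemb Q T (emb Q T p + t *\<^sub>R T (axis k 1)) = (fst p + t *\<^sub>R axis (if k = 1 then 1 else 2) 1, snd p)" if "k \<noteq> 3" for t k
  proof -
    have lin: "linear T" using T by (rule orthogonal_transformation_linear)
    have "vec3 (fst p) (snd p) + t *\<^sub>R axis k 1 = vec3 (fst p + t *\<^sub>R axis (if k = 1 then 1 else 2) 1) (snd p)"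
      using that exhaust_3[of k] by (auto simp: vec_eq_iff forall_3 axis_def)
    then have "emb Q T p + t *\<^sub>R T (axis k 1) = emb Q T (fst p + t *\<^sub>R axis (if k = 1 then 1 else 2) 1, snd p)"
      unfolding emb_def by (simp add: linear_add[OF lin, symmetric] linear_scale[OF lin, symmetric] add.assoc)
    then show ?thesis by (simp add: unemb_emb[OF T])
  qed
  have hor: "frechet_derivative \<psi> (at (emb Q T p)) (T (axis k 1)) = - (rho r (fst p) * fst p $ (if k = 1 then 1 else 2)) * \<kappa> (snd p)" if "k \<noteq> 3" for k
  proof -
    let ?e = "T (axis k 1)" and ?x = "emb Q T p"
    have "((\<lambda>t. ?x + t *\<^sub>R ?e) has_derivative (\<lambda>t. t *\<^sub>R ?e)) (at 0)" by (auto intro!: derivative_eq_intros)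
    moreover have "(\<psi> has_derivative frechet_derivative \<psi> (at ?x)) (at (?x + 0 *\<^sub>R ?e))" using smoothnD(1)[OF sm] by simp
    ultimately have 1: "((\<lambda>t. \<psi> (?x + t *\<^sub>R ?e)) has_derivative (\<lambda>t. frechet_derivative \<psi> (at ?x) (t *\<^sub>R ?e))) (at 0)"
      by (rule has_derivative_compose)
    have "((\<lambda>t. \<psi> (?x + t *\<^sub>R ?e)) has_derivative times (- (rho r (fst p) * fst p $ (if k = 1 then 1 else 2)) * \<kappa> (snd p))) (at 0)"
      using DERIV_cmult_right[OF eta_line_derivative[of r "fst p" "if k = 1 then 1 else 2"], of "\<kappa> (snd p)"]
      unfolding \<psi>_def un[OF that] fst_conv snd_conv has_field_derivative_def by simp
    from has_derivative_unique[OF 1 this, THEN fun_cong, of 1] show ?thesis by simp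
  qed
  show "frechet_derivative \<psi> (at (emb Q T p)) (T (axis 1 1)) = - (rho r (fst p) * fst p $ 1) * \<kappa> (snd p)"
    "frechet_derivative \<psi> (at (emb Q T p)) (T (axis 2 1)) = - (rho r (fst p) * fst p $ 2) * \<kappa> (snd p)"
    using hor[of 1] hor[of 2] by auto
qed

end

lemma (in -) compact_emb: "orthogonal_transformation T \<Longrightarrow> compact K \<Longrightarrow> compact (emb Q T ` K)"
  by (intro compact_continuous_image continuous_emb)

lemma bounded_emb: "orthogonal_transformation T \<Longrightarrow> bounded X \<Longrightarrow> bounded (emb Q T ` X)"
  using compact_emb[of T "closure X" Q] closure_subset[of X]
  by (meson bounded_subset compact_closure compact_imp_bounded image_mono)

text \<open>One point below the graph where \<open>f\<close> vanishes determines the constant of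
  integration. As \<open>g\<close> vanishes there too, the constant is the full integral of
  \<open>g\<close> and the tail formula becomes an integral from below.\<close>

lemma slice_below_vanishing:
  fixes f g :: "'a::euclidean_space \<times> real \<Rightarrow> real"
  assumes g: "integrable lborel g"
    and M: "AE p in lborel. fst p \<in> C \<and> - s < snd p \<and> snd p < s \<longrightarrow>
      f p = M (fst p) - (\<integral>z. indicator {snd p..} z * g (fst p, z) \<partial>lborel)"
    and \<beta>: "\<And>v. v \<in> C \<Longrightarrow> - s < \<beta> v \<and> \<beta> v < s"
    and f0: "AE p in lborel. fst p \<in> C \<and> snd p \<le> \<beta> (fst p) \<longrightarrow> f p = 0"
    and g0: "AE p in lborel. fst p \<in> C \<and> snd p \<le> \<beta> (fst p) \<longrightarrow> g p = 0"
  shows "AE v in lborel. v \<in> C \<longrightarrow> (AE z in lborel. - s < z \<and> z < s \<longrightarrow> f (v, z) = (\<integral>t. indicator {..<z} t * g (v, t) \<partial>lborel))"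
  using AE_lborel_prodD[OF M] AE_lborel_prodD[OF f0] AE_lborel_prodD[OF g0] AE_lborel_slice_integrable[OF g]
proof eventually_elim
  case (elim v)
  show ?case
  proof
    assume v: "v \<in> C"
    have [measurable]: "(\<lambda>z. g (v, z)) \<in> borel_measurable borel" using elim(4) by auto
    have gi: "integrable lborel (\<lambda>t. indicator A t * g (v, t))" if "A \<in> sets borel" for A
      using integrable_mult_indicator[OF _ elim(4), of A] that by simp
    have "AE z in lborel. (- s < z \<and> z < s \<longrightarrow> f (v, z) = M v - (\<integral>t. indicator {z..} t * g (v, t) \<partial>lborel)) \<and> (z \<le> \<beta> v \<longrightarrow> f (v, z) = 0)"
      using elim(1,2) by eventually_elim (use v in auto)
    \<comment> \<open>The interval from \<open>- s\<close> to \<open>\<beta> v\<close> has positive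
      length, so it contains a point at which the almost-everywhere statements hold.\<close>
    then obtain z0 where z0: "- s < z0" "z0 < \<beta> v" "(- s < z0 \<and> z0 < s \<longrightarrow> f (v, z0) = M v - (\<integral>t. indicator {z0..} t * g (v, t) \<partial>lborel)) \<and> (z0 \<le> \<beta> v \<longrightarrow> f (v, z0) = 0)"
      using AE_interval_ex \<beta>[OF v] by blast
    have "M v = (\<integral>t. indicator {z0..} t * g (v, t) \<partial>lborel)" using z0 \<beta>[OF v] by auto
    also have "\<dots> = (\<integral>t. g (v, t) \<partial>lborel)"
    proof (rule integral_cong_AE)
      show "AE t in lborel. indicator {z0..} t * g (v, t) = g (v, t)"
        using elim(3) by eventually_elim (use v z0 in \<open>auto simp: indicator_def\<close>)
    qed measurable
    finally have Mv: "M v = (\<integral>t. g (v, t) \<partial>lborel)" .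
    have split: "(\<integral>t. g (v, t) \<partial>lborel) - (\<integral>t. indicator {z..} t * g (v, t) \<partial>lborel) = (\<integral>t. indicator {..<z} t * g (v, t) \<partial>lborel)" for z
    proof -
      have "(\<integral>t. g (v, t) \<partial>lborel) - (\<integral>t. indicator {z..} t * g (v, t) \<partial>lborel) = (\<integral>t. g (v, t) - indicator {z..} t * g (v, t) \<partial>lborel)"
        by (rule Bochner_Integration.integral_diff[OF elim(4) gi, symmetric]) simp
      also have "\<dots> = (\<integral>t. indicator {..<z} t * g (v, t) \<partial>lborel)"
        by (intro Bochner_Integration.integral_cong) (auto simp: indicator_def)
      finally show ?thesis .
    qed
    show "AE z in lborel. - s < z \<and> z < s \<longrightarrow> f (v, z) = (\<integral>t. indicator {..<z} t * g (v, t) \<partial>lborel)"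
      using elim(1) by eventually_elim (use v Mv split in auto)
  qed
qed

definition frame_rep :: "real^3 \<Rightarrow> (real^3 \<Rightarrow> real^3) \<Rightarrow> (real^3 \<Rightarrow> real) \<Rightarrow> ((real^2) \<times> real \<Rightarrow> real) \<Rightarrow> bool" where
  "frame_rep Q T f f' \<longleftrightarrow> f' \<in> borel_measurable borel \<and> (AE p in lborel. f' p = f (emb Q T p)) \<and>
    (\<forall>h\<in>borel_measurable borel. (\<integral>x. f x * h x \<partial>lebesgue) = (\<integral>p. f' p * h (emb Q T p) \<partial>lborel)) \<and> integrable lborel f'"

lemma frame_repD:
  assumes "frame_rep Q T f f'"
  shows "f' \<in> borel_measurable borel" "AE p in lborel. f' p = f (emb Q T p)"
    "h \<in> borel_measurable borel \<Longrightarrow> (\<integral>x. f x * h x \<partial>lebesgue) = (\<integral>p. f' p * h (emb Q T p) \<partial>lborel)"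
    "integrable lborel f'"
  using assms by (auto simp: frame_rep_def)

context
  fixes Q :: "real^3" and T :: "real^3 \<Rightarrow> real^3"
  assumes T: "orthogonal_transformation T"
begin

lemma frame_rep_exists:
  assumes f: "integrable lebesgue f" shows "\<exists>f'. frame_rep Q T f f'"
proof -
  obtain f' :: "(real^2) \<times> real \<Rightarrow> real" where f': "f' \<in> borel_measurable borel" "AE p in lborel. f' p = f (emb Q T p)"
    "\<And>(h :: real \<Rightarrow> real) l. h \<in> borel_measurable borel \<Longrightarrow> l \<in> borel_measurable borel \<Longrightarrow>
       (\<integral>x. h (f x) * l x \<partial>lebesgue) = (\<integral>p. h (f' p) * l (emb Q T p) \<partial>lborel)"
    "\<And>(h :: real \<Rightarrow> real) l. h \<in> borel_measurable borel \<Longrightarrow> l \<in> borel_measurable borel \<Longrightarrow>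
       integrable lebesgue (\<lambda>x. h (f x) * l x) \<longleftrightarrow> integrable lborel (\<lambda>p. h (f' p) * l (emb Q T p))"
    using emb_transport[OF T borel_measurable_integrable[OF f]] by blast
  show ?thesis unfolding frame_rep_def
    using f'(1,2) f'(3)[of "\<lambda>t. t"] f'(4)[of "\<lambda>t. t" "\<lambda>_. 1"] f by (intro exI[of _ f']) auto
qed

text \<open>The set \<open>Bs\<close> starts at the boundary of \<Omega> and continues through the
  gap into the solid; nothing is cut at the boundary of \<open>S\<close>. Extended by zero below
  \<open>\<beta>\<close>, the components keep their weak vertical derivatives in the whole cylinder
  by \<open>W12_0_cut\<close>. The same device makes the flux identity valid for test functions that
  do not vanish at the bottom.\<close>

lemma coordinate_fields:
  fixes u :: "real^3 \<Rightarrow> real^3" and \<beta> :: "real^2 \<Rightarrow> real"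
  assumes \<Omega>: "open \<Omega>" and u: "u \<in> W12_0 \<Omega>" and Du: "weak_grad \<Omega> u Du"
    and tr: "AE x in lebesgue. x \<in> \<Omega> \<longrightarrow> trace (Du x) = 0"
    and R: "0 < R" and \<beta>c: "continuous_on (ball 0 R) \<beta>" and \<beta>s: "\<And>v. norm v < R \<Longrightarrow> - s < \<beta> v \<and> \<beta> v < s"
    and B\<Omega>: "\<And>v z. norm v < R \<Longrightarrow> \<beta> v < z \<Longrightarrow> z < s \<Longrightarrow> emb Q T (v, z) \<in> \<Omega>"
    and \<beta>\<Omega>: "\<And>v. norm v < R \<Longrightarrow> emb Q T (v, \<beta> v) \<notin> \<Omega>"
  defines "Bs \<equiv> {p. norm (fst p) < R \<and> \<beta> (fst p) < snd p \<and> snd p < s}"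
  obtains uu pp :: "3 \<Rightarrow> (real^2) \<times> real \<Rightarrow> real" where
    "\<And>k. integrable lborel (uu k)" "\<And>k. integrable lborel (pp k)"
    "\<And>k. AE p in lborel. uu k p = (if p \<in> Bs then u (emb Q T p) \<bullet> T (axis k 1) else 0)"
    "\<And>k. AE p in lborel. pp k p = (if p \<in> Bs then Du (emb Q T p) \<bullet> outer (T (axis k 1)) (T (axis 3 1)) else 0)"
    "\<And>k. AE v in lborel. norm v < R \<longrightarrow> (AE z in lborel. - s < z \<and> z < s \<longrightarrow> uu k (v, z) = (\<integral>t. indicator {..<z} t * pp k (v, t) \<partial>lborel))"
    "\<And>r \<kappa>. 0 < r \<Longrightarrow> r < R \<Longrightarrow> vert_test (- s) s \<kappa> \<Longrightarrow>
       (\<integral>p. uu 1 p * (- (rho r (fst p) * fst p $ 1) * \<kappa> (snd p)) + uu 2 p * (- (rho r (fst p) * fst p $ 2) * \<kappa> (snd p))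
         + uu 3 p * (eta r (fst p) * deriv \<kappa> (snd p)) \<partial>lborel) = 0"
    "L2_on \<Omega> Du"
proof -
  obtain Du' where Du': "weak_grad \<Omega> u Du'" "L2_on \<Omega> u" "L2_on \<Omega> Du'"
    and cut: "\<And>B N \<psi> i j. \<lbrakk>open B; B \<subseteq> \<Omega>; \<And>x. x \<in> N \<Longrightarrow> x \<in> B \<or> x \<notin> \<Omega> \<or> x \<notin> closure B; test_fun N \<psi>\<rbrakk> \<Longrightarrow>
       (\<integral>x. (indicator B x * (u x $ i)) * partial_deriv j \<psi> x \<partial>lebesgue)
         = - (\<integral>x. (indicator B x * (Du' x $ i $ j)) * \<psi> x \<partial>lebesgue)"
    using W12_0_cut[OF u \<Omega>] by blast
  have Duae: "AE x in lebesgue. x \<in> \<Omega> \<longrightarrow> Du' x = Du x" by (rule weak_grad_unique[OF \<Omega> Du'(1) Du])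
  have \<Omega>m: "\<Omega> \<in> sets lebesgue" using \<Omega> by simp
  have L2: "L2_on \<Omega> Du" by (rule L2_on_cong_AE[OF Du'(3) \<Omega>m Duae])
  define B where "B = emb Q T ` Bs"
  define N where "N = emb Q T ` (ball 0 R \<times> {- s<..<s})"
  have s: "- s < s" using \<beta>s[of 0] R by auto
  have Bs_open: "open Bs"
  proof -
    have "Bs = {p. fst p \<in> ball 0 R \<and> \<beta> (fst p) < snd p} \<inter> (UNIV \<times> {..<s})" by (auto simp: Bs_def)
    then show ?thesis using open_above_graph(1)[OF open_ball \<beta>c] by (auto intro!: open_Int open_Times)
  qed
  have Bo: "open B" unfolding B_def by (rule open_emb[OF T Bs_open])
  have Bsub: "B \<subseteq> \<Omega>" unfolding B_def Bs_def using B\<Omega> by auto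
  have Bm: "B \<in> sets lebesgue" using Bo by simp
  \<comment> \<open>Above the graph a point lies in \<open>B\<close>, on it outside \<Omega>, and
    below it outside the closure of \<open>B\<close>.\<close>
  have sep: "x \<in> B \<or> x \<notin> \<Omega> \<or> x \<notin> closure B" if xN: "x \<in> N" for x
  proof -
    obtain v z where x: "x = emb Q T (v, z)" "norm v < R" "- s < z" "z < s" using xN by (auto simp: N_def)
    consider "z > \<beta> v" | "z = \<beta> v" | "z < \<beta> v" by linarith
    then show ?thesis
    proof cases
      case 1 then show ?thesis using x by (auto simp: B_def Bs_def)
    next
      case 2 then show ?thesis using x \<beta>\<Omega> by auto
    next
      case 3
      let ?L = "{p. fst p \<in> ball 0 R \<and> snd p < \<beta> (fst p)}"
      have o: "open (emb Q T ` ?L)" by (rule open_emb[OF T open_above_graph(2)[OF open_ball \<beta>c]])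
      have "p = q" if "emb Q T p = emb Q T q" for p q using that unemb_emb[OF T, of Q] by metis
      then have "emb Q T ` ?L \<inter> B = {}" by (fastforce simp: B_def Bs_def)
      then have "emb Q T ` ?L \<inter> closure B = {}" using o open_Int_closure_eq_empty by blast
      moreover have "x \<in> emb Q T ` ?L" using x 3 by auto
      ultimately show ?thesis by blast
    qed
  qed
  have Bb: "bounded B" unfolding B_def
  proof (rule bounded_emb[OF T])
    have "Bs \<subseteq> ball 0 R \<times> {- s<..<s}" using \<beta>s by (force simp: Bs_def)
    moreover have "bounded {- s<..<s}" using bounded_box[of "- s" s] by simp
    ultimately show "bounded Bs" using bounded_subset[OF bounded_Times[OF bounded_ball]] by metis
  qed
  have na: "norm (axis i (1::real)) \<le> 1" "norm (axis i (axis j (1::real))) \<le> 1" for i j :: 3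
    by (simp_all add: norm_eq_sqrt_inner inner_axis_axis)
  have nT: "norm (T (axis k 1)) \<le> 1" "norm (outer (T (axis k 1)) (T (axis 3 1))) \<le> 1" for k
    by (simp_all add: frame_norm[OF T] norm_outer)
  have ui: "integrable lebesgue (\<lambda>x. indicator B x * (u x $ i))" for i
    using L2_on_integrable[OF Du'(2) \<Omega>m Bm Bsub Bb na(1)[of i]] by (simp add: inner_axis)
  have Di: "integrable lebesgue (\<lambda>x. indicator B x * (Du' x $ i $ j))" for i j
    using L2_on_integrable[OF Du'(3) \<Omega>m Bm Bsub Bb na(2)[of i j]] by (simp add: inner_axis)
  define U where "U k x = indicator B x * (u x \<bullet> T (axis k 1))" for k x
  define P where "P k x = indicator B x * (Du' x \<bullet> outer (T (axis k 1)) (T (axis 3 1)))" for k x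
  have Ui: "integrable lebesgue (U k)" and Pi: "integrable lebesgue (P k)" for k
    unfolding U_def[abs_def] P_def[abs_def]
    by (rule L2_on_integrable[OF Du'(2) \<Omega>m Bm Bsub Bb nT(1)], rule L2_on_integrable[OF Du'(3) \<Omega>m Bm Bsub Bb nT(2)])
  have weak: "(\<integral>x. U k x * frechet_derivative \<psi> (at x) (T (axis 3 1)) \<partial>lebesgue) = - (\<integral>x. P k x * \<psi> x \<partial>lebesgue)"
    if \<psi>: "test_fun N \<psi>" for k \<psi>
  proof -
    have "(\<Sum>i\<in>UNIV. T (axis k 1) $ i * (indicator B x * (u x $ i))) = U k x" for x
      by (simp add: U_def inner_vec_def sum_distrib_left mult_ac)
    moreover have "(\<Sum>i\<in>UNIV. \<Sum>j\<in>UNIV. T (axis k 1) $ i * T (axis 3 1) $ j * (indicator B x * (Du' x $ i $ j))) = P k x" for x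
      by (simp add: P_def inner_outer inner_vec_def[of "_ $ _"] sum_distrib_left mult_ac)
    ultimately show ?thesis
      using weak_contract[where f="\<lambda>i x. indicator B x * (u x $ i)" and g="\<lambda>i j x. indicator B x * (Du' x $ i $ j)" and a="\<lambda>i. T (axis k 1) $ i" and e="T (axis 3 1)",
        OF ui Di \<psi> cut[OF Bo Bsub sep \<psi>]] by simp
  qed
  have "\<forall>k. \<exists>u'. frame_rep Q T (U k) u'" "\<forall>k. \<exists>u'. frame_rep Q T (P k) u'"
    using frame_rep_exists[OF Ui] frame_rep_exists[OF Pi] by auto
  then obtain uu pp where "\<And>k. frame_rep Q T (U k) (uu k)" "\<And>k. frame_rep Q T (P k) (pp k)" by metis
  note rep = this
  note uu = frame_repD[OF rep(1)] and pp = frame_repD[OF rep(2)]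
  have inB: "emb Q T p \<in> B \<longleftrightarrow> p \<in> Bs" for p
    unfolding B_def emb_image_vimage[OF T] by (simp add: unemb_emb[OF T])
  have uuae: "AE p in lborel. uu k p = (if p \<in> Bs then u (emb Q T p) \<bullet> T (axis k 1) else 0)" for k
    using uu(2)[of k] by eventually_elim (auto simp: U_def inB)
  have ppae: "AE p in lborel. pp k p = (if p \<in> Bs then Du (emb Q T p) \<bullet> outer (T (axis k 1)) (T (axis 3 1)) else 0)" for k
    using pp(2)[of k] AE_emb[OF T Duae, of Q]
  proof eventually_elim
    case (elim p)
    then show ?case using inB[of p] Bsub by (auto simp: P_def)
  qed
  show ?thesis
  proof (rule that[OF uu(4) pp(4) uuae ppae _ _ L2])
    fix k
    obtain M where M: "AE p in lborel. fst p \<in> ball 0 R \<and> - s < snd p \<and> snd p < s \<longrightarrow>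
      uu k p = M (fst p) - (\<integral>z. indicator {snd p..} z * pp k (fst p, z) \<partial>lborel)"
    proof -
      have sub: "emb Q T ` (ball 0 R \<times> {- s<..<s}) \<subseteq> N" by (simp add: N_def)
      show ?thesis
        by (rule weak_vertical_slice[OF T sub open_ball s weak uu(4)[of k] frame_repD(3)[OF rep(1)[of k]] pp(4)[of k] frame_repD(3)[OF rep(2)[of k]]])
          (assumption | erule that)+
    qed
    have "AE v in lborel. v \<in> ball 0 R \<longrightarrow> (AE z in lborel. - s < z \<and> z < s \<longrightarrow> uu k (v, z) = (\<integral>t. indicator {..<z} t * pp k (v, t) \<partial>lborel))"
    proof (rule slice_below_vanishing[OF pp(4) M])
      show "- s < \<beta> v \<and> \<beta> v < s" if "v \<in> ball 0 R" for v using that \<beta>s by simp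
      show "AE p in lborel. fst p \<in> ball 0 R \<and> snd p \<le> \<beta> (fst p) \<longrightarrow> uu k p = 0"
        using uuae[of k] by eventually_elim (auto simp: Bs_def)
      show "AE p in lborel. fst p \<in> ball 0 R \<and> snd p \<le> \<beta> (fst p) \<longrightarrow> pp k p = 0"
        using ppae[of k] by eventually_elim (auto simp: Bs_def)
    qed
    then show "AE v in lborel. norm v < R \<longrightarrow> (AE z in lborel. - s < z \<and> z < s \<longrightarrow> uu k (v, z) = (\<integral>t. indicator {..<z} t * pp k (v, t) \<partial>lborel))"
      by simp
  next
    fix r and \<kappa> :: "real \<Rightarrow> real" assume r: "0 < r" "r < R" and \<kappa>: "vert_test (- s) s \<kappa>"
    have \<kappa>s: "smooth1 \<kappa>" using \<kappa> by (simp add: vert_test_def)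
    define \<psi> where "\<psi> = (\<lambda>x. eta r (fst (unemb Q T x)) * \<kappa> (snd (unemb Q T x)))"
    have tf: "test_fun N \<psi>" unfolding \<psi>_def
      by (rule test_fun_product[OF T smoothn_eta[OF T] compact_cball[of 0 r] _ _ \<kappa>, of "ball 0 R"])
        (use r eta_rho_0(1)[of r] in \<open>auto simp: N_def\<close>)
    note sm = test_fun_smoothn[OF tf]
    have K: "compact (closure {x. \<psi> x \<noteq> 0})" using tf by (simp add: test_fun_def)
    define D where "D k x = frechet_derivative \<psi> (at x) (T (axis k 1))" for k x
    have Dc: "continuous_on UNIV (D k)" for k
      unfolding D_def[abs_def]
      using smoothnD(1)[OF sm] by (subst frechet_eq_sum_partial) (auto simp: differentiable_def intro!: continuous_intros smoothnD(3)[OF sm])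
    have D0: "D k x = 0" if "x \<notin> closure {x. \<psi> x \<noteq> 0}" for k x
      unfolding D_def using smoothnD(1)[OF sm] test_fun_zero_outside(2)[OF tf that]
      by (subst frechet_eq_sum_partial) (auto simp: differentiable_def)
    have UD: "integrable lebesgue (\<lambda>x. U k x * D k x)" for k
    proof -
      obtain M where "\<And>x. \<bar>D k x\<bar> \<le> M" using continuous_compact_support_bounded[OF Dc K D0] by metis
      then show ?thesis by (intro integrable_times_bounded[OF Ui] borel_imp_lebesgue borel_measurable_continuous_onI Dc)
    qed
    have i1: "integrable lebesgue (\<lambda>x. (indicator B x * (u x $ i)) * partial_deriv i \<psi> x)" for i
    proof -
      obtain M where "\<And>x. \<bar>partial_deriv i \<psi> x\<bar> \<le> M"
        using continuous_compact_support_bounded[OF smoothnD(3)[OF sm] K test_fun_zero_outside(2)[OF tf]] by metis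
      then show ?thesis
        by (intro integrable_times_bounded[OF ui] borel_imp_lebesgue borel_measurable_continuous_onI smoothnD(3) sm)
    qed
    have i2: "integrable lebesgue (\<lambda>x. (indicator B x * (Du' x $ i $ i)) * \<psi> x)" for i
    proof -
      obtain M where "\<And>x. \<bar>\<psi> x\<bar> \<le> M"
        using continuous_compact_support_bounded[OF smoothnD(2)[OF sm] K test_fun_zero_outside(1)[OF tf]] by metis
      then show ?thesis
        by (intro integrable_times_bounded[OF Di] borel_imp_lebesgue borel_measurable_continuous_onI smoothnD(2) sm)
    qed
    \<comment> \<open>Both sums are the derivative of \<open>\<psi>\<close> in the direction of
      \<open>u\<close>, written in the frame and in the standard basis. Only the latter meets the
      trace condition.\<close>
    have split: "(\<Sum>k\<in>UNIV. U k x * D k x) = (\<Sum>i\<in>UNIV. (indicator B x * (u x $ i)) * partial_deriv i \<psi> x)" for x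
    proof -
      have d: "\<psi> differentiable (at x)" using smoothnD(1)[OF sm] by (auto simp: differentiable_def)
      have lin: "linear (frechet_derivative \<psi> (at x))" using linear_frechet_derivative[OF d] .
      have "frechet_derivative \<psi> (at x) (u x) = frechet_derivative \<psi> (at x) (\<Sum>k\<in>UNIV. (u x \<bullet> T (axis k 1)) *\<^sub>R T (axis k 1))"
        using frame_expand[OF T, of "u x"] by simp
      also have "\<dots> = (\<Sum>k\<in>UNIV. (u x \<bullet> T (axis k 1)) * D k x)"
        by (simp add: linear_sum[OF lin] linear_scale[OF lin] D_def)
      finally have "(\<Sum>i\<in>UNIV. u x $ i * partial_deriv i \<psi> x) = (\<Sum>k\<in>UNIV. (u x \<bullet> T (axis k 1)) * D k x)"
        by (simp add: frechet_eq_sum_partial[OF d])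
      then have "indicator B x * (\<Sum>i\<in>UNIV. u x $ i * partial_deriv i \<psi> x) = indicator B x * (\<Sum>k\<in>UNIV. (u x \<bullet> T (axis k 1)) * D k x)"
        by simp
      then show ?thesis by (simp add: U_def sum_distrib_left mult.assoc)
    qed
    have uD: "integrable lborel (\<lambda>p. uu k p * D k (emb Q T p))" for k
    proof -
      obtain M where M: "\<And>x. \<bar>D k x\<bar> \<le> M" using continuous_compact_support_bounded[OF Dc K D0] by metis
      have "(\<lambda>p. D k (emb Q T p)) \<in> borel_measurable borel"
        by (intro borel_measurable_continuous_onI continuous_on_compose2[OF Dc continuous_emb[OF T]]) auto
      then show ?thesis by (intro integrable_times_bounded[OF uu(4) _ M]) simp
    qed
    have "(\<Sum>k\<in>UNIV. \<integral>p. uu k p * D k (emb Q T p) \<partial>lborel) = (\<Sum>k\<in>UNIV. \<integral>x. U k x * D k x \<partial>lebesgue)"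
      by (intro sum.cong refl uu(3)[symmetric] borel_measurable_continuous_onI Dc)
    also have "\<dots> = (\<integral>x. (\<Sum>k\<in>UNIV. U k x * D k x) \<partial>lebesgue)" using UD by (subst Bochner_Integration.integral_sum) auto
    also have "\<dots> = (\<Sum>i\<in>UNIV. \<integral>x. (indicator B x * (u x $ i)) * partial_deriv i \<psi> x \<partial>lebesgue)"
      unfolding split using i1 by (subst Bochner_Integration.integral_sum) auto
    also have "\<dots> = - (\<Sum>i\<in>UNIV. \<integral>x. (indicator B x * (Du' x $ i $ i)) * \<psi> x \<partial>lebesgue)"
      by (simp add: cut[OF Bo Bsub sep tf] sum_negf)
    also have "(\<Sum>i\<in>UNIV. \<integral>x. (indicator B x * (Du' x $ i $ i)) * \<psi> x \<partial>lebesgue)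
        = (\<integral>x. (\<Sum>i\<in>UNIV. (indicator B x * (Du' x $ i $ i)) * \<psi> x) \<partial>lebesgue)"
      using i2 by (subst Bochner_Integration.integral_sum) auto
    also have "\<dots> = 0"
    proof (rule integral_eq_zero_AE)
      show "AE x in lebesgue. (\<Sum>i\<in>UNIV. (indicator B x * (Du' x $ i $ i)) * \<psi> x) = 0"
        using Duae tr
      proof eventually_elim
        case (elim x)
        have "(\<Sum>i\<in>UNIV. (indicator B x * (Du' x $ i $ i)) * \<psi> x) = indicator B x * \<psi> x * trace (Du' x)"
          by (simp add: trace_def sum_distrib_left mult_ac)
        then show ?case using elim Bsub by (auto simp: indicator_def)
      qed
    qed
    finally have z: "(\<Sum>k\<in>UNIV. \<integral>p. uu k p * D k (emb Q T p) \<partial>lborel) = 0" by simp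
    have Dv: "D 1 (emb Q T p) = - (rho r (fst p) * fst p $ 1) * \<kappa> (snd p)" "D 2 (emb Q T p) = - (rho r (fst p) * fst p $ 2) * \<kappa> (snd p)"
      "D 3 (emb Q T p) = eta r (fst p) * deriv \<kappa> (snd p)" for p
      using eta_product_derivative[OF T \<kappa>s, of r] by (auto simp: D_def \<psi>_def)
    have "(\<integral>p. uu 1 p * D 1 (emb Q T p) + uu 2 p * D 2 (emb Q T p) + uu 3 p * D 3 (emb Q T p) \<partial>lborel) = 0"
      using z uD by (simp add: sum_3)
    then show "(\<integral>p. uu 1 p * (- (rho r (fst p) * fst p $ 1) * \<kappa> (snd p)) + uu 2 p * (- (rho r (fst p) * fst p $ 2) * \<kappa> (snd p))
         + uu 3 p * (eta r (fst p) * deriv \<kappa> (snd p)) \<partial>lborel) = 0"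
      unfolding Dv .
  qed
qed

end

section \<open>Second derivatives inside the gap\<close>

lemma weak_partial_mono:
  assumes w: "weak_partial U j f g" and V: "V \<subseteq> U"
  shows "weak_partial V j f g"
  unfolding weak_partial_def
proof (intro conjI allI impI)
  show "loc_integrable V f" "loc_integrable V g" using w V by (auto simp: weak_partial_def loc_integrable_def)
  fix \<phi> assume \<phi>: "test_fun V \<phi>"
  then have \<phi>U: "test_fun U \<phi>" using V by (auto simp: test_fun_def)
  have z: "\<phi> x = 0" "partial_deriv j \<phi> x = 0" if "x \<notin> V" for x
    using test_fun_zero_outside[OF \<phi>, of x] \<phi> that by (auto simp: test_fun_def)
  have 1: "(LINT x:U|lebesgue. f x * partial_deriv j \<phi> x) = (LINT x:V|lebesgue. f x * partial_deriv j \<phi> x)"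
    unfolding set_lebesgue_integral_def
    using V z(2) by (intro Bochner_Integration.integral_cong) (auto simp: indicator_def)
  have 2: "(LINT x:U|lebesgue. g x * \<phi> x) = (LINT x:V|lebesgue. g x * \<phi> x)"
    unfolding set_lebesgue_integral_def
    using V z(1) by (intro Bochner_Integration.integral_cong) (auto simp: indicator_def)
  show "(LINT x:V|lebesgue. f x * partial_deriv j \<phi> x) = - (LINT x:V|lebesgue. g x * \<phi> x)"
    using w \<phi>U unfolding weak_partial_def 1[symmetric] 2[symmetric] by blast
qed

lemma L2_on_subset:
  fixes v :: "'a::euclidean_space \<Rightarrow> 'b::euclidean_space"
  assumes v: "L2_on A v" and A: "A \<in> sets lebesgue" and B: "B \<in> sets lebesgue" "B \<subseteq> A"
  shows "L2_on B v"
proof -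
  have m: "(\<lambda>x. indicator A x *\<^sub>R v x) \<in> borel_measurable lebesgue" "integrable lebesgue (\<lambda>x. indicator A x *\<^sub>R (norm (v x))\<^sup>2)"
    using v A by (simp_all add: L2_on_def borel_measurable_restrict_space_iff set_integrable_def)
  have "(\<lambda>x. indicator B x *\<^sub>R (indicator A x *\<^sub>R v x)) \<in> borel_measurable lebesgue"
    by (rule borel_measurable_scaleR[OF borel_measurable_indicator[OF B(1)] m(1)])
  moreover have "(\<lambda>x. indicator B x *\<^sub>R (indicator A x *\<^sub>R v x)) = (\<lambda>x. indicator B x *\<^sub>R v x)"
    using B(2) by (auto simp: indicator_def fun_eq_iff)
  moreover have "integrable lebesgue (\<lambda>x. indicator B x *\<^sub>R (indicator A x *\<^sub>R (norm (v x))\<^sup>2))"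
    by (rule integrable_mult_indicator[OF B(1) m(2)])
  moreover have "(\<lambda>x. indicator B x *\<^sub>R (indicator A x *\<^sub>R (norm (v x))\<^sup>2)) = (\<lambda>x. indicator B x *\<^sub>R (norm (v x))\<^sup>2)"
    using B(2) by (auto simp: indicator_def fun_eq_iff)
  ultimately show ?thesis using B(1) by (simp add: L2_on_def borel_measurable_restrict_space_iff set_integrable_def)
qed

lemma slice_difference_bound:
  fixes M :: real and h :: "real \<Rightarrow> real"
  assumes h: "integrable lborel h" and "p1 = M - (\<integral>t. indicator {t1..} t * h t \<partial>lborel)"
    "p2 = M - (\<integral>t. indicator {t2..} t * h t \<partial>lborel)"
  shows "\<bar>p1 - p2\<bar> \<le> (\<integral>t. \<bar>h t\<bar> \<partial>lborel)"
proof -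
  have i: "integrable lborel (\<lambda>t. indicator {a..} t * h t)" for a
    using integrable_mult_indicator[OF _ h, of "{a..}"] by simp
  have "p1 - p2 = (\<integral>t. indicator {t2..} t * h t - indicator {t1..} t * h t \<partial>lborel)"
    using assms i by simp
  also have "\<bar>\<dots>\<bar> \<le> (\<integral>t. \<bar>indicator {t2..} t * h t - indicator {t1..} t * h t\<bar> \<partial>lborel)"
    by (rule integral_abs_bound)
  also have "\<dots> \<le> (\<integral>t. \<bar>h t\<bar> \<partial>lborel)"
    using i h by (intro integral_mono) (auto simp: indicator_def)
  finally show ?thesis .
qed

text \<open>The Hessian is available only between two graphs of varying height, which is not a
  cylinder. The slice theorem is applied on countably many small cylinders; any two heights in the
  open gap over \<open>v\<close> lie in a common one, where the values of \<open>pp\<close> share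
  the constant of integration.\<close>

lemma coordinate_hessian:
  fixes u :: "real^3 \<Rightarrow> real^3" and \<beta> \<tau> :: "real^2 \<Rightarrow> real" and pp :: "3 \<Rightarrow> (real^2) \<times> real \<Rightarrow> real"
  assumes T: "orthogonal_transformation T" and F: "open F" and \<Omega>: "open \<Omega>" and F\<Omega>: "F \<subseteq> \<Omega>"
    and Du: "weak_grad \<Omega> u Du" "L2_on \<Omega> Du" and D2: "weak_hess F u D2u" "L2_on F D2u"
    and ppi: "\<And>k. integrable lborel (pp k)"
    and \<beta>c: "continuous_on (ball 0 R) \<beta>" and \<tau>c: "continuous_on (ball 0 R) \<tau>"
    and bd: "\<And>v. norm v < R \<Longrightarrow> - s < \<beta> v \<and> \<tau> v < s"
  defines "Gs \<equiv> {p. norm (fst p) < R \<and> \<beta> (fst p) < snd p \<and> snd p < \<tau> (fst p)}"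
  assumes ppae: "\<And>k. AE p in lborel. p \<in> Gs \<longrightarrow> pp k p = Du (emb Q T p) \<bullet> outer (T (axis k 1)) (T (axis 3 1))"
    and GF: "emb Q T ` Gs \<subseteq> F"
  obtains hh :: "3 \<Rightarrow> (real^2) \<times> real \<Rightarrow> real" where
    "\<And>k. integrable lborel (hh k)"
    "\<And>k. AE p in lborel. hh k p = (if p \<in> Gs then D2u (emb Q T p) \<bullet> outer (T (axis k 1)) (outer (T (axis 3 1)) (T (axis 3 1))) else 0)"
    "\<And>k. AE v in lborel. norm v < R \<longrightarrow> (AE t1 in lborel. AE t2 in lborel. t1 \<in> {\<beta> v<..<\<tau> v} \<and> t2 \<in> {\<beta> v<..<\<tau> v} \<longrightarrow>
       \<bar>pp k (v, t1) - pp k (v, t2)\<bar> \<le> (\<integral>t. \<bar>hh k (v, t)\<bar> \<partial>lborel))"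
proof -
  let ?e = "T (axis 3 1)"
  obtain Dv where Dv: "weak_grad F u Dv" "\<And>i j k. weak_partial F k (\<lambda>x. Dv x $ i $ j) (\<lambda>x. D2u x $ i $ j $ k)"
    using D2(1) by (auto simp: weak_hess_def)
  have "weak_grad F u Du" using Du(1) weak_partial_mono[OF _ F\<Omega>] by (auto simp: weak_grad_def)
  then have Dae: "AE x in lebesgue. x \<in> F \<longrightarrow> Du x = Dv x" using weak_grad_unique[OF F _ Dv(1)] by blast
  have Fm: "F \<in> sets lebesgue" "\<Omega> \<in> sets lebesgue" using F \<Omega> by simp_all
  have L2v: "L2_on F Dv" by (rule L2_on_cong_AE[OF L2_on_subset[OF Du(2) Fm(2,1) F\<Omega>] Fm(1) Dae])
  have Gs_open: "open Gs"
  proof -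
    have "Gs = {p. fst p \<in> ball 0 R \<and> \<beta> (fst p) < snd p} \<inter> {p. fst p \<in> ball 0 R \<and> snd p < \<tau> (fst p)}" by (auto simp: Gs_def)
    then show ?thesis using open_above_graph(1)[OF open_ball \<beta>c] open_above_graph(2)[OF open_ball \<tau>c] by auto
  qed
  define N where "N = emb Q T ` Gs"
  have No: "open N" unfolding N_def by (rule open_emb[OF T Gs_open])
  then have Nm: "N \<in> sets lebesgue" by simp
  have NF: "N \<subseteq> F" using GF by (simp add: N_def)
  have Nb: "bounded N" unfolding N_def
  proof (rule bounded_emb[OF T])
    have "Gs \<subseteq> ball 0 R \<times> {- s<..<s}" using bd by (force simp: Gs_def)
    moreover have "bounded {- s<..<s}" using bounded_box[of "- s" s] by simp
    ultimately show "bounded Gs" using bounded_subset[OF bounded_Times[OF bounded_ball]] by metis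
  qed
  have inN: "emb Q T p \<in> N \<longleftrightarrow> p \<in> Gs" for p
    unfolding N_def emb_image_vimage[OF T] by (simp add: unemb_emb[OF T])
  have nT: "norm (outer (T (axis k 1)) ?e) \<le> 1" "norm (outer (T (axis k 1)) (outer ?e ?e)) \<le> 1" for k
    by (simp_all add: frame_norm[OF T] norm_outer)
  have na: "norm (axis i (axis j (1::real))) \<le> 1" "norm (axis i (axis j (axis l (1::real)))) \<le> 1" for i j l :: 3
    by (simp_all add: norm_eq_sqrt_inner inner_axis_axis)
  have ci: "integrable lebesgue (\<lambda>x. indicator N x * (Dv x $ i $ j))" for i j
    using L2_on_integrable[OF L2v Fm(1) Nm NF Nb na(1)[of i j]] by (simp add: inner_axis)
  have di: "integrable lebesgue (\<lambda>x. indicator N x * (D2u x $ i $ j $ l))" for i j l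
    using L2_on_integrable[OF D2(2) Fm(1) Nm NF Nb na(2)[of i j l]] by (simp add: inner_axis)
  define P where "P k x = indicator N x * (Dv x \<bullet> outer (T (axis k 1)) ?e)" for k x
  define H where "H k x = indicator N x * (D2u x \<bullet> outer (T (axis k 1)) (outer ?e ?e))" for k x
  have Pi: "integrable lebesgue (P k)" and Hi: "integrable lebesgue (H k)" for k
    unfolding P_def[abs_def] H_def[abs_def]
    by (rule L2_on_integrable[OF L2v Fm(1) Nm NF Nb nT(1)], rule L2_on_integrable[OF D2(2) Fm(1) Nm NF Nb nT(2)])
  have weak: "(\<integral>x. P k x * frechet_derivative \<psi> (at x) ?e \<partial>lebesgue) = - (\<integral>x. H k x * \<psi> x \<partial>lebesgue)"
    if \<psi>: "test_fun N \<psi>" for k \<psi>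
  proof -
    have w: "(\<integral>x. (indicator N x * (Dv x $ i $ j)) * partial_deriv l \<psi> x \<partial>lebesgue) = - (\<integral>x. (indicator N x * (D2u x $ i $ j $ l)) * \<psi> x \<partial>lebesgue)" for i j l
      using weak_partial_mono[OF Dv(2) NF] \<psi> by (simp add: weak_partial_def set_lebesgue_integral_def mult.assoc)
    \<comment> \<open>Gradient entries are indexed by pairs \<open>q\<close>, so that
      \<open>weak_contract\<close> applies with the gradient in the role of the field.\<close>
    have "(\<Sum>q\<in>UNIV. (T (axis k 1) $ fst q * ?e $ snd q) * (indicator N x * (Dv x $ fst q $ snd q))) = P k x" for x
      unfolding P_def inner_outer inner_vec_def[of "_ $ _"] UNIV_Times_UNIV[symmetric] sum.cartesian_product'
      by (simp add: sum_distrib_left mult_ac)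
    moreover have "(\<Sum>q\<in>UNIV. \<Sum>l\<in>UNIV. (T (axis k 1) $ fst q * ?e $ snd q) * ?e $ l * (indicator N x * (D2u x $ fst q $ snd q $ l))) = H k x" for x
      unfolding H_def inner_outer inner_vec_def[of "_ $ _ $ _"] UNIV_Times_UNIV[symmetric] sum.cartesian_product'
      by (simp add: sum_distrib_left mult_ac)
    ultimately show ?thesis
      using weak_contract[where f="\<lambda>q x. indicator N x * (Dv x $ fst q $ snd q)" and g="\<lambda>q l x. indicator N x * (D2u x $ fst q $ snd q $ l)"
        and a="\<lambda>q. T (axis k 1) $ fst q * ?e $ snd q" and e="?e", OF ci di \<psi> w] by simp
  qed
  have "\<forall>k. \<exists>u'. frame_rep Q T (P k) u'" "\<forall>k. \<exists>u'. frame_rep Q T (H k) u'"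
    using frame_rep_exists[OF T Pi] frame_rep_exists[OF T Hi] by auto
  then obtain p1 hh where rep: "\<And>k. frame_rep Q T (P k) (p1 k)" "\<And>k. frame_rep Q T (H k) (hh k)" by metis
  have hhae: "AE p in lborel. hh k p = (if p \<in> Gs then D2u (emb Q T p) \<bullet> outer (T (axis k 1)) (outer ?e ?e) else 0)" for k
    using frame_repD(2)[OF rep(2)[of k]] by eventually_elim (auto simp: H_def inN)
  have p1ae: "AE p in lborel. p \<in> Gs \<longrightarrow> p1 k p = pp k p" for k
    using frame_repD(2)[OF rep(1)[of k]] AE_emb[OF T Dae, of Q] ppae[of k]
  proof eventually_elim
    case (elim p)
    then show ?case using inN[of p] NF by (auto simp: P_def)
  qed
  \<comment> \<open>Over \<open>C a b\<close> every height in the interval from \<open>a\<close> to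
    \<open>b\<close> lies in the gap, so the product is a cylinder inside \<open>Gs\<close>.\<close>
  define C where "C a b = {v. norm v < R \<and> \<beta> v < a \<and> b < \<tau> v}" for a b
  have Co: "open (C a b)" for a b
  proof -
    have "open (\<beta> -` {..<a} \<inter> ball 0 R)" "open (\<tau> -` {b<..} \<inter> ball 0 R)"
      using \<beta>c[unfolded continuous_on_open_vimage[OF open_ball], rule_format, OF open_lessThan]
        \<tau>c[unfolded continuous_on_open_vimage[OF open_ball], rule_format, OF open_greaterThan] by auto
    moreover have "C a b = (\<beta> -` {..<a} \<inter> ball 0 R) \<inter> (\<tau> -` {b<..} \<inter> ball 0 R)" by (auto simp: C_def)
    ultimately show ?thesis by auto
  qed
  have slices: "AE v in lborel. norm v < R \<longrightarrow> (AE t1 in lborel. AE t2 in lborel. t1 \<in> {\<beta> v<..<\<tau> v} \<and> t2 \<in> {\<beta> v<..<\<tau> v} \<longrightarrow>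
       \<bar>pp k (v, t1) - pp k (v, t2)\<bar> \<le> (\<integral>t. \<bar>hh k (v, t)\<bar> \<partial>lborel))" for k
  proof -
    define ok where "ok a b M \<longleftrightarrow> (AE p in lborel. fst p \<in> C a b \<and> a < snd p \<and> snd p < b \<longrightarrow>
      p1 k p = M (fst p) - (\<integral>z. indicator {snd p..} z * hh k (fst p, z) \<partial>lborel))" for a b M
    have "\<exists>M. ok a b M" if ab: "a < b" for a b
    proof -
      have sub: "emb Q T ` (C a b \<times> {a<..<b}) \<subseteq> N" unfolding N_def by (intro image_mono) (auto simp: C_def Gs_def)
      show ?thesis unfolding ok_def
        by (rule weak_vertical_slice[OF T sub Co ab weak frame_repD(4)[OF rep(1)[of k]] frame_repD(3)[OF rep(1)[of k]] frame_repD(4)[OF rep(2)[of k]] frame_repD(3)[OF rep(2)[of k]]])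
          (assumption | erule exI)+
    qed
    then have "\<forall>a b. \<exists>M. a < b \<longrightarrow> ok a b M" by blast
    then obtain M where "\<And>a b. a < b \<Longrightarrow> ok a b (M a b)" by metis
    note M = this[unfolded ok_def]
    \<comment> \<open>Rational heights suffice because they are dense, and being countable they
      leave one exceptional null set for all cylinders.\<close>
    let ?I = "{q::real\<times>real. fst q \<in> \<rat> \<and> snd q \<in> \<rat> \<and> fst q < snd q}"
    have "countable (\<rat> \<times> \<rat> :: (real \<times> real) set)" by (intro countable_SIGMA countable_rat)
    then have cI: "countable ?I" by (rule countable_subset[rotated]) auto
    have "AE p in lborel. \<forall>q\<in>?I. fst p \<in> C (fst q) (snd q) \<and> fst q < snd p \<and> snd p < snd q \<longrightarrow>
      p1 k p = M (fst q) (snd q) (fst p) - (\<integral>z. indicator {snd p..} z * hh k (fst p, z) \<partial>lborel)"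
      using cI M by (intro AE_ball_countable') auto
    from AE_lborel_prodD[OF this] AE_lborel_prodD[OF p1ae[of k]] AE_lborel_slice_integrable[OF frame_repD(4)[OF rep(2)[of k]]]
    show ?thesis
    proof eventually_elim
      case (elim v)
      show ?case
      proof
        assume v: "norm v < R"
        let ?good = "\<lambda>z. (\<forall>q\<in>?I. v \<in> C (fst q) (snd q) \<and> fst q < z \<and> z < snd q \<longrightarrow>
           p1 k (v, z) = M (fst q) (snd q) v - (\<integral>t. indicator {z..} t * hh k (v, t) \<partial>lborel)) \<and> ((v, z) \<in> Gs \<longrightarrow> p1 k (v, z) = pp k (v, z))"
        have good: "AE z in lborel. ?good z" using elim(1,2) by eventually_elim auto
        have key: "\<bar>pp k (v, t1) - pp k (v, t2)\<bar> \<le> (\<integral>t. \<bar>hh k (v, t)\<bar> \<partial>lborel)"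
          if g: "?good t1" "?good t2" and t: "t1 \<in> {\<beta> v<..<\<tau> v}" "t2 \<in> {\<beta> v<..<\<tau> v}" for t1 t2
        proof -
          obtain a where a: "a \<in> \<rat>" "\<beta> v < a" "a < min t1 t2" using Rats_dense_in_real[of "\<beta> v" "min t1 t2"] t by auto
          obtain b where b: "b \<in> \<rat>" "max t1 t2 < b" "b < \<tau> v" using Rats_dense_in_real[of "max t1 t2" "\<tau> v"] t by auto
          have I: "(a, b) \<in> ?I" "v \<in> C a b" using a b v by (auto simp: C_def)
          have G: "(v, t1) \<in> Gs" "(v, t2) \<in> Gs" using t v by (auto simp: Gs_def)
          have "pp k (v, t1) = M a b v - (\<integral>t. indicator {t1..} t * hh k (v, t) \<partial>lborel)"
            using g(1) I a b G by fastforce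
          moreover have "pp k (v, t2) = M a b v - (\<integral>t. indicator {t2..} t * hh k (v, t) \<partial>lborel)"
            using g(2) I a b G by fastforce
          ultimately show ?thesis by (rule slice_difference_bound[OF elim(3)])
        qed
        show "AE t1 in lborel. AE t2 in lborel. t1 \<in> {\<beta> v<..<\<tau> v} \<and> t2 \<in> {\<beta> v<..<\<tau> v} \<longrightarrow>
          \<bar>pp k (v, t1) - pp k (v, t2)\<bar> \<le> (\<integral>t. \<bar>hh k (v, t)\<bar> \<partial>lborel)"
          using good
        proof eventually_elim
          case e1: (elim t1)
          show ?case using good by eventually_elim (use key e1 in blast)
        qed
      qed
    qed
  qed
  show ?thesis by (rule that[OF frame_repD(4)[OF rep(2)] hhae slices])
qed

subsection \<open>Flux through the gap\<close>

lemma
  fixes f :: "'a::euclidean_space \<Rightarrow> real"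
  shows integral_reflect_lborel: "f \<in> borel_measurable borel \<Longrightarrow> (\<integral>v. f (- v) \<partial>lborel) = (\<integral>v. f v \<partial>lborel)"
    and integrable_reflect_lborel: "integrable lborel f \<Longrightarrow> integrable lborel (\<lambda>v. f (- v))"
proof -
  have "lborel = distr lborel borel (\<lambda>v::'a. - v)"
    using lborel_affine[of "-1" "0::'a"] by (simp add: density_1 one_ennreal_def[symmetric])
  then show "f \<in> borel_measurable borel \<Longrightarrow> (\<integral>v. f (- v) \<partial>lborel) = (\<integral>v. f v \<partial>lborel)"
    "integrable lborel f \<Longrightarrow> integrable lborel (\<lambda>v. f (- v))"
    using integral_distr[of "\<lambda>v::'a. - v" lborel borel f] integrable_distr_eq[of "\<lambda>v::'a. - v" lborel borel f] by auto
qed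

lemma odd_integral:
  fixes f :: "'a::euclidean_space \<Rightarrow> real"
  assumes "integrable lborel f" "\<And>v. f (- v) = - f v"
  shows "(\<integral>v. f v \<partial>lborel) = 0"
  using integral_reflect_lborel[of f] assms by (auto simp: assms(2))

text \<open>A primitive of a unit bump to the left of \<open>- m\<close> minus a unit bump to the
  right of \<open>m\<close>: it rises to one, stays there on the middle interval and returns to
  zero.\<close>

lemma cutoff_exists:
  assumes m: "0 < m" "m < (s::real)"
  obtains \<kappa> where "vert_test (- s) s \<kappa>" "\<And>t. t \<in> {- m..m} \<Longrightarrow> \<kappa> t = 1"
proof -
  \<comment> \<open>The midpoint of \<open>m\<close> and \<open>s\<close> leaves room for the
    support of the bumps inside the open interval.\<close>
  define b where "b = (m + s) / 2"
  have b: "m < b" "b < s" using m by (auto simp: b_def)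
  define I1 where "I1 = (\<integral>x. bump 1 (- b) (- m) x \<partial>lborel)"
  define I2 where "I2 = (\<integral>x. bump 1 m b x \<partial>lborel)"
  have I: "I1 > 0" "I2 > 0" unfolding I1_def I2_def by (rule integral_bump_pos, use b in simp)+
  define \<phi> where "\<phi> t = bump 1 (- b) (- m) t / I1 + (- 1 / I2) * bump 1 m b t" for t
  define \<kappa> where "\<kappa> t = (\<integral>s. indicator {..t} s * \<phi> s \<partial>lborel)" for t
  have \<phi>s: "smooth1 \<phi>" unfolding \<phi>_def[abs_def] divide_inverse
    by (intro smooth1_add smooth1_mult smooth1_bump smooth1_const)
  have z1: "bump 1 (- b) (- m) t = 0" if "t \<notin> {- b<..<- m}" for t using that bump_eq_0[of t "- b" "- m" 1] by auto
  have z2: "bump 1 m b t = 0" if "t \<notin> {m<..<b}" for t using that bump_eq_0[of t m b 1] by auto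
  have \<phi>0: "\<phi> t = 0" if "t \<notin> {- b..b}" for t using that z1[of t] z2[of t] b m by (auto simp: \<phi>_def)
  have d: "(\<kappa> has_real_derivative \<phi> t) (at t)" for t
    unfolding \<kappa>_def[abs_def] by (rule primitive_compact_support[OF smooth1_continuous_on[OF \<phi>s] \<phi>0])
  have i1: "integrable lborel (\<lambda>s. bump 1 (- b) (- m) s / I1)" and i2: "integrable lborel (\<lambda>s. (- 1 / I2) * bump 1 m b s)"
    using integrable_bump by auto
  have J1: "(\<integral>s. bump 1 (- b) (- m) s / I1 \<partial>lborel) = 1" using I by (simp add: I1_def)
  have J2: "(\<integral>s. (- 1 / I2) * bump 1 m b s \<partial>lborel) = - 1" using I by (simp add: I2_def)
  have one: "\<kappa> t = 1" if t: "t \<in> {- m..m}" for t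
  proof -
    have "(\<lambda>s. indicator {..t} s * \<phi> s) = (\<lambda>s. bump 1 (- b) (- m) s / I1)"
    proof
      fix s show "indicator {..t} s * \<phi> s = bump 1 (- b) (- m) s / I1"
        using z1[of s] z2[of s] t m by (cases "s \<le> t") (auto simp: \<phi>_def indicator_def)
    qed
    then show ?thesis by (simp only: \<kappa>_def J1)
  qed
  have zero: "\<kappa> t = 0" if t: "t \<notin> {- b..b}" for t
  proof (cases "t < - b")
    case True
    have "(\<lambda>s. indicator {..t} s * \<phi> s) = (\<lambda>_. 0)"
    proof
      fix s show "indicator {..t} s * \<phi> s = 0" using \<phi>0[of s] True by (cases "s \<le> t") auto
    qed
    then show ?thesis by (simp only: \<kappa>_def integral_zero)
  next
    case False
    then have tb: "t > b" using t by auto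
    have "(\<lambda>s. indicator {..t} s * \<phi> s) = \<phi>"
    proof
      fix s show "indicator {..t} s * \<phi> s = \<phi> s" using \<phi>0[of s] tb by (cases "s \<le> t") auto
    qed
    then have "\<kappa> t = (\<integral>s. \<phi> s \<partial>lborel)" by (simp only: \<kappa>_def)
    also have "\<dots> = 0" unfolding \<phi>_def using i1 i2 J1 J2 by simp
    finally show ?thesis .
  qed
  have "vert_test (- s) s \<kappa>" unfolding vert_test_def
    using smooth1_has_derivI[OF d \<phi>s] zero b by (intro conjI exI[of _ "- b"] exI[of _ b]) auto
  then show ?thesis using that one by blast
qed

text \<open>Since \<open>\<kappa>\<close> is one between \<tau> and \<open>m\<close>, the dependence
  on \<tau> is that of an explicit polynomial, and the remainder above \<open>m\<close> does not
  depend on \<tau>. The derivative integrates to -1 because \<open>\<kappa>\<close> falls from one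
  to zero.\<close>

lemma cutoff_integrals:
  fixes \<kappa> :: "real \<Rightarrow> real"
  assumes \<kappa>: "vert_test (- s) s \<kappa>" and one: "\<And>t. t \<in> {- m..m} \<Longrightarrow> \<kappa> t = 1" and \<tau>: "- m \<le> \<tau>" "\<tau> \<le> m"
  shows "integrable lborel (\<lambda>z. indicator {\<tau>..} z * \<kappa> z)" "integrable lborel (\<lambda>z. indicator {\<tau>..} z * ((z - h) * \<kappa> z))"
    "integrable lborel (\<lambda>z. indicator {\<tau>..} z * deriv \<kappa> z)"
    "(\<integral>z. indicator {\<tau>..} z * \<kappa> z \<partial>lborel) = (\<integral>z. indicator {m..} z * \<kappa> z \<partial>lborel) + (m - h) - (\<tau> - h)"
    "(\<integral>z. indicator {\<tau>..} z * ((z - h) * \<kappa> z) \<partial>lborel) = (\<integral>z. indicator {m..} z * ((z - h) * \<kappa> z) \<partial>lborel) + (m - h)\<^sup>2 / 2 - (\<tau> - h)\<^sup>2 / 2"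
    "(\<integral>z. indicator {\<tau>..} z * deriv \<kappa> z \<partial>lborel) = - 1"
proof -
  obtain a b where ab: "- s < a" "b < s" "\<And>t. t \<notin> {a..b} \<Longrightarrow> \<kappa> t = 0" and sm: "smooth1 \<kappa>"
    using \<kappa> by (auto simp: vert_test_def)
  \<comment> \<open>A height beyond the support of \<open>\<kappa>\<close>, at which the integrals
    to infinity may be stopped.\<close>
  define B where "B = max b m + 1"
  have B: "\<tau> \<le> B" "m \<le> B" "b < B" using \<tau> by (auto simp: B_def)
  have d0: "deriv \<kappa> t = 0" if "t > b" for t
  proof -
    have "(\<kappa> has_real_derivative 0) (at t)"
      by (rule has_field_derivative_transform_within_open[OF DERIV_const[of 0], of "{b<..}"]) (use that ab(3) in auto)
    then show ?thesis by (rule DERIV_imp_deriv)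
  qed
  have gen: "integrable lborel (\<lambda>z. indicator {x..} z * g z)" "(\<integral>z. indicator {x..} z * g z \<partial>lborel) = G B - G x"
    if x: "x \<le> B" and g0: "\<And>t. t > b \<Longrightarrow> g t = 0" and gc: "continuous_on UNIV g"
      and G: "\<And>t. (G has_real_derivative g t) (at t)" for x g G
  proof -
    have eq: "(\<lambda>z. indicator {x..} z * g z) = (\<lambda>z. indicator {x..B} z *\<^sub>R g z)"
      using g0 B by (auto simp: indicator_def fun_eq_iff)
    show "integrable lborel (\<lambda>z. indicator {x..} z * g z)" unfolding eq
      by (intro borel_integrable_compact continuous_on_subset[OF gc]) auto
    show "(\<integral>z. indicator {x..} z * g z \<partial>lborel) = G B - G x" unfolding eq
      by (rule integral_FTC_atLeastAtMost[OF x])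
        (use G in \<open>auto simp: has_real_derivative_iff_has_vector_derivative[symmetric] intro: DERIV_subset continuous_on_subset[OF gc]\<close>)
  qed
  have prim: "\<exists>G. \<forall>t. (G has_real_derivative g t) (at t)" if gc: "continuous_on UNIV g" and g0: "\<And>t. t \<notin> {a..b} \<Longrightarrow> g t = 0" for g
    using primitive_compact_support[OF gc g0] by blast
  have \<kappa>c: "continuous_on UNIV \<kappa>" by (rule smooth1_continuous_on[OF sm])
  have k0: "\<kappa> t = 0" if "t > b" for t using ab(3) that by auto
  obtain G1 where G1: "\<And>t. (G1 has_real_derivative \<kappa> t) (at t)" using prim[OF \<kappa>c ab(3)] by blast
  have c2: "continuous_on UNIV (\<lambda>z. (z - h) * \<kappa> z)" by (intro continuous_intros \<kappa>c)
  obtain G2 where G2: "\<And>t. (G2 has_real_derivative (t - h) * \<kappa> t) (at t)" using prim[OF c2] ab(3) by auto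
  have mm: "G1 m - G1 \<tau> = (m - h) - (\<tau> - h)"
  proof (cases "\<tau> < m")
    case True
    have "\<exists>c. \<forall>x\<in>{\<tau>..m}. G1 x - x = c"
    proof (rule has_field_derivative_zero_constant)
      fix x assume "x \<in> {\<tau>..m}"
      then have "\<kappa> x = 1" using \<tau> one by auto
      then show "((\<lambda>x. G1 x - x) has_field_derivative 0) (at x within {\<tau>..m})"
        by (auto intro!: derivative_eq_intros DERIV_subset[OF G1])
    qed auto
    then obtain c where "\<forall>x\<in>{\<tau>..m}. G1 x - x = c" ..
    then have "G1 m - m = c" "G1 \<tau> - \<tau> = c" using True by auto
    then show ?thesis by linarith
  qed (use \<tau> in auto)
  have mm2: "G2 m - G2 \<tau> = (m - h)\<^sup>2 / 2 - (\<tau> - h)\<^sup>2 / 2"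
  proof (cases "\<tau> < m")
    case True
    have "\<exists>c. \<forall>x\<in>{\<tau>..m}. G2 x - (x - h)\<^sup>2 / 2 = c"
    proof (rule has_field_derivative_zero_constant)
      fix x assume "x \<in> {\<tau>..m}"
      then have "\<kappa> x = 1" using \<tau> one by auto
      then show "((\<lambda>x. G2 x - (x - h)\<^sup>2 / 2) has_field_derivative 0) (at x within {\<tau>..m})"
        by (auto intro!: derivative_eq_intros DERIV_subset[OF G2])
    qed auto
    then obtain c where "\<forall>x\<in>{\<tau>..m}. G2 x - (x - h)\<^sup>2 / 2 = c" ..
    then have "G2 m - (m - h)\<^sup>2 / 2 = c" "G2 \<tau> - (\<tau> - h)\<^sup>2 / 2 = c" using True by auto
    then show ?thesis by linarith
  qed (use \<tau> in auto)
  show "integrable lborel (\<lambda>z. indicator {\<tau>..} z * \<kappa> z)" by (rule gen(1)[OF B(1) k0 \<kappa>c G1])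
  show "integrable lborel (\<lambda>z. indicator {\<tau>..} z * ((z - h) * \<kappa> z))" by (rule gen(1)[OF B(1) _ c2 G2]) (simp add: k0)
  have dc: "continuous_on UNIV (deriv \<kappa>)" by (rule smooth1_continuous_on[OF smooth1_deriv(2)[OF sm]])
  show "integrable lborel (\<lambda>z. indicator {\<tau>..} z * deriv \<kappa> z)" by (rule gen(1)[OF B(1) d0 dc smooth1_deriv(1)[OF sm]])
  have "(\<integral>z. indicator {\<tau>..} z * deriv \<kappa> z \<partial>lborel) = \<kappa> B - \<kappa> \<tau>" by (rule gen(2)[OF B(1) d0 dc smooth1_deriv(1)[OF sm]])
  then show "(\<integral>z. indicator {\<tau>..} z * deriv \<kappa> z \<partial>lborel) = - 1" using k0[OF B(3)] one[of \<tau>] \<tau> by simp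
  show "(\<integral>z. indicator {\<tau>..} z * \<kappa> z \<partial>lborel) = (\<integral>z. indicator {m..} z * \<kappa> z \<partial>lborel) + (m - h) - (\<tau> - h)"
    using gen(2)[OF B(1) k0 \<kappa>c G1] gen(2)[OF B(2) k0 \<kappa>c G1] mm by simp
  have "(\<integral>z. indicator {\<tau>..} z * ((z - h) * \<kappa> z) \<partial>lborel) = G2 B - G2 \<tau>" by (rule gen(2)[OF B(1) _ c2 G2]) (simp add: k0)
  moreover have "(\<integral>z. indicator {m..} z * ((z - h) * \<kappa> z) \<partial>lborel) = G2 B - G2 m" by (rule gen(2)[OF B(2) _ c2 G2]) (simp add: k0)
  ultimately show "(\<integral>z. indicator {\<tau>..} z * ((z - h) * \<kappa> z) \<partial>lborel) = (\<integral>z. indicator {m..} z * ((z - h) * \<kappa> z) \<partial>lborel) + (m - h)\<^sup>2 / 2 - (\<tau> - h)\<^sup>2 / 2"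
    using mm2 by simp
qed

lemma
  assumes "r < R" "0 < r" "continuous_on (ball 0 R) g"
  shows integrable_rho_times: "integrable lborel (\<lambda>v. rho r v * g v)"
    and integrable_eta_times: "integrable lborel (\<lambda>v. eta r v * g v)"
proof -
  have c: "continuous_on (cball 0 r) g" by (rule continuous_on_subset[OF assms(3)]) (use assms in auto)
  have "integrable lborel (\<lambda>v. indicator (cball 0 r) v *\<^sub>R (rho r v * g v))" "integrable lborel (\<lambda>v. indicator (cball 0 r) v *\<^sub>R (eta r v * g v))"
    by (intro borel_integrable_compact continuous_intros c continuous_rho continuous_eta; simp)+
  moreover have "(\<lambda>v. indicator (cball 0 r) v *\<^sub>R (rho r v * g v)) = (\<lambda>v. rho r v * g v)"
    "(\<lambda>v. indicator (cball 0 r) v *\<^sub>R (eta r v * g v)) = (\<lambda>v. eta r v * g v)"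
    using eta_rho_0[OF assms(2)] by (auto simp: indicator_def fun_eq_iff)
  ultimately show "integrable lborel (\<lambda>v. rho r v * g v)" "integrable lborel (\<lambda>v. eta r v * g v)" by simp_all
qed

text \<open>The formula is known only for almost every height above \<tau>, but both sides are
  continuous down to \<tau>. Approaching \<tau> along admissible heights yields the value at the top
  itself.\<close>

lemma slice_top:
  fixes p U :: "real \<Rightarrow> real"
  assumes p: "integrable lborel p" and U: "continuous_on UNIV U" and \<tau>: "\<tau> < s"
    and eq: "AE z in lborel. \<tau> < z \<and> z < s \<longrightarrow> U z = (\<integral>t. indicator {..<z} t * p t \<partial>lborel)"
  shows "U \<tau> = (\<integral>t. indicator {..<\<tau>} t * p t \<partial>lborel)"
proof -
  have "\<exists>z. \<tau> < z \<and> z < \<tau> + (s - \<tau>) / real (Suc n) \<and> (\<tau> < z \<and> z < s \<longrightarrow> U z = (\<integral>t. indicator {..<z} t * p t \<partial>lborel))" for n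
    by (rule AE_interval_ex[OF eq, of \<tau> "\<tau> + (s - \<tau>) / real (Suc n)"]) (use \<tau> in auto)
  then obtain z where z: "\<And>n. \<tau> < z n" "\<And>n. z n < \<tau> + (s - \<tau>) / real (Suc n)"
    "\<And>n. \<tau> < z n \<and> z n < s \<longrightarrow> U (z n) = (\<integral>t. indicator {..<z n} t * p t \<partial>lborel)" by metis
  have "\<tau> + (s - \<tau>) / real (Suc n) \<le> s" for n
    using \<tau> mult_left_mono[of 1 "real (Suc n)" "s - \<tau>"] by (simp add: divide_le_eq field_simps)
  then have zs: "z n < s" for n using z(2)[of n] by (meson less_le_trans)
  have "(\<lambda>n. \<tau> + (s - \<tau>) / real (Suc n)) \<longlonglongrightarrow> \<tau> + (s - \<tau>) * 0"
    unfolding divide_inverse by (intro tendsto_intros LIMSEQ_inverse_real_of_nat)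
  then have lim: "(\<lambda>n. \<tau> + (s - \<tau>) / real (Suc n)) \<longlonglongrightarrow> \<tau>" by simp
  have zl: "z \<longlonglongrightarrow> \<tau>"
  proof (rule real_tendsto_sandwich[OF _ _ tendsto_const lim])
    show "\<forall>\<^sub>F n in sequentially. \<tau> \<le> z n" using z(1) by (intro always_eventually allI less_imp_le)
    show "\<forall>\<^sub>F n in sequentially. z n \<le> \<tau> + (s - \<tau>) / real (Suc n)" using z(2) by (intro always_eventually allI less_imp_le)
  qed
  have "(\<lambda>n. \<integral>t. indicator {..<z n} t * p t \<partial>lborel) \<longlonglongrightarrow> (\<integral>t. indicator {..<\<tau>} t * p t \<partial>lborel)"
  proof (rule integral_dominated_convergence[where w="\<lambda>t. norm (p t)"])
    show "AE t in lborel. (\<lambda>n. indicator {..<z n} t * p t) \<longlonglongrightarrow> indicator {..<\<tau>} t * p t"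
      \<comment> \<open>At the height \<tau> itself the indicators do not converge to the strict
        one, so this point is discarded.\<close>
      using AE_lborel_singleton[of \<tau>]
    proof eventually_elim
      case (elim t)
      show ?case
      proof (cases "t < \<tau>")
        case True
        then have "indicator {..<z n} t * p t = indicator {..<\<tau>} t * p t" for n using z(1)[of n] by (simp add: indicator_def)
          then show ?thesis by (intro tendsto_eventually always_eventually allI)
      next
        case False
        then have "\<tau> < t" using elim by simp
        then have "\<forall>\<^sub>F n in sequentially. z n < t" using zl order_tendstoD(2) by blast
        then have "\<forall>\<^sub>F n in sequentially. indicator {..<z n} t * p t = indicator {..<\<tau>} t * p t"
          by eventually_elim (use False in \<open>auto simp: indicator_def\<close>)
        then show ?thesis by (rule tendsto_eventually)
      qed
    qed
  qed (use p in \<open>auto simp: indicator_def\<close>)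
  moreover have "(\<lambda>n. U (z n)) \<longlonglongrightarrow> U \<tau>"
    using U zl by (simp add: continuous_on_eq_continuous_at isCont_tendsto_compose)
  moreover have "U (z n) = (\<integral>t. indicator {..<z n} t * p t \<partial>lborel)" for n using z zs by blast
  ultimately show ?thesis using LIMSEQ_unique by auto
qed

text \<open>By Fubini the integral of \<open>u\<close> is that of \<open>p\<close> with weight
  \<open>\<tau> - s\<close>, and the trapezoidal value, with \<open>u\<close> zero at the bottom,
  has the constant weight \<open>(\<tau> - \<beta>) / 2\<close>. The difference of the weights has
  mean zero, so a fixed value of \<open>p\<close> may be subtracted and only the oscillation of
  \<open>p\<close> remains.\<close>

lemma trapezoid:
  fixes p u :: "real \<Rightarrow> real"
  assumes p: "integrable lborel p" and \<beta>\<tau>: "\<beta> < \<tau>"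
    and u: "AE z in lborel. z \<in> {\<beta><..<\<tau>} \<longrightarrow> u z = (\<integral>t. indicator {..<z} t * p t \<partial>lborel)"
    and um: "u \<in> borel_measurable borel"
    and p0: "AE t in lborel. t \<le> \<beta> \<longrightarrow> p t = 0"
    and L: "AE t1 in lborel. AE t2 in lborel. t1 \<in> {\<beta><..<\<tau>} \<and> t2 \<in> {\<beta><..<\<tau>} \<longrightarrow> \<bar>p t1 - p t2\<bar> \<le> L"
  shows "\<bar>(\<integral>z. indicator {\<beta><..<\<tau>} z * u z \<partial>lborel) - (\<tau> - \<beta>) / 2 * (\<integral>t. indicator {..<\<tau>} t * p t \<partial>lborel)\<bar> \<le> (\<tau> - \<beta>)\<^sup>2 / 2 * L"
proof -
  let ?I = "indicator {\<beta><..<\<tau>} :: real \<Rightarrow> real"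
  have pm[measurable]: "p \<in> borel_measurable borel" using p by auto
  have Ii: "integrable lborel ?I" using \<beta>\<tau> by (intro integrable_real_indicator) auto
  have ind: "integrable lborel (\<lambda>t. indicator A t * k t)" if "A \<in> sets borel" "integrable lborel k" for A :: "real set" and k :: "real \<Rightarrow> real"
    using integrable_mult_indicator[OF _ that(2), of A] that(1) by simp
  have Ip: "integrable lborel (\<lambda>t. ?I t * p t)" by (intro ind p) simp
  have low: "(\<integral>t. indicator {..<z} t * p t \<partial>lborel) = (\<integral>t. indicator {..z} t * (?I t * p t) \<partial>lborel)" if "z \<le> \<tau>" for z
  proof (rule integral_cong_AE)
    show "AE t in lborel. indicator {..<z} t * p t = indicator {..z} t * (?I t * p t)"
      using p0 AE_lborel_singleton[of z] by eventually_elim (use that in \<open>auto simp: indicator_def\<close>)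
  qed measurable
  have top: "(\<integral>t. indicator {..<\<tau>} t * p t \<partial>lborel) = (\<integral>t. ?I t * p t \<partial>lborel)"
    unfolding low[OF order_refl] by (intro Bochner_Integration.integral_cong) (auto simp: indicator_def)
  have "(\<integral>z. ?I z * u z \<partial>lborel) = (\<integral>z. ?I z * (\<integral>t. indicator {..z} t * (?I t * p t) \<partial>lborel) \<partial>lborel)"
  proof (rule integral_cong_AE)
    show "(\<lambda>z. ?I z * u z) \<in> borel_measurable lborel" using um by measurable
    have "(\<lambda>z. ?I z * (\<integral>t. indicator {..z} t * (?I t * p t) \<partial>lborel)) = (\<lambda>z. ?I z * (\<integral>t. (if t \<le> z then 1 else 0) * (?I t * p t) \<partial>lborel))"
      by (auto simp: indicator_def of_bool_def)
    also have "\<dots> \<in> borel_measurable lborel" by measurable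
    finally show "(\<lambda>z. ?I z * (\<integral>t. indicator {..z} t * (?I t * p t) \<partial>lborel)) \<in> borel_measurable lborel" .
    show "AE z in lborel. ?I z * u z = ?I z * (\<integral>t. indicator {..z} t * (?I t * p t) \<partial>lborel)"
      using u
    proof eventually_elim
      case (elim z)
      show ?case
      proof (cases "z \<in> {\<beta><..<\<tau>}")
        case True
        then have "u z = (\<integral>t. indicator {..z} t * (?I t * p t) \<partial>lborel)"
          using elim low[of z] by simp
        then show ?thesis by simp
      qed simp
    qed
  qed
  also have "\<dots> = (\<integral>s. (\<integral>z. indicator {s..} z * ?I z \<partial>lborel) * (?I s * p s) \<partial>lborel)"
    using triangle_Fubini[OF Ii Ip] by simp
  also have "\<dots> = (\<integral>s. (\<tau> - s) * (?I s * p s) \<partial>lborel)"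
  proof (intro Bochner_Integration.integral_cong refl)
    fix s
    show "(\<integral>z. indicator {s..} z * ?I z \<partial>lborel) * (?I s * p s) = (\<tau> - s) * (?I s * p s)"
    proof (cases "s \<in> {\<beta><..<\<tau>}")
      case True
      have "(\<lambda>z. indicator {s..} z * ?I z) = (indicator {s..<\<tau>} :: real \<Rightarrow> real)" using True by (auto simp: indicator_def fun_eq_iff)
      then show ?thesis using True by simp
    qed simp
  qed
  finally have J: "(\<integral>z. ?I z * u z \<partial>lborel) = (\<integral>s. (\<tau> - s) * (?I s * p s) \<partial>lborel)" .
  \<comment> \<open>With the midpoint, the difference of the two weights is
    \<open>mid - s\<close>.\<close>
  define mid where "mid = (\<tau> + \<beta>) / 2"
  have tb: "integrable lborel (\<lambda>s. (c - s) * (?I s * k s))" if "integrable lborel (\<lambda>s. ?I s * k s)" for c k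
  proof -
    have "integrable lborel (\<lambda>s. (?I s * k s) * (?I s * (c - s)))"
    proof (rule integrable_times_bounded[OF that, where K="\<bar>c\<bar> + \<bar>\<beta>\<bar> + \<bar>\<tau>\<bar>"])
      show "\<bar>?I s * (c - s)\<bar> \<le> \<bar>c\<bar> + \<bar>\<beta>\<bar> + \<bar>\<tau>\<bar>" for s by (auto simp: indicator_def)
    qed measurable
    moreover have "(\<lambda>s. (?I s * k s) * (?I s * (c - s))) = (\<lambda>s. (c - s) * (?I s * k s))" by (auto simp: indicator_def fun_eq_iff)
    ultimately show ?thesis by simp
  qed
  have mz: "(\<integral>s. (mid - s) * (?I s * 1) \<partial>lborel) = 0"
  proof -
    have "(\<integral>s. (mid - s) * (?I s * 1) \<partial>lborel) = (\<integral>s. indicator {\<beta>..\<tau>} s *\<^sub>R (mid - s) \<partial>lborel)"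
    proof (rule integral_cong_AE)
      show "AE s in lborel. (mid - s) * (?I s * 1) = indicator {\<beta>..\<tau>} s *\<^sub>R (mid - s)"
        using AE_lborel_singleton[of \<beta>] AE_lborel_singleton[of \<tau>] by eventually_elim (auto simp: indicator_def)
    qed measurable
    also have "\<dots> = (mid * \<tau> - \<tau>\<^sup>2 / 2) - (mid * \<beta> - \<beta>\<^sup>2 / 2)"
      by (rule integral_FTC_atLeastAtMost[of \<beta> \<tau> "\<lambda>s. mid * s - s\<^sup>2 / 2"])
        (use \<beta>\<tau> in \<open>auto simp: has_real_derivative_iff_has_vector_derivative[symmetric] intro!: derivative_eq_intros continuous_intros\<close>)
    also have "\<dots> = 0" by (simp add: mid_def power2_eq_square field_simps)
    finally show ?thesis .
  qed
  \<comment> \<open>The value of \<open>p\<close> at one good height serves as the subtracted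
    constant.\<close>
  obtain t0 where t0: "\<beta> < t0" "t0 < \<tau>" "AE t2 in lborel. t0 \<in> {\<beta><..<\<tau>} \<and> t2 \<in> {\<beta><..<\<tau>} \<longrightarrow> \<bar>p t0 - p t2\<bar> \<le> L"
    using AE_interval_ex[OF L \<beta>\<tau>] by blast
  have I1: "integrable lborel (\<lambda>s. ?I s * 1)" using Ii by simp
  let ?w = "\<lambda>s. (mid - s) * (?I s * p s) - p t0 * ((mid - s) * (?I s * 1))"
  have "(\<integral>z. ?I z * u z \<partial>lborel) - (\<tau> - \<beta>) / 2 * (\<integral>t. ?I t * p t \<partial>lborel) = (\<integral>s. (\<tau> - s) * (?I s * p s) - (\<tau> - \<beta>) / 2 * (?I s * p s) \<partial>lborel)"
    unfolding J using tb[OF Ip] Ip by simp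
  also have "\<dots> = (\<integral>s. (mid - s) * (?I s * p s) - p t0 * ((mid - s) * (?I s * 1)) \<partial>lborel)"
  proof -
    have "(\<integral>s. (mid - s) * (?I s * p s) - p t0 * ((mid - s) * (?I s * 1)) \<partial>lborel) = (\<integral>s. (mid - s) * (?I s * p s) \<partial>lborel) - p t0 * (\<integral>s. (mid - s) * (?I s * 1) \<partial>lborel)"
      using tb[OF Ip] tb[OF I1] by (subst Bochner_Integration.integral_diff) auto
    then show ?thesis unfolding mz by (auto intro!: Bochner_Integration.integral_cong simp: mid_def field_simps)
  qed
  finally have e: "(\<integral>z. ?I z * u z \<partial>lborel) - (\<tau> - \<beta>) / 2 * (\<integral>t. ?I t * p t \<partial>lborel) = (\<integral>s. ?w s \<partial>lborel)" .
  have "\<bar>\<integral>s. ?w s \<partial>lborel\<bar> \<le> (\<integral>s. \<bar>?w s\<bar> \<partial>lborel)"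
    by (rule integral_abs_bound)
  also have "\<dots> \<le> (\<integral>s. (\<tau> - \<beta>) / 2 * L * ?I s \<partial>lborel)"
  proof (rule integral_mono_AE)
    show "integrable lborel (\<lambda>s. \<bar>(mid - s) * (?I s * p s) - p t0 * ((mid - s) * (?I s * 1))\<bar>)"
      using tb[OF Ip] tb[OF I1] by (intro integrable_abs Bochner_Integration.integrable_diff integrable_mult_right)
    show "integrable lborel (\<lambda>s. (\<tau> - \<beta>) / 2 * L * ?I s)" using Ii by (intro integrable_mult_right)
    show "AE s in lborel. \<bar>(mid - s) * (?I s * p s) - p t0 * ((mid - s) * (?I s * 1))\<bar> \<le> (\<tau> - \<beta>) / 2 * L * ?I s"
      using t0(3)
    proof eventually_elim
      case (elim s)
      show ?case
      proof (cases "s \<in> {\<beta><..<\<tau>}")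
        case True
        have "\<bar>mid - s\<bar> \<le> (\<tau> - \<beta>) / 2" using True by (auto simp: mid_def abs_le_iff field_simps)
        moreover have "\<bar>p s - p t0\<bar> \<le> L" using elim True t0 by (auto simp: abs_minus_commute)
        ultimately have "\<bar>mid - s\<bar> * \<bar>p s - p t0\<bar> \<le> (\<tau> - \<beta>) / 2 * L" using \<beta>\<tau> by (intro mult_mono) auto
        then show ?thesis using True by (simp add: abs_mult[symmetric] algebra_simps)
      qed simp
    qed
  qed
  also have "\<dots> = (\<tau> - \<beta>)\<^sup>2 / 2 * L" using \<beta>\<tau> by (simp add: power2_eq_square)
  finally show ?thesis unfolding top e .
qed

text \<open>All that the estimates need to know about \<open>u\<close> and the geometry. The cut-off
  lives on radius \<open>r\<close>, the data on the larger radius \<open>R\<close>; the graphs stay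
  within height \<open>m\<close>, where the vertical cut-off is one, and the strip ends at
  \<open>s\<close>. Above the gap the field is rigid: \<open>c1\<close>, \<open>c2\<close>,
  \<open>V\<close> are its value at height \<open>h\<close> on the axis, and \<open>w\<close>,
  \<open>a\<close>, \<open>b\<close> the entries of its skew-symmetric matrix. The graphs may touch,
  so that the contact case is included.\<close>

locale gap =
  fixes r R s m h :: real and \<beta> \<tau> :: "real^2 \<Rightarrow> real" and uu pp :: "3 \<Rightarrow> (real^2) \<times> real \<Rightarrow> real"
    and V c1 c2 w a b :: real
  assumes r: "0 < r" "r < R" and m: "0 < m" "m < s"
    and \<beta>c: "continuous_on (ball 0 R) \<beta>" and \<tau>c: "continuous_on (ball 0 R) \<tau>"
    and bd: "\<And>v. norm v < R \<Longrightarrow> - m \<le> \<beta> v \<and> \<beta> v \<le> \<tau> v \<and> \<tau> v \<le> m"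
    and uui: "\<And>k. integrable lborel (uu k)" and ppi: "\<And>k. integrable lborel (pp k)"
    and uu0: "\<And>k. AE p in lborel. norm (fst p) < R \<and> snd p \<le> \<beta> (fst p) \<longrightarrow> uu k p = 0"
    and pp0: "\<And>k. AE p in lborel. norm (fst p) < R \<and> snd p \<le> \<beta> (fst p) \<longrightarrow> pp k p = 0"
    and slice: "\<And>k. AE v in lborel. norm v < R \<longrightarrow> (AE z in lborel. - s < z \<and> z < s \<longrightarrow> uu k (v, z) = (\<integral>t. indicator {..<z} t * pp k (v, t) \<partial>lborel))"
    and flux: "\<And>\<kappa>. vert_test (- s) s \<kappa> \<Longrightarrow>
       (\<integral>p. uu 1 p * (- (rho r (fst p) * fst p $ 1) * \<kappa> (snd p)) + uu 2 p * (- (rho r (fst p) * fst p $ 2) * \<kappa> (snd p))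
         + uu 3 p * (eta r (fst p) * deriv \<kappa> (snd p)) \<partial>lborel) = 0"
    and top1: "AE p in lborel. norm (fst p) < R \<and> \<tau> (fst p) < snd p \<and> snd p < s \<longrightarrow> uu 1 p = c1 - w * fst p $ 2 + a * (snd p - h)"
    and top2: "AE p in lborel. norm (fst p) < R \<and> \<tau> (fst p) < snd p \<and> snd p < s \<longrightarrow> uu 2 p = c2 + w * fst p $ 1 + b * (snd p - h)"
    and top3: "AE p in lborel. norm (fst p) < R \<and> \<tau> (fst p) < snd p \<and> snd p < s \<longrightarrow> uu 3 p = V - a * fst p $ 1 - b * fst p $ 2"
begin

text \<open>Pairing the horizontal rigid velocity with \<open>v\<close> gives
  \<open>l v + q v * (z - h)\<close>; the rotation \<open>w\<close> about the vertical axis drops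
  out. The function \<open>q\<close> also is the variable part of the vertical velocity, and both
  functions are odd.\<close>

definition "l v = c1 * v $ 1 + c2 * (v $ 2)" for v :: "real^2"
definition "q v = a * v $ 1 + b * (v $ 2)" for v :: "real^2"
definition "Gs = {p::(real^2)\<times>real. norm (fst p) < R \<and> \<beta> (fst p) < snd p \<and> snd p < \<tau> (fst p)}"
definition "J k v = (\<integral>z. indicator Gs (v, z) * uu k (v, z) \<partial>lborel)"

lemma Gs_borel[measurable]: "Gs \<in> sets borel"
proof -
  have "Gs = {p. fst p \<in> ball 0 R \<and> \<beta> (fst p) < snd p} \<inter> {p. fst p \<in> ball 0 R \<and> snd p < \<tau> (fst p)}" by (auto simp: Gs_def)
  then have "open Gs" using open_above_graph(1)[OF open_ball \<beta>c] open_above_graph(2)[OF open_ball \<tau>c] by auto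
  then show ?thesis by simp
qed

lemma integrable_Gs: "integrable lborel f \<Longrightarrow> integrable lborel (\<lambda>p. indicator Gs p * f p)" for f :: "(real^2)\<times>real \<Rightarrow> real"
  using integrable_mult_indicator[of Gs lborel f] by simp

lemma indicator_Gs: "norm v < R \<Longrightarrow> indicator Gs (v, z) = (indicator {\<beta> v<..<\<tau> v} z :: real)"
  by (auto simp: Gs_def indicator_def)

lemma J_integrable: "integrable lborel (J k)"
  unfolding J_def[abs_def] by (rule lborel_slice_integrable[OF integrable_Gs[OF uui]])

lemma norm2: "\<bar>v $ 1\<bar> \<le> norm v" "\<bar>v $ 2\<bar> \<le> norm (v::real^2)"
  using component_le_norm_cart[of v] by auto

lemma rho_comp_bound: "\<bar>rho r v * v $ k\<bar> \<le> 4 / r"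
proof (cases "norm v < r")
  case True
  have "\<bar>v $ k\<bar> \<le> r" using component_le_norm_cart[of v k] True by linarith
  then have "\<bar>rho r v * v $ k\<bar> \<le> (4 / r\<^sup>2) * r"
    unfolding abs_mult using rho_bounds[OF r(1), of v] by (intro mult_mono) auto
  then show ?thesis using r(1) by (simp add: power2_eq_square)
next
  case False
  then show ?thesis using eta_rho_0[of r v] r by simp
qed

lemma rho_comp_measurable[measurable]: "(\<lambda>v. rho r v * v $ k) \<in> borel_measurable borel"
  by (intro borel_measurable_continuous_onI continuous_intros continuous_rho)

lemma rho_component_integrable:
  assumes "integrable lborel f"
  shows "integrable lborel (\<lambda>v. rho r v * v $ k * f v)"
proof -
  have "integrable lborel (\<lambda>v. f v * (rho r v * v $ k))"
    by (rule integrable_times_bounded[OF assms _ rho_comp_bound]) simp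
  then show ?thesis by (simp add: mult.commute)
qed

text \<open>The slice splits into nothing below \<open>\<beta>\<close>, the gap where
  \<open>g\<close> is the constant \<open>c\<close>, and the rigid part above. It is used with
  \<open>c = 1\<close> for the cut-off and \<open>c = 0\<close> for its derivative.\<close>

lemma uu_slice_integral:
  assumes gc: "continuous_on UNIV g" and g0: "\<And>t. t \<notin> {- s<..<s} \<Longrightarrow> g t = 0" and g1: "\<And>t. t \<in> {- m<..<m} \<Longrightarrow> g t = c"
    and v: "norm v < R" and i: "integrable lborel (\<lambda>z. uu k (v, z))"
    and z0: "AE z in lborel. z \<le> \<beta> v \<longrightarrow> uu k (v, z) = 0"
    and top: "AE z in lborel. \<tau> v < z \<and> z < s \<longrightarrow> uu k (v, z) = U z"
    and Ui: "integrable lborel (\<lambda>z. indicator {\<tau> v..} z * (U z * g z))"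
  shows "(\<integral>z. uu k (v, z) * g z \<partial>lborel) = c * J k v + (\<integral>z. indicator {\<tau> v..} z * (U z * g z) \<partial>lborel)"
proof -
  have Ji: "integrable lborel (\<lambda>z. indicator Gs (v, z) * uu k (v, z))"
    using integrable_mult_indicator[OF _ i, of "{\<beta> v<..<\<tau> v}"] by (simp add: indicator_Gs[OF v])
  have um: "(\<lambda>z. uu k (v, z)) \<in> borel_measurable borel" using i by auto
  have gm: "g \<in> borel_measurable borel" by (rule borel_measurable_continuous_onI[OF gc])
  have "(\<integral>z. uu k (v, z) * g z \<partial>lborel) = (\<integral>z. c * (indicator Gs (v, z) * uu k (v, z)) + indicator {\<tau> v..} z * (U z * g z) \<partial>lborel)"
  proof (rule integral_cong_AE)
    show "(\<lambda>z. uu k (v, z) * g z) \<in> borel_measurable lborel" using um gm by measurable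
    show "(\<lambda>z. c * (indicator Gs (v, z) * uu k (v, z)) + indicator {\<tau> v..} z * (U z * g z)) \<in> borel_measurable lborel"
      using Ji Ui by (intro borel_measurable_add borel_measurable_times[OF borel_measurable_const]) auto
    show "AE z in lborel. uu k (v, z) * g z = c * (indicator Gs (v, z) * uu k (v, z)) + indicator {\<tau> v..} z * (U z * g z)"
      using z0 top AE_lborel_singleton[of "\<tau> v"]
    proof eventually_elim
      case (elim z)
      have bv: "- m \<le> \<beta> v" "\<beta> v \<le> \<tau> v" "\<tau> v \<le> m" using bd[OF v] by auto
      consider "z \<le> \<beta> v" | "\<beta> v < z" "z < \<tau> v" | "\<tau> v < z" "z < s" | "\<tau> v < z" "s \<le> z" using elim(3) by linarith
      then show ?case
      proof cases
        case 1
        then show ?thesis using elim bv by (auto simp: indicator_Gs[OF v] indicator_def)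
      next
        case 2
        then have "g z = c" using bv by (intro g1) auto
        moreover have "(v, z) \<in> Gs" using 2 v by (auto simp: Gs_def)
        ultimately show ?thesis using 2 by simp
      next
        case 3
        then have "(v, z) \<notin> Gs" by (auto simp: Gs_def)
        then show ?thesis using elim 3 by simp
      next
        case 4
        then have "(v, z) \<notin> Gs" by (auto simp: Gs_def)
        then show ?thesis using g0[of z] 4 by simp
      qed
    qed
  qed
  also have "\<dots> = c * J k v + (\<integral>z. indicator {\<tau> v..} z * (U z * g z) \<partial>lborel)"
    unfolding J_def using Ji Ui by simp
  finally show ?thesis .
qed

lemma rho_even: "rho r (- v) = rho r v" "eta r (- v) = eta r v"
  by (simp_all add: rho_def eta_def)

lemma l_odd: "l (- v) = - l v" and q_odd: "q (- v) = - q v"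
  by (simp_all add: l_def q_def)

lemma continuous_l: "continuous_on X l" and continuous_q: "continuous_on X q"
  unfolding l_def[abs_def] q_def[abs_def] by (intro continuous_intros)+

text \<open>The flux of \<open>u\<close> through the bottom of \<open>S\<close> balances the flux through the gap; the rigid field is divergence-free,
  so only its value at \<open>P\<close> and terms of higher order in the height of \<open>S\<close> survive the averaging.\<close>

lemma flux_formula:
  "V * (\<integral>v. eta r v \<partial>lborel) = - (\<integral>v. rho r v * v $ 1 * J 1 v + rho r v * v $ 2 * J 2 v \<partial>lborel)
    + (\<integral>v. rho r v * (l v * (\<tau> v - h)) \<partial>lborel) + (\<integral>v. rho r v * (q v * ((\<tau> v - h)\<^sup>2 / 2)) \<partial>lborel)"
proof -
  obtain \<kappa> where \<kappa>: "vert_test (- s) s \<kappa>" "\<And>t. t \<in> {- m..m} \<Longrightarrow> \<kappa> t = 1" using cutoff_exists[OF m] by blast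
  obtain a' b' where ab: "- s < a'" "b' < s" "\<And>t. t \<notin> {a'..b'} \<Longrightarrow> \<kappa> t = 0" and \<kappa>s: "smooth1 \<kappa>"
    using \<kappa>(1) by (auto simp: vert_test_def)
  have \<kappa>c: "continuous_on UNIV \<kappa>" "continuous_on UNIV (deriv \<kappa>)"
    using smooth1_continuous_on[OF \<kappa>s] smooth1_continuous_on[OF smooth1_deriv(2)[OF \<kappa>s]] by auto
  have \<kappa>0: "\<kappa> t = 0" if "t \<notin> {- s<..<s}" for t using that ab by auto
  have d0: "deriv \<kappa> t = 0" if "t \<notin> {a'..b'}" for t
  proof -
    have "open (- {a'..b'})" by auto
    from has_field_derivative_transform_within_open[OF DERIV_const[of 0] this, of t \<kappa>] that ab(3)
    show ?thesis by (intro DERIV_imp_deriv) auto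
  qed
  have \<kappa>d0: "deriv \<kappa> t = 0" if "t \<notin> {- s<..<s}" for t using that ab by (intro d0) auto
  have \<kappa>d1: "deriv \<kappa> t = 0" if t: "t \<in> {- m<..<m}" for t
    by (rule DERIV_imp_deriv, rule has_field_derivative_transform_within_open[OF DERIV_const[of 1], of "{- m<..<m}"]) (use t \<kappa>(2) in auto)
  obtain K1 where K1: "\<And>t. \<bar>\<kappa> t\<bar> \<le> K1" using continuous_compact_support_bounded[OF \<kappa>c(1) compact_Icc ab(3)] by blast
  obtain K2 where K2: "\<And>t. \<bar>deriv \<kappa> t\<bar> \<le> K2" using continuous_compact_support_bounded[OF \<kappa>c(2) compact_Icc d0] by blast
  have K: "0 \<le> K1" "0 \<le> K2" using K1[of 0] K2[of 0] by linarith+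
  have mfst: "(\<lambda>p. f (fst p)) \<in> borel_measurable (borel :: ((real^2)\<times>real) measure)" if "continuous_on UNIV f" for f :: "real^2 \<Rightarrow> real"
    by (intro borel_measurable_continuous_onI continuous_on_compose2[OF that] continuous_intros) auto
  have msnd: "(\<lambda>p. f (snd p)) \<in> borel_measurable (borel :: ((real^2)\<times>real) measure)" if "continuous_on UNIV f" for f :: "real \<Rightarrow> real"
    by (intro borel_measurable_continuous_onI continuous_on_compose2[OF that] continuous_intros) auto
  have rc: "continuous_on UNIV (\<lambda>v. - (rho r v * v $ k))" for k by (intro continuous_intros continuous_rho)
  have i1: "integrable lborel (\<lambda>p. uu j p * (- (rho r (fst p) * fst p $ k) * \<kappa> (snd p)))" for j k
  proof (rule integrable_times_bounded[OF uui])
    show "(\<lambda>p. - (rho r (fst p) * fst p $ k) * \<kappa> (snd p)) \<in> borel_measurable lborel"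
      using mfst[OF rc] msnd[OF \<kappa>c(1)] by simp
    show "\<bar>- (rho r (fst p) * fst p $ k) * \<kappa> (snd p)\<bar> \<le> (4 / r) * K1" for p
      unfolding abs_mult abs_minus using mult_mono[OF rho_comp_bound[of "fst p" k] K1[of "snd p"]] r K by (simp add: abs_mult)
  qed
  have i3: "integrable lborel (\<lambda>p. uu 3 p * (eta r (fst p) * deriv \<kappa> (snd p)))"
  proof (rule integrable_times_bounded[OF uui])
    show "(\<lambda>p. eta r (fst p) * deriv \<kappa> (snd p)) \<in> borel_measurable lborel"
      using mfst[OF continuous_eta] msnd[OF \<kappa>c(2)] by simp
    show "\<bar>eta r (fst p) * deriv \<kappa> (snd p)\<bar> \<le> 1 * K2" for p
      unfolding abs_mult using K2 K eta_bounds by (intro mult_mono) (auto simp: abs_of_nonneg)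
  qed
  \<comment> \<open>The parts of the integrals above the gap that do not depend on \<open>v\<close>.
    They only multiply odd functions, so they disappear after integration and the choice of
    \<open>\<kappa>\<close> leaves no trace.\<close>
  define X1 where "X1 = (\<integral>z. indicator {m..} z * \<kappa> z \<partial>lborel) + (m - h)"
  define Y1 where "Y1 = (\<integral>z. indicator {m..} z * ((z - h) * \<kappa> z) \<partial>lborel) + (m - h)\<^sup>2 / 2"
  let ?S = "\<lambda>v. \<integral>z. uu 1 (v, z) * (- (rho r v * v $ 1) * \<kappa> z) + uu 2 (v, z) * (- (rho r v * v $ 2) * \<kappa> z)
         + uu 3 (v, z) * (eta r v * deriv \<kappa> z) \<partial>lborel"
  let ?T = "\<lambda>v. - (rho r v * v $ 1 * J 1 v + rho r v * v $ 2 * J 2 v) + rho r v * (l v * (\<tau> v - h)) + rho r v * (q v * ((\<tau> v - h)\<^sup>2 / 2))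
      - X1 * (rho r v * l v) - Y1 * (rho r v * q v) - V * eta r v + eta r v * q v"
  have "0 = (\<integral>v. ?S v \<partial>lborel)"
    using flux[OF \<kappa>(1)] lborel_slice_integral[OF Bochner_Integration.integrable_add[OF Bochner_Integration.integrable_add[OF i1 i1] i3], of 1 1 2 2] by simp
  also have "\<dots> = (\<integral>v. ?T v \<partial>lborel)"
  proof (rule integral_cong_AE)
    show "?S \<in> borel_measurable lborel"
      using lborel_slice_integrable[OF Bochner_Integration.integrable_add[OF Bochner_Integration.integrable_add[OF i1 i1] i3], of 1 1 2 2] by auto
    have 1: "integrable lborel (\<lambda>v. rho r v * (l v * (\<tau> v - h)))" "integrable lborel (\<lambda>v. rho r v * (q v * ((\<tau> v - h)\<^sup>2 / 2)))"
      "integrable lborel (\<lambda>v. rho r v * l v)" "integrable lborel (\<lambda>v. rho r v * q v)" "integrable lborel (\<lambda>v. eta r v * 1)" "integrable lborel (\<lambda>v. eta r v * q v)"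
      by (intro integrable_rho_times[OF r(2,1)] integrable_eta_times[OF r(2,1)] continuous_intros continuous_l continuous_q \<tau>c; simp)+
    have 2: "integrable lborel (\<lambda>v. rho r v * v $ k * J k' v)" for k k' by (rule rho_component_integrable[OF J_integrable])
    have "integrable lborel ?T"
      using 1 2[of 1 1] 2[of 2 2] by (intro Bochner_Integration.integrable_add Bochner_Integration.integrable_diff Bochner_Integration.integrable_minus integrable_mult_right) simp_all
    then show "?T \<in> borel_measurable lborel" by auto
    show "AE v in lborel. ?S v = ?T v"
      using AE_lborel_slice_integrable[OF uui[of 1]] AE_lborel_slice_integrable[OF uui[of 2]] AE_lborel_slice_integrable[OF uui[of 3]]
        AE_lborel_prodD[OF uu0[of 1]] AE_lborel_prodD[OF uu0[of 2]] AE_lborel_prodD[OF uu0[of 3]]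
        AE_lborel_prodD[OF top1] AE_lborel_prodD[OF top2] AE_lborel_prodD[OF top3]
    proof eventually_elim
      case (elim v)
      show ?case
      proof (cases "norm v < r")
        case False
        then show ?thesis using eta_rho_0[OF r(1), of v] by simp
      next
        case True
        then have v: "norm v < R" using r by simp
        have \<tau>m: "- m \<le> \<tau> v" "\<tau> v \<le> m" using bd[OF v] by auto
        note ci = cutoff_integrals[OF \<kappa> \<tau>m]
        have g1: "\<kappa> t = 1" if "t \<in> {- m<..<m}" for t using that \<kappa>(2) by auto
        have U: "integrable lborel (\<lambda>z. indicator {\<tau> v..} z * ((A + B * (z - h)) * \<kappa> z))"
          "(\<integral>z. indicator {\<tau> v..} z * ((A + B * (z - h)) * \<kappa> z) \<partial>lborel) = A * (X1 - (\<tau> v - h)) + B * (Y1 - (\<tau> v - h)\<^sup>2 / 2)" for A B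
        proof -
          have eq: "(\<lambda>z. indicator {\<tau> v..} z * ((A + B * (z - h)) * \<kappa> z)) = (\<lambda>z. A * (indicator {\<tau> v..} z * \<kappa> z) + B * (indicator {\<tau> v..} z * ((z - h) * \<kappa> z)))"
            by (auto simp: algebra_simps)
          show "integrable lborel (\<lambda>z. indicator {\<tau> v..} z * ((A + B * (z - h)) * \<kappa> z))" unfolding eq using ci(1) ci(2)[of h] by simp
          show "(\<integral>z. indicator {\<tau> v..} z * ((A + B * (z - h)) * \<kappa> z) \<partial>lborel) = A * (X1 - (\<tau> v - h)) + B * (Y1 - (\<tau> v - h)\<^sup>2 / 2)"
            unfolding eq using ci(1) ci(2)[of h] ci(4)[of h] ci(5)[of h] by (simp add: X1_def Y1_def)
        qed
        have e1: "(\<integral>z. uu 1 (v, z) * \<kappa> z \<partial>lborel) = 1 * J 1 v + ((c1 - w * v $ 2) * (X1 - (\<tau> v - h)) + a * (Y1 - (\<tau> v - h)\<^sup>2 / 2))"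
          unfolding U(2)[symmetric]
          by (rule uu_slice_integral[OF \<kappa>c(1) \<kappa>0 g1 v elim(1) _ _ U(1)]) (use elim(4,7) v in auto)
        have e2: "(\<integral>z. uu 2 (v, z) * \<kappa> z \<partial>lborel) = 1 * J 2 v + ((c2 + w * v $ 1) * (X1 - (\<tau> v - h)) + b * (Y1 - (\<tau> v - h)\<^sup>2 / 2))"
          unfolding U(2)[symmetric]
          by (rule uu_slice_integral[OF \<kappa>c(1) \<kappa>0 g1 v elim(2) _ _ U(1)]) (use elim(5,8) v in auto)
        have e3: "(\<integral>z. uu 3 (v, z) * deriv \<kappa> z \<partial>lborel) = - (V - q v)"
        proof -
          have eq: "(\<lambda>z. indicator {\<tau> v..} z * ((V - q v) * deriv \<kappa> z)) = (\<lambda>z. (V - q v) * (indicator {\<tau> v..} z * deriv \<kappa> z))" by (auto simp: algebra_simps)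
          have Ui: "integrable lborel (\<lambda>z. indicator {\<tau> v..} z * ((V - q v) * deriv \<kappa> z))" unfolding eq using ci(3) by simp
          have "(\<integral>z. uu 3 (v, z) * deriv \<kappa> z \<partial>lborel) = 0 * J 3 v + (\<integral>z. indicator {\<tau> v..} z * ((V - q v) * deriv \<kappa> z) \<partial>lborel)"
            by (rule uu_slice_integral[OF \<kappa>c(2) \<kappa>d0 \<kappa>d1 v elim(3) _ _ Ui]) (use elim(6,9) v in \<open>auto simp: q_def algebra_simps\<close>)
          also have "\<dots> = - (V - q v)" unfolding eq using ci(6) by simp
          finally show ?thesis .
        qed
        have ig: "integrable lborel (\<lambda>z. uu 1 (v, z) * \<kappa> z)" "integrable lborel (\<lambda>z. uu 2 (v, z) * \<kappa> z)" "integrable lborel (\<lambda>z. uu 3 (v, z) * deriv \<kappa> z)"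
          using integrable_times_bounded[OF elim(1) _ K1] integrable_times_bounded[OF elim(2) _ K1] integrable_times_bounded[OF elim(3) _ K2]
            borel_measurable_continuous_onI[OF \<kappa>c(1)] borel_measurable_continuous_onI[OF \<kappa>c(2)] by auto
        have "?S v = (\<integral>z. (- (rho r v * v $ 1)) * (uu 1 (v, z) * \<kappa> z) + (- (rho r v * v $ 2)) * (uu 2 (v, z) * \<kappa> z) + eta r v * (uu 3 (v, z) * deriv \<kappa> z) \<partial>lborel)"
          by (intro Bochner_Integration.integral_cong) (auto simp: mult_ac)
        also have "\<dots> = (- (rho r v * v $ 1)) * (\<integral>z. uu 1 (v, z) * \<kappa> z \<partial>lborel) + (- (rho r v * v $ 2)) * (\<integral>z. uu 2 (v, z) * \<kappa> z \<partial>lborel) + eta r v * (\<integral>z. uu 3 (v, z) * deriv \<kappa> z \<partial>lborel)"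
          using ig by simp
        also have "\<dots> = ?T v" unfolding e1 e2 e3 l_def q_def by (simp add: algebra_simps)
        finally show ?thesis .
      qed
    qed
  qed
  also have "\<dots> = - (\<integral>v. rho r v * v $ 1 * J 1 v + rho r v * v $ 2 * J 2 v \<partial>lborel) + (\<integral>v. rho r v * (l v * (\<tau> v - h)) \<partial>lborel) + (\<integral>v. rho r v * (q v * ((\<tau> v - h)\<^sup>2 / 2)) \<partial>lborel)
      - V * (\<integral>v. eta r v \<partial>lborel)"
  proof -
    have 1: "integrable lborel (\<lambda>v. rho r v * (l v * (\<tau> v - h)))" "integrable lborel (\<lambda>v. rho r v * (q v * ((\<tau> v - h)\<^sup>2 / 2)))"
      "integrable lborel (\<lambda>v. rho r v * l v)" "integrable lborel (\<lambda>v. rho r v * q v)" "integrable lborel (\<lambda>v. eta r v * 1)" "integrable lborel (\<lambda>v. eta r v * q v)"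
      by (intro integrable_rho_times[OF r(2,1)] integrable_eta_times[OF r(2,1)] continuous_intros continuous_l continuous_q \<tau>c; simp)+
    have 2: "integrable lborel (\<lambda>v. rho r v * v $ k * J k' v)" for k k' by (rule rho_component_integrable[OF J_integrable])
    have 3: "integrable lborel (\<lambda>v. rho r v * v $ 1 * J 1 v + rho r v * v $ 2 * J 2 v)" using 2[of 1 1] 2[of 2 2] by simp
    \<comment> \<open>The weights are even while \<open>l\<close> and \<open>q\<close> are
      odd.\<close>
    have z: "(\<integral>v. rho r v * l v \<partial>lborel) = 0" "(\<integral>v. rho r v * q v \<partial>lborel) = 0" "(\<integral>v. eta r v * q v \<partial>lborel) = 0"
      using 1 by (auto intro!: odd_integral simp: rho_even l_odd q_odd)
    have comb: "(\<integral>v. - A v + B v + C v - X * D v - Y * E v - W * F v + G v \<partial>lborel) = - (\<integral>v. A v \<partial>lborel) + (\<integral>v. B v \<partial>lborel) + (\<integral>v. C v \<partial>lborel)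
        - X * (\<integral>v. D v \<partial>lborel) - Y * (\<integral>v. E v \<partial>lborel) - W * (\<integral>v. F v \<partial>lborel) + (\<integral>v. G v \<partial>lborel)"
      if "integrable lborel A" "integrable lborel B" "integrable lborel C" "integrable lborel D" "integrable lborel E" "integrable lborel F" "integrable lborel G"
      for A B C D E F G :: "real^2 \<Rightarrow> real" and X Y W :: real
      using that by simp
    have eta: "integrable lborel (eta r)" using 1(5) by simp
    show ?thesis unfolding comb[OF 3 1(1,2,3,4) eta 1(6)] z by simp
  qed
  finally show ?thesis by simp
qed

end

section \<open>Estimates derived from the flux identity\<close>

context gap
begin

definition "A k v = (\<integral>t. indicator Gs (v, t) * \<bar>pp k (v, t)\<bar> \<partial>lborel)"
definition "aa k = (\<integral>p. indicator Gs p * \<bar>pp k p\<bar> \<partial>lborel)"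

lemma A_integrable: "integrable lborel (A k)" and A_integral: "(\<integral>v. A k v \<partial>lborel) = aa k" and A_nonneg: "0 \<le> A k v"
proof -
  have i: "integrable lborel (\<lambda>p. indicator Gs p * \<bar>pp k p\<bar>)" using integrable_Gs[OF integrable_abs[OF ppi]] .
  show "integrable lborel (A k)" unfolding A_def[abs_def] by (rule lborel_slice_integrable[OF i])
  show "(\<integral>v. A k v \<partial>lborel) = aa k" unfolding A_def aa_def by (rule lborel_slice_integral[OF i, symmetric])
  show "0 \<le> A k v" unfolding A_def by (intro Bochner_Integration.integral_nonneg) auto
qed

lemma slice_bound:
  assumes v: "norm v < R" and i: "integrable lborel (\<lambda>t. pp k (v, t))" and z0: "AE t in lborel. t \<le> \<beta> v \<longrightarrow> pp k (v, t) = 0"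
    and z: "z \<le> \<tau> v"
  shows "\<bar>\<integral>t. indicator {..<z} t * pp k (v, t) \<partial>lborel\<bar> \<le> A k v"
proof -
  have i1: "integrable lborel (\<lambda>t. indicator {..<z} t * pp k (v, t))" using integrable_mult_indicator[OF _ i, of "{..<z}"] by simp
  have i2: "integrable lborel (\<lambda>t. indicator Gs (v, t) * \<bar>pp k (v, t)\<bar>)"
    using integrable_mult_indicator[OF _ integrable_abs[OF i], of "{\<beta> v<..<\<tau> v}"] by (simp add: indicator_Gs[OF v])
  have "\<bar>\<integral>t. indicator {..<z} t * pp k (v, t) \<partial>lborel\<bar> \<le> (\<integral>t. \<bar>indicator {..<z} t * pp k (v, t)\<bar> \<partial>lborel)" by (rule integral_abs_bound)
  also have "\<dots> \<le> A k v" unfolding A_def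
  proof (rule integral_mono_AE[OF integrable_abs[OF i1] i2])
    show "AE t in lborel. \<bar>indicator {..<z} t * pp k (v, t)\<bar> \<le> indicator Gs (v, t) * \<bar>pp k (v, t)\<bar>"
      using z0 by eventually_elim (use z v in \<open>auto simp: Gs_def abs_mult indicator_def\<close>)
  qed
  finally show ?thesis .
qed

text \<open>The value of the component at the top of the gap, recovered from its vertical derivative
  because the field vanishes at the bottom. It equals the rigid velocity there and is at the same
  time bounded by the gradient; this double role controls the rigid motion.\<close>

definition "Pt k v = (\<integral>t. indicator {..<\<tau> v} t * pp k (v, t) \<partial>lborel)"

lemma top_values:
  "AE v in lborel. norm v < R \<longrightarrow> Pt 1 v = c1 - w * v $ 2 + a * (\<tau> v - h) \<and> Pt 2 v = c2 + w * v $ 1 + b * (\<tau> v - h) \<and> Pt 3 v = V - q v"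
  using AE_lborel_slice_integrable[OF ppi[of 1]] AE_lborel_slice_integrable[OF ppi[of 2]] AE_lborel_slice_integrable[OF ppi[of 3]]
    slice[of 1] slice[of 2] slice[of 3] AE_lborel_prodD[OF top1] AE_lborel_prodD[OF top2] AE_lborel_prodD[OF top3]
proof eventually_elim
  case (elim v)
  show ?case
  proof (intro impI conjI)
    assume v: "norm v < R"
    have \<tau>s: "- s < \<tau> v" "\<tau> v < s" using bd[OF v] m by auto
    have 1: "AE z in lborel. - s < z \<and> z < s \<longrightarrow> uu k (v, z) = (\<integral>t. indicator {..<z} t * pp k (v, t) \<partial>lborel)" if "k = 1 \<or> k = 2 \<or> k = 3" for k
      using that elim(4-6) v by blast
    have "AE z in lborel. \<tau> v < z \<and> z < s \<longrightarrow> c1 - w * v $ 2 + a * (z - h) = (\<integral>t. indicator {..<z} t * pp 1 (v, t) \<partial>lborel)"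
      using 1[of 1, simplified] elim(7) by eventually_elim (use v \<tau>s in auto)
    from slice_top[OF elim(1) _ \<tau>s(2) this] show "Pt 1 v = c1 - w * v $ 2 + a * (\<tau> v - h)"
      unfolding Pt_def by (simp add: continuous_intros)
    have "AE z in lborel. \<tau> v < z \<and> z < s \<longrightarrow> c2 + w * v $ 1 + b * (z - h) = (\<integral>t. indicator {..<z} t * pp 2 (v, t) \<partial>lborel)"
      using 1[of 2, simplified] elim(8) by eventually_elim (use v \<tau>s in auto)
    from slice_top[OF elim(2) _ \<tau>s(2) this] show "Pt 2 v = c2 + w * v $ 1 + b * (\<tau> v - h)"
      unfolding Pt_def by (simp add: continuous_intros)
    have "AE z in lborel. \<tau> v < z \<and> z < s \<longrightarrow> V - q v = (\<integral>t. indicator {..<z} t * pp 3 (v, t) \<partial>lborel)"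
      using 1[of 3, simplified] elim(9) by eventually_elim (use v \<tau>s in \<open>auto simp: q_def\<close>)
    from slice_top[OF elim(3) _ \<tau>s(2) this] show "Pt 3 v = V - q v"
      unfolding Pt_def by (simp add: continuous_intros)
  qed
qed

lemma Pt_bound: "AE v in lborel. norm v < R \<longrightarrow> \<bar>Pt k v\<bar> \<le> A k v"
  using AE_lborel_slice_integrable[OF ppi[of k]] AE_lborel_prodD[OF pp0[of k]]
proof eventually_elim
  case (elim v)
  show ?case unfolding Pt_def
    by (intro impI slice_bound elim(1) order_refl) (use elim(2) in auto)
qed

definition "bi f = (\<integral>v. indicator (ball (0::real^2) r) v * \<bar>f v :: real\<bar> \<partial>lborel)"

lemma ball_integrable:
  fixes f :: "real^2 \<Rightarrow> real"
  assumes "continuous_on (ball 0 R) f"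
  shows "integrable lborel (\<lambda>v. indicator (ball (0::real^2) r) v * \<bar>f v\<bar>)"
proof -
  have "continuous_on (cball 0 r) (\<lambda>v. \<bar>f v\<bar>)"
    by (intro continuous_intros continuous_on_subset[OF assms]) (use r in auto)
  then have "integrable lborel (\<lambda>v. indicator (cball 0 r) v *\<^sub>R \<bar>f v\<bar>)" by (intro borel_integrable_compact) auto
  then have "integrable lborel (\<lambda>v. indicator (ball 0 r) v *\<^sub>R (indicator (cball 0 r) v *\<^sub>R \<bar>f v\<bar>))" by (rule integrable_mult_indicator[rotated]) simp
  moreover have "(\<lambda>v. indicator (ball 0 r) v *\<^sub>R (indicator (cball 0 r) v *\<^sub>R \<bar>f v\<bar>)) = (\<lambda>v. indicator (ball (0::real^2) r) v * \<bar>f v\<bar>)"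
    by (auto simp: indicator_def fun_eq_iff)
  ultimately show ?thesis by simp
qed

text \<open>The vertical velocity at the top is \<open>V - q v\<close>. Reflection of the disc turns
  it into \<open>V + q v\<close> with the same integral, and the triangle inequality extracts
  \<open>q\<close> without any bound on \<open>V\<close>.\<close>

lemma bi_q: "bi q \<le> aa 3"
proof -
  have c: "continuous_on (ball 0 R) (\<lambda>v. V - q v)" "continuous_on (ball 0 R) (\<lambda>v. V + q v)" by (intro continuous_intros continuous_q)+
  have 1: "bi (\<lambda>v. V - q v) \<le> aa 3" unfolding bi_def A_integral[symmetric]
  proof (rule integral_mono_AE[OF ball_integrable[OF c(1)] A_integrable])
    show "AE v in lborel. indicator (ball 0 r) v * \<bar>V - q v\<bar> \<le> A 3 v"
      using top_values Pt_bound[of 3] by eventually_elim (use r A_nonneg in \<open>auto simp: indicator_def\<close>)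
  qed
  have "bi (\<lambda>v. V + q v) = bi (\<lambda>v. V - q v)"
  proof -
    have m: "(\<lambda>v. indicator (ball (0::real^2) r) v * \<bar>V - q v\<bar>) \<in> borel_measurable borel" using ball_integrable[OF c(1)] by auto
    show ?thesis unfolding bi_def integral_reflect_lborel[OF m, symmetric] by (simp add: q_odd indicator_def)
  qed
  moreover have "bi q \<le> (\<integral>v. 1/2 * (indicator (ball (0::real^2) r) v * \<bar>V + q v\<bar>) + 1/2 * (indicator (ball (0::real^2) r) v * \<bar>V - q v\<bar>) \<partial>lborel)"
    unfolding bi_def
  proof (intro integral_mono ball_integrable continuous_q Bochner_Integration.integrable_add integrable_mult_right c)
    fix v :: "real^2"
    have "2 * \<bar>q v\<bar> \<le> \<bar>V + q v\<bar> + \<bar>V - q v\<bar>" using abs_triangle_ineq4[of "V + q v" "V - q v"] by simp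
    then have "\<bar>q v\<bar> \<le> 1/2 * \<bar>V + q v\<bar> + 1/2 * \<bar>V - q v\<bar>" by simp
    then show "indicator (ball 0 r) v * \<bar>q v\<bar> \<le> 1/2 * (indicator (ball 0 r) v * \<bar>V + q v\<bar>) + 1/2 * (indicator (ball 0 r) v * \<bar>V - q v\<bar>)"
      by (cases "v \<in> ball 0 r") (simp_all only: indicator_simps, simp_all)
  qed
  moreover have "\<dots> = 1/2 * bi (\<lambda>v. V + q v) + 1/2 * bi (\<lambda>v. V - q v)"
    unfolding bi_def using ball_integrable[OF c(1)] ball_integrable[OF c(2)] by simp
  ultimately show ?thesis using 1 by linarith
qed

text \<open>Pairing the top velocity with \<open>v\<close> removes the rotation \<open>w\<close>,
  gains a factor \<open>r\<close>, and leaves \<open>l\<close> up to a multiple of \<open>q\<close>,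
  for which \<open>bi_q\<close> is available.\<close>

lemma bi_l:
  assumes G: "\<And>v. norm v < R \<Longrightarrow> \<bar>\<tau> v - h\<bar> \<le> G"
  shows "bi l \<le> r * (aa 1 + aa 2) + G * aa 3"
proof -
  have G0: "0 \<le> G" using G[of 0] r by auto
  have qi: "integrable lborel (\<lambda>v. indicator (ball (0::real^2) r) v * \<bar>q v\<bar>)" by (rule ball_integrable[OF continuous_q])
  have "bi l \<le> (\<integral>v. r * A 1 v + r * A 2 v + G * (indicator (ball (0::real^2) r) v * \<bar>q v\<bar>) \<partial>lborel)"
    unfolding bi_def
  proof (rule integral_mono_AE)
    show "integrable lborel (\<lambda>v. r * A 1 v + r * A 2 v + G * (indicator (ball (0::real^2) r) v * \<bar>q v\<bar>))"
      using A_integrable qi by (intro Bochner_Integration.integrable_add integrable_mult_right)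
    show "AE v in lborel. indicator (ball 0 r) v * \<bar>l v\<bar> \<le> r * A 1 v + r * A 2 v + G * (indicator (ball (0::real^2) r) v * \<bar>q v\<bar>)"
      using top_values Pt_bound[of 1] Pt_bound[of 2]
    proof eventually_elim
      case (elim v)
      show ?case
      proof (cases "norm v < r")
        case True
        then have v: "norm v < R" using r by simp
        have P: "Pt 1 v = c1 - w * v $ 2 + a * (\<tau> v - h)" "Pt 2 v = c2 + w * v $ 1 + b * (\<tau> v - h)" using elim(1) v by auto
        \<comment> \<open>The two terms with \<open>w\<close> cancel here.\<close>
        have eq: "l v = v $ 1 * Pt 1 v + v $ 2 * Pt 2 v - q v * (\<tau> v - h)"
          unfolding P by (simp add: l_def q_def algebra_simps)
        have "\<bar>v $ 1 * Pt 1 v\<bar> \<le> r * A 1 v" "\<bar>v $ 2 * Pt 2 v\<bar> \<le> r * A 2 v"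
          unfolding abs_mult using elim v True norm2[of v] r A_nonneg by (auto intro!: mult_mono)
        moreover have "\<bar>q v * (\<tau> v - h)\<bar> \<le> G * \<bar>q v\<bar>" unfolding abs_mult using mult_right_mono[OF G[OF v], of "\<bar>q v\<bar>"] by (simp add: mult.commute)
        ultimately have "\<bar>l v\<bar> \<le> r * A 1 v + r * A 2 v + G * \<bar>q v\<bar>" unfolding eq by linarith
        then show ?thesis using True by simp
      next
        case False
        then show ?thesis using r A_nonneg[of 1 v] A_nonneg[of 2 v] by (simp add: mult_nonneg_nonneg)
      qed
    qed
  qed (rule ball_integrable[OF continuous_l])
  also have "\<dots> = r * (aa 1 + aa 2) + G * bi q"
    using A_integrable qi by (simp add: A_integral bi_def algebra_simps)
  also have "\<dots> \<le> r * (aa 1 + aa 2) + G * aa 3" using bi_q G0 by (simp add: mult_left_mono)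
  finally show ?thesis .
qed

lemma rho_integral_bound:
  assumes f: "continuous_on (ball 0 R) f" and g: "continuous_on (ball 0 R) g" and K: "\<And>v. norm v < r \<Longrightarrow> \<bar>g v\<bar> \<le> K"
  shows "\<bar>\<integral>v. rho r v * (f v * g v) \<partial>lborel\<bar> \<le> 4 / r\<^sup>2 * K * bi f"
proof -
  have i: "integrable lborel (\<lambda>v. rho r v * (f v * g v))" by (intro integrable_rho_times[OF r(2,1)] continuous_intros f g)
  have "\<bar>\<integral>v. rho r v * (f v * g v) \<partial>lborel\<bar> \<le> (\<integral>v. \<bar>rho r v * (f v * g v)\<bar> \<partial>lborel)" by (rule integral_abs_bound)
  also have "\<dots> \<le> (\<integral>v. 4 / r\<^sup>2 * K * (indicator (ball 0 r) v * \<bar>f v\<bar>) \<partial>lborel)"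
  proof (rule integral_mono[OF integrable_abs[OF i]])
    show "integrable lborel (\<lambda>v. 4 / r\<^sup>2 * K * (indicator (ball 0 r) v * \<bar>f v\<bar>))" using ball_integrable[OF f] by simp
    fix v
    show "\<bar>rho r v * (f v * g v)\<bar> \<le> 4 / r\<^sup>2 * K * (indicator (ball 0 r) v * \<bar>f v\<bar>)"
    proof (cases "norm v < r")
      case True
      have "rho r v * (\<bar>g v\<bar> * \<bar>f v\<bar>) \<le> 4 / r\<^sup>2 * (K * \<bar>f v\<bar>)"
        using rho_bounds[OF r(1), of v] K[OF True] by (intro mult_mono) auto
      then show ?thesis using True rho_bounds(1)[OF r(1), of v] by (simp add: abs_mult mult_ac)
    next
      case False
      then show ?thesis using eta_rho_0[OF r(1), of v] by simp
    qed
  qed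
  also have "\<dots> = 4 / r\<^sup>2 * K * bi f" unfolding bi_def by simp
  finally show ?thesis .
qed

text \<open>The weight is even and \<open>f\<close> is odd, so the even part of \<open>g\<close>
  integrates to zero and only its odd part has to be small.\<close>

lemma rho_odd_bound:
  assumes f: "continuous_on (ball 0 R) f" "\<And>v. f (- v) = - f v" and g: "continuous_on (ball 0 R) g"
    and K: "\<And>v. norm v < r \<Longrightarrow> \<bar>g v - g (- v)\<bar> \<le> K"
  shows "\<bar>\<integral>v. rho r v * (f v * g v) \<partial>lborel\<bar> \<le> 2 / r\<^sup>2 * K * bi f"
proof -
  have g': "continuous_on (ball 0 R) (\<lambda>v. g (- v))"
    by (rule continuous_on_compose2[OF g]) (auto intro!: continuous_intros)
  have i: "integrable lborel (\<lambda>v. rho r v * (f v * g v))" "integrable lborel (\<lambda>v. rho r v * (f v * g (- v)))"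
    by (intro integrable_rho_times[OF r(2,1)] continuous_intros f g g')+
  have "(\<integral>v. rho r v * (f v * g v) \<partial>lborel) = (\<integral>v. rho r (- v) * (f (- v) * g (- v)) \<partial>lborel)"
    using integral_reflect_lborel[of "\<lambda>v. rho r v * (f v * g v)"] i by auto
  also have "\<dots> = - (\<integral>v. rho r v * (f v * g (- v)) \<partial>lborel)" by (simp add: rho_even f(2))
  finally have "2 * (\<integral>v. rho r v * (f v * g v) \<partial>lborel) = (\<integral>v. rho r v * (f v * g v) - rho r v * (f v * g (- v)) \<partial>lborel)"
    using i by simp
  also have "\<dots> = (\<integral>v. rho r v * (f v * (g v - g (- v))) \<partial>lborel)" by (simp add: algebra_simps)
  finally have "2 * \<bar>\<integral>v. rho r v * (f v * g v) \<partial>lborel\<bar> = \<bar>\<integral>v. rho r v * (f v * (g v - g (- v))) \<partial>lborel\<bar>" by linarith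
  also have "\<dots> \<le> 4 / r\<^sup>2 * K * bi f" by (intro rho_integral_bound f continuous_intros g g' K)
  finally show ?thesis by simp
qed

text \<open>Insert the trapezoidal values into \<open>flux_formula\<close>. The factor of
  \<open>l\<close> becomes half of \<open>\<tau> - h + \<beta>\<close>, minus the constant
  \<open>h / 2\<close> which oddness removes; its odd part is bounded by \<open>K\<close>. The
  factor of \<open>q\<close> becomes half of \<open>(\<tau> - h) * (\<beta> - h)\<close>, which is
  already of second order in the heights.\<close>

lemma core_estimate:
  assumes G: "\<And>v. norm v < R \<Longrightarrow> \<bar>\<tau> v - h\<bar> \<le> G" "\<And>v. norm v < R \<Longrightarrow> \<bar>\<beta> v\<bar> \<le> G" and h: "0 \<le> h"
    and pos: "\<And>v. norm v < R \<Longrightarrow> \<beta> v < \<tau> v"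
    and K: "\<And>v. norm v < r \<Longrightarrow> \<bar>\<tau> v - \<tau> (- v)\<bar> \<le> K" "\<And>v. norm v < r \<Longrightarrow> \<bar>\<beta> v - \<beta> (- v)\<bar> \<le> K"
    and hhi: "\<And>k. integrable lborel (hh k)"
    and hh: "\<And>k. AE v in lborel. norm v < R \<longrightarrow> (AE t1 in lborel. AE t2 in lborel. t1 \<in> {\<beta> v<..<\<tau> v} \<and> t2 \<in> {\<beta> v<..<\<tau> v} \<longrightarrow>
       \<bar>pp k (v, t1) - pp k (v, t2)\<bar> \<le> (\<integral>t. \<bar>hh k (v, t)\<bar> \<partial>lborel))"
  shows "\<bar>V\<bar> * (\<integral>v. eta r v \<partial>lborel) \<le> 2 / r\<^sup>2 * (K * (r * (aa 1 + aa 2) + G * aa 3) + (G\<^sup>2 + h * G) * aa 3)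
     + 2 * (h + 2 * G)\<^sup>2 / r * ((\<integral>p. \<bar>hh 1 p\<bar> \<partial>lborel) + (\<integral>p. \<bar>hh 2 p\<bar> \<partial>lborel))"
proof -
  define N where "N k v = (\<integral>t. \<bar>hh k (v, t)\<bar> \<partial>lborel)" for k :: 3 and v
  have Ni: "integrable lborel (N k)" for k unfolding N_def[abs_def] by (rule lborel_slice_integrable[OF integrable_abs[OF hhi]])
  have NI: "(\<integral>v. N k v \<partial>lborel) = (\<integral>p. \<bar>hh k p\<bar> \<partial>lborel)" for k
    unfolding N_def by (rule lborel_slice_integral[OF integrable_abs[OF hhi], symmetric])
  have N0: "0 \<le> N k v" for k v unfolding N_def by (intro Bochner_Integration.integral_nonneg) auto
  have G0: "0 \<le> G" using G(2)[of 0] r by auto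
  \<comment> \<open>The height of the gap is at most \<open>h + 2 * G\<close>, which gives a bound
    that no longer varies with \<open>v\<close>.\<close>
  have trap: "AE v in lborel. norm v < R \<longrightarrow> \<bar>J k v - (\<tau> v - \<beta> v) / 2 * Pt k v\<bar> \<le> (h + 2 * G)\<^sup>2 / 2 * N k v" for k
    using AE_lborel_slice_integrable[OF ppi[of k]] AE_lborel_slice_integrable[OF uui[of k]] slice[of k] AE_lborel_prodD[OF pp0[of k]] hh[of k]
  proof eventually_elim
    case (elim v)
    show ?case
    proof
      assume v: "norm v < R"
      have \<tau>s: "- s < \<beta> v" "\<tau> v < s" using bd[OF v] m by auto
      have u: "AE z in lborel. z \<in> {\<beta> v<..<\<tau> v} \<longrightarrow> uu k (v, z) = (\<integral>t. indicator {..<z} t * pp k (v, t) \<partial>lborel)"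
        using elim(3)[rule_format, OF v] by eventually_elim (use \<tau>s in auto)
      have z0: "AE t in lborel. t \<le> \<beta> v \<longrightarrow> pp k (v, t) = 0" using elim(4) by eventually_elim (use v in auto)
      have "\<bar>J k v - (\<tau> v - \<beta> v) / 2 * Pt k v\<bar> \<le> (\<tau> v - \<beta> v)\<^sup>2 / 2 * N k v"
        unfolding J_def indicator_Gs[OF v] Pt_def N_def
        by (rule trapezoid[OF elim(1) pos[OF v] u _ z0 elim(5)[rule_format, OF v]]) (use elim(2) in auto)
      also have "\<dots> \<le> (h + 2 * G)\<^sup>2 / 2 * N k v"
      proof (intro mult_right_mono N0 divide_right_mono power_mono)
        show "\<tau> v - \<beta> v \<le> h + 2 * G" "0 \<le> \<tau> v - \<beta> v" using G(1)[OF v] G(2)[OF v] pos[OF v] by linarith+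
      qed simp
      finally show "\<bar>J k v - (\<tau> v - \<beta> v) / 2 * Pt k v\<bar> \<le> (h + 2 * G)\<^sup>2 / 2 * N k v" .
    qed
  qed
  let ?e = "\<lambda>v. (rho r v * v $ 1 * J 1 v + rho r v * v $ 2 * J 2 v) - rho r v * ((\<tau> v - \<beta> v) / 2 * (l v + q v * (\<tau> v - h)))"
  have i1: "integrable lborel (\<lambda>v. rho r v * v $ 1 * J 1 v + rho r v * v $ 2 * J 2 v)"
    by (intro Bochner_Integration.integrable_add rho_component_integrable J_integrable)
  have i2: "integrable lborel (\<lambda>v. rho r v * ((\<tau> v - \<beta> v) / 2 * (l v + q v * (\<tau> v - h))))"
    by (intro integrable_rho_times[OF r(2,1)] continuous_intros continuous_l continuous_q \<tau>c \<beta>c) auto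
  have ei: "integrable lborel ?e" using i1 i2 by (rule Bochner_Integration.integrable_diff)
  have eb: "\<bar>\<integral>v. ?e v \<partial>lborel\<bar> \<le> 2 * (h + 2 * G)\<^sup>2 / r * ((\<integral>p. \<bar>hh 1 p\<bar> \<partial>lborel) + (\<integral>p. \<bar>hh 2 p\<bar> \<partial>lborel))"
  proof -
    let ?c = "4 / r * ((h + 2 * G)\<^sup>2 / 2)"
    have "\<bar>\<integral>v. ?e v \<partial>lborel\<bar> \<le> (\<integral>v. \<bar>?e v\<bar> \<partial>lborel)" by (rule integral_abs_bound)
    also have "\<dots> \<le> (\<integral>v. ?c * N 1 v + ?c * N 2 v \<partial>lborel)"
    proof (rule integral_mono_AE[OF integrable_abs[OF ei]])
      show "integrable lborel (\<lambda>v. ?c * N 1 v + ?c * N 2 v)" using Ni by (intro Bochner_Integration.integrable_add integrable_mult_right)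
      show "AE v in lborel. \<bar>?e v\<bar> \<le> ?c * N 1 v + ?c * N 2 v"
        using top_values trap[of 1] trap[of 2]
      proof eventually_elim
        case (elim v)
        show ?case
        proof (cases "norm v < r")
          case True
          then have v: "norm v < R" using r by simp
          have P: "Pt 1 v = c1 - w * v $ 2 + a * (\<tau> v - h)" "Pt 2 v = c2 + w * v $ 1 + b * (\<tau> v - h)" using elim(1) v by auto
          \<comment> \<open>The trapezoidal values see the rigid velocity only through its pairing
            with \<open>v\<close>, so again \<open>w\<close> is absent.\<close>
          have lq: "l v + q v * (\<tau> v - h) = v $ 1 * Pt 1 v + v $ 2 * Pt 2 v"
            unfolding P by (simp add: l_def q_def algebra_simps)
          have eq: "?e v = (rho r v * v $ 1) * (J 1 v - (\<tau> v - \<beta> v) / 2 * Pt 1 v) + (rho r v * v $ 2) * (J 2 v - (\<tau> v - \<beta> v) / 2 * Pt 2 v)"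
            unfolding lq by (simp add: algebra_simps)
          have "\<bar>(rho r v * v $ 1) * (J 1 v - (\<tau> v - \<beta> v) / 2 * Pt 1 v)\<bar> \<le> 4 / r * ((h + 2 * G)\<^sup>2 / 2 * N 1 v)"
            unfolding abs_mult[of "rho r v * v $ 1"] using elim(2) v rho_comp_bound[of v 1] r by (intro mult_mono) auto
          moreover have "\<bar>(rho r v * v $ 2) * (J 2 v - (\<tau> v - \<beta> v) / 2 * Pt 2 v)\<bar> \<le> 4 / r * ((h + 2 * G)\<^sup>2 / 2 * N 2 v)"
            unfolding abs_mult[of "rho r v * v $ 2"] using elim(3) v rho_comp_bound[of v 2] r by (intro mult_mono) auto
          ultimately show ?thesis unfolding eq by (simp only: mult.assoc)
        next
          case False
          have "0 \<le> ?c * N 1 v + ?c * N 2 v" using r N0 by (intro add_nonneg_nonneg mult_nonneg_nonneg) auto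
          then show ?thesis using False eta_rho_0[OF r(1), of v] by simp
        qed
      qed
    qed
    also have "\<dots> = ?c * (\<integral>p. \<bar>hh 1 p\<bar> \<partial>lborel) + ?c * (\<integral>p. \<bar>hh 2 p\<bar> \<partial>lborel)"
      using Ni by (simp add: NI)
    also have "\<dots> = 2 * (h + 2 * G)\<^sup>2 / r * ((\<integral>p. \<bar>hh 1 p\<bar> \<partial>lborel) + (\<integral>p. \<bar>hh 2 p\<bar> \<partial>lborel))"
      by (simp add: distrib_left)
    finally show ?thesis .
  qed
  have cg: "continuous_on (ball 0 R) (\<lambda>v. (\<tau> v - h + \<beta> v) / 2)" "continuous_on (ball 0 R) (\<lambda>v. (\<beta> v * (\<tau> v - h) - h * (\<tau> v - h)) / 2)"
    by (intro continuous_intros \<tau>c \<beta>c; simp)+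
  have j: "integrable lborel (\<lambda>v. rho r v * (l v * (\<tau> v - h)))" "integrable lborel (\<lambda>v. rho r v * (q v * ((\<tau> v - h)\<^sup>2 / 2)))"
      "integrable lborel (\<lambda>v. rho r v * l v)" "integrable lborel (\<lambda>v. rho r v * (l v * ((\<tau> v - h + \<beta> v) / 2)))"
      "integrable lborel (\<lambda>v. rho r v * (q v * ((\<beta> v * (\<tau> v - h) - h * (\<tau> v - h)) / 2)))"
    by (intro integrable_rho_times[OF r(2,1)] continuous_intros continuous_l continuous_q \<tau>c cg; simp)+
  have z: "(\<integral>v. rho r v * l v \<partial>lborel) = 0" using j(3) by (auto intro!: odd_integral simp: rho_even l_odd)
  have "(\<integral>v. rho r v * (l v * (\<tau> v - h)) \<partial>lborel) + (\<integral>v. rho r v * (q v * ((\<tau> v - h)\<^sup>2 / 2)) \<partial>lborel)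
     - (\<integral>v. rho r v * ((\<tau> v - \<beta> v) / 2 * (l v + q v * (\<tau> v - h))) \<partial>lborel)
    = (\<integral>v. rho r v * (l v * (\<tau> v - h)) + rho r v * (q v * ((\<tau> v - h)\<^sup>2 / 2)) - rho r v * ((\<tau> v - \<beta> v) / 2 * (l v + q v * (\<tau> v - h))) \<partial>lborel)"
    by (simp only: Bochner_Integration.integral_add[OF j(1,2)] Bochner_Integration.integral_diff[OF Bochner_Integration.integrable_add[OF j(1,2)] i2])
  \<comment> \<open>Pointwise algebra: \<open>(\<tau> - h) - (\<tau> - \<beta>) / 2\<close> is half
    of \<open>\<tau> - h + \<beta>\<close>, less \<open>h / 2\<close>, and the factors of
    \<open>q\<close> combine in the same way.\<close>
  also have "\<dots> = (\<integral>v. rho r v * (l v * ((\<tau> v - h + \<beta> v) / 2)) + rho r v * (q v * ((\<beta> v * (\<tau> v - h) - h * (\<tau> v - h)) / 2)) - h / 2 * (rho r v * l v) \<partial>lborel)"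
    by (intro Bochner_Integration.integral_cong refl) (simp add: field_simps power2_eq_square)
  also have "\<dots> = (\<integral>v. rho r v * (l v * ((\<tau> v - h + \<beta> v) / 2)) \<partial>lborel) + (\<integral>v. rho r v * (q v * ((\<beta> v * (\<tau> v - h) - h * (\<tau> v - h)) / 2)) \<partial>lborel)"
    by (simp only: Bochner_Integration.integral_add[OF j(4,5)] Bochner_Integration.integral_diff[OF Bochner_Integration.integrable_add[OF j(4,5)] integrable_mult_right[OF j(3)]] integral_mult_right_zero z mult_zero_right diff_zero)
  finally have main: "V * (\<integral>v. eta r v \<partial>lborel) = - (\<integral>v. ?e v \<partial>lborel) + (\<integral>v. rho r v * (l v * ((\<tau> v - h + \<beta> v) / 2)) \<partial>lborel)
     + (\<integral>v. rho r v * (q v * ((\<beta> v * (\<tau> v - h) - h * (\<tau> v - h)) / 2)) \<partial>lborel)"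
    using flux_formula unfolding Bochner_Integration.integral_diff[OF i1 i2] by linarith
  have b1: "\<bar>\<integral>v. rho r v * (l v * ((\<tau> v - h + \<beta> v) / 2)) \<partial>lborel\<bar> \<le> 2 / r\<^sup>2 * K * bi l"
  proof (rule rho_odd_bound[OF continuous_l l_odd cg(1)])
    fix v :: "real^2" assume "norm v < r"
    then have "\<bar>(\<tau> v - \<tau> (- v)) + (\<beta> v - \<beta> (- v))\<bar> \<le> 2 * K"
      using K[of v] abs_triangle_ineq[of "\<tau> v - \<tau> (- v)" "\<beta> v - \<beta> (- v)"] by linarith
    moreover have "(\<tau> v - h + \<beta> v) / 2 - (\<tau> (- v) - h + \<beta> (- v)) / 2 = ((\<tau> v - \<tau> (- v)) + (\<beta> v - \<beta> (- v))) / 2"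
      by (simp add: field_simps)
    ultimately show "\<bar>(\<tau> v - h + \<beta> v) / 2 - (\<tau> (- v) - h + \<beta> (- v)) / 2\<bar> \<le> K"
      by (simp only: abs_divide) (simp only: abs_numeral pos_divide_le_eq[OF zero_less_numeral] mult.commute[of K])
  qed
  have b2: "\<bar>\<integral>v. rho r v * (q v * ((\<beta> v * (\<tau> v - h) - h * (\<tau> v - h)) / 2)) \<partial>lborel\<bar> \<le> 4 / r\<^sup>2 * ((G\<^sup>2 + h * G) / 2) * bi q"
  proof (rule rho_integral_bound[OF continuous_q cg(2)])
    fix v :: "real^2" assume "norm v < r"
    then have v: "norm v < R" using r by simp
    have "\<bar>\<beta> v * (\<tau> v - h)\<bar> \<le> G\<^sup>2" "\<bar>h * (\<tau> v - h)\<bar> \<le> h * G"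
      unfolding abs_mult power2_eq_square using G(1)[OF v] G(2)[OF v] h G0 by (auto intro!: mult_mono)
    from order_trans[OF abs_triangle_ineq4 add_mono[OF this]]
    have "\<bar>\<beta> v * (\<tau> v - h) - h * (\<tau> v - h)\<bar> \<le> G\<^sup>2 + h * G" .
    then show "\<bar>(\<beta> v * (\<tau> v - h) - h * (\<tau> v - h)) / 2\<bar> \<le> (G\<^sup>2 + h * G) / 2"
      unfolding abs_divide abs_numeral by (rule divide_right_mono) simp
  qed
  have K0: "0 \<le> K" using K(1)[of 0] r by auto
  have "2 / r\<^sup>2 * K * bi l \<le> 2 / r\<^sup>2 * K * (r * (aa 1 + aa 2) + G * aa 3)"
    using bi_l[OF G(1)] K0 by (intro mult_left_mono) auto
  moreover have "4 / r\<^sup>2 * ((G\<^sup>2 + h * G) / 2) * bi q \<le> 4 / r\<^sup>2 * ((G\<^sup>2 + h * G) / 2) * aa 3"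
    using bi_q G0 h by (intro mult_left_mono) auto
  moreover have "\<bar>V\<bar> * (\<integral>v. eta r v \<partial>lborel) = \<bar>V * (\<integral>v. eta r v \<partial>lborel)\<bar>"
    using Bochner_Integration.integral_nonneg[of lborel "eta r"] eta_bounds(1) by (simp add: abs_mult)
  ultimately have "\<bar>V\<bar> * (\<integral>v. eta r v \<partial>lborel) \<le> 2 * (h + 2 * G)\<^sup>2 / r * ((\<integral>p. \<bar>hh 1 p\<bar> \<partial>lborel) + (\<integral>p. \<bar>hh 2 p\<bar> \<partial>lborel))
     + 2 / r\<^sup>2 * K * (r * (aa 1 + aa 2) + G * aa 3) + 4 / r\<^sup>2 * ((G\<^sup>2 + h * G) / 2) * aa 3"
    using main eb b1 b2 by linarith
  then show ?thesis by (simp add: algebra_simps add_divide_distrib)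
qed

text \<open>The gap integral is bounded by height times the vertical integral of the gradient,
  without Hessian, without parity of the graphs and without strict separation. The integrals of
  \<open>l\<close> and \<open>q\<close> are kept on the right, since at contact fixed bounds for
  them are good enough.\<close>

lemma core_estimate_rough:
  assumes G: "\<And>v. norm v < R \<Longrightarrow> \<bar>\<tau> v - h\<bar> \<le> G" and d: "\<And>v. norm v < R \<Longrightarrow> \<tau> v - \<beta> v \<le> d"
  shows "\<bar>V\<bar> * (\<integral>v. eta r v \<partial>lborel) \<le> 4 / r * d * (aa 1 + aa 2) + 4 / r\<^sup>2 * (G * bi l + G\<^sup>2 / 2 * bi q)"
proof -
  have Jb: "AE v in lborel. norm v < R \<longrightarrow> \<bar>J k v\<bar> \<le> d * A k v" for k
    using AE_lborel_slice_integrable[OF ppi[of k]] AE_lborel_slice_integrable[OF uui[of k]] slice[of k] AE_lborel_prodD[OF pp0[of k]]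
  proof eventually_elim
    case (elim v)
    show ?case
    proof
      assume v: "norm v < R"
      have \<tau>s: "- s < \<beta> v" "\<tau> v < s" "\<beta> v \<le> \<tau> v" using bd[OF v] m by auto
      have z0: "AE t in lborel. t \<le> \<beta> v \<longrightarrow> pp k (v, t) = 0" using elim(4) by eventually_elim (use v in auto)
      have iu: "integrable lborel (\<lambda>z. indicator {\<beta> v<..<\<tau> v} z * uu k (v, z))" using integrable_mult_indicator[OF _ elim(2), of "{\<beta> v<..<\<tau> v}"] by simp
      have "\<bar>J k v\<bar> \<le> (\<integral>z. \<bar>indicator {\<beta> v<..<\<tau> v} z * uu k (v, z)\<bar> \<partial>lborel)"
        unfolding J_def indicator_Gs[OF v] by (rule integral_abs_bound)
      also have "\<dots> \<le> (\<integral>z. A k v * indicator {\<beta> v<..<\<tau> v} z \<partial>lborel)"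
      proof (rule integral_mono_AE[OF integrable_abs[OF iu]])
        show "integrable lborel (\<lambda>z. A k v * indicator {\<beta> v<..<\<tau> v} z)"
          using \<tau>s by (intro integrable_mult_right integrable_real_indicator) auto
        show "AE z in lborel. \<bar>indicator {\<beta> v<..<\<tau> v} z * uu k (v, z)\<bar> \<le> A k v * indicator {\<beta> v<..<\<tau> v} z"
          using elim(3)[rule_format, OF v]
        proof eventually_elim
          case e: (elim z)
          show ?case
          proof (cases "z \<in> {\<beta> v<..<\<tau> v}")
            case True
            then have "uu k (v, z) = (\<integral>t. indicator {..<z} t * pp k (v, t) \<partial>lborel)" using e \<tau>s by auto
            then show ?thesis using slice_bound[OF v elim(1) z0, of z] True by simp
          qed simp
        qed
      qed
      also have "\<dots> = (\<tau> v - \<beta> v) * A k v" using \<tau>s by simp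
      also have "\<dots> \<le> d * A k v" by (intro mult_right_mono d v A_nonneg)
      finally show "\<bar>J k v\<bar> \<le> d * A k v" .
    qed
  qed
  have i1: "integrable lborel (\<lambda>v. rho r v * v $ 1 * J 1 v + rho r v * v $ 2 * J 2 v)"
    by (intro Bochner_Integration.integrable_add rho_component_integrable J_integrable)
  have d0: "0 \<le> d" using d[of 0] bd[of 0] r by auto
  have "\<bar>\<integral>v. rho r v * v $ 1 * J 1 v + rho r v * v $ 2 * J 2 v \<partial>lborel\<bar> \<le> (\<integral>v. \<bar>rho r v * v $ 1 * J 1 v + rho r v * v $ 2 * J 2 v\<bar> \<partial>lborel)" by (rule integral_abs_bound)
  also have "\<dots> \<le> (\<integral>v. 4 / r * d * A 1 v + 4 / r * d * A 2 v \<partial>lborel)"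
  proof (rule integral_mono_AE[OF integrable_abs[OF i1]])
    show "integrable lborel (\<lambda>v. 4 / r * d * A 1 v + 4 / r * d * A 2 v)" using A_integrable by (intro Bochner_Integration.integrable_add integrable_mult_right)
    show "AE v in lborel. \<bar>rho r v * v $ 1 * J 1 v + rho r v * v $ 2 * J 2 v\<bar> \<le> 4 / r * d * A 1 v + 4 / r * d * A 2 v"
      using Jb[of 1] Jb[of 2]
    proof eventually_elim
      case (elim v)
      show ?case
      proof (cases "norm v < r")
        case True
        then have v: "norm v < R" using r by simp
        have "\<bar>rho r v * v $ 1 * J 1 v\<bar> \<le> 4 / r * (d * A 1 v)" "\<bar>rho r v * v $ 2 * J 2 v\<bar> \<le> 4 / r * (d * A 2 v)"
          using mult_mono[OF rho_comp_bound[of v 1], of "\<bar>J 1 v\<bar>" "d * A 1 v"] mult_mono[OF rho_comp_bound[of v 2], of "\<bar>J 2 v\<bar>" "d * A 2 v"] elim v r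
          by (simp_all add: abs_mult)
        then show ?thesis by (simp only: mult.assoc)
      next
        case False
        have "0 \<le> 4 / r * d * A 1 v + 4 / r * d * A 2 v" using r d0 A_nonneg by (intro add_nonneg_nonneg mult_nonneg_nonneg) auto
        then show ?thesis using False eta_rho_0[OF r(1), of v] by simp
      qed
    qed
  qed
  also have "\<dots> = 4 / r * d * aa 1 + 4 / r * d * aa 2" using A_integrable by (simp add: A_integral)
  finally have 1: "\<bar>\<integral>v. rho r v * v $ 1 * J 1 v + rho r v * v $ 2 * J 2 v \<partial>lborel\<bar> \<le> 4 / r * d * (aa 1 + aa 2)" by (simp add: algebra_simps)
  have 2: "\<bar>\<integral>v. rho r v * (l v * (\<tau> v - h)) \<partial>lborel\<bar> \<le> 4 / r\<^sup>2 * G * bi l"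
    by (intro rho_integral_bound continuous_l continuous_intros \<tau>c G) (use r in auto)
  have 3: "\<bar>\<integral>v. rho r v * (q v * ((\<tau> v - h)\<^sup>2 / 2)) \<partial>lborel\<bar> \<le> 4 / r\<^sup>2 * (G\<^sup>2 / 2) * bi q"
  proof (rule rho_integral_bound[OF continuous_q])
    show "continuous_on (ball 0 R) (\<lambda>v. (\<tau> v - h)\<^sup>2 / 2)" by (intro continuous_intros \<tau>c) auto
    fix v :: "real^2" assume "norm v < r"
    then have "\<bar>\<tau> v - h\<bar>\<^sup>2 \<le> G\<^sup>2" using G[of v] r by (intro power_mono) auto
    then show "\<bar>(\<tau> v - h)\<^sup>2 / 2\<bar> \<le> G\<^sup>2 / 2" by simp
  qed
  have "\<bar>V\<bar> * (\<integral>v. eta r v \<partial>lborel) = \<bar>V * (\<integral>v. eta r v \<partial>lborel)\<bar>"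
    using Bochner_Integration.integral_nonneg[of lborel "eta r"] eta_bounds(1) by (simp add: abs_mult)
  also have "\<dots> \<le> 4 / r * d * (aa 1 + aa 2) + 4 / r\<^sup>2 * G * bi l + 4 / r\<^sup>2 * (G\<^sup>2 / 2) * bi q"
    using 1 2 3 unfolding flux_formula by linarith
  finally show ?thesis by (simp add: algebra_simps)
qed

end

subsection \<open>Boundaries as graphs\<close>

lemma deriv_normsq_nonneg: "0 \<le> deriv_normsq k f x"
  by (induction k arbitrary: f) (auto intro: sum_nonneg)

lemma deriv_norm_0: "deriv_norm 0 f x = \<bar>f x\<bar>"
  by (simp add: deriv_norm_def)

lemma partial_le_deriv_norm: "deriv_norm k (partial_deriv i f) x \<le> deriv_norm (Suc k) f x"
  unfolding deriv_norm_def deriv_normsq.simps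
  by (intro real_sqrt_le_mono member_le_sum) (auto intro: deriv_normsq_nonneg)

lemma Ck_line_derivative:
  fixes f :: "real^'n::finite \<Rightarrow> real"
  assumes "f differentiable (at (t *\<^sub>R z))"
  shows "((\<lambda>t. f (t *\<^sub>R z)) has_real_derivative (\<Sum>i\<in>UNIV. z $ i * partial_deriv i f (t *\<^sub>R z))) (at t)"
proof -
  have "((\<lambda>t. t *\<^sub>R z) has_derivative (\<lambda>t. t *\<^sub>R z)) (at t)" by (auto intro!: derivative_eq_intros)
  from has_derivative_compose[OF this assms[unfolded frechet_derivative_works]]
  have "((\<lambda>t. f (t *\<^sub>R z)) has_derivative (\<lambda>s. frechet_derivative f (at (t *\<^sub>R z)) (s *\<^sub>R z))) (at t)" .
  moreover have "frechet_derivative f (at (t *\<^sub>R z)) (s *\<^sub>R z) = (\<Sum>i\<in>UNIV. z $ i * partial_deriv i f (t *\<^sub>R z)) * s" for s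
    by (simp add: frechet_eq_sum_partial[OF assms] sum_distrib_left mult_ac)
  ultimately show ?thesis by (simp add: has_field_derivative_def)
qed

text \<open>Taylor expansion of \<open>g\<close> along the line through \<open>z\<close>, at the
  parameters 1 and -1. The even orders cancel in the difference, the first order vanishes by
  hypothesis, and the remainders are of third order; the cube of the dimension counts the third
  partial derivatives.\<close>

lemma C3_odd_part:
  fixes g :: "real^'n::finite \<Rightarrow> real"
  assumes C3: "Ck_on 3 (ball 0 \<sigma>) g" and z: "norm z < \<sigma>"
    and K1: "deriv_norm 1 g 0 \<le> 0" and K3: "\<And>z. norm z < \<sigma> \<Longrightarrow> deriv_norm 3 g z \<le> K"
  shows "\<bar>g z - g (- z)\<bar> \<le> real (CARD('n))^3 * K * norm z ^ 3"
proof -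
  define P where "P i = partial_deriv i g" for i
  define P2 where "P2 i j = partial_deriv j (P i)" for i j
  define P3 where "P3 i j k = partial_deriv k (P2 i j)" for i j k
  have d1: "g differentiable (at x)" "P i differentiable (at x)" "P2 i j differentiable (at x)" if "norm x < \<sigma>" for x i j
    using C3 that by (auto simp: numeral_3_eq_3 P_def P2_def)
  \<comment> \<open>The derivatives of \<open>g\<close> along the line up to order three, written
    out by partial derivatives; orders above three are never consulted.\<close>
  define d where "d m t = (if m = 0 then g (t *\<^sub>R z) else if m = 1 then (\<Sum>i\<in>UNIV. z $ i * P i (t *\<^sub>R z))
     else if m = 2 then (\<Sum>i\<in>UNIV. z $ i * (\<Sum>j\<in>UNIV. z $ j * P2 i j (t *\<^sub>R z)))
     else (\<Sum>i\<in>UNIV. z $ i * (\<Sum>j\<in>UNIV. z $ j * (\<Sum>k\<in>UNIV. z $ k * P3 i j k (t *\<^sub>R z)))))" for m :: nat and t :: real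
  have inb: "norm (t *\<^sub>R z) < \<sigma>" if "\<bar>t\<bar> \<le> 1" for t
    using that z mult_right_mono[OF that, of "norm z"] by simp
  have der: "\<forall>m t. m < 3 \<and> \<bar>t\<bar> \<le> \<bar>x\<bar> \<longrightarrow> (d m has_real_derivative d (Suc m) t) (at t)" if x: "\<bar>x\<bar> = 1" for x :: real
  proof (intro allI impI)
    fix m :: nat and t :: real assume mt: "m < 3 \<and> \<bar>t\<bar> \<le> \<bar>x\<bar>"
    then have b: "norm (t *\<^sub>R z) < \<sigma>" using inb x by simp
    consider "m = 0" | "m = 1" | "m = 2" using mt by linarith
    then show "(d m has_real_derivative d (Suc m) t) (at t)"
    proof cases
      case 1
      then show ?thesis using Ck_line_derivative[OF d1(1)[OF b]] by (simp add: d_def[abs_def] P_def)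
    next
      case 2
      then show ?thesis unfolding d_def[abs_def]
        by (auto intro!: DERIV_sum DERIV_cmult simp: P2_def Ck_line_derivative[OF d1(2)[OF b]])
    next
      case 3
      then show ?thesis unfolding d_def[abs_def]
        by (auto intro!: DERIV_sum DERIV_cmult simp: P3_def Ck_line_derivative[OF d1(3)[OF b]])
    qed
  qed
  have bound: "\<bar>d 3 t\<bar> \<le> real (CARD('n))^3 * K * norm z ^ 3" if t: "\<bar>t\<bar> \<le> 1" for t
  proof -
    have p3: "\<bar>P3 i j k (t *\<^sub>R z)\<bar> \<le> K" for i j k
    proof -
      have "\<bar>P3 i j k (t *\<^sub>R z)\<bar> = deriv_norm 0 (P3 i j k) (t *\<^sub>R z)" by (simp add: deriv_norm_0)
      also have "\<dots> \<le> deriv_norm (Suc 0) (P2 i j) (t *\<^sub>R z)" unfolding P3_def by (rule partial_le_deriv_norm)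
      also have "\<dots> \<le> deriv_norm (Suc (Suc 0)) (P i) (t *\<^sub>R z)" unfolding P2_def by (rule partial_le_deriv_norm)
      also have "\<dots> \<le> deriv_norm (Suc (Suc (Suc 0))) g (t *\<^sub>R z)" unfolding P_def by (rule partial_le_deriv_norm)
      also have "\<dots> \<le> K" using K3[OF inb[OF t]] by (simp add: numeral_3_eq_3)
      finally show ?thesis .
    qed
    have K0: "0 \<le> K" using p3[of undefined undefined undefined] by linarith
    have step: "\<bar>\<Sum>i\<in>UNIV. z $ i * f i\<bar> \<le> real CARD('n) * (norm z * B)" if "\<And>i. \<bar>f i\<bar> \<le> B" "0 \<le> B" for f :: "'n \<Rightarrow> real" and B
    proof -
      have "\<bar>\<Sum>i\<in>UNIV. z $ i * f i\<bar> \<le> (\<Sum>i\<in>UNIV. \<bar>z $ i * f i\<bar>)" by (rule sum_abs)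
      also have "\<dots> \<le> (\<Sum>i\<in>(UNIV::'n set). norm z * B)"
        unfolding abs_mult using that component_le_norm_cart[of z] by (intro sum_mono mult_mono) auto
      finally show ?thesis by simp
    qed
    have 1: "\<bar>\<Sum>k\<in>UNIV. z $ k * P3 i j k (t *\<^sub>R z)\<bar> \<le> real CARD('n) * (norm z * K)" for i j by (rule step[OF p3 K0])
    have 2: "\<bar>\<Sum>j\<in>UNIV. z $ j * (\<Sum>k\<in>UNIV. z $ k * P3 i j k (t *\<^sub>R z))\<bar> \<le> real CARD('n) * (norm z * (real CARD('n) * (norm z * K)))" for i
      by (rule step[OF 1]) (use K0 in auto)
    have "\<bar>d 3 t\<bar> \<le> real CARD('n) * (norm z * (real CARD('n) * (norm z * (real CARD('n) * (norm z * K)))))"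
      unfolding d_def by (simp, rule step[OF 2]) (use K0 in auto)
    then show ?thesis by (simp add: power3_eq_cube mult_ac)
  qed
  \<comment> \<open>The gradient vanishes at the origin, the boundary being tangent to the
    coordinate plane.\<close>
  have d00: "d 1 0 = 0"
  proof -
    have "\<bar>P i 0\<bar> \<le> 0" for i
    proof -
      have "\<bar>P i 0\<bar> = deriv_norm 0 (P i) 0" by (simp add: deriv_norm_0)
      also have "\<dots> \<le> deriv_norm (Suc 0) g 0" unfolding P_def by (rule partial_le_deriv_norm)
      finally show ?thesis using K1 by simp
    qed
    then show ?thesis by (simp add: d_def)
  qed
  obtain t1 where t1: "\<bar>t1\<bar> \<le> \<bar>1\<bar>" "d 0 1 = (\<Sum>m<3. d m 0 / fact m * 1 ^ m) + d 3 t1 / fact 3 * 1 ^ 3"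
    using Maclaurin_bi_le[of d "d 0" 3 1, OF refl der] by auto
  obtain t2 where t2: "\<bar>t2\<bar> \<le> \<bar>-1\<bar>" "d 0 (-1) = (\<Sum>m<3. d m 0 / fact m * (-1) ^ m) + d 3 t2 / fact 3 * (-1) ^ 3"
    using Maclaurin_bi_le[of d "d 0" 3 "-1", OF refl der] by auto
  have "g z - g (- z) = d 0 1 - d 0 (-1)" by (simp add: d_def)
  \<comment> \<open>Two remainders with factor 1/6 each; the resulting gain of 1/3 is given
    away.\<close>
  also have "\<dots> = d 3 t1 / 6 + d 3 t2 / 6" unfolding t1(2) t2(2) by (simp add: numeral_3_eq_3 d00[simplified] fact_numeral)
  finally show ?thesis using bound[of t1] bound[of t2] t1(1) t2(1) by simp
qed

text \<open>The consequences of the regularity that the estimate uses: flatness to second order, an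
  odd part of third order, and the graph description of the boundary. The factor 8 is the cube of
  the dimension 2 in \<open>C3_odd_part\<close>. Unlike bounds on partial derivatives, these
  conditions are plainly unchanged by a planar isometry.\<close>

definition graph_frame :: "(real^3) set \<Rightarrow> real^3 \<Rightarrow> (real^3 \<Rightarrow> real^3) \<Rightarrow> real \<Rightarrow> real \<Rightarrow> (real^2 \<Rightarrow> real) \<Rightarrow> bool" where
  "graph_frame D p T \<sigma> K g \<longleftrightarrow> continuous_on (ball 0 \<sigma>) g \<and>
     (\<forall>v. norm v < \<sigma> \<longrightarrow> \<bar>g v\<bar> \<le> K * (norm v)\<^sup>2 \<and> \<bar>g v - g (- v)\<bar> \<le> 8 * K * norm v ^ 3) \<and>
     (\<forall>v z. norm v < \<sigma> \<longrightarrow> \<bar>z\<bar> < \<sigma> \<longrightarrow> (emb p T (v, z) \<in> frontier D \<longleftrightarrow> z = g v))"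

text \<open>\<open>C3_graphs \<sigma> K D\<close> is the condition in the definition of \<open>uniformly_C3\<close> with explicit constants.\<close>

definition C3_graphs :: "real \<Rightarrow> real \<Rightarrow> (real^3) set \<Rightarrow> bool" where
  "C3_graphs \<sigma>\<^sub>0 K D \<longleftrightarrow> (\<forall>p\<in>frontier D. \<exists>T g.
       orthogonal_transformation T \<and>
       frontier D \<inter> (\<lambda>y. p + T y) ` {y. norm (horiz y) < \<sigma>\<^sub>0 \<and> \<bar>y$3\<bar> < \<sigma>\<^sub>0}
         = (\<lambda>y. p + T y) ` {y. norm (horiz y) < \<sigma>\<^sub>0 \<and> \<bar>y$3\<bar> < \<sigma>\<^sub>0 \<and> y$3 = g (horiz y)} \<and>
       Ck_on 3 (ball 0 \<sigma>\<^sub>0) g \<and>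
       (\<forall>z. norm z < \<sigma>\<^sub>0 \<longrightarrow>
          (\<forall>i\<le>2. deriv_norm i g z \<le> K * norm z ^ (2 - i)) \<and> deriv_norm 3 g z \<le> K))"

lemma C3_graphs_frame:
  assumes C: "C3_graphs \<sigma> K D" and \<sigma>: "0 < \<sigma>" and p: "p \<in> frontier D"
  obtains T g where "orthogonal_transformation T" "graph_frame D p T \<sigma> K g"
proof -
  obtain T g where *: "orthogonal_transformation T \<and>
       frontier D \<inter> (\<lambda>y. p + T y) ` {y. norm (horiz y) < \<sigma> \<and> \<bar>y$3\<bar> < \<sigma>}
         = (\<lambda>y. p + T y) ` {y. norm (horiz y) < \<sigma> \<and> \<bar>y$3\<bar> < \<sigma> \<and> y$3 = g (horiz y)} \<and>
       Ck_on 3 (ball 0 \<sigma>) g \<and>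
       (\<forall>z. norm z < \<sigma> \<longrightarrow>
          (\<forall>i\<le>2. deriv_norm i g z \<le> K * norm z ^ (2 - i)) \<and> deriv_norm 3 g z \<le> K)"
    using C p unfolding C3_graphs_def by blast
  then have T: "orthogonal_transformation T" and
    eq: "frontier D \<inter> (\<lambda>y. p + T y) ` {y. norm (horiz y) < \<sigma> \<and> \<bar>y$3\<bar> < \<sigma>}
         = (\<lambda>y. p + T y) ` {y. norm (horiz y) < \<sigma> \<and> \<bar>y$3\<bar> < \<sigma> \<and> y$3 = g (horiz y)}" and
    C3: "Ck_on 3 (ball 0 \<sigma>) g" by auto
  have b: "\<And>z i. norm z < \<sigma> \<Longrightarrow> i \<le> 2 \<Longrightarrow> deriv_norm i g z \<le> K * norm z ^ (2 - i)" "\<And>z. norm z < \<sigma> \<Longrightarrow> deriv_norm 3 g z \<le> K"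
    using * by auto
  have inj: "y = y'" if "p + T y = p + T y'" for y y'
    using that orthogonal_transformation_inj[OF T] by (simp add: injD)
  have "emb p T (v, z) \<in> frontier D \<longleftrightarrow> z = g v" if vz: "norm v < \<sigma>" "\<bar>z\<bar> < \<sigma>" for v z
  proof -
    have e: "emb p T (v, z) = p + T (vec3 v z)" by (simp add: emb_def)
    have "emb p T (v, z) \<in> frontier D \<longleftrightarrow> p + T (vec3 v z) \<in> frontier D \<inter> (\<lambda>y. p + T y) ` {y. norm (horiz y) < \<sigma> \<and> \<bar>y$3\<bar> < \<sigma>}"
    proof -
      have "p + T (vec3 v z) \<in> (\<lambda>y. p + T y) ` {y. norm (horiz y) < \<sigma> \<and> \<bar>y$3\<bar> < \<sigma>}"
        using vz by (intro image_eqI[of _ _ "vec3 v z"]) auto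
      then show ?thesis by (simp add: e)
    qed
    also have "\<dots> \<longleftrightarrow> (\<exists>y. p + T (vec3 v z) = p + T y \<and> norm (horiz y) < \<sigma> \<and> \<bar>y$3\<bar> < \<sigma> \<and> y$3 = g (horiz y))"
      unfolding eq by blast
    also have "\<dots> \<longleftrightarrow> z = g v" using vz inj by (metis horiz_vec3 vec3_nth(3))
    finally show ?thesis .
  qed
  moreover have "continuous_on (ball 0 \<sigma>) g"
    using C3 by (auto simp: numeral_3_eq_3 intro!: continuous_at_imp_continuous_on differentiable_imp_continuous_within)
  moreover have "\<bar>g v\<bar> \<le> K * (norm v)\<^sup>2" if "norm v < \<sigma>" for v using b(1)[OF that, of 0] by (simp add: deriv_norm_0)
  moreover have "\<bar>g v - g (- v)\<bar> \<le> 8 * K * norm v ^ 3" if "norm v < \<sigma>" for v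
  proof -
    have "deriv_norm 1 g 0 \<le> 0" using b(1)[of 0 1] \<sigma> by simp
    from C3_odd_part[OF C3 that this b(2)] show ?thesis by simp
  qed
  ultimately show ?thesis using that[OF T] unfolding graph_frame_def by blast
qed

lemma graph_frameD:
  assumes "graph_frame D p T \<sigma> K g"
  shows "continuous_on (ball 0 \<sigma>) g" "norm v < \<sigma> \<Longrightarrow> \<bar>g v\<bar> \<le> K * (norm v)\<^sup>2" "norm v < \<sigma> \<Longrightarrow> \<bar>g v - g (- v)\<bar> \<le> 8 * K * norm v ^ 3"
    "norm v < \<sigma> \<Longrightarrow> \<bar>z\<bar> < \<sigma> \<Longrightarrow> emb p T (v, z) \<in> frontier D \<longleftrightarrow> z = g v"
  using assms by (auto simp: graph_frame_def)

text \<open>If \<open>n\<close> had a horizontal part \<open>w\<close> in the frame of the graph,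
  then moving along the boundary by a small multiple of \<open>w\<close> would give a displacement
  whose component along \<open>n\<close> is comparable to its length, against tangency.\<close>

lemma normal_direction:
  assumes T: "orthogonal_transformation T" and g: "graph_frame D p T \<sigma> K g" and \<sigma>: "0 < \<sigma>"
    and n: "normal_at (frontier D) p n" "norm n = 1"
  shows "n = T (axis 3 1) \<or> n = - T (axis 3 1)"
proof -
  obtain y where y: "n = T y" using orthogonal_transformation_surj[OF T] by (metis surjD)
  have lin: "linear T" using T by (rule orthogonal_transformation_linear)
  have ny: "norm y = 1" using n(2) T y by (simp add: orthogonal_transformation)
  define w where "w = horiz y"
  have w0: "w = 0"
  proof (rule ccontr)
    assume "w \<noteq> 0"
    then have wp: "0 < norm w" by simp
    have "\<forall>\<^sub>F x in at p within frontier D. dist (((x - p) \<bullet> n) / norm (x - p)) 0 < norm w / 4"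
      using n(1) wp unfolding normal_at_def by (intro tendstoD) auto
    then obtain \<delta> where \<delta>: "\<delta> > 0" "\<And>x. x \<in> frontier D \<Longrightarrow> x \<noteq> p \<Longrightarrow> dist x p < \<delta> \<Longrightarrow> \<bar>((x - p) \<bullet> n) / norm (x - p)\<bar> < norm w / 4"
      unfolding eventually_at by auto
    \<comment> \<open>A positive substitute for \<open>K\<close>, whose sign is not known
      here.\<close>
    define k where "k = \<bar>K\<bar> + 1"
    have k: "k > 0" "K \<le> k" by (auto simp: k_def)
    define X where "X = norm w + 1"
    have X: "X > 0" "norm w \<le> X" "1 \<le> X" using norm_ge_zero[of w] unfolding X_def by linarith+
    \<comment> \<open>The three bounds serve, in turn, to make the graph flat compared with the
      step, to stay inside the chart, and to stay within the distance at which tangency is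
      effective. Since \<open>X\<close> is at least one and at least \<open>norm w\<close>, one
      bound covers both products with \<open>k\<close>.\<close>
    define t where "t = min (1 / (2 * k * X)) (min (\<sigma> / (2 * X)) (\<delta> / (4 * X)))"
    have tp: "0 < t" using k \<sigma> \<delta>(1) X by (simp add: t_def)
    have "t \<le> 1 / (2 * k * X)" "t \<le> \<sigma> / (2 * X)" "t \<le> \<delta> / (4 * X)"
      by (auto simp: t_def)
    then have t1: "t * (2 * k * X) \<le> 1" "t * (2 * X) \<le> \<sigma>" "t * (4 * X) \<le> \<delta>"
      using k X by (simp_all add: pos_le_divide_eq)
    have tX: "t * norm w \<le> t * X" "0 < t * norm w" using X tp wp by (auto intro: mult_left_mono)
    have ktX: "k * (t * norm w) \<le> k * (t * X)" "k * t \<le> k * (t * X)" using tX(1) k X(3) tp by (auto intro!: mult_left_mono)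
    have tw: "t * norm w < \<sigma>" using t1(2) tX by linarith
    have tk: "k * (t * norm w) \<le> 1 / 2" "k * t \<le> 1 / 2" using t1(1) ktX by (simp_all add: mult_ac)
    define G where "G = g (t *\<^sub>R w)"
    have ntw: "norm (t *\<^sub>R w) = t * norm w" using tp by simp
    have Gb: "\<bar>G\<bar> \<le> k * (t * norm w) * (t * norm w)"
    proof -
      have "\<bar>G\<bar> \<le> K * (t * norm w)\<^sup>2" using graph_frameD(2)[OF g, of "t *\<^sub>R w", unfolded ntw, OF tw] by (simp add: G_def)
      also have "\<dots> \<le> k * (t * norm w)\<^sup>2" using k by (intro mult_right_mono) auto
      finally show ?thesis by (simp add: power2_eq_square mult_ac)
    qed
    have Gb2: "\<bar>G\<bar> \<le> 1 / 2 * (t * norm w)"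
      using Gb mult_right_mono[OF tk(1) less_imp_le[OF tX(2)]] by linarith
    have G\<sigma>: "\<bar>G\<bar> < \<sigma>" using Gb2 tw tX by linarith
    define x where "x = emb p T (t *\<^sub>R w, G)"
    have xf: "x \<in> frontier D" using graph_frameD(4)[OF g, of "t *\<^sub>R w" G, unfolded ntw, OF tw G\<sigma>] by (simp add: x_def G_def)
    have xp: "x - p = T (vec3 (t *\<^sub>R w) G)" by (simp add: x_def emb_def)
    have nx: "norm (x - p) = norm (vec3 (t *\<^sub>R w) G)" using T by (simp add: xp orthogonal_transformation)
    have nv2: "(norm (vec3 (t *\<^sub>R w) G))\<^sup>2 = (t * norm w)\<^sup>2 + G\<^sup>2"
      unfolding power2_norm_eq_inner inner_vec3 by (simp add: power2_eq_square dot_square_norm)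
    have lo: "t * norm w \<le> norm (x - p)" unfolding nx
      by (rule power2_le_imp_le) (use nv2 in auto)
    have hi: "norm (x - p) \<le> 2 * (t * norm w)" unfolding nx
    proof (rule power2_le_imp_le)
      have "G\<^sup>2 \<le> (t * norm w)\<^sup>2"
        using Gb2 tX by (simp add: abs_le_square_iff[symmetric])
      then have "(norm (vec3 (t *\<^sub>R w) G))\<^sup>2 \<le> 4 * (t * norm w)\<^sup>2" using nv2 zero_le_power2[of "t * norm w"] by linarith
      then show "(norm (vec3 (t *\<^sub>R w) G))\<^sup>2 \<le> (2 * (t * norm w))\<^sup>2" by (simp add: power_mult_distrib)
    qed (use tp wp in auto)
    have np: "0 < norm (x - p)" using lo tX by linarith
    have "dist x p < \<delta>"
      using hi t1(3) tX unfolding dist_norm by linarith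
    then have r: "\<bar>((x - p) \<bullet> n) / norm (x - p)\<bar> < norm w / 4" using \<delta>(2)[OF xf] np by auto
    have "(x - p) \<bullet> n = vec3 (t *\<^sub>R w) G \<bullet> y" using T by (simp add: xp y orthogonal_transformation_def)
    also have "\<dots> = vec3 (t *\<^sub>R w) G \<bullet> vec3 w (y $ 3)" by (simp add: w_def)
    also have "\<dots> = t * (norm w)\<^sup>2 + G * y $ 3" unfolding inner_vec3 by (simp add: power2_norm_eq_inner)
    finally have ip: "(x - p) \<bullet> n = t * (norm w)\<^sup>2 + G * y $ 3" .
    have "\<bar>y $ 3\<bar> \<le> 1" using component_le_norm_cart[of y 3] ny by simp
    then have "\<bar>G * y $ 3\<bar> \<le> \<bar>G\<bar>" unfolding abs_mult by (simp add: mult_left_le)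
    also have "\<bar>G\<bar> \<le> (k * t) * (t * (norm w)\<^sup>2)" using Gb by (simp add: power2_eq_square mult_ac)
    also have "\<dots> \<le> 1 / 2 * (t * (norm w)\<^sup>2)" using tk(2) tp by (intro mult_right_mono) auto
    \<comment> \<open>The graph height can cancel at most half of the horizontal contribution. The
      upper bound from tangency below is the same number with a strict inequality.\<close>
    finally have "t * (norm w)\<^sup>2 / 2 \<le> (x - p) \<bullet> n" unfolding ip by linarith
    also have "\<dots> \<le> \<bar>(x - p) \<bullet> n\<bar>" by simp
    also have "\<dots> < norm w / 4 * norm (x - p)" using r np by (simp add: abs_divide pos_divide_less_eq)
    also have "\<dots> \<le> norm w / 4 * (2 * (t * norm w))" by (intro mult_left_mono hi) auto
    also have "\<dots> = t * (norm w)\<^sup>2 / 2" by (simp add: power2_eq_square)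
    finally show False by simp
  qed
  have "y = vec3 w (y $ 3)" by (simp add: w_def)
  then have yv: "y = vec3 0 (y $ 3)" using w0 by simp
  have "(norm y)\<^sup>2 = (y $ 3)\<^sup>2" by (subst yv) (simp only: power2_norm_eq_inner inner_vec3, simp add: power2_eq_square)
  then have "y $ 3 = 1 \<or> y $ 3 = -1" using ny by (simp add: power2_eq_1_iff)
  moreover have "vec3 0 1 = axis 3 1" "vec3 0 (- 1) = - axis 3 1" by (simp_all add: vec_eq_iff forall_3 axis_def)
  ultimately have "y = axis 3 1 \<or> y = - axis 3 1" using yv by metis
  then show ?thesis using y linear_neg[OF lin] by auto
qed

text \<open>Two frames with the same axis up to sign differ by a planar isometry and possibly a
  reflection of the height. The bounds depend only on the length of \<open>v\<close>, and the
  isometry is odd, so nothing is lost.\<close>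

lemma change_frame:
  assumes T: "orthogonal_transformation T" and T2: "orthogonal_transformation T2"
    and e: "T2 (axis 3 1) = \<epsilon> *\<^sub>R T (axis 3 1)" "\<epsilon> = 1 \<or> \<epsilon> = -1"
    and g: "graph_frame D p T \<sigma> K g"
  obtains g2 where "graph_frame D p T2 \<sigma> K g2"
proof -
  \<comment> \<open>The planar isometry, read off from the points at height zero.\<close>
  define S where "S v = fst (unemb p T (emb p T2 (v, 0)))" for v
  have \<epsilon>2: "\<epsilon> * \<epsilon> = 1" using e(2) by auto
  have lin2: "linear T2" using T2 by (rule orthogonal_transformation_linear)
  have split: "vec3 v z = vec3 v 0 + z *\<^sub>R axis 3 1" for v z by (simp add: vec_eq_iff forall_3 axis_def)
  have T2s: "T2 (vec3 v z) = T2 (vec3 v 0) + (z * \<epsilon>) *\<^sub>R T (axis 3 1)" for v z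
    by (subst split) (simp add: linear_add[OF lin2] linear_scale[OF lin2] e(1))
  have i3: "T2 (vec3 v 0) \<bullet> T (axis 3 1) = 0" for v
  proof -
    have "T2 (vec3 v 0) \<bullet> T2 (axis 3 1) = 0" using T2 by (simp add: orthogonal_transformation_def inner_axis)
    then show ?thesis using e by auto
  qed
  have un: "unemb p T (emb p T2 (v, z)) = (S v, \<epsilon> * z)" for v z
  proof -
    have "emb p T2 (v, z) - p = T2 (vec3 v 0) + (z * \<epsilon>) *\<^sub>R T (axis 3 1)" by (simp add: emb_def T2s[of v z])
    moreover have "emb p T2 (v, 0) - p = T2 (vec3 v 0)" by (simp add: emb_def)
    ultimately show ?thesis unfolding S_def unemb_def by (simp add: inner_add_left frame_inner[OF T] i3)
  qed
  have em: "emb p T2 (v, z) = emb p T (S v, \<epsilon> * z)" for v z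
    using emb_unemb[OF T, of p "emb p T2 (v, z)"] by (simp add: un)
  have nS: "norm (S v) = norm v" for v
  proof -
    have "T2 (vec3 v 0) = T (vec3 (S v) 0)" using em[of v 0] by (simp add: emb_def)
    then have "norm (vec3 v 0) = norm (vec3 (S v) 0)" using T T2 by (metis orthogonal_transformation)
    then show ?thesis unfolding norm_eq_sqrt_inner inner_vec3 by simp
  qed
  have Sneg: "S (- v) = - S v" for v
  proof -
    have "vec3 (- v) 0 = - vec3 v 0" by (simp add: vec_eq_iff forall_3)
    then have "emb p T2 (- v, 0) - p = - (emb p T2 (v, 0) - p)" by (simp add: emb_def linear_neg[OF lin2])
    then show ?thesis unfolding S_def unemb_def fst_conv by (simp only: inner_minus_left) (simp add: vec_eq_iff forall_2)
  qed
  have Sc: "continuous_on X S" for X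
    unfolding S_def
    by (intro continuous_intros continuous_on_compose2[OF continuous_unemb[OF T, of UNIV]] continuous_on_compose2[OF continuous_emb[OF T2, of UNIV]]) auto
  have "graph_frame D p T2 \<sigma> K (\<lambda>v. \<epsilon> * g (S v))"
    unfolding graph_frame_def
  proof (intro conjI allI impI)
    show "continuous_on (ball 0 \<sigma>) (\<lambda>v. \<epsilon> * g (S v))"
      by (intro continuous_intros continuous_on_compose2[OF graph_frameD(1)[OF g] Sc]) (auto simp: nS)
    fix v :: "real^2" assume v: "norm v < \<sigma>"
    have ae: "\<bar>\<epsilon>\<bar> = 1" using e(2) by auto
    show "\<bar>\<epsilon> * g (S v)\<bar> \<le> K * (norm v)\<^sup>2" using graph_frameD(2)[OF g, of "S v"] v by (simp add: abs_mult ae nS)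
    have "\<bar>\<epsilon> * g (S v) - \<epsilon> * g (S (- v))\<bar> = \<bar>\<epsilon>\<bar> * \<bar>g (S v) - g (- S v)\<bar>" by (simp add: Sneg abs_mult[symmetric] right_diff_distrib)
    then show "\<bar>\<epsilon> * g (S v) - \<epsilon> * g (S (- v))\<bar> \<le> 8 * K * norm v ^ 3" using graph_frameD(3)[OF g, of "S v"] v by (simp add: ae nS)
    fix z :: real assume z: "\<bar>z\<bar> < \<sigma>"
    have "emb p T2 (v, z) \<in> frontier D \<longleftrightarrow> \<epsilon> * z = g (S v)"
      unfolding em by (rule graph_frameD(4)[OF g]) (use v z ae in \<open>auto simp: nS abs_mult\<close>)
    also have "\<dots> \<longleftrightarrow> z = \<epsilon> * g (S v)" using e(2) by auto
    finally show "emb p T2 (v, z) \<in> frontier D \<longleftrightarrow> z = \<epsilon> * g (S v)" .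
  qed
  then show ?thesis by (rule that)
qed

text \<open>The regularity hypothesis supplies some chart at the point, while the frame of the gap
  is prescribed by tangency. \<open>normal_direction\<close> shows that the two axes agree up to
  sign, and then \<open>change_frame\<close> applies.\<close>

lemma adapted_graph:
  assumes C: "C3_graphs \<sigma> K D" and \<sigma>: "0 < \<sigma>" and p: "p \<in> frontier D"
    and T2: "orthogonal_transformation T2" and n: "normal_at (frontier D) p (T2 (axis 3 1))"
  obtains g where "graph_frame D p T2 \<sigma> K g"
proof -
  obtain T g where T: "orthogonal_transformation T" and g: "graph_frame D p T \<sigma> K g"
    using C3_graphs_frame[OF C \<sigma> p] by blast
  have "T2 (axis 3 1) = T (axis 3 1) \<or> T2 (axis 3 1) = - T (axis 3 1)"
    by (rule normal_direction[OF T g \<sigma> n frame_norm[OF T2]])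
  then obtain \<epsilon> :: real where "T2 (axis 3 1) = \<epsilon> *\<^sub>R T (axis 3 1)" "\<epsilon> = 1 \<or> \<epsilon> = -1"
  proof
    assume "T2 (axis 3 1) = T (axis 3 1)" then show ?thesis using that[of 1] by simp
  next
    assume "T2 (axis 3 1) = - T (axis 3 1)" then show ?thesis using that[of "-1"] by simp
  qed
  then show ?thesis using change_frame[OF T T2 _ _ g] that by blast
qed

section \<open>Which side of a boundary graph belongs to the domain\<close>

lemma connected_between_graphs:
  fixes a b :: "'a::euclidean_space \<Rightarrow> real"
  assumes a: "continuous_on (ball 0 R) a" and b: "continuous_on (ball 0 R) b" and ab: "\<And>v. norm v < R \<Longrightarrow> a v < b v"
  shows "connected {p. norm (fst p) < R \<and> a (fst p) < snd p \<and> snd p < b (fst p)}"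
proof -
  let ?f = "\<lambda>p::'a \<times> real. (fst p, a (fst p) + snd p * (b (fst p) - a (fst p)))"
  have "connected (?f ` (ball 0 R \<times> {0<..<1}))"
  proof (rule connected_continuous_image)
    show "continuous_on (ball 0 R \<times> {0<..<1}) ?f"
      by (intro continuous_intros continuous_on_compose2[OF a] continuous_on_compose2[OF b]) auto
    show "connected (ball (0::'a) R \<times> {0<..<1::real})" by (intro connected_Times) auto
  qed
  moreover have "?f ` (ball 0 R \<times> {0<..<1}) = {p. norm (fst p) < R \<and> a (fst p) < snd p \<and> snd p < b (fst p)}"
  proof (intro equalityI subsetI)
    fix p assume "p \<in> ?f ` (ball 0 R \<times> {0<..<1})"
    then obtain x where x: "x \<in> ball 0 R \<times> {0<..<1}" "p = ?f x" by blast
    define v t where "v = fst x" and "t = snd x"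
    have p: "p = ?f (v, t)" "norm v < R" "0 < t" "t < 1" using x by (auto simp: v_def t_def)
    have "0 < t * (b v - a v)" "t * (b v - a v) < 1 * (b v - a v)" using ab[OF p(2)] p by (intro mult_pos_pos mult_strict_right_mono; simp)+
    then show "p \<in> {p. norm (fst p) < R \<and> a (fst p) < snd p \<and> snd p < b (fst p)}" using p by auto
  next
    fix p assume "p \<in> {p. norm (fst p) < R \<and> a (fst p) < snd p \<and> snd p < b (fst p)}"
    then have p: "norm (fst p) < R" "a (fst p) < snd p" "snd p < b (fst p)" by auto
    have ba: "0 < b (fst p) - a (fst p)" using ab[OF p(1)] by simp
    show "p \<in> ?f ` (ball 0 R \<times> {0<..<1})"
      by (rule image_eqI[of _ _ "(fst p, (snd p - a (fst p)) / (b (fst p) - a (fst p)))"])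
        (use p ba in \<open>auto simp: prod_eq_iff\<close>)
  qed
  ultimately show ?thesis by simp
qed

definition region :: "real \<Rightarrow> (real^2 \<Rightarrow> real) \<Rightarrow> (real^2 \<Rightarrow> real) \<Rightarrow> ((real^2) \<times> real) set" where
  "region R a b = {p. norm (fst p) < R \<and> a (fst p) < snd p \<and> snd p < b (fst p)}"

lemma region_iff: "(v, z) \<in> region R a b \<longleftrightarrow> norm v < R \<and> a v < z \<and> z < b v"
  by (simp add: region_def)

text \<open>The region between two graphs is connected, so if it misses the boundary of
  \<open>D\<close> it lies entirely on one side, and a single point decides which.\<close>

lemma region_subset_domain:
  assumes T: "orthogonal_transformation T" and a: "continuous_on (ball 0 R) a" and b: "continuous_on (ball 0 R) b"
    and ab: "\<And>v. norm v < R \<Longrightarrow> a v < b v"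
    and avoid: "\<And>v z. norm v < R \<Longrightarrow> a v < z \<Longrightarrow> z < b v \<Longrightarrow> emb Q T (v, z) \<notin> frontier D"
    and v0: "norm v0 < R" "a v0 < z0" "z0 < b v0"
  shows "emb Q T (v0, z0) \<in> D \<Longrightarrow> emb Q T ` region R a b \<subseteq> D"
    "emb Q T (v0, z0) \<notin> D \<Longrightarrow> emb Q T ` region R a b \<inter> D = {}"
proof -
  have c: "connected (emb Q T ` region R a b)"
    unfolding region_def by (intro connected_continuous_image continuous_emb T connected_between_graphs a b ab)
  have f: "emb Q T ` region R a b \<inter> frontier D = {}" using avoid by (auto simp: region_def)
  have i: "emb Q T (v0, z0) \<in> emb Q T ` region R a b" using v0 by (auto simp: region_def)
  show "emb Q T (v0, z0) \<in> D \<Longrightarrow> emb Q T ` region R a b \<subseteq> D"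
    using connected_Int_frontier[OF c] f i by blast
  show "emb Q T (v0, z0) \<notin> D \<Longrightarrow> emb Q T ` region R a b \<inter> D = {}"
    using connected_Int_frontier[OF c] f i by blast
qed

text \<open>Charts do not tell on which side of its graph \<open>S\<close> lies; the distance does.
  The point halfway between \<open>Q\<close> and \<open>P\<close> is too close to \<open>Q\<close>
  to be in \<open>S\<close>, so the gap misses \<open>S\<close>; as \<open>P\<close> is a limit of
  points of \<open>S\<close>, these must lie above. The condition
  \<open>4 * K * R\<^sup>2 \<le> h\<close> keeps both graphs within \<open>h / 4\<close> of their
  base planes.\<close>

lemma gap_geometry:
  assumes T: "orthogonal_transformation T" and \<Omega>: "open \<Omega>" and S: "open S" "S \<subseteq> \<Omega>"
    and Q: "Q \<in> frontier \<Omega>" and h: "0 < h" "h = setdist S (frontier \<Omega>)" and P: "emb Q T (0, h) \<in> frontier S"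
    and gO: "graph_frame \<Omega> Q T \<sigma> K gO" and gS: "graph_frame S (emb Q T (0, h)) T \<sigma> K gS"
    and R: "0 < R" "R < \<sigma>" "4 * K * R\<^sup>2 \<le> h" and K: "0 < K" and s: "2 * h \<le> s" "s + h < \<sigma>"
  shows "norm v < R \<Longrightarrow> gO v < z \<Longrightarrow> z < s \<Longrightarrow> emb Q T (v, z) \<in> \<Omega>"
    "norm v < R \<Longrightarrow> emb Q T (v, gO v) \<notin> \<Omega>"
    "norm v < R \<Longrightarrow> h + gS v < z \<Longrightarrow> z < s \<Longrightarrow> emb Q T (v, z) \<in> S"
    "norm v < R \<Longrightarrow> gO v < z \<Longrightarrow> z < h + gS v \<Longrightarrow> emb Q T (v, z) \<in> \<Omega> - closure S"
proof -
  have small: "\<bar>gO v\<bar> \<le> h / 4" "\<bar>gS v\<bar> \<le> h / 4" if "norm v < R" for v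
  proof -
    have "K * (norm v)\<^sup>2 \<le> K * R\<^sup>2" using that K by (intro mult_left_mono power_mono) auto
    then have "K * (norm v)\<^sup>2 \<le> h / 4" using R by simp
    then show "\<bar>gO v\<bar> \<le> h / 4" "\<bar>gS v\<bar> \<le> h / 4"
      using graph_frameD(2)[OF gO, of v] graph_frameD(2)[OF gS, of v] that R by linarith+
  qed
  have g0: "gO 0 = 0" "gS 0 = 0" using graph_frameD(2)[OF gO, of 0] graph_frameD(2)[OF gS, of 0] R by auto
  have lin: "linear T" using T by (rule orthogonal_transformation_linear)
  have shift: "emb (emb Q T (0, h)) T (v, z) = emb Q T (v, z + h)" for v z
  proof -
    have "vec3 v (z + h) = vec3 0 h + vec3 v z" by (simp add: vec_eq_iff forall_3)
    then show ?thesis by (simp add: emb_def linear_add[OF lin] add.assoc)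
  qed
  have fO: "emb Q T (v, z) \<in> frontier \<Omega> \<longleftrightarrow> z = gO v" if "norm v < R" "\<bar>z\<bar> < \<sigma>" for v z
    using graph_frameD(4)[OF gO] that R by auto
  have fS: "emb Q T (v, z) \<in> frontier S \<longleftrightarrow> z = h + gS v" if "norm v < R" "\<bar>z - h\<bar> < \<sigma>" for v z
    using graph_frameD(4)[OF gS, of v "z - h"] that R by (auto simp: shift)
  have cO: "continuous_on (ball 0 R) gO" "continuous_on (ball 0 R) gS"
    using graph_frameD(1)[OF gO] graph_frameD(1)[OF gS] R by (auto intro: continuous_on_subset[OF _ subset_ball])
  have c\<tau>: "continuous_on (ball 0 R) (\<lambda>v. h + gS v)" by (intro continuous_intros cO)
  have cs: "continuous_on (ball 0 R) (\<lambda>v::real^2. s)" by (intro continuous_intros)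
  have b1: "gO v < s" "h + gS v < s" "gO v < h + gS v" if "norm v < R" for v
    using small[OF that] h s by linarith+
  have av1: "emb Q T (v, z) \<notin> frontier \<Omega>" if "norm v < R" "gO v < z" "z < s" for v z
    using fO[of v z] that small[of v] h s by auto
  have av2: "emb Q T (v, z) \<notin> frontier S" if "norm v < R" "gO v < z" "z < s" "z \<noteq> h + gS v" for v z
    using fS[of v z] that small[of v] h s by auto
  have "S \<subseteq> \<Omega>" by (rule S(2))
  \<comment> \<open>\<open>P\<close> is a limit of points of \<Omega>, and above the origin the
    boundary of \<Omega> passes at height zero, not at \<open>h\<close>.\<close>
  have P\<Omega>: "emb Q T (0, h) \<in> \<Omega>"
  proof -
    have "emb Q T (0, h) \<in> closure \<Omega>" using P S(2) closure_mono[OF S(2)] by (auto simp: frontier_def)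
    moreover have "emb Q T (0, h) \<notin> frontier \<Omega>" using av1[of 0 h] R h s g0 by simp
    ultimately show ?thesis using interior_open[OF \<Omega>] by (auto simp: frontier_def)
  qed
  have B: "emb Q T ` region R gO (\<lambda>_. s) \<subseteq> \<Omega>"
    by (rule region_subset_domain(1)[OF T cO(1) cs b1(1) av1 _ _ _ P\<Omega>]) (use R h s g0 in auto)
  \<comment> \<open>The distance from this point to \<open>Q\<close> is \<open>h / 2\<close>,
    smaller than the distance of \<open>S\<close> from the boundary of \<Omega>.\<close>
  have mid: "emb Q T (0, h / 2) \<notin> S"
  proof
    assume "emb Q T (0, h / 2) \<in> S"
    then have "setdist S (frontier \<Omega>) \<le> dist (emb Q T (0, h / 2)) Q" using Q by (rule setdist_le_dist)
    also have "\<dots> = h / 2"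
    proof -
      have "norm (T (vec3 0 (h / 2))) = norm (vec3 0 (h / 2))" using T by (simp add: orthogonal_transformation)
      also have "\<dots> = sqrt ((h / 2)\<^sup>2)" unfolding norm_eq_sqrt_inner inner_vec3 by (simp add: power2_eq_square)
      also have "\<dots> = h / 2" using h(1) unfolding real_sqrt_abs by simp
      finally show ?thesis by (simp add: emb_def dist_norm)
    qed
    finally show False using h by simp
  qed
  have G: "emb Q T ` region R gO (\<lambda>v. h + gS v) \<inter> S = {}"
  proof (rule region_subset_domain(2)[OF T cO(1) c\<tau> b1(3) _ _ _ _ mid])
    fix v :: "real^2" and z assume vz: "norm v < R" "gO v < z" "z < h + gS v"
    then show "emb Q T (v, z) \<notin> frontier S" using b1(2)[of v] by (intro av2) auto
  qed (use R h g0 in auto)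
  have A: "emb Q T ` region R (\<lambda>v. h + gS v) (\<lambda>_. s) \<subseteq> S"
  proof -
    have "\<exists>v z. norm v < R \<and> h + gS v < z \<and> z < s \<and> emb Q T (v, z) \<in> S"
    proof -
      have o: "open (region R gO (\<lambda>_. s))"
      proof -
        have eq: "region R gO (\<lambda>_. s) = {p. fst p \<in> ball 0 R \<and> gO (fst p) < snd p} \<inter> (UNIV \<times> {..<s})" by (auto simp: region_def)
        show ?thesis unfolding eq by (intro open_Int open_above_graph(1)[OF open_ball cO(1)] open_Times) auto
      qed
      have "emb Q T (0, h) \<in> emb Q T ` region R gO (\<lambda>_. s)" using R h s g0 by (auto simp: region_def)
      moreover have "emb Q T (0, h) \<in> closure S" using P by (simp add: frontier_def)
      \<comment> \<open>An open neighbourhood of \<open>P\<close> meets \<open>S\<close>. Below the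
        graph and on it this is impossible, so the point found lies above.\<close>
      ultimately have "emb Q T ` region R gO (\<lambda>_. s) \<inter> S \<noteq> {}"
        using open_Int_closure_eq_empty[OF open_emb[OF T o], of Q S] by (metis IntI empty_iff)
      then obtain v z where vz: "norm v < R" "gO v < z" "z < s" "emb Q T (v, z) \<in> S" by (auto simp: region_def)
      have "z \<noteq> h + gS v"
      proof
        assume "z = h + gS v"
        then have "emb Q T (v, z) \<in> frontier S" using fS[of v z] vz small[of v] h s by auto
        then show False using vz(4) S(1) by (simp add: frontier_def interior_open)
      qed
      moreover have "\<not> z < h + gS v"
      proof
        assume "z < h + gS v"
        then have "(v, z) \<in> region R gO (\<lambda>v. h + gS v)" using vz by (simp add: region_iff)
        then show False using G vz(4) by blast
      qed
      ultimately show ?thesis using vz by (intro exI[of _ v] exI[of _ z]) auto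
    qed
    then obtain v z where vz: "norm v < R" "h + gS v < z" "z < s" "emb Q T (v, z) \<in> S" by blast
    show ?thesis
    proof (rule region_subset_domain(1)[OF T c\<tau> cs b1(2) _ vz(1-3) vz(4)])
      fix v :: "real^2" and z assume "norm v < R" "h + gS v < z" "z < s"
      then show "emb Q T (v, z) \<notin> frontier S" using b1(3)[of v] by (intro av2) auto
    qed
  qed
  show "norm v < R \<Longrightarrow> gO v < z \<Longrightarrow> z < s \<Longrightarrow> emb Q T (v, z) \<in> \<Omega>"
    using B by (auto simp: region_def)
  show "emb Q T (v, gO v) \<notin> \<Omega>" if v: "norm v < R"
  proof -
    have "emb Q T (v, gO v) \<in> frontier \<Omega>" using fO[of v "gO v"] v small[OF v] h s by auto
    then show ?thesis using \<Omega> by (simp add: frontier_def interior_open)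
  qed
  show "norm v < R \<Longrightarrow> h + gS v < z \<Longrightarrow> z < s \<Longrightarrow> emb Q T (v, z) \<in> S"
    using A by (auto simp: region_def)
  show "emb Q T (v, z) \<in> \<Omega> - closure S" if v: "norm v < R" "gO v < z" "z < h + gS v"
  proof -
    have zs: "z < s" using b1(2)[OF v(1)] v(3) by linarith
    have "emb Q T (v, z) \<in> \<Omega>" using B v zs by (auto simp: region_def)
    moreover have "(v, z) \<in> region R gO (\<lambda>v. h + gS v)" using v by (simp add: region_iff)
    then have "emb Q T (v, z) \<notin> S" using G by blast
    moreover have "emb Q T (v, z) \<notin> frontier S" using av2[of v z] v zs by simp
    ultimately show ?thesis using S(1) by (simp add: frontier_def interior_open)
  qed
qed

text \<open>Without a positive distance the side of \<open>S\<close> cannot be deduced, so one point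
  of \<open>S\<close> above its graph is taken as input. The order of the two graphs is then forced
  by \<open>S \<subseteq> \<Omega>\<close>.\<close>

lemma contact_geometry:
  assumes T: "orthogonal_transformation T" and \<Omega>: "open \<Omega>" and S: "open S" "S \<subseteq> \<Omega>"
    and gO: "graph_frame \<Omega> Q T \<sigma> K gO" and gS: "graph_frame S Q T \<sigma> K gS"
    and R: "0 < R" "R < \<sigma>" and small: "K * R\<^sup>2 < s" and K: "0 < K" and s: "s < \<sigma>"
    and up: "norm v0 < R" "gS v0 < z0" "z0 < s" "emb Q T (v0, z0) \<in> S"
  shows "norm v < R \<Longrightarrow> gO v < z \<Longrightarrow> z < s \<Longrightarrow> emb Q T (v, z) \<in> \<Omega>"
    "norm v < R \<Longrightarrow> emb Q T (v, gO v) \<notin> \<Omega>"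
    "norm v < R \<Longrightarrow> gS v < z \<Longrightarrow> z < s \<Longrightarrow> emb Q T (v, z) \<in> S"
    "norm v < R \<Longrightarrow> gO v \<le> gS v"
proof -
  have sm: "\<bar>gO v\<bar> < s" "\<bar>gS v\<bar> < s" if "norm v < R" for v
  proof -
    have "K * (norm v)\<^sup>2 \<le> K * R\<^sup>2" using that K by (intro mult_left_mono power_mono) auto
    then show "\<bar>gO v\<bar> < s" "\<bar>gS v\<bar> < s"
      using graph_frameD(2)[OF gO, of v] graph_frameD(2)[OF gS, of v] that R small by linarith+
  qed
  have fO: "emb Q T (v, z) \<in> frontier \<Omega> \<longleftrightarrow> z = gO v" if "norm v < R" "\<bar>z\<bar> < \<sigma>" for v z
    using graph_frameD(4)[OF gO] that R by auto
  have fS: "emb Q T (v, z) \<in> frontier S \<longleftrightarrow> z = gS v" if "norm v < R" "\<bar>z\<bar> < \<sigma>" for v z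
    using graph_frameD(4)[OF gS] that R by auto
  have c: "continuous_on (ball 0 R) gO" "continuous_on (ball 0 R) gS" "continuous_on (ball 0 R) (\<lambda>v::real^2. s)"
    using graph_frameD(1)[OF gO] graph_frameD(1)[OF gS] R by (auto intro: continuous_on_subset[OF _ subset_ball] continuous_intros)
  have bs: "gO v < s" "gS v < s" if "norm v < R" for v using sm[OF that] by auto
  have A: "emb Q T ` region R gS (\<lambda>_. s) \<subseteq> S"
  proof (rule region_subset_domain(1)[OF T c(2,3) bs(2) _ up])
    fix v :: "real^2" and z assume "norm v < R" "gS v < z" "z < s"
    then show "emb Q T (v, z) \<notin> frontier S" using fS[of v z] sm[of v] s by auto
  qed
  have nO: "emb Q T (v, gO v) \<notin> \<Omega>" if v: "norm v < R" for v
  proof -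
    have "emb Q T (v, gO v) \<in> frontier \<Omega>" using fO[of v "gO v"] v sm[OF v] s by auto
    then show ?thesis using \<Omega> by (simp add: frontier_def interior_open)
  qed
  \<comment> \<open>Otherwise a boundary point of \<Omega> would lie above the graph of
    \<open>S\<close>, hence in \<open>S\<close> and in \<Omega>.\<close>
  have le: "gO v \<le> gS v" if v: "norm v < R" for v
  proof (rule ccontr)
    assume "\<not> gO v \<le> gS v"
    then have "(v, gO v) \<in> region R gS (\<lambda>_. s)" using v bs by (auto simp: region_def)
    then show False using A nO[OF v] S(2) by blast
  qed
  have B: "emb Q T ` region R gO (\<lambda>_. s) \<subseteq> \<Omega>"
  proof (rule region_subset_domain(1)[OF T c(1,3) bs(1) _ up(1) _ up(3)])
    show "gO v0 < z0" using le[OF up(1)] up(2) by simp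
    show "emb Q T (v0, z0) \<in> \<Omega>" using up(4) S(2) by blast
    fix v :: "real^2" and z assume "norm v < R" "gO v < z" "z < s"
    then show "emb Q T (v, z) \<notin> frontier \<Omega>" using fO[of v z] sm[of v] s by auto
  qed
  show "norm v < R \<Longrightarrow> gO v < z \<Longrightarrow> z < s \<Longrightarrow> emb Q T (v, z) \<in> \<Omega>" using B by (auto simp: region_def)
  show "norm v < R \<Longrightarrow> emb Q T (v, gO v) \<notin> \<Omega>" by (rule nO)
  show "norm v < R \<Longrightarrow> gS v < z \<Longrightarrow> z < s \<Longrightarrow> emb Q T (v, z) \<in> S" using A by (auto simp: region_def)
  show "norm v < R \<Longrightarrow> gO v \<le> gS v" by (rule le)
qed

subsection \<open>The two cases of the estimate\<close>

lemma cross3_antisym: "cross3 \<omega> x \<bullet> y = - (cross3 \<omega> y \<bullet> x)"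
  by (simp add: cross3_def inner_vec_def sum_3 algebra_simps)

text \<open>In an orthonormal frame the map \<open>cross3 \<omega>\<close> has a skew-symmetric
  matrix, so three entries describe it. The signs are arranged to match the locale
  \<open>gap\<close>.\<close>

lemma rigid_components:
  fixes h :: real
  assumes T: "orthogonal_transformation T" and U: "\<And>x. U x = us + cross3 \<omega> (x - xs)"
  defines "L k j \<equiv> cross3 \<omega> (T (axis j 1)) \<bullet> T (axis k 1)"
  shows "U (emb Q T (v, z)) \<bullet> T (axis 1 1) = U (emb Q T (0, h)) \<bullet> T (axis 1 1) - (- L 1 2) * v $ 2 + L 1 3 * (z - h)"
    "U (emb Q T (v, z)) \<bullet> T (axis 2 1) = U (emb Q T (0, h)) \<bullet> T (axis 2 1) + (- L 1 2) * v $ 1 + L 2 3 * (z - h)"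
    "U (emb Q T (v, z)) \<bullet> T (axis 3 1) = U (emb Q T (0, h)) \<bullet> T (axis 3 1) - L 1 3 * v $ 1 - L 2 3 * v $ 2"
proof -
  have lin: "linear T" using T by (rule orthogonal_transformation_linear)
  have "vec3 v z = vec3 0 h + (v $ 1 *\<^sub>R axis 1 1 + v $ 2 *\<^sub>R axis 2 1 + (z - h) *\<^sub>R axis 3 1)"
    by (simp add: vec_eq_iff forall_3 axis_def)
  then have e: "emb Q T (v, z) = emb Q T (0, h) + (v $ 1 *\<^sub>R T (axis 1 1) + v $ 2 *\<^sub>R T (axis 2 1) + (z - h) *\<^sub>R T (axis 3 1))"
    unfolding emb_def fst_conv snd_conv by (simp only: linear_add[OF lin] linear_scale[OF lin] add.assoc)
  have cadd: "cross3 \<omega> (x + y) = cross3 \<omega> x + cross3 \<omega> y" "cross3 \<omega> (c *\<^sub>R x) = c *\<^sub>R cross3 \<omega> x" for x y c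
    by (simp_all add: cross3_def vec_eq_iff forall_3 algebra_simps)
  have "U (emb Q T (v, z)) = U (emb Q T (0, h)) + (v $ 1 *\<^sub>R cross3 \<omega> (T (axis 1 1)) + v $ 2 *\<^sub>R cross3 \<omega> (T (axis 2 1)) + (z - h) *\<^sub>R cross3 \<omega> (T (axis 3 1)))"
  proof -
    have "emb Q T (v, z) - xs = (emb Q T (0, h) - xs) + (v $ 1 *\<^sub>R T (axis 1 1) + v $ 2 *\<^sub>R T (axis 2 1) + (z - h) *\<^sub>R T (axis 3 1))"
      unfolding e by (simp add: algebra_simps)
    then show ?thesis unfolding U by (simp only: cadd add.assoc)
  qed
  then have ex: "U (emb Q T (v, z)) \<bullet> T (axis k 1) = U (emb Q T (0, h)) \<bullet> T (axis k 1) + v $ 1 * L k 1 + v $ 2 * L k 2 + (z - h) * L k 3" for k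
    by (simp add: inner_add_left L_def)
  have anti: "L k j = - L j k" for k j unfolding L_def by (rule cross3_antisym)
  have "L 1 1 = 0" "L 2 2 = 0" "L 3 3 = 0" using anti[of 1 1] anti[of 2 2] anti[of 3 3] by linarith+
  then show "U (emb Q T (v, z)) \<bullet> T (axis 1 1) = U (emb Q T (0, h)) \<bullet> T (axis 1 1) - (- L 1 2) * v $ 2 + L 1 3 * (z - h)"
    "U (emb Q T (v, z)) \<bullet> T (axis 2 1) = U (emb Q T (0, h)) \<bullet> T (axis 2 1) + (- L 1 2) * v $ 1 + L 2 3 * (z - h)"
    "U (emb Q T (v, z)) \<bullet> T (axis 3 1) = U (emb Q T (0, h)) \<bullet> T (axis 3 1) - L 1 3 * v $ 1 - L 2 3 * v $ 2"
    unfolding ex using anti[of 2 1] anti[of 3 1] anti[of 3 2] by (simp_all add: algebra_simps)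
qed

text \<open>The passage from the field on \<Omega> to the locale. The gradient formula for
  \<open>pp\<close> is returned as well, because the L2 norms on the right of the final estimate
  refer to \<open>Du\<close>.\<close>

lemma gap_exists:
  fixes h :: real
  assumes T: "orthogonal_transformation T" and \<Omega>: "open \<Omega>" and u: "u \<in> W12_0 \<Omega>" and Du: "weak_grad \<Omega> u Du"
    and tr: "AE x in lebesgue. x \<in> \<Omega> \<longrightarrow> trace (Du x) = 0" and rig: "rigid_on S u xs us \<omega>"
    and r: "0 < r" "r < R" and m: "0 < m" "m < s"
    and c: "continuous_on (ball 0 R) \<beta>" "continuous_on (ball 0 R) \<tau>"
    and bd: "\<And>v. norm v < R \<Longrightarrow> - m \<le> \<beta> v \<and> \<beta> v \<le> \<tau> v \<and> \<tau> v \<le> m"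
    and g1: "\<And>v z. norm v < R \<Longrightarrow> \<beta> v < z \<Longrightarrow> z < s \<Longrightarrow> emb Q T (v, z) \<in> \<Omega>"
    and g2: "\<And>v. norm v < R \<Longrightarrow> emb Q T (v, \<beta> v) \<notin> \<Omega>"
    and g3: "\<And>v z. norm v < R \<Longrightarrow> \<tau> v < z \<Longrightarrow> z < s \<Longrightarrow> emb Q T (v, z) \<in> S"
  defines "L k j \<equiv> cross3 \<omega> (T (axis j 1)) \<bullet> T (axis k 1)" and "UP \<equiv> us + cross3 \<omega> (emb Q T (0, h) - xs)"
  obtains uu pp where "gap r R s m h \<beta> \<tau> uu pp (UP \<bullet> T (axis 3 1)) (UP \<bullet> T (axis 1 1)) (UP \<bullet> T (axis 2 1)) (- L 1 2) (L 1 3) (L 2 3)"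
    "\<And>k. AE p in lborel. p \<in> region R \<beta> \<tau> \<longrightarrow> pp k p = Du (emb Q T p) \<bullet> outer (T (axis k 1)) (T (axis 3 1))"
    "L2_on \<Omega> Du"
proof -
  have R: "0 < R" using r by simp
  have \<beta>s: "- s < \<beta> v \<and> \<beta> v < s" if "norm v < R" for v using bd[OF that] m by auto
  obtain uu pp :: "3 \<Rightarrow> (real^2) \<times> real \<Rightarrow> real" where
    i: "\<And>k. integrable lborel (uu k)" "\<And>k. integrable lborel (pp k)" and
    uu: "\<And>k. AE p in lborel. uu k p = (if p \<in> {p. norm (fst p) < R \<and> \<beta> (fst p) < snd p \<and> snd p < s} then u (emb Q T p) \<bullet> T (axis k 1) else 0)" and
    pp: "\<And>k. AE p in lborel. pp k p = (if p \<in> {p. norm (fst p) < R \<and> \<beta> (fst p) < snd p \<and> snd p < s} then Du (emb Q T p) \<bullet> outer (T (axis k 1)) (T (axis 3 1)) else 0)" and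
    sl: "\<And>k. AE v in lborel. norm v < R \<longrightarrow> (AE z in lborel. - s < z \<and> z < s \<longrightarrow> uu k (v, z) = (\<integral>t. indicator {..<z} t * pp k (v, t) \<partial>lborel))" and
    fl: "\<And>r \<kappa>. 0 < r \<Longrightarrow> r < R \<Longrightarrow> vert_test (- s) s \<kappa> \<Longrightarrow>
       (\<integral>p. uu 1 p * (- (rho r (fst p) * fst p $ 1) * \<kappa> (snd p)) + uu 2 p * (- (rho r (fst p) * fst p $ 2) * \<kappa> (snd p))
         + uu 3 p * (eta r (fst p) * deriv \<kappa> (snd p)) \<partial>lborel) = 0" and
    L2: "L2_on \<Omega> Du"
    using coordinate_fields[OF T \<Omega> u Du tr R c(1) \<beta>s g1 g2] by blast
  define U where "U x = us + cross3 \<omega> (x - xs)" for x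
  have Uae: "AE p in lborel. emb Q T p \<in> S \<longrightarrow> u (emb Q T p) = U (emb Q T p)"
    using AE_emb[OF T rig[unfolded rigid_on_def], of Q] by (simp add: U_def)
  have top: "AE p in lborel. norm (fst p) < R \<and> \<tau> (fst p) < snd p \<and> snd p < s \<longrightarrow> uu k p = U (emb Q T p) \<bullet> T (axis k 1)" for k
    using uu[of k] Uae
  proof eventually_elim
    case (elim p)
    show ?case
    proof
      assume p: "norm (fst p) < R \<and> \<tau> (fst p) < snd p \<and> snd p < s"
      then have "emb Q T p \<in> S" using g3[of "fst p" "snd p"] by simp
      moreover have "\<beta> (fst p) < snd p" using bd[of "fst p"] p by auto
      ultimately show "uu k p = U (emb Q T p) \<bullet> T (axis k 1)" using elim p by simp
    qed
  qed
  have UP: "U (emb Q T (0, h)) = UP" by (simp add: U_def UP_def)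
  note rc = rigid_components[OF T U_def, of Q _ _ h, folded L_def, unfolded UP]
  have top': "U (emb Q T p) \<bullet> T (axis 1 1) = UP \<bullet> T (axis 1 1) - (- L 1 2) * fst p $ 2 + L 1 3 * (snd p - h)"
    "U (emb Q T p) \<bullet> T (axis 2 1) = UP \<bullet> T (axis 2 1) + (- L 1 2) * fst p $ 1 + L 2 3 * (snd p - h)"
    "U (emb Q T p) \<bullet> T (axis 3 1) = UP \<bullet> T (axis 3 1) - L 1 3 * fst p $ 1 - L 2 3 * fst p $ 2" for p
    using rc[of "fst p" "snd p"] by simp_all
  show ?thesis
  proof (rule that[OF _ _ L2])
    show "gap r R s m h \<beta> \<tau> uu pp (UP \<bullet> T (axis 3 1)) (UP \<bullet> T (axis 1 1)) (UP \<bullet> T (axis 2 1)) (- L 1 2) (L 1 3) (L 2 3)"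
    proof
      show "AE p in lborel. norm (fst p) < R \<and> snd p \<le> \<beta> (fst p) \<longrightarrow> uu k p = 0" for k using uu[of k] by eventually_elim auto
      show "AE p in lborel. norm (fst p) < R \<and> snd p \<le> \<beta> (fst p) \<longrightarrow> pp k p = 0" for k using pp[of k] by eventually_elim auto
      show "AE p in lborel. norm (fst p) < R \<and> \<tau> (fst p) < snd p \<and> snd p < s \<longrightarrow> uu 1 p = UP \<bullet> T (axis 1 1) - (- L 1 2) * fst p $ 2 + L 1 3 * (snd p - h)"
        using top[of 1] unfolding top' .
      show "AE p in lborel. norm (fst p) < R \<and> \<tau> (fst p) < snd p \<and> snd p < s \<longrightarrow> uu 2 p = UP \<bullet> T (axis 2 1) + (- L 1 2) * fst p $ 1 + L 2 3 * (snd p - h)"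
        using top[of 2] unfolding top' .
      show "AE p in lborel. norm (fst p) < R \<and> \<tau> (fst p) < snd p \<and> snd p < s \<longrightarrow> uu 3 p = UP \<bullet> T (axis 3 1) - L 1 3 * fst p $ 1 - L 2 3 * fst p $ 2"
        using top[of 3] unfolding top' .
    qed (use r m c bd i sl fl[OF r] in blast)+
    fix k
    show "AE p in lborel. p \<in> region R \<beta> \<tau> \<longrightarrow> pp k p = Du (emb Q T p) \<bullet> outer (T (axis k 1)) (T (axis 3 1))"
      using pp[of k]
    proof eventually_elim
      case (elim p)
      then show ?case using bd[of "fst p"] m by (auto simp: region_def)
    qed
  qed
qed

lemma L2_transport:
  fixes D :: "real^3 \<Rightarrow> 'b::euclidean_space"
  assumes T: "orthogonal_transformation T" and D: "L2_on A D" "A \<in> sets lebesgue" and G: "G \<in> sets borel" "emb Q T ` G \<subseteq> A"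
    and b: "norm b \<le> 1" and f: "f \<in> borel_measurable borel" "AE p in lborel. p \<in> G \<longrightarrow> f p = D (emb Q T p) \<bullet> b"
  shows "integrable lborel (\<lambda>p. (indicator G p * f p)\<^sup>2)" "sqrt (\<integral>p. (indicator G p * f p)\<^sup>2 \<partial>lborel) \<le> L2_norm A D"
proof -
  define B where "B = emb Q T ` G"
  have B: "B \<in> sets lebesgue" "B \<subseteq> A" using emb_image_borel[OF T G(1)] G(2) by (auto simp: B_def)
  note L = L2_on_inner[OF D B b]
  obtain f' :: "(real^2) \<times> real \<Rightarrow> real" where f': "f' \<in> borel_measurable borel"
    "AE p in lborel. f' p = indicator B (emb Q T p) * (D (emb Q T p) \<bullet> b)"
    "\<And>(h :: real \<Rightarrow> real) l. h \<in> borel_measurable borel \<Longrightarrow> l \<in> borel_measurable borel \<Longrightarrow>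
       (\<integral>x. h (indicator B x * (D x \<bullet> b)) * l x \<partial>lebesgue) = (\<integral>p. h (f' p) * l (emb Q T p) \<partial>lborel)"
    "\<And>(h :: real \<Rightarrow> real) l. h \<in> borel_measurable borel \<Longrightarrow> l \<in> borel_measurable borel \<Longrightarrow>
       integrable lebesgue (\<lambda>x. h (indicator B x * (D x \<bullet> b)) * l x) \<longleftrightarrow> integrable lborel (\<lambda>p. h (f' p) * l (emb Q T p))"
    using emb_transport[OF T L(1)] by blast
  have inB: "emb Q T p \<in> B \<longleftrightarrow> p \<in> G" for p
    unfolding B_def emb_image_vimage[OF T] by (simp add: unemb_emb[OF T])
  have ae: "AE p in lborel. (f' p)\<^sup>2 = (indicator G p * f p)\<^sup>2"
    using f'(2) f(2) by eventually_elim (auto simp: indicator_def inB)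
  have sq: "(\<lambda>t::real. t\<^sup>2) \<in> borel_measurable borel" by measurable
  have m: "(\<lambda>p. (indicator G p * f p)\<^sup>2) \<in> borel_measurable lborel" using f(1) G(1) by measurable
  have "integrable lborel (\<lambda>p. (f' p)\<^sup>2)" using f'(4)[OF sq, of "\<lambda>_. 1"] L(2) by simp
  then show "integrable lborel (\<lambda>p. (indicator G p * f p)\<^sup>2)" by (rule integrable_cong_AE_imp[OF _ m ae])
  have "(\<integral>p. (f' p)\<^sup>2 \<partial>lborel) = (\<integral>p. (indicator G p * f p)\<^sup>2 \<partial>lborel)"
    by (rule integral_cong_AE[OF _ m ae]) (use f'(1) in measurable)
  then have "(\<integral>p. (indicator G p * f p)\<^sup>2 \<partial>lborel) = (\<integral>p. (f' p)\<^sup>2 \<partial>lborel)" by (rule sym)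
  also have "\<dots> = (\<integral>x. (indicator B x * (D x \<bullet> b))\<^sup>2 \<partial>lebesgue)" using f'(3)[OF sq, of "\<lambda>_. 1"] by simp
  finally show "sqrt (\<integral>p. (indicator G p * f p)\<^sup>2 \<partial>lborel) \<le> L2_norm A D" using L(3) by simp
qed

section \<open>Volume of the gap and passage to L2 norms\<close>

context gap
begin

lemma volume_Gs:
  assumes d: "\<And>v. norm v < R \<Longrightarrow> \<tau> v - \<beta> v \<le> d"
  shows "integrable lborel (indicator Gs :: (real^2) \<times> real \<Rightarrow> real)" "(\<integral>p. indicator Gs p \<partial>lborel) \<le> d * (R\<^sup>2 * pi)"
proof -
  have "Gs \<subseteq> cball 0 R \<times> {- m..m}" using bd by (force simp: Gs_def)
  then have bdd: "bounded Gs" using bounded_subset[OF bounded_Times[OF bounded_cball bounded_closed_interval]] by blast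
  show i: "integrable lborel (indicator Gs :: (real^2) \<times> real \<Rightarrow> real)"
    using emeasure_bounded_finite[OF bdd] by (intro integrable_real_indicator) auto
  have bi: "integrable lborel (indicator (ball (0::real^2) R) :: real^2 \<Rightarrow> real)"
    by (intro integrable_real_indicator emeasure_bounded_finite) auto
  have "(\<integral>p. indicator Gs p \<partial>lborel) = (\<integral>v. (\<integral>z. (indicator Gs (v, z) :: real) \<partial>lborel) \<partial>lborel)" by (rule lborel_slice_integral[OF i])
  also have "\<dots> \<le> (\<integral>v. d * indicator (ball (0::real^2) R) v \<partial>lborel)"
  proof (rule Bochner_Integration.integral_mono)
    show "integrable lborel (\<lambda>v. \<integral>z. (indicator Gs (v, z) :: real) \<partial>lborel)" by (rule lborel_slice_integrable[OF i])
    show "integrable lborel (\<lambda>v. d * indicator (ball (0::real^2) R) v)" using bi by simp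
    fix v :: "real^2"
    show "(\<integral>z. indicator Gs (v, z) \<partial>lborel) \<le> d * indicator (ball 0 R) v"
    proof (cases "norm v < R")
      case True
      then show ?thesis using d[OF True] bd[OF True] by (simp add: indicator_Gs)
    next
      case False
      then have "(\<lambda>z. indicator Gs (v, z) :: real) = (\<lambda>_. 0)" by (auto simp: Gs_def indicator_def fun_eq_iff)
      then show ?thesis using False by simp
    qed
  qed
  also have "\<dots> = d * (R\<^sup>2 * pi)" using r circle_area[of R "0::real^2"] by simp
  finally show "(\<integral>p. indicator Gs p \<partial>lborel) \<le> d * (R\<^sup>2 * pi)" .
qed

text \<open>Cauchy-Schwarz against the indicator of the gap, whose volume is at most the height
  \<open>d\<close> times the area of the disc of radius \<open>R\<close>.\<close>

lemma integral_Gs_le: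
  fixes f :: "(real^2) \<times> real \<Rightarrow> real"
  assumes d: "\<And>v. norm v < R \<Longrightarrow> \<tau> v - \<beta> v \<le> d" and f: "f \<in> borel_measurable borel"
    and f2: "integrable lborel (\<lambda>p. (indicator Gs p * f p)\<^sup>2)" "sqrt (\<integral>p. (indicator Gs p * f p)\<^sup>2 \<partial>lborel) \<le> D"
  shows "(\<integral>p. indicator Gs p * \<bar>f p\<bar> \<partial>lborel) \<le> sqrt (d * (R\<^sup>2 * pi)) * D"
proof -
  have i: "integrable lborel (\<lambda>p. (indicator Gs p :: real)\<^sup>2)"
    using volume_Gs(1)[OF d] by (rule Bochner_Integration.integrable_cong[THEN iffD1, OF refl, rotated]) (auto simp: indicator_def)
  have "(\<integral>p. indicator Gs p * \<bar>f p\<bar> \<partial>lborel) = (\<integral>p. \<bar>indicator Gs p * (indicator Gs p * f p)\<bar> \<partial>lborel)"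
    by (intro Bochner_Integration.integral_cong) (auto simp: indicator_def)
  also have "\<dots> \<le> sqrt (\<integral>p. (indicator Gs p)\<^sup>2 \<partial>lborel) * sqrt (\<integral>p. (indicator Gs p * f p)\<^sup>2 \<partial>lborel)"
    using f by (intro Cauchy_Schwarz_integral(2) i f2(1)) auto
  also have "(\<integral>p. (indicator Gs p :: real)\<^sup>2 \<partial>lborel) = (\<integral>p. indicator Gs p \<partial>lborel)"
    by (intro Bochner_Integration.integral_cong) (auto simp: indicator_def)
  also have "sqrt (\<integral>p. indicator Gs p \<partial>lborel) * sqrt (\<integral>p. (indicator Gs p * f p)\<^sup>2 \<partial>lborel) \<le> sqrt (d * (R\<^sup>2 * pi)) * D"
  proof (intro mult_mono real_sqrt_le_mono volume_Gs(2)[OF d] f2(2))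
    have "0 \<le> (\<integral>p. (indicator Gs p :: real) \<partial>lborel)" by (rule Bochner_Integration.integral_nonneg) simp
    also have "\<dots> \<le> d * (R\<^sup>2 * pi)" by (rule volume_Gs(2)[OF d])
    finally show "0 \<le> sqrt (d * (R\<^sup>2 * pi))" by (simp only: real_sqrt_ge_0_iff)
    show "0 \<le> sqrt (\<integral>p. (indicator Gs p * f p)\<^sup>2 \<partial>lborel)" by (simp only: real_sqrt_ge_0_iff) (rule Bochner_Integration.integral_nonneg, simp)
  qed
  finally show ?thesis .
qed

end

text \<open>On the disc of half the radius the argument of \<open>fl\<close> is at least 3/4, and
  that disc has area \<open>pi / 4 * r\<^sup>2\<close>.\<close>

lemma eta_integral_ge:
  assumes r: "0 < r" shows "fl (3/4) * pi / 4 * r\<^sup>2 \<le> (\<integral>v. eta r v \<partial>lborel)"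
proof -
  have i: "integrable lborel (eta r)"
    using integrable_eta_times[of r "2 * r" "\<lambda>_. 1"] r by simp
  have "fl (3/4) * pi / 4 * r\<^sup>2 = (\<integral>v. fl (3/4) * indicator (ball (0::real^2) (r / 2)) v \<partial>lborel)"
    using r circle_area[of "r / 2" "0::real^2"] by (simp add: power_divide)
  also have "\<dots> \<le> (\<integral>v. eta r v \<partial>lborel)"
  proof (rule integral_mono[OF _ i])
    show "integrable lborel (\<lambda>v. fl (3/4) * indicator (ball (0::real^2) (r / 2)) v)"
      by (intro integrable_mult_right integrable_real_indicator emeasure_bounded_finite) auto
    fix v :: "real^2"
    show "fl (3/4) * indicator (ball 0 (r / 2)) v \<le> eta r v"
    proof (cases "norm v < r / 2")
      case True
      then have "(norm v)\<^sup>2 \<le> (r / 2)\<^sup>2" by (intro power_mono) auto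
      then have "(norm v)\<^sup>2 / r\<^sup>2 \<le> 1 / 4" using r by (simp add: power_divide divide_le_eq)
      then have "3 / 4 \<le> 1 - (norm v)\<^sup>2 / r\<^sup>2" by simp
      moreover have "fl (3/4) \<le> fl t" if "3/4 \<le> t" for t
        using that by (simp add: fl_def field_simps)
      ultimately show ?thesis using True by (simp add: eta_def)
    qed (simp add: eta_bounds)
  qed
  finally show ?thesis .
qed

lemma cyl_eq: assumes T: "orthogonal_transformation T" shows "cyl Q T \<sigma> = emb Q T ` (ball 0 \<sigma> \<times> UNIV)"
proof -
  have "{y. norm (horiz y) < \<sigma>} = (\<lambda>p. vec3 (fst p) (snd p)) ` (ball 0 \<sigma> \<times> UNIV)"
  proof safe
    fix y assume "norm (horiz y) < \<sigma>"
    then show "y \<in> (\<lambda>p. vec3 (fst p) (snd p)) ` (ball 0 \<sigma> \<times> UNIV)"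
      by (intro image_eqI[of _ _ "(horiz y, y $ 3)"]) auto
  qed auto
  then show ?thesis by (simp add: cyl_def emb_def[abs_def] image_image)
qed

lemma open_cyl: "orthogonal_transformation T \<Longrightarrow> open (cyl Q T \<sigma>)"
  unfolding cyl_eq by (intro open_emb open_Times) auto

lemma L2_norm_nonneg: "0 \<le> L2_norm A f"
  by (simp add: L2_norm_def set_lebesgue_integral_def)

text \<open>The relation \<open>h = 16 * K * r\<^sup>2\<close> makes the data radius
  \<open>2 * r\<close> the largest one at which both graphs are guaranteed to stay within
  \<open>h / 4\<close>. The height, the cut-off radius and the odd parts are then all powers of
  \<open>r\<close>, and \<open>core_estimate\<close> becomes a polynomial inequality.\<close>

lemma gap_estimate:
  fixes h r \<sigma> K :: real
  assumes T: "orthogonal_transformation T" and \<Omega>: "open \<Omega>" and S: "open S" "S \<subseteq> \<Omega>"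
    and u: "u \<in> W12_0 \<Omega>" and Du: "weak_grad \<Omega> u Du"
    and tr: "AE x in lebesgue. x \<in> \<Omega> \<longrightarrow> trace (Du x) = 0" and rig: "rigid_on S u xs us \<omega>"
    and D2: "weak_hess (\<Omega> - closure S) u D2u" "L2_on (\<Omega> - closure S) D2u"
    and Q: "Q \<in> frontier \<Omega>" and h: "0 < h" "h = setdist S (frontier \<Omega>)" and P: "emb Q T (0, h) \<in> frontier S"
    and gO: "graph_frame \<Omega> Q T \<sigma> K gO" and gS: "graph_frame S (emb Q T (0, h)) T \<sigma> K gS"
    and K: "0 < K" and r: "0 < r" "r \<le> 1" "2 * r < \<sigma>" "h = 16 * K * r\<^sup>2" and s: "3 * h < \<sigma>"
  defines "N \<equiv> cyl Q T (2 * r) \<inter> (\<Omega> - closure S)" and "B \<equiv> sqrt (96 * pi * K)"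
  shows "fl (3/4) * pi / 4 * \<bar>(us + cross3 \<omega> (emb Q T (0, h) - xs)) \<bullet> T (axis 3 1)\<bar>
    \<le> B * K * (32 + 224 * K) * r\<^sup>2 * L2_norm N Du + 2304 * K\<^sup>2 * B * r ^ 3 * L2_norm N D2u"
proof -
  define R where "R = 2 * r"
  have R: "0 < R" "R < \<sigma>" "4 * K * R\<^sup>2 \<le> h" using r by (simp_all add: R_def power_mult_distrib)
  define \<tau> where "\<tau> v = h + gS v" for v
  note geo = gap_geometry[OF T \<Omega> S Q h P gO gS R K order_refl, folded \<tau>_def]
  have s': "2 * h + h < \<sigma>" using s by simp
  note geo = geo[OF s']
  have small: "\<bar>gO v\<bar> \<le> h / 4" "\<bar>gS v\<bar> \<le> h / 4" if "norm v < R" for v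
  proof -
    have "K * (norm v)\<^sup>2 \<le> K * R\<^sup>2" using that K by (intro mult_left_mono power_mono) auto
    then have "K * (norm v)\<^sup>2 \<le> h / 4" using R by simp
    then show "\<bar>gO v\<bar> \<le> h / 4" "\<bar>gS v\<bar> \<le> h / 4"
      using graph_frameD(2)[OF gO, of v] graph_frameD(2)[OF gS, of v] that R by linarith+
  qed
  have c: "continuous_on (ball 0 R) gO" "continuous_on (ball 0 R) \<tau>"
    using graph_frameD(1)[OF gO] graph_frameD(1)[OF gS] R unfolding \<tau>_def
    by (auto intro!: continuous_intros intro: continuous_on_subset[OF _ subset_ball])
  have bd: "- (3 / 2 * h) \<le> gO v \<and> gO v \<le> \<tau> v \<and> \<tau> v \<le> 3 / 2 * h" if "norm v < R" for v
    using small[OF that] h(1) unfolding \<tau>_def by linarith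
  let ?V = "(us + cross3 \<omega> (emb Q T (0, h) - xs)) \<bullet> T (axis 3 1)"
  have rR: "r < R" using r by (simp add: R_def)
  \<comment> \<open>The top graph stays below \<open>5 / 4 * h\<close>, so the level
    \<open>3 / 2 * h\<close> is safe for the cut-off and the strip may end at
    \<open>2 * h\<close>.\<close>
  have mm: "0 < 3 / 2 * h" "3 / 2 * h < 2 * h" using h(1) by auto
  obtain uu pp c1 c2 w a b where g: "gap r R (2 * h) (3 / 2 * h) h gO \<tau> uu pp ?V c1 c2 w a b"
    and pp: "\<And>k. AE p in lborel. p \<in> region R gO \<tau> \<longrightarrow> pp k p = Du (emb Q T p) \<bullet> outer (T (axis k 1)) (T (axis 3 1))"
    and L2: "L2_on \<Omega> Du"
    by (rule gap_exists[OF T \<Omega> u Du tr rig r(1) rR mm c bd geo(1,2,3), where h = h]) (assumption+, rule that)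
  interpret g: gap r R "2 * h" "3 / 2 * h" h gO \<tau> uu pp ?V c1 c2 w a b by (rule g)
  have Fo: "open (\<Omega> - closure S)" using \<Omega> by (simp add: open_Diff)
  have GsF: "emb Q T ` g.Gs \<subseteq> \<Omega> - closure S" using geo(4) by (auto simp: g.Gs_def)
  have Gsr: "region R gO \<tau> = g.Gs" by (simp add: region_def g.Gs_def)
  have GsN: "emb Q T ` g.Gs \<subseteq> N"
  proof -
    have "g.Gs \<subseteq> ball 0 (2 * r) \<times> UNIV" unfolding g.Gs_def using R_def by auto
    then show ?thesis using GsF by (auto simp: N_def cyl_eq[OF T])
  qed
  have Nm: "N \<in> sets lebesgue" using open_Int[OF open_cyl[OF T] Fo] by (simp add: N_def)
  have L2N: "L2_on N Du" "L2_on N D2u"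
    using L2_on_subset[OF L2 _ Nm] L2_on_subset[OF D2(2) _ Nm] \<Omega> Fo by (auto simp: N_def)
  have bd2: "- (2 * h) < gO v \<and> \<tau> v < 2 * h" if "norm v < R" for v using bd[OF that] mm by auto
  obtain hh :: "3 \<Rightarrow> (real^2) \<times> real \<Rightarrow> real" where hhi: "\<And>k. integrable lborel (hh k)"
    and hhae: "\<And>k. AE p in lborel. hh k p = (if p \<in> g.Gs then D2u (emb Q T p) \<bullet> outer (T (axis k 1)) (outer (T (axis 3 1)) (T (axis 3 1))) else 0)"
    and hh: "\<And>k. AE v in lborel. norm v < R \<longrightarrow> (AE t1 in lborel. AE t2 in lborel. t1 \<in> {gO v<..<\<tau> v} \<and> t2 \<in> {gO v<..<\<tau> v} \<longrightarrow>
       \<bar>pp k (v, t1) - pp k (v, t2)\<bar> \<le> (\<integral>t. \<bar>hh k (v, t)\<bar> \<partial>lborel))"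
    using coordinate_hessian[OF T Fo \<Omega> Diff_subset Du L2 D2 g.ppi c bd2 pp[unfolded Gsr g.Gs_def] GsF[unfolded g.Gs_def], folded g.Gs_def]
    by blast
  have nT: "norm (outer (T (axis k 1)) (T (axis 3 1))) \<le> 1" "norm (outer (T (axis k 1)) (outer (T (axis 3 1)) (T (axis 3 1)))) \<le> 1" for k
    by (simp_all add: frame_norm[OF T] norm_outer)
  have d: "\<tau> v - gO v \<le> 3 / 2 * h" if "norm v < R" for v using small[OF that] unfolding \<tau>_def by linarith
  \<comment> \<open>Height \<open>3 / 2 * h\<close> times the area of the disc of radius
    \<open>2 * r\<close> is \<open>96 * pi * K\<close> times the fourth power of \<open>r\<close>,
    which explains \<open>B\<close>.\<close>
  have vol: "sqrt (3 / 2 * h * (R\<^sup>2 * pi)) = B * r\<^sup>2"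
  proof -
    have "3 / 2 * h * (R\<^sup>2 * pi) = (96 * pi * K) * (r\<^sup>2)\<^sup>2" unfolding r(4) R_def by (simp add: power2_eq_square)
    then show ?thesis unfolding B_def by (simp only: real_sqrt_mult real_sqrt_abs abs_power2)
  qed
  have meas: "pp k \<in> borel_measurable borel" "hh k \<in> borel_measurable borel" for k
    using borel_measurable_integrable[OF g.ppi[of k]] borel_measurable_integrable[OF hhi[of k]] by simp_all
  have aa: "g.aa k \<le> B * r\<^sup>2 * L2_norm N Du" for k
    unfolding g.aa_def vol[symmetric]
    by (rule g.integral_Gs_le[OF d meas(1) L2_transport[OF T L2N(1) Nm g.Gs_borel GsN nT(1) meas(1) pp[unfolded Gsr]]])
  have hhae': "AE p in lborel. p \<in> g.Gs \<longrightarrow> hh k p = D2u (emb Q T p) \<bullet> outer (T (axis k 1)) (outer (T (axis 3 1)) (T (axis 3 1)))" for k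
    using hhae[of k] by eventually_elim simp
  have hb: "(\<integral>p. \<bar>hh k p\<bar> \<partial>lborel) \<le> B * r\<^sup>2 * L2_norm N D2u" for k
  proof -
    have "(\<integral>p. \<bar>hh k p\<bar> \<partial>lborel) = (\<integral>p. indicator g.Gs p * \<bar>hh k p\<bar> \<partial>lborel)"
    proof (rule integral_cong_AE)
      show "AE p in lborel. \<bar>hh k p\<bar> = indicator g.Gs p * \<bar>hh k p\<bar>" using hhae[of k] by eventually_elim (auto simp: indicator_def)
    qed (use meas in measurable)
    also have "\<dots> \<le> B * r\<^sup>2 * L2_norm N D2u" unfolding vol[symmetric]
      by (rule g.integral_Gs_le[OF d meas(2) L2_transport[OF T L2N(2) Nm g.Gs_borel GsN nT(2) meas(2) hhae']])
    finally show ?thesis .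
  qed
  have G: "\<bar>\<tau> v - h\<bar> \<le> 4 * K * r\<^sup>2" "\<bar>gO v\<bar> \<le> 4 * K * r\<^sup>2" if "norm v < R" for v
    using small[OF that] r(4) by (simp_all add: \<tau>_def)
  have pos: "gO v < \<tau> v" if "norm v < R" for v using small[OF that] h(1) unfolding \<tau>_def by linarith
  have odd: "\<bar>\<tau> v - \<tau> (- v)\<bar> \<le> 8 * K * r ^ 3" "\<bar>gO v - gO (- v)\<bar> \<le> 8 * K * r ^ 3" if v: "norm v < r" for v
  proof -
    have "8 * K * norm v ^ 3 \<le> 8 * K * r ^ 3" using v K by (intro mult_left_mono power_mono) auto
    moreover have "norm v < \<sigma>" using v rR R by simp
    ultimately show "\<bar>\<tau> v - \<tau> (- v)\<bar> \<le> 8 * K * r ^ 3" "\<bar>gO v - gO (- v)\<bar> \<le> 8 * K * r ^ 3"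
      using graph_frameD(3)[OF gO, of v] graph_frameD(3)[OF gS, of v] by (auto simp: \<tau>_def)
  qed
  define X where "X = B * r\<^sup>2 * L2_norm N Du"
  define Y where "Y = B * r\<^sup>2 * L2_norm N D2u"
  have XY: "0 \<le> X" "0 \<le> Y" using K by (auto simp: X_def Y_def B_def L2_norm_nonneg)
  have "\<bar>?V\<bar> * (\<integral>v. eta r v \<partial>lborel) \<le> 2 / r\<^sup>2 * (8 * K * r ^ 3 * (r * (g.aa 1 + g.aa 2) + 4 * K * r\<^sup>2 * g.aa 3) + ((4 * K * r\<^sup>2)\<^sup>2 + h * (4 * K * r\<^sup>2)) * g.aa 3)
     + 2 * (h + 2 * (4 * K * r\<^sup>2))\<^sup>2 / r * ((\<integral>p. \<bar>hh 1 p\<bar> \<partial>lborel) + (\<integral>p. \<bar>hh 2 p\<bar> \<partial>lborel))"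
    by (rule g.core_estimate[OF G less_imp_le[OF h(1)] pos odd hhi hh])
  also have "\<dots> \<le> 2 / r\<^sup>2 * (8 * K * r ^ 3 * (r * (X + X) + 4 * K * r\<^sup>2 * X) + ((4 * K * r\<^sup>2)\<^sup>2 + h * (4 * K * r\<^sup>2)) * X)
     + 2 * (h + 2 * (4 * K * r\<^sup>2))\<^sup>2 / r * (Y + Y)"
    using aa hb K r(1) h(1) by (intro add_mono mult_left_mono) (auto simp: X_def Y_def)
  \<comment> \<open>The 32 and the 64 come from the odd part of the graphs against \<open>l\<close>,
    the 160 from the terms with \<open>q\<close>, and 2304 is 4 times the square of 24, the gap
    height bound being \<open>24 * K * r\<^sup>2\<close>.\<close>
  also have "\<dots> = (32 * K * r\<^sup>2 + 64 * K\<^sup>2 * r ^ 3 + 160 * K\<^sup>2 * r\<^sup>2) * X + 2304 * K\<^sup>2 * r ^ 3 * Y"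
    using r(1) unfolding r(4) by (simp add: field_simps power2_eq_square power3_eq_cube)
  \<comment> \<open>The assumption \<open>r \<le> 1\<close> absorbs the one term of higher order, so
    that the gradient keeps the single factor \<open>r\<^sup>2\<close>.\<close>
  also have "\<dots> \<le> (32 * K * r\<^sup>2 + 64 * K\<^sup>2 * r\<^sup>2 + 160 * K\<^sup>2 * r\<^sup>2) * X + 2304 * K\<^sup>2 * r ^ 3 * Y"
  proof -
    have "r ^ 3 \<le> r\<^sup>2" using r by (intro power_decreasing) auto
    then show ?thesis using XY K by (intro add_mono mult_right_mono mult_left_mono) auto
  qed
  also have "\<dots> = r\<^sup>2 * (B * K * (32 + 224 * K) * r\<^sup>2 * L2_norm N Du + 2304 * K\<^sup>2 * B * r ^ 3 * L2_norm N D2u)"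
    by (simp add: X_def Y_def algebra_simps power2_eq_square power3_eq_cube)
  finally have "\<bar>?V\<bar> * (\<integral>v. eta r v \<partial>lborel) \<le> r\<^sup>2 * (B * K * (32 + 224 * K) * r\<^sup>2 * L2_norm N Du + 2304 * K\<^sup>2 * B * r ^ 3 * L2_norm N D2u)" .
  moreover have "r\<^sup>2 * (fl (3/4) * pi / 4 * \<bar>?V\<bar>) \<le> \<bar>?V\<bar> * (\<integral>v. eta r v \<partial>lborel)"
    using mult_left_mono[OF eta_integral_ge[OF r(1)], of "\<bar>?V\<bar>"] by (simp add: algebra_simps)
  ultimately have "r\<^sup>2 * (fl (3/4) * pi / 4 * \<bar>?V\<bar>) \<le> r\<^sup>2 * (B * K * (32 + 224 * K) * r\<^sup>2 * L2_norm N Du + 2304 * K\<^sup>2 * B * r ^ 3 * L2_norm N D2u)"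
    by linarith
  then show ?thesis using r(1) by (simp only: mult_le_cancel_left_pos zero_less_power)
qed

text \<open>With contact there is no length scale, so every small \<open>r\<close> is admissible.
  Height and graph deviations are of order \<open>r\<^sup>2\<close>, while the gradient norm and the
  rigid motion are fixed; the rough estimate then bounds the normal velocity by a fixed multiple of
  \<open>r\<close>.\<close>

lemma contact_zero_above:
  fixes \<sigma> K :: real
  assumes T: "orthogonal_transformation T" and \<Omega>: "open \<Omega>" and S: "open S" "S \<subseteq> \<Omega>"
    and u: "u \<in> W12_0 \<Omega>" and Du: "weak_grad \<Omega> u Du"
    and tr: "AE x in lebesgue. x \<in> \<Omega> \<longrightarrow> trace (Du x) = 0" and rig: "rigid_on S u xs us \<omega>"
    and gO: "graph_frame \<Omega> Q T \<sigma> K gO" and gS: "graph_frame S Q T \<sigma> K gS"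
    and R1: "0 < R1" "R1 < \<sigma>" and small: "K * R1\<^sup>2 < s" and K: "0 < K" and s: "s < \<sigma>"
    and up: "norm v0 < R1" "gS v0 < z0" "z0 < s" "emb Q T (v0, z0) \<in> S"
  shows "(us + cross3 \<omega> (Q - xs)) \<bullet> T (axis 3 1) = 0"
proof -
  let ?V = "(us + cross3 \<omega> (Q - xs)) \<bullet> T (axis 3 1)"
  define c1 where "c1 = (us + cross3 \<omega> (Q - xs)) \<bullet> T (axis 1 1)"
  define c2 where "c2 = (us + cross3 \<omega> (Q - xs)) \<bullet> T (axis 2 1)"
  define a where "a = cross3 \<omega> (T (axis 3 1)) \<bullet> T (axis 1 1)"
  define b where "b = cross3 \<omega> (T (axis 3 1)) \<bullet> T (axis 2 1)"
  define w where "w = - (cross3 \<omega> (T (axis 2 1)) \<bullet> T (axis 1 1))"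
  note geo1 = contact_geometry[OF T \<Omega> S gO gS R1 small K s up]
  have Q0: "emb Q T (0, 0) = Q"
  proof -
    have "vec3 0 0 = 0" by (simp add: vec_eq_iff forall_3)
    then show ?thesis using linear_0[OF orthogonal_transformation_linear[OF T]] by (simp add: emb_def)
  qed
  define D where "D = L2_norm \<Omega> Du"
  define B where "B = sqrt (32 * pi * K)"
  \<comment> \<open>The coefficients of the rough estimate after division by
    \<open>r\<^sup>2\<close>, with the surplus power of \<open>r\<close> in the last term estimated
    by one. No entry depends on \<open>r\<close>.\<close>
  define M where "M = 64 * K * B * D + 16 * K * pi * (\<bar>c1\<bar> + \<bar>c2\<bar>) + 32 * K\<^sup>2 * pi * (\<bar>a\<bar> + \<bar>b\<bar>)"
  have main: "fl (3/4) * pi / 4 * \<bar>?V\<bar> \<le> M * r" if r: "0 < r" "r \<le> 1" "2 * r \<le> R1" for r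
  proof -
    define R where "R = 2 * r"
    have R: "0 < R" "R \<le> R1" "R < \<sigma>" "r < R" using r R1 by (simp_all add: R_def)
    have KR: "K * R\<^sup>2 \<le> K * R1\<^sup>2" using R K by (intro mult_left_mono power_mono) auto
    define m where "m = 4 * K * r\<^sup>2"
    have m: "m = K * R\<^sup>2" "0 < m" using K r by (simp_all add: m_def R_def power_mult_distrib)
    then have m: "m = K * R\<^sup>2" "0 < m" "m < s" using KR small by auto
    have gb: "\<bar>gO v\<bar> \<le> m" "\<bar>gS v\<bar> \<le> m" if "norm v < R" for v
    proof -
      have "K * (norm v)\<^sup>2 \<le> m" unfolding m(1) using that K by (intro mult_left_mono power_mono) auto
      then show "\<bar>gO v\<bar> \<le> m" "\<bar>gS v\<bar> \<le> m"
        using graph_frameD(2)[OF gO, of v] graph_frameD(2)[OF gS, of v] that R by linarith+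
    qed
    have c: "continuous_on (ball 0 R) gO" "continuous_on (ball 0 R) gS"
      using graph_frameD(1)[OF gO] graph_frameD(1)[OF gS] R by (auto intro: continuous_on_subset[OF _ subset_ball])
    have bd: "- m \<le> gO v \<and> gO v \<le> gS v \<and> gS v \<le> m" if "norm v < R" for v
      using gb[OF that] geo1(4)[of v] that R by (auto simp: abs_le_iff)
    have g1: "emb Q T (v, z) \<in> \<Omega>" if "norm v < R" "gO v < z" "z < s" for v z using geo1(1) that R by simp
    have g2: "emb Q T (v, gO v) \<notin> \<Omega>" if "norm v < R" for v using geo1(2) that R by simp
    have g3: "emb Q T (v, z) \<in> S" if "norm v < R" "gS v < z" "z < s" for v z using geo1(3) that R by simp
    obtain uu pp where g: "gap r R s m 0 gO gS uu pp ?V c1 c2 w a b"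
      and pp: "\<And>k. AE p in lborel. p \<in> region R gO gS \<longrightarrow> pp k p = Du (emb Q T p) \<bullet> outer (T (axis k 1)) (T (axis 3 1))"
      and L2: "L2_on \<Omega> Du"
      by (rule gap_exists[OF T \<Omega> u Du tr rig r(1) R(4) m(2,3) c bd g1 g2 g3, where h = 0, unfolded Q0, folded a_def b_def c1_def c2_def w_def])
        (assumption+, rule that)
    interpret g: gap r R s m 0 gO gS uu pp ?V c1 c2 w a b by (rule g)
    have Gsr: "region R gO gS = g.Gs" by (simp add: region_def g.Gs_def)
    have Gs\<Omega>: "emb Q T ` g.Gs \<subseteq> \<Omega>" using g1 gb m by (fastforce simp: g.Gs_def)
    have nT: "norm (outer (T (axis k 1)) (T (axis 3 1))) \<le> 1" for k by (simp add: frame_norm[OF T] norm_outer)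
    have d: "gS v - gO v \<le> 2 * m" if "norm v < R" for v using gb[OF that] by linarith
    \<comment> \<open>The gap height is at most \<open>2 * m\<close>, that is
      \<open>8 * K * r\<^sup>2\<close>; times the area of the disc of radius \<open>2 * r\<close>
      this gives the \<open>32 * pi * K\<close> in \<open>B\<close>.\<close>
    have vol: "sqrt (2 * m * (R\<^sup>2 * pi)) = B * r\<^sup>2"
    proof -
      have "2 * m * (R\<^sup>2 * pi) = (32 * pi * K) * (r\<^sup>2)\<^sup>2" unfolding m_def R_def by (simp add: power2_eq_square)
      then show ?thesis unfolding B_def by (simp only: real_sqrt_mult real_sqrt_abs abs_power2)
    qed
    have meas: "pp k \<in> borel_measurable borel" for k using borel_measurable_integrable[OF g.ppi[of k]] by simp
    have \<Omega>m: "\<Omega> \<in> sets lebesgue" using \<Omega> by simp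
    have aa: "g.aa k \<le> B * r\<^sup>2 * D" for k
      unfolding g.aa_def vol[symmetric] D_def
      by (rule g.integral_Gs_le[OF d meas L2_transport[OF T L2 \<Omega>m g.Gs_borel Gs\<Omega> nT meas pp[unfolded Gsr]]])
    have bi: "g.bi (\<lambda>v. x * v $ 1 + y * v $ 2) \<le> r * (\<bar>x\<bar> + \<bar>y\<bar>) * (r\<^sup>2 * pi)" for x y
    proof -
      have "g.bi (\<lambda>v. x * v $ 1 + y * v $ 2) \<le> (\<integral>v. r * (\<bar>x\<bar> + \<bar>y\<bar>) * indicator (ball (0::real^2) r) v \<partial>lborel)"
        unfolding g.bi_def
      proof (rule Bochner_Integration.integral_mono)
        show "integrable lborel (\<lambda>v::real^2. indicator (ball 0 r) v * \<bar>x * v $ 1 + y * v $ 2\<bar>)"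
          by (intro g.ball_integrable continuous_intros)
        show "integrable lborel (\<lambda>v. r * (\<bar>x\<bar> + \<bar>y\<bar>) * indicator (ball (0::real^2) r) v)"
          by (intro integrable_mult_right integrable_real_indicator emeasure_bounded_finite) auto
        fix v :: "real^2"
        show "indicator (ball 0 r) v * \<bar>x * v $ 1 + y * v $ 2\<bar> \<le> r * (\<bar>x\<bar> + \<bar>y\<bar>) * indicator (ball 0 r) v"
        proof (cases "norm v < r")
          case True
          then have "\<bar>v $ 1\<bar> \<le> r" "\<bar>v $ 2\<bar> \<le> r" using component_le_norm_cart[of v] by (meson less_imp_le order_trans)+
          then have "\<bar>x\<bar> * \<bar>v $ 1\<bar> + \<bar>y\<bar> * \<bar>v $ 2\<bar> \<le> \<bar>x\<bar> * r + \<bar>y\<bar> * r" by (intro add_mono mult_left_mono) auto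
          moreover have "\<bar>x * v $ 1 + y * v $ 2\<bar> \<le> \<bar>x\<bar> * \<bar>v $ 1\<bar> + \<bar>y\<bar> * \<bar>v $ 2\<bar>"
            using abs_triangle_ineq[of "x * v $ 1" "y * v $ 2"] by (simp add: abs_mult)
          ultimately show ?thesis using True by (simp add: algebra_simps)
        qed simp
      qed
      also have "\<dots> = r * (\<bar>x\<bar> + \<bar>y\<bar>) * (r\<^sup>2 * pi)" using r circle_area[of r "0::real^2"] by simp
      finally show ?thesis .
    qed
    have bl: "g.bi g.l \<le> r * (\<bar>c1\<bar> + \<bar>c2\<bar>) * (r\<^sup>2 * pi)" and bq: "g.bi g.q \<le> r * (\<bar>a\<bar> + \<bar>b\<bar>) * (r\<^sup>2 * pi)"
      using bi[of c1 c2] bi[of a b] by (simp_all add: g.l_def[abs_def] g.q_def[abs_def])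
    have G: "\<bar>gS v - 0\<bar> \<le> m" if "norm v < R" for v using gb[OF that] by simp
    have "\<bar>?V\<bar> * (\<integral>v. eta r v \<partial>lborel) \<le> 4 / r * (2 * m) * (g.aa 1 + g.aa 2) + 4 / r\<^sup>2 * (m * g.bi g.l + m\<^sup>2 / 2 * g.bi g.q)"
      by (rule g.core_estimate_rough[OF G d])
    also have "\<dots> \<le> 4 / r * (2 * m) * (B * r\<^sup>2 * D + B * r\<^sup>2 * D) + 4 / r\<^sup>2 * (m * (r * (\<bar>c1\<bar> + \<bar>c2\<bar>) * (r\<^sup>2 * pi)) + m\<^sup>2 / 2 * (r * (\<bar>a\<bar> + \<bar>b\<bar>) * (r\<^sup>2 * pi)))"
      using aa bl bq r(1) m(2) by (intro add_mono mult_left_mono) auto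
    also have "\<dots> = r\<^sup>2 * ((64 * K * B * D + 16 * K * pi * (\<bar>c1\<bar> + \<bar>c2\<bar>) + 32 * K\<^sup>2 * r\<^sup>2 * pi * (\<bar>a\<bar> + \<bar>b\<bar>)) * r)"
      using r(1) unfolding m_def by (simp add: field_simps power2_eq_square power3_eq_cube)
    also have "\<dots> \<le> r\<^sup>2 * (M * r)"
    proof -
      have "32 * K\<^sup>2 * r\<^sup>2 * pi * (\<bar>a\<bar> + \<bar>b\<bar>) \<le> 32 * K\<^sup>2 * 1 * pi * (\<bar>a\<bar> + \<bar>b\<bar>)"
        using r power_le_one[of r 2] by (intro mult_right_mono mult_left_mono) auto
      then show ?thesis unfolding M_def using r(1) by (intro mult_left_mono mult_right_mono) auto
    qed
    finally have "\<bar>?V\<bar> * (\<integral>v. eta r v \<partial>lborel) \<le> r\<^sup>2 * (M * r)" .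
    moreover have "r\<^sup>2 * (fl (3/4) * pi / 4 * \<bar>?V\<bar>) \<le> \<bar>?V\<bar> * (\<integral>v. eta r v \<partial>lborel)"
      using mult_left_mono[OF eta_integral_ge[OF r(1)], of "\<bar>?V\<bar>"] by (simp add: algebra_simps)
    ultimately have "r\<^sup>2 * (fl (3/4) * pi / 4 * \<bar>?V\<bar>) \<le> r\<^sup>2 * (M * r)" by linarith
    then show ?thesis using r(1) by (simp only: mult_le_cancel_left_pos zero_less_power)
  qed
  \<comment> \<open>Letting \<open>r\<close> tend to zero leaves no room for a nonzero normal
    velocity.\<close>
  have "((\<lambda>r. M * r) \<longlongrightarrow> M * 0) (at_right 0)" by (intro tendsto_intros)
  moreover have "eventually (\<lambda>r. fl (3/4) * pi / 4 * \<bar>?V\<bar> \<le> M * r) (at_right 0)"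
    unfolding eventually_at_right_field using main R1 by (intro exI[of _ "min 1 (R1 / 2)"]) auto
  ultimately have "fl (3/4) * pi / 4 * \<bar>?V\<bar> \<le> M * 0"
    by (intro tendsto_lowerbound[of "\<lambda>r. M * r" _ "at_right 0"]) auto
  moreover have "0 < fl (3/4)" by (simp add: fl_def)
  ultimately show ?thesis using pi_gt_zero by (simp add: mult_le_0_iff)
qed

text \<open>Orthogonal transformations may reverse orientation, so a frame can be turned upside down
  by reflecting the third coordinate alone; graphs simply change sign.\<close>

lemma flip_frame:
  assumes T: "orthogonal_transformation T"
  defines "T' \<equiv> \<lambda>y. T (vec3 (horiz y) (- (y $ 3)))"
  shows "orthogonal_transformation T'" "T' (axis 3 1) = - T (axis 3 1)" "emb Q T' (v, z) = emb Q T (v, - z)"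
    "graph_frame D Q T \<sigma> K g \<Longrightarrow> graph_frame D Q T' \<sigma> K (\<lambda>v. - g v)"
proof -
  have "linear (\<lambda>y::real^3. vec3 (horiz y) (- (y $ 3)))" by (rule linearI) (simp_all add: vec_eq_iff forall_3)
  moreover have "vec3 (horiz x) (- (x $ 3)) \<bullet> vec3 (horiz y) (- (y $ 3)) = x \<bullet> y" for x y
    by (simp add: inner_vec_def sum_3)
  ultimately have "orthogonal_transformation (\<lambda>y::real^3. vec3 (horiz y) (- (y $ 3)))" by (simp add: orthogonal_transformation_def)
  from orthogonal_transformation_compose[OF T this] show "orthogonal_transformation T'" by (simp add: T'_def o_def)
  have "vec3 (horiz (axis 3 1)) (- (axis 3 1 $ 3)) = - axis 3 1" by (simp add: vec_eq_iff forall_3 axis_def)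
  then show "T' (axis 3 1) = - T (axis 3 1)" using linear_neg[OF orthogonal_transformation_linear[OF T]] by (simp add: T'_def)
  show e: "emb Q T' (v, z) = emb Q T (v, - z)" for v z by (simp add: emb_def T'_def)
  show "graph_frame D Q T' \<sigma> K (\<lambda>v. - g v)" if g: "graph_frame D Q T \<sigma> K g"
    unfolding graph_frame_def e using g
    by (auto simp: graph_frame_def abs_minus_commute intro!: continuous_on_minus)
qed

text \<open>At contact the adapted frame does not say on which side of the tangent plane the body
  lies. Some point of \<open>S\<close> near \<open>Q\<close> lies off the graph; if it is below, the
  flipped frame puts it above.\<close>

lemma contact_zero:
  fixes \<sigma> K :: real
  assumes T: "orthogonal_transformation T" and \<Omega>: "open \<Omega>" and S: "open S" "S \<subseteq> \<Omega>"
    and u: "u \<in> W12_0 \<Omega>" and Du: "weak_grad \<Omega> u Du"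
    and tr: "AE x in lebesgue. x \<in> \<Omega> \<longrightarrow> trace (Du x) = 0" and rig: "rigid_on S u xs us \<omega>"
    and gO: "graph_frame \<Omega> Q T \<sigma> K gO" and gS: "graph_frame S Q T \<sigma> K gS"
    and K: "0 < K" and \<sigma>: "0 < \<sigma>" and Q: "Q \<in> frontier S"
  shows "(us + cross3 \<omega> (Q - xs)) \<bullet> T (axis 3 1) = 0"
proof -
  \<comment> \<open>The second bound gives \<open>K * R\<^sup>2 \<le> R\<close>, which is less than
    \<open>s = 2 * R\<close>; the first keeps \<open>s\<close> below \<sigma>.\<close>
  define R where "R = min (\<sigma> / 4) (1 / (2 * K))"
  define s where "s = 2 * R"
  have R: "0 < R" "R < \<sigma>" "s < \<sigma>" using \<sigma> K by (auto simp: R_def s_def)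
  have "K * R \<le> 1" using K mult_left_mono[of R "1 / (2 * K)" K] by (simp add: R_def)
  then have "K * R\<^sup>2 \<le> R" using R(1) mult_right_mono[of "K * R" 1 R] by (simp add: power2_eq_square)
  then have small: "K * R\<^sup>2 < s" using R(1) by (simp add: s_def)
  have lin: "linear T" using T by (rule orthogonal_transformation_linear)
  have Q0: "emb Q T (0, 0) = Q"
  proof -
    have "vec3 0 0 = 0" by (simp add: vec_eq_iff forall_3)
    then show ?thesis using linear_0[OF lin] by (simp add: emb_def)
  qed
  have "open (emb Q T ` (ball 0 R \<times> {- s<..<s}))" by (intro open_emb[OF T] open_Times) auto
  moreover have "Q \<in> emb Q T ` (ball 0 R \<times> {- s<..<s})" using R Q0 by (intro image_eqI[of _ _ "(0, 0)"]) (auto simp: s_def)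
  moreover have "Q \<in> closure S" using Q by (simp add: frontier_def)
  ultimately have "emb Q T ` (ball 0 R \<times> {- s<..<s}) \<inter> S \<noteq> {}"
    using open_Int_closure_eq_empty[of "emb Q T ` (ball 0 R \<times> {- s<..<s})" S] by blast
  then obtain v z where vz: "norm v < R" "- s < z" "z < s" "emb Q T (v, z) \<in> S" by auto
  have "z \<noteq> gS v"
  proof
    assume "z = gS v"
    then have "emb Q T (v, z) \<in> frontier S" using graph_frameD(4)[OF gS, of v z] vz R by auto
    then show False using vz(4) S(1) by (simp add: frontier_def interior_open)
  qed
  then consider "gS v < z" | "z < gS v" by linarith
  then show ?thesis
  proof cases
    case 1
    show ?thesis by (rule contact_zero_above[OF T \<Omega> S u Du tr rig gO gS R(1,2) small K R(3) vz(1) 1 vz(3,4)])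
  next
    case 2
    \<comment> \<open>In the flipped frame the normal velocity only changes its sign, so its
      vanishing carries over.\<close>
    define T' where "T' y = T (vec3 (horiz y) (- (y $ 3)))" for y
    note f = flip_frame[OF T, folded T'_def]
    have "(us + cross3 \<omega> (Q - xs)) \<bullet> T' (axis 3 1) = 0"
      by (rule contact_zero_above[OF f(1) \<Omega> S u Du tr rig f(4)[OF gO] f(4)[OF gS] R(1,2) small K R(3) vz(1), of "- z"])
        (use 2 vz in \<open>simp_all add: f(3)\<close>)
    then show ?thesis by (simp add: f(2))
  qed
qed

lemma graph_frame_mono:
  assumes "graph_frame D p T \<sigma> K g" "\<sigma>' \<le> \<sigma>" "K \<le> K'" shows "graph_frame D p T \<sigma>' K' g"
proof -
  note f = graph_frameD[OF assms(1)]
  have "\<bar>g v\<bar> \<le> K' * (norm v)\<^sup>2 \<and> \<bar>g v - g (- v)\<bar> \<le> 8 * K' * norm v ^ 3" if "norm v < \<sigma>'" for v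
  proof -
    have "K * (norm v)\<^sup>2 \<le> K' * (norm v)\<^sup>2" "8 * K * norm v ^ 3 \<le> 8 * K' * norm v ^ 3"
      using assms(3) by (intro mult_right_mono; simp)+
    then show ?thesis using f(2,3)[of v] that assms(2) by linarith
  qed
  then show ?thesis unfolding graph_frame_def
    using continuous_on_subset[OF f(1) subset_ball[OF assms(2)]] f(4) assms(2) by auto
qed

text \<open>Composing a chart with the rigid motion leaves the graph function and hence both
  constants untouched. This is why the final constants depend on the shape of the body and not on
  its position.\<close>

lemma C3_graphs_rigid:
  assumes M: "orthogonal_transformation M" and C: "C3_graphs \<sigma> K D"
  shows "C3_graphs \<sigma> K ((\<lambda>x. b + M x) ` D)"
proof -
  let ?f = "\<lambda>x. b + M x"
  have lin: "linear M" and inj: "inj M" using M by (auto intro: orthogonal_transformation_linear orthogonal_transformation_inj)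
  have injf: "inj ?f" using inj by (auto simp: inj_def)
  have fr: "frontier (?f ` D) = ?f ` frontier D"
  proof -
    have "?f ` X = (+) b ` (M ` X)" for X by (auto simp: image_image)
    moreover have "frontier (M ` D) = M ` frontier D"
      unfolding frontier_def interior_injective_linear_image[OF lin inj] closure_injective_linear_image[OF lin inj, symmetric]
      by (rule image_set_diff[OF inj, symmetric])
    ultimately show ?thesis by (simp add: frontier_translation)
  qed
  show ?thesis unfolding C3_graphs_def fr
  proof safe
    fix p assume "p \<in> frontier D"
    then obtain T g where T: "orthogonal_transformation T"
      and gr: "frontier D \<inter> (\<lambda>y. p + T y) ` {y. norm (horiz y) < \<sigma> \<and> \<bar>y$3\<bar> < \<sigma>}
         = (\<lambda>y. p + T y) ` {y. norm (horiz y) < \<sigma> \<and> \<bar>y$3\<bar> < \<sigma> \<and> y$3 = g (horiz y)}"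
      and g: "Ck_on 3 (ball 0 \<sigma>) g" "\<forall>z. norm z < \<sigma> \<longrightarrow>
          (\<forall>i\<le>2. deriv_norm i g z \<le> K * norm z ^ (2 - i)) \<and> deriv_norm 3 g z \<le> K"
      using C unfolding C3_graphs_def by blast
    have im: "(\<lambda>y. b + M p + M (T y)) ` X = ?f ` (\<lambda>y. p + T y) ` X" for X
      by (simp add: image_image linear_add[OF lin] add.assoc)
    show "\<exists>T g. orthogonal_transformation T \<and>
       ?f ` frontier D \<inter> (\<lambda>y. b + M p + T y) ` {y. norm (horiz y) < \<sigma> \<and> \<bar>y$3\<bar> < \<sigma>}
         = (\<lambda>y. b + M p + T y) ` {y. norm (horiz y) < \<sigma> \<and> \<bar>y$3\<bar> < \<sigma> \<and> y$3 = g (horiz y)} \<and>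
       Ck_on 3 (ball 0 \<sigma>) g \<and>
       (\<forall>z. norm z < \<sigma> \<longrightarrow>
          (\<forall>i\<le>2. deriv_norm i g z \<le> K * norm z ^ (2 - i)) \<and> deriv_norm 3 g z \<le> K)"
    proof (intro exI[of _ "\<lambda>y. M (T y)"] exI[of _ g] conjI g)
      show "orthogonal_transformation (\<lambda>y. M (T y))" using orthogonal_transformation_compose[OF M T] by (simp add: o_def)
      show "?f ` frontier D \<inter> (\<lambda>y. b + M p + M (T y)) ` {y. norm (horiz y) < \<sigma> \<and> \<bar>y$3\<bar> < \<sigma>}
         = (\<lambda>y. b + M p + M (T y)) ` {y. norm (horiz y) < \<sigma> \<and> \<bar>y$3\<bar> < \<sigma> \<and> y$3 = g (horiz y)}"
        unfolding im image_Int[OF injf, symmetric] gr ..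
    qed
  qed
qed

theorem theorem1p2:
  fixes \<Omega> S\<^sub>0 :: "(real^3) set"
  assumes "is_domain \<Omega>" and "uniformly_C3 \<Omega>"
    and "is_domain S\<^sub>0" and "bounded S\<^sub>0" and "uniformly_C3 S\<^sub>0"
    and "S\<^sub>0 \<subseteq> \<Omega>"
  shows "\<exists>H\<^sub>s>0. \<exists>C\<^sub>s>0. \<exists>c\<^sub>0>0.
    \<forall>S x\<^sub>s u Du D2u u\<^sub>s \<omega> P Q T h F \<sigma>\<^sub>h.
      rigid_copy S\<^sub>0 S \<and> S \<subseteq> \<Omega> \<and>
      F = \<Omega> - closure S \<and>
      x\<^sub>s \<in> closure S \<and>
      u \<in> W12_0_rigid S \<Omega> x\<^sub>s \<and> rigid_on S u x\<^sub>s u\<^sub>s \<omega> \<and>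
      weak_grad \<Omega> u Du \<and>
      (AE x in lebesgue. x \<in> \<Omega> \<longrightarrow> trace (Du x) = 0) \<and>
      weak_hess F u D2u \<and> L2_on F D2u \<and>
      h = setdist S (frontier \<Omega>) \<and> h < diameter S \<and>
      adapted_frame S \<Omega> P Q T \<and>
      h < H\<^sub>s \<and> \<sigma>\<^sub>h = c\<^sub>0 * h powr (1/2)
      \<longrightarrow>
      \<bar>(u\<^sub>s + cross3 \<omega> (P - x\<^sub>s)) \<bullet> T (axis 3 1)\<bar>
        \<le> C\<^sub>s * (h powr (3/2) * L2_norm (cyl Q T \<sigma>\<^sub>h \<inter> F) D2u
                + h * L2_norm (cyl Q T \<sigma>\<^sub>h \<inter> F) Du)"
proof -
  obtain \<sigma>1 K1 where 1: "0 < \<sigma>1" "0 < K1" "C3_graphs \<sigma>1 K1 \<Omega>"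
    using assms(2) unfolding uniformly_C3_def C3_graphs_def by blast
  obtain \<sigma>2 K2 where 2: "0 < \<sigma>2" "0 < K2" "C3_graphs \<sigma>2 K2 S\<^sub>0"
    using assms(5) unfolding uniformly_C3_def C3_graphs_def by blast
  \<comment> \<open>One pair of constants for both boundaries, fixed from the reference body before
    any copy \<open>S\<close> is considered.\<close>
  define \<sigma> where "\<sigma> = min \<sigma>1 \<sigma>2"
  define K where "K = max K1 K2"
  have \<sigma>: "0 < \<sigma>" "\<sigma> \<le> \<sigma>1" "\<sigma> \<le> \<sigma>2" and K: "0 < K" "K1 \<le> K" "K2 \<le> K" using 1 2 by (auto simp: \<sigma>_def K_def)
  define \<kappa> where "\<kappa> = fl (3/4) * pi / 4"
  have \<kappa>: "0 < \<kappa>" by (simp add: \<kappa>_def fl_def)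
  define B where "B = sqrt (96 * pi * K)"
  have B: "0 < B" using K by (simp add: B_def)
  \<comment> \<open>Chosen so that \<open>r = k * sqrt h\<close> satisfies
    \<open>h = 16 * K * r\<^sup>2\<close>. The cylinder of \<open>gap_estimate\<close> has radius
    \<open>2 * r\<close>, hence \<open>2 * k\<close> is the constant in front of the square root of
    \<open>h\<close>.\<close>
  define k where "k = 1 / (4 * sqrt K)"
  have k: "0 < k" "16 * K * k\<^sup>2 = 1" using K by (simp_all add: k_def power_divide power_mult_distrib)
  define C where "C = max (B * K * (32 + 224 * K) * k\<^sup>2) (2304 * K\<^sup>2 * B * k ^ 3) / \<kappa>"
  \<comment> \<open>The three entries ensure, in turn, \<open>3 * h < \<sigma>\<close>,
    \<open>r \<le> 1\<close> and \<open>2 * r < \<sigma>\<close>.\<close>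
  define H where "H = min (\<sigma> / 3) (min (1 / k\<^sup>2) ((\<sigma> / (2 * k))\<^sup>2))"
  have H: "0 < H" and C: "0 < C" using \<sigma> k \<kappa> B K by (auto simp: H_def C_def less_max_iff_disj)
  have k2: "0 < 2 * k" using k by simp
  have main: "\<bar>(u\<^sub>s + cross3 \<omega> (P - x\<^sub>s)) \<bullet> T (axis 3 1)\<bar>
        \<le> C * (h powr (3/2) * L2_norm (cyl Q T (2 * k * h powr (1/2)) \<inter> (\<Omega> - closure S)) D2u
                + h * L2_norm (cyl Q T (2 * k * h powr (1/2)) \<inter> (\<Omega> - closure S)) Du)"
    if rc: "rigid_copy S\<^sub>0 S" and S: "S \<subseteq> \<Omega>" and u: "u \<in> W12_0_rigid S \<Omega> x\<^sub>s" and rig: "rigid_on S u x\<^sub>s u\<^sub>s \<omega>"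
      and Du: "weak_grad \<Omega> u Du" and tr: "AE x in lebesgue. x \<in> \<Omega> \<longrightarrow> trace (Du x) = 0"
      and D2: "weak_hess (\<Omega> - closure S) u D2u" "L2_on (\<Omega> - closure S) D2u"
      and h: "h = setdist S (frontier \<Omega>)" and fr: "adapted_frame S \<Omega> P Q T" and hH: "h < H"
    for S x\<^sub>s u Du D2u u\<^sub>s \<omega> P Q T h
  proof -
    have \<Omega>: "open \<Omega>" using assms(1) by (simp add: is_domain_def)
    obtain A b where A: "rotation_matrix A" "S = (\<lambda>x. b + A *v x) ` S\<^sub>0" using rc by (auto simp: rigid_copy_def)
    have M: "orthogonal_transformation (\<lambda>x. A *v x)"
      using A(1) by (simp add: orthogonal_transformation_matrix rotation_matrix_def)
    have So: "open S"
    proof -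
      have "open ((+) b ` ((\<lambda>x. A *v x) ` S\<^sub>0))"
        using assms(3) orthogonal_transformation_surj[OF M]
        by (intro open_translation open_surjective_linear_image orthogonal_transformation_linear[OF M]) (simp_all add: is_domain_def)
      then show ?thesis unfolding A(2) by (simp add: image_image)
    qed
    have CS: "C3_graphs \<sigma>2 K2 S" unfolding A(2) by (rule C3_graphs_rigid[OF M 2(3)])
    note fr = fr[unfolded adapted_frame_def, folded h]
    have P: "P \<in> frontier S" and Q: "Q \<in> frontier \<Omega>" and T: "orthogonal_transformation T" and PQ: "P = Q + T (axis 3 h)"
      and n: "normal_at (frontier \<Omega>) Q (T (axis 3 1))" "normal_at (frontier S) P (T (axis 3 1))" using fr by auto
    have PE: "P = emb Q T (0, h)"
    proof -
      have "vec3 0 h = axis 3 h" by (simp add: vec_eq_iff forall_3 axis_def)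
      then show ?thesis by (simp add: PQ emb_def)
    qed
    obtain gO where gO: "graph_frame \<Omega> Q T \<sigma> K gO"
      using adapted_graph[OF 1(3,1) Q T n(1)] graph_frame_mono[OF _ \<sigma>(2) K(2)] by metis
    obtain gS where gS: "graph_frame S P T \<sigma> K gS"
      using adapted_graph[OF CS 2(1) P T n(2)] graph_frame_mono[OF _ \<sigma>(3) K(3)] by metis
    have u0: "u \<in> W12_0 \<Omega>" using u by (simp add: W12_0_rigid_def)
    have h0: "0 \<le> h" by (simp add: h setdist_pos_le)
    show ?thesis
    proof (cases "h = 0")
      \<comment> \<open>For \<open>h = 0\<close> the right-hand side is zero, so the normal velocity
        at the contact point must vanish exactly.\<close>
      case True
      then have "P = Q" using linear_0[OF orthogonal_transformation_linear[OF T]] by (simp add: PQ axis_def zero_vec_def[symmetric])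
      then have "(u\<^sub>s + cross3 \<omega> (P - x\<^sub>s)) \<bullet> T (axis 3 1) = 0"
        using contact_zero[OF T \<Omega> So S u0 Du tr rig gO _ K(1) \<sigma>(1)] gS P by simp
      then show ?thesis using True by simp
    next
      case False
      then have h1: "0 < h" using h0 by simp
      define r where "r = k * sqrt h"
      have hh: "h powr (1/2) = sqrt h" "h powr (3/2) = h * sqrt h"
      proof -
        show "h powr (1/2) = sqrt h" using h1 by (simp add: powr_half_sqrt)
        have "h powr (1 + 1/2) = h powr 1 * h powr (1/2)" by (rule powr_add)
        then show "h powr (3/2) = h * sqrt h" using h1 by (simp add: powr_half_sqrt)
      qed
      have r2: "r\<^sup>2 = k\<^sup>2 * h" "r ^ 3 = k ^ 3 * (h * sqrt h)"
        using h1 by (simp_all add: r_def power_mult_distrib power3_eq_cube)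
      have r: "0 < r" "r \<le> 1" "2 * r < \<sigma>" "h = 16 * K * r\<^sup>2" "3 * h < \<sigma>"
      proof -
        show "0 < r" using h1 k by (simp add: r_def)
        have "h < 1 / k\<^sup>2" "h < (\<sigma> / (2 * k))\<^sup>2" using hH by (auto simp: H_def)
        then have "sqrt h < sqrt ((1 / k)\<^sup>2)" "sqrt h < sqrt ((\<sigma> / (2 * k))\<^sup>2)" by (simp_all only: real_sqrt_less_iff power_one_over[symmetric])
        then have "sqrt h < 1 / k" "sqrt h < \<sigma> / (2 * k)" using k \<sigma> by simp_all
        then show "r \<le> 1" "2 * r < \<sigma>" using k by (simp_all add: r_def field_simps)
        have "16 * K * r\<^sup>2 = (16 * K * k\<^sup>2) * h" unfolding r2 by simp
        then show "h = 16 * K * r\<^sup>2" unfolding k by simp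
        show "3 * h < \<sigma>" using hH by (simp add: H_def)
      qed
      let ?N = "cyl Q T (2 * r) \<inter> (\<Omega> - closure S)"
      have "\<kappa> * \<bar>(u\<^sub>s + cross3 \<omega> (P - x\<^sub>s)) \<bullet> T (axis 3 1)\<bar>
        \<le> B * K * (32 + 224 * K) * r\<^sup>2 * L2_norm ?N Du + 2304 * K\<^sup>2 * B * r ^ 3 * L2_norm ?N D2u"
        unfolding \<kappa>_def B_def PE
        by (rule gap_estimate[OF T \<Omega> So S u0 Du tr rig D2 Q h1 h P[unfolded PE] gO gS[unfolded PE] K(1) r])
      also have "\<dots> = (B * K * (32 + 224 * K) * k\<^sup>2) * (h * L2_norm ?N Du) + (2304 * K\<^sup>2 * B * k ^ 3) * (h * sqrt h * L2_norm ?N D2u)"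
        unfolding r2 by (simp only: mult.assoc)
      also have "\<dots> \<le> (\<kappa> * C) * (h * L2_norm ?N Du) + (\<kappa> * C) * (h * sqrt h * L2_norm ?N D2u)"
        using h1 \<kappa> by (intro add_mono mult_right_mono mult_nonneg_nonneg L2_norm_nonneg) (auto simp: C_def)
      also have "\<dots> = \<kappa> * (C * (h * sqrt h * L2_norm ?N D2u + h * L2_norm ?N Du))" by (simp add: algebra_simps)
      finally have "\<bar>(u\<^sub>s + cross3 \<omega> (P - x\<^sub>s)) \<bullet> T (axis 3 1)\<bar> \<le> C * (h * sqrt h * L2_norm ?N D2u + h * L2_norm ?N Du)"
        using \<kappa> by (simp only: mult_le_cancel_left_pos)
      then show ?thesis unfolding hh r_def by (simp only: mult.assoc)
    qed
  qed
  show ?thesis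
  proof (rule exI[of _ H], rule conjI[OF H], rule exI[of _ C], rule conjI[OF C], rule exI[of _ "2 * k"], rule conjI[OF k2],
      intro allI impI, elim conjE)
    fix S x\<^sub>s u Du D2u u\<^sub>s \<omega> P Q T h F \<sigma>\<^sub>h
    assume F: "F = \<Omega> - closure S" and \<sigma>\<^sub>h: "\<sigma>\<^sub>h = 2 * k * h powr (1/2)"
      and D2: "weak_hess F u D2u" "L2_on F D2u"
      and rest: "rigid_copy S\<^sub>0 S" "S \<subseteq> \<Omega>" "u \<in> W12_0_rigid S \<Omega> x\<^sub>s" "rigid_on S u x\<^sub>s u\<^sub>s \<omega>"
      "weak_grad \<Omega> u Du" "AE x in lebesgue. x \<in> \<Omega> \<longrightarrow> trace (Du x) = 0"
      "h = setdist S (frontier \<Omega>)" "adapted_frame S \<Omega> P Q T" "h < H"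
    show "\<bar>(u\<^sub>s + cross3 \<omega> (P - x\<^sub>s)) \<bullet> T (axis 3 1)\<bar>
        \<le> C * (h powr (3/2) * L2_norm (cyl Q T \<sigma>\<^sub>h \<inter> F) D2u + h * L2_norm (cyl Q T \<sigma>\<^sub>h \<inter> F) Du)"
      unfolding F \<sigma>\<^sub>h by (rule main[OF rest(1-6) D2[unfolded F] rest(7-9)])
  qed
qed

end
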